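(* Let $\Omega\subseteq\mathbb{R}^d$, $d\ge2$, be a bounded Lipschitz domain, $I=(0,T)$ with $0<T<\infty$, $Q_T=I\times\Omega$, and $q,p\in\mathcal{P}^{\log}(Q_T)$ with $q^-,p^->1$. For $h>0$ define $\mathcal{R}^h_{Q_T}:\mathcal{X}^{q,p}_{\boldsymbol\varepsilon}(Q_T)^*\to\mathcal{X}^{q,p}_{\boldsymbol\varepsilon}(Q_T)^*$ by $$\langle\mathcal{R}^h_{Q_T}\boldsymbol{u}^*,\boldsymbol{v}\rangle_{\mathcal{X}^{q,p}_{\boldsymbol\varepsilon}(Q_T)}:=\langle\boldsymbol{u}^*,(\mathcal{R}^h_{Q_T})^\star\boldsymbol{v}\rangle_{\mathcal{X}^{q,p}_{\boldsymbol\varepsilon}(Q_T)}$$ for $\boldsymbol{u}^*\in\mathcal{X}^{q,p}_{\boldsymbol\varepsilon}(Q_T)^*$, $\boldsymbol{v}\in\mathcal{X}^{q,p}_{\boldsymbol\varepsilon}(Q_T)$, with $(\mathcal{R}^h_{Q_T})^\star$ and $h_1>0$ as in the context. Then for every $\boldsymbol{u}^*\in\mathcal{X}^{q,p}_{\boldsymbol\varepsilon}(Q_T)^*$ it holds: (i) $\sup_{h\in(0,h_1)}\|\mathcal{R}^h_{Q_T}\boldsymbol{u}^*\|_{\mathcal{X}^{q,p}_{\boldsymbol\varepsilon}(Q_T)^*}\le c_{\overline{q},\overline{p}}\,\|\boldsymbol{u}^*\|_{\mathcal{X}^{q,p}_{\boldsymbol\varepsilon}(Q_T)^*}$, where $c_{\overline{q},\overline{p}}>0$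 is a constant with $\sup_{h\in(0,h_1)}\|(\mathcal{R}^h_{Q_T})^\star\boldsymbol{v}\|_{\mathcal{X}^{q,p}_{\boldsymbol\varepsilon}(Q_T)}\le c_{\overline{q},\overline{p}}\|\boldsymbol{v}\|_{\mathcal{X}^{q,p}_{\boldsymbol\varepsilon}(Q_T)}$ for all $\boldsymbol{v}\in\mathcal{X}^{q,p}_{\boldsymbol\varepsilon}(Q_T)$ (such a constant exists). (ii) $(\mathcal{R}^h_{Q_T}\boldsymbol{u}^* )_{h>0}\subseteq\mathcal{C}^\infty_*(Q_T):=\mathcal{J}_{\boldsymbol\varepsilon}\big(C^\infty(\overline{I},C_0^\infty(\Omega)^d)\times C^\infty(\overline{I},C_0^\infty(\Omega,\mathbb{M}^{d\times d}_{\mathrm{sym}}))\big)$. (iii) $\mathcal{R}^h_{Q_T}\boldsymbol{u}^*\to\boldsymbol{u}^*$ in $\mathcal{X}^{q,p}_{\boldsymbol\varepsilon}(Q_T)^*$ as $h\to0$; i.e. $\mathcal{C}^\infty_*(Q_T)$ is dense in $\mathcal{X}^{q,p}_{\boldsymbol\varepsilon}(Q_T)^*$.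
   Context: Exponents: for $G\subseteq\mathbb{R}^n$, $\mathcal{P}^{\log}(G)$ is the set of bounded measurable $p:G\to[1,\infty)$ for which there are $c_1,c_2>0$, $p_\infty\in\mathbb{R}$ with $|p(x)-p(y)|\le c_1/\log(e+1/|x-y|)$ for all $x\neq y$ in $G$ and $|p(x)-p_\infty|\le c_2/\log(e+|x|)$ for all $x\in G$; $p^\pm$ are ess sup/ess inf, $p'=p/(p-1)$. $L^{p(\cdot)}(G)$ is the space of measurable $f$ with $\rho(f)=\int_G|f|^{p(x)}dx<\infty$ and Luxemburg norm $\inf\{\lambda>0:\rho(f/\lambda)\le1\}$ (Euclidean norm for vector/matrix values). Spaces: $\boldsymbol\varepsilon(\mathbf{u})=\frac12(\nabla\mathbf{u}+\nabla\mathbf{u}^\top)$ (spatial, distributional). $X^{q(\cdot),p(\cdot)}_{\boldsymbol\varepsilon}(\Omega)$ is the closure of $C_0^\infty(\Omega)^d$ with respect to $\|\mathbf{u}\|_{L^{q(\cdot)}}+\|\boldsymbol\varepsilon(\mathbf{u})\|_{L^{p(\cdot)}}$. $\mathcal{X}^{q,p}_{\boldsymbol\varepsilon}(Q_T):=\{\boldsymbol{u}\in L^{q(\cdot,\cdot)}(Q_T)^d:\boldsymbol\varepsilon(\boldsymbol{u})\in L^{p(\cdot,\cdot)}(Q_T,\mathbb{M}^{d\times d}_{\mathrm{sym}}),\ \boldsymbol{u}(t)\in X^{q(t,\cdot),p(t,\cdot)}_{\boldsymbol\varepsilon}(\Omega)\text{ for a.e. }t\in I\}$ with norm $\|\boldsymbol{u}\|_{L^{q(\cdot,\cdot)}(Q_T)^d}+\|\boldsymbol\varepsilon(\boldsymbol{u})\|_{L^{p(\cdot,\cdot)}(Q_T)^{d\times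 d}}$. For $\boldsymbol{f}\in L^{q'(\cdot,\cdot)}(Q_T)^d$, $\boldsymbol{F}\in L^{p'(\cdot,\cdot)}(Q_T,\mathbb{M}^{d\times d}_{\mathrm{sym}})$, $\mathcal{J}_{\boldsymbol\varepsilon}(\boldsymbol{f},\boldsymbol{F})\in\mathcal{X}^{q,p}_{\boldsymbol\varepsilon}(Q_T)^*$ is $\boldsymbol{u}\mapsto\int_{Q_T}\boldsymbol{f}\cdot\boldsymbol{u}+\boldsymbol{F}:\boldsymbol\varepsilon(\boldsymbol{u})\,dt\,dx$. $C^\infty(\overline I,C_0^\infty(\Omega)^d)$ denotes smooth functions on $\overline I\times\Omega$ with compact support in $\overline I\times\Omega$ (similarly for matrix values). Smoothing: let $h_0,c_0>0$ be constants (depending only on $d,\Omega$; such constants exist) such that $|\mathbf{u}(x)|\le c_0\int_{B^d_{2r(x)}(x)\cap\Omega}|\boldsymbol\varepsilon(\mathbf{u})(y)||x-y|^{1-d}dy$ for all $\mathbf{u}\in X^{1,1}_{\boldsymbol\varepsilon}(\Omega)$ and a.e. $x\in\Omega$ with $r(x):=\operatorname{dist}(x,\partial\Omega)\le h_0$; set $h_1:=h_0/4$. $\omega^n$ is the standard mollifier on $\mathbb{R}^n$, $\omega^n(x)=c\exp(-1/(1-|x|^2))$ for $|x|<1$, $0$ otherwise, $\int\omega^n=1$, and $\omega^n_h(x)=h^{-n}\omega^n(x/h)$; $\boldsymbol\omega_h:=\omega^{d+1}_h$. $\Omega_\delta:=\{x\in\Omega:\operatorname{dist}(x,\partial\Omega)>\delta\}$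 and $\eta_h:=\omega^d_{h/2}*\chi_{\Omega_{5h/2}}$. $\mathcal{F}_{Q_T}$ is extension by zero from $Q_T$ to $\mathbb{R}^{d+1}$. For $\boldsymbol{v}\in L^{q(\cdot,\cdot)}(Q_T)^d$, $(\mathcal{R}^h_{Q_T})^\star\boldsymbol{v}:=(\boldsymbol\omega_h*(\mathcal{F}_{Q_T}\boldsymbol{v}))\,\eta_h$, restricted to $Q_T$ (with $\eta_h$ acting in $x$); this maps $\mathcal{X}^{q,p}_{\boldsymbol\varepsilon}(Q_T)$ boundedly into itself. *)

theory Defs
  imports "HOL-Analysis.Analysis" "HOL-Probability.Essential_Supremum"
begin

text \<open>
  Elements of function spaces over a set \<open>G\<close> are represented by total functions; only their values
  on \<open>G\<close> matter, up to null sets. Accordingly the norms below are seminorms on functions, and a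
  functional that is bounded with respect to such a seminorm does not distinguish representatives.
  Space-time points are pairs \<open>(t, x)\<close>; norms and inner products on products, vectors and
  matrices are the Euclidean (Frobenius) ones.
\<close>

subsection \<open>Bounded Lipschitz domains\<close>

text \<open>Near each boundary point the domain is the strict epigraph, in some unit direction \<open>\<nu>\<close>,
  of a Lipschitz function on the hyperplane orthogonal to \<open>\<nu>\<close>.\<close>

definition bounded_lipschitz_domain :: "'a::euclidean_space set \<Rightarrow> bool" where
  "bounded_lipschitz_domain \<Omega> \<longleftrightarrow>
     open \<Omega> \<and> connected \<Omega> \<and> \<Omega> \<noteq> {} \<and> bounded \<Omega> \<and>
     (\<forall>x0\<in>frontier \<Omega>. \<exists>r>0. \<exists>\<nu>. \<exists>L. \<exists>\<gamma>::'a \<Rightarrow> real.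
        norm \<nu> = 1 \<and> L-lipschitz_on {y. y \<bullet> \<nu> = 0} \<gamma> \<and>
        \<Omega> \<inter> ball x0 r = {x \<in> ball x0 r. \<gamma> (x - (x \<bullet> \<nu>) *\<^sub>R \<nu>) < x \<bullet> \<nu>})"

subsection \<open>Variable exponents\<close>

definition log_exponents :: "'a::euclidean_space set \<Rightarrow> ('a \<Rightarrow> real) set" where
  "log_exponents G = {p. p \<in> borel_measurable (lebesgue_on G) \<and>
     (\<forall>x\<in>G. 1 \<le> p x) \<and> (\<exists>M. \<forall>x\<in>G. p x \<le> M) \<and>
     (\<exists>c1>0. \<exists>c2>0. \<exists>p_inf.
        (\<forall>x\<in>G. \<forall>y\<in>G. x \<noteq> y \<longrightarrow> \<bar>p x - p y\<bar> \<le> c1 / ln (exp 1 + 1 / norm (x - y))) \<and>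
        (\<forall>x\<in>G. \<bar>p x - p_inf\<bar> \<le> c2 / ln (exp 1 + norm x)))}"

definition ess_inf :: "'a::euclidean_space set \<Rightarrow> ('a \<Rightarrow> real) \<Rightarrow> ereal" where
  "ess_inf G p = - esssup (lebesgue_on G) (\<lambda>x. - ereal (p x))"

definition modular ::
  "'a::euclidean_space set \<Rightarrow> ('a \<Rightarrow> real) \<Rightarrow> ('a \<Rightarrow> 'b::euclidean_space) \<Rightarrow> ennreal" where
  "modular G p f = (\<integral>\<^sup>+x. ennreal (norm (f x) powr p x) \<partial>lebesgue_on G)"

definition Lp_space ::
  "'a::euclidean_space set \<Rightarrow> ('a \<Rightarrow> real) \<Rightarrow> ('a \<Rightarrow> 'b::euclidean_space) set" where
  "Lp_space G p = {f \<in> borel_measurable (lebesgue_on G). modular G p f < \<infinity>}"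

definition Lp_norm ::
  "'a::euclidean_space set \<Rightarrow> ('a \<Rightarrow> real) \<Rightarrow> ('a \<Rightarrow> 'b::euclidean_space) \<Rightarrow> real" where
  "Lp_norm G p f = Inf {l. 0 < l \<and> modular G p (\<lambda>x. f x /\<^sub>R l) \<le> 1}"

subsection \<open>Smooth functions\<close>

text \<open>Derivatives are taken within \<open>S\<close>. For open \<open>S\<close> these are the usual ones; for
  \<open>S = {0..T} \<times> \<Omega>\<close> they are one-sided in time at \<open>t = 0\<close> and \<open>t = T\<close> (and still unique).\<close>

primrec Ck_on :: "nat \<Rightarrow> 'a::real_normed_vector set \<Rightarrow> ('a \<Rightarrow> 'b::real_normed_vector) \<Rightarrow> bool" where
  "Ck_on 0 S f \<longleftrightarrow> continuous_on S f"
| "Ck_on (Suc k) S f \<longleftrightarrow>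
     f differentiable_on S \<and> (\<forall>v. Ck_on k S (\<lambda>x. frechet_derivative f (at x within S) v))"

text \<open>Smooth functions with compact support in \<open>S\<close>, represented by their extension by zero.\<close>

definition smooth_compact ::
  "'a::euclidean_space set \<Rightarrow> ('a \<Rightarrow> 'b::real_normed_vector) set" where
  "smooth_compact S = {f. (\<forall>k. Ck_on k S f) \<and>
     compact (closure {x. f x \<noteq> 0}) \<and> closure {x. f x \<noteq> 0} \<subseteq> S}"

subsection \<open>The distributional symmetric gradient\<close>

definition locally_integrable ::
  "'a::euclidean_space set \<Rightarrow> ('a \<Rightarrow> 'b::euclidean_space) \<Rightarrow> bool" where
  "locally_integrable G f \<longleftrightarrow> (\<forall>K. compact K \<and> K \<subseteq> G \<longrightarrow> integrable (lebesgue_on K) f)"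

text \<open>\<open>D i\<close> is the direction of the \<open>i\<close>-th spatial derivative in the space containing \<open>G\<close>. This
  covers both \<open>G = \<Omega>\<close> and the spatial symmetric gradient on space-time cylinders.\<close>

definition has_sym_grad ::
  "('n::finite \<Rightarrow> 'a::euclidean_space) \<Rightarrow> 'a set \<Rightarrow> ('a \<Rightarrow> real^'n) \<Rightarrow> ('a \<Rightarrow> real^'n^'n) \<Rightarrow> bool" where
  "has_sym_grad D G u E \<longleftrightarrow>
     locally_integrable G u \<and> locally_integrable G E \<and>
     (\<forall>z\<in>G. transpose (E z) = E z) \<and>
     (\<forall>\<phi> \<in> smooth_compact G. \<forall>i j.
        (LINT z|lebesgue_on G. E z $ i $ j * \<phi> z) =
        - (1/2) * (LINT z|lebesgue_on G.
             u z $ i * frechet_derivative \<phi> (at z) (D j) +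
             u z $ j * frechet_derivative \<phi> (at z) (D i)))"

text \<open>Unique up to null sets whenever it exists.\<close>

definition sym_grad ::
  "('n::finite \<Rightarrow> 'a::euclidean_space) \<Rightarrow> 'a set \<Rightarrow> ('a \<Rightarrow> real^'n) \<Rightarrow> 'a \<Rightarrow> real^'n^'n" where
  "sym_grad D G u = (SOME E. has_sym_grad D G u E)"

definition sp_dir :: "'n::finite \<Rightarrow> real^'n" where
  "sp_dir i = axis i 1"

definition st_dir :: "'n::finite \<Rightarrow> real \<times> (real^'n)" where
  "st_dir i = (0, axis i 1)"

definition eps_norm ::
  "('n::finite \<Rightarrow> 'a::euclidean_space) \<Rightarrow> 'a set \<Rightarrow> ('a \<Rightarrow> real) \<Rightarrow> ('a \<Rightarrow> real) \<Rightarrow>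
   ('a \<Rightarrow> real^'n) \<Rightarrow> real" where
  "eps_norm D G q p u = Lp_norm G q u + Lp_norm G p (sym_grad D G u)"

text \<open>The space of all \<open>u \<in> L\<^sup>q\<close> with \<open>\<epsilon>(u) \<in> L\<^sup>p\<close>, in which the closure of the test functions
  is taken.\<close>

definition eps_space ::
  "('n::finite \<Rightarrow> 'a::euclidean_space) \<Rightarrow> 'a set \<Rightarrow> ('a \<Rightarrow> real) \<Rightarrow> ('a \<Rightarrow> real) \<Rightarrow>
   ('a \<Rightarrow> real^'n) set" where
  "eps_space D G q p = {u \<in> Lp_space G q. \<exists>E \<in> Lp_space G p. has_sym_grad D G u E}"

definition X_sp ::
  "(real^'n::finite) set \<Rightarrow> (real^'n \<Rightarrow> real) \<Rightarrow> (real^'n \<Rightarrow> real) \<Rightarrow> (real^'n \<Rightarrow> real^'n) set" where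
  "X_sp \<Omega> q p = {u \<in> eps_space sp_dir \<Omega> q p.
     \<forall>e>0. \<exists>\<phi> \<in> smooth_compact \<Omega>. eps_norm sp_dir \<Omega> q p (\<lambda>x. u x - \<phi> x) < e}"

subsection \<open>The parabolic space and its dual\<close>

definition cylinder :: "real \<Rightarrow> 'a set \<Rightarrow> (real \<times> 'a) set" where
  "cylinder T \<Omega> = {0<..<T} \<times> \<Omega>"

definition X_st ::
  "real \<Rightarrow> (real^'n::finite) set \<Rightarrow> (real \<times> (real^'n) \<Rightarrow> real) \<Rightarrow> (real \<times> (real^'n) \<Rightarrow> real) \<Rightarrow>
   (real \<times> (real^'n) \<Rightarrow> real^'n) set" where
  "X_st T \<Omega> q p = {u \<in> eps_space st_dir (cylinder T \<Omega>) q p.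
     AE t in lebesgue_on {0<..<T}.
       (\<lambda>x. u (t, x)) \<in> X_sp \<Omega> (\<lambda>x. q (t, x)) (\<lambda>x. p (t, x))}"

definition X_st_norm ::
  "real \<Rightarrow> (real^'n::finite) set \<Rightarrow> (real \<times> (real^'n) \<Rightarrow> real) \<Rightarrow> (real \<times> (real^'n) \<Rightarrow> real) \<Rightarrow>
   (real \<times> (real^'n) \<Rightarrow> real^'n) \<Rightarrow> real" where
  "X_st_norm T \<Omega> q p = eps_norm st_dir (cylinder T \<Omega>) q p"

text \<open>The topological dual of a linear space \<open>X\<close> of functions, seminormed by \<open>N\<close>. Functionals are
  made extensional, so that equality of functionals is equality on \<open>X\<close>.\<close>

definition dual_space ::
  "('a \<Rightarrow> 'b::real_vector) set \<Rightarrow> (('a \<Rightarrow> 'b) \<Rightarrow> real) \<Rightarrow> (('a \<Rightarrow> 'b) \<Rightarrow> real) set" where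
  "dual_space X N = {L \<in> extensional X.
     (\<forall>u\<in>X. \<forall>v\<in>X. L (\<lambda>z. u z + v z) = L u + L v) \<and>
     (\<forall>a. \<forall>u\<in>X. L (\<lambda>z. a *\<^sub>R u z) = a * L u) \<and>
     (\<exists>C. \<forall>u\<in>X. \<bar>L u\<bar> \<le> C * N u)}"

definition dual_norm ::
  "('a \<Rightarrow> 'b::real_vector) set \<Rightarrow> (('a \<Rightarrow> 'b) \<Rightarrow> real) \<Rightarrow> (('a \<Rightarrow> 'b) \<Rightarrow> real) \<Rightarrow> real" where
  "dual_norm X N L = Sup {\<bar>L u\<bar> | u. u \<in> X \<and> N u \<le> 1}"

definition X_dual ::
  "real \<Rightarrow> (real^'n::finite) set \<Rightarrow> (real \<times> (real^'n) \<Rightarrow> real) \<Rightarrow> (real \<times> (real^'n) \<Rightarrow> real) \<Rightarrow>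
   ((real \<times> (real^'n) \<Rightarrow> real^'n) \<Rightarrow> real) set" where
  "X_dual T \<Omega> q p = dual_space (X_st T \<Omega> q p) (X_st_norm T \<Omega> q p)"

definition X_dual_norm ::
  "real \<Rightarrow> (real^'n::finite) set \<Rightarrow> (real \<times> (real^'n) \<Rightarrow> real) \<Rightarrow> (real \<times> (real^'n) \<Rightarrow> real) \<Rightarrow>
   ((real \<times> (real^'n) \<Rightarrow> real^'n) \<Rightarrow> real) \<Rightarrow> real" where
  "X_dual_norm T \<Omega> q p = dual_norm (X_st T \<Omega> q p) (X_st_norm T \<Omega> q p)"

definition J_eps ::
  "real \<Rightarrow> (real^'n::finite) set \<Rightarrow> (real \<times> (real^'n) \<Rightarrow> real) \<Rightarrow> (real \<times> (real^'n) \<Rightarrow> real) \<Rightarrow>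
   (real \<times> (real^'n) \<Rightarrow> real^'n) \<Rightarrow> (real \<times> (real^'n) \<Rightarrow> real^'n^'n) \<Rightarrow>
   (real \<times> (real^'n) \<Rightarrow> real^'n) \<Rightarrow> real" where
  "J_eps T \<Omega> q p f F = (\<lambda>u\<in>X_st T \<Omega> q p.
     LINT z|lebesgue_on (cylinder T \<Omega>).
       f z \<bullet> u z + F z \<bullet> sym_grad st_dir (cylinder T \<Omega>) u z)"

definition C_inf_star ::
  "real \<Rightarrow> (real^'n::finite) set \<Rightarrow> (real \<times> (real^'n) \<Rightarrow> real) \<Rightarrow> (real \<times> (real^'n) \<Rightarrow> real) \<Rightarrow>
   ((real \<times> (real^'n) \<Rightarrow> real^'n) \<Rightarrow> real) set" where
  "C_inf_star T \<Omega> q p = {J_eps T \<Omega> q p f F | f F.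
     f \<in> smooth_compact ({0..T} \<times> \<Omega>) \<and> F \<in> smooth_compact ({0..T} \<times> \<Omega>) \<and>
     (\<forall>z. transpose (F z) = F z)}"

subsection \<open>Smoothing\<close>

definition bump :: "'a::euclidean_space \<Rightarrow> real" where
  "bump x = (if norm x < 1 then exp (- 1 / (1 - (norm x)\<^sup>2)) else 0)"

definition mollifier :: "real \<Rightarrow> 'a::euclidean_space \<Rightarrow> real" where
  "mollifier h x = bump (x /\<^sub>R h) / (h ^ DIM('a) * (LINT y|lebesgue. bump (y::'a)))"

definition convolution ::
  "('a::euclidean_space \<Rightarrow> real) \<Rightarrow> ('a \<Rightarrow> 'b::euclidean_space) \<Rightarrow> 'a \<Rightarrow> 'b" where
  "convolution k f x = (LINT y|lebesgue. k (x - y) *\<^sub>R f y)"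

definition bdist :: "'a::euclidean_space set \<Rightarrow> 'a \<Rightarrow> real" where
  "bdist \<Omega> x = infdist x (frontier \<Omega>)"

definition inner_part :: "'a::euclidean_space set \<Rightarrow> real \<Rightarrow> 'a set" where
  "inner_part \<Omega> \<delta> = {x \<in> \<Omega>. bdist \<Omega> x > \<delta>}"

definition cutoff :: "'a::euclidean_space set \<Rightarrow> real \<Rightarrow> 'a \<Rightarrow> real" where
  "cutoff \<Omega> h = convolution (mollifier (h / 2)) (indicator (inner_part \<Omega> (5 * h / 2)))"

definition zero_ext :: "'a set \<Rightarrow> ('a \<Rightarrow> 'b::real_vector) \<Rightarrow> 'a \<Rightarrow> 'b" where
  "zero_ext G v z = (if z \<in> G then v z else 0)"

definition R_star ::
  "real \<Rightarrow> (real^'n::finite) set \<Rightarrow> real \<Rightarrow> (real \<times> (real^'n) \<Rightarrow> real^'n) \<Rightarrow>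
   real \<times> (real^'n) \<Rightarrow> real^'n" where
  "R_star T \<Omega> h v = zero_ext (cylinder T \<Omega>)
     (\<lambda>z. cutoff \<Omega> h (snd z) *\<^sub>R convolution (mollifier h) (zero_ext (cylinder T \<Omega>) v) z)"

definition R_op ::
  "real \<Rightarrow> (real^'n::finite) set \<Rightarrow> (real \<times> (real^'n) \<Rightarrow> real) \<Rightarrow> (real \<times> (real^'n) \<Rightarrow> real) \<Rightarrow>
   real \<Rightarrow> ((real \<times> (real^'n) \<Rightarrow> real^'n) \<Rightarrow> real) \<Rightarrow>
   (real \<times> (real^'n) \<Rightarrow> real^'n) \<Rightarrow> real" where
  "R_op T \<Omega> q p h us = (\<lambda>v\<in>X_st T \<Omega> q p. us (R_star T \<Omega> h v))"

text \<open>The defining property of the constants \<open>h\<^sub>0\<close> and \<open>c\<^sub>0\<close>.\<close>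

definition boundary_strip_estimate :: "(real^'n::finite) set \<Rightarrow> real \<Rightarrow> real \<Rightarrow> bool" where
  "boundary_strip_estimate \<Omega> h0 c0 \<longleftrightarrow>
     (\<forall>u \<in> X_sp \<Omega> (\<lambda>_. 1) (\<lambda>_. 1). AE x in lebesgue_on \<Omega>. bdist \<Omega> x \<le> h0 \<longrightarrow>
        ennreal (norm (u x)) \<le> ennreal c0 *
          (\<integral>\<^sup>+y. ennreal (norm (sym_grad sp_dir \<Omega> u y) * norm (x - y) powr (1 - real CARD('n)))
             \<partial>lebesgue_on (ball x (2 * bdist \<Omega> x) \<inter> \<Omega>)))"

end

theory Submission
  imports Defs
begin

text \<open>
  For \<open>v\<close> supported away from the boundary the symmetric gradient of the smoothed function is an average of
  \<open>\<epsilon>(v)\<close>; where the cut-off varies, the extra term \<open>v \<otimes> \<nabla>\<eta>\<^sub>h\<close> is controlled by the boundary strip estimate. Both are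
  bounded by averages over balls, which log-Hoelder continuity makes uniformly bounded on \<open>L\<^sup>p\<close>. Hence the smoothing operators
  are uniformly bounded, and so are their adjoints.

  Testing a functional against translated bumps gives a smooth density, since
  \<open>us (\<eta>\<^sub>h (\<omega>\<^sub>h * v)) = \<integral> us (\<eta>\<^sub>h \<omega>\<^sub>h(\<cdot> - y)) v(y) dy\<close>.

  For the convergence, uniform boundedness reduces the claim to a dense class. Functionals with continuous compactly supported
  densities are dense because a near-minimiser \<open>u\<close> of \<open>\<integral> \<bar>v\<bar>\<^sup>q + \<integral> \<bar>\<epsilon>(v)\<bar>\<^sup>p - us v\<close> almost solves the Euler-Lagrange
  equation, which represents \<open>us\<close> up to a small error. For such densities the cut-off is eventually \<open>1\<close> on the support and
  mollification converges uniformly.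
\<close>

section \<open>Smooth functions\<close>

text \<open>The obstacle is the boundary strip: there the gradient of eta_h is of size 1/h, so a
  compensating factor h has to come from v. The Riesz kernel of order 1 - d provides it, since its
  integral over a ball of radius r is of order r. The cut-off varies only at distance 2h to 3h from
  the boundary and a kernel of radius h then reaches distance 4h; hence \<open>h0 / 4\<close>. The
  strip estimate concerns single time slices and exponent 1, whereas elements of \<open>X_st\<close>
  carry one space-time gradient. Identifying the two for almost every t calls for countably many
  test functions, so that one null set serves them all. Log-Hoelder continuity enters through one
  fact: the modular averaged over a ball of radius h is at most of order h^(-n), and this number
  raised to the oscillation of the exponent, of order 1/log(1/h), stays bounded. Smoothness of
  convolutions and of the densities of smoothed functionals is a single argument: a functional
  continuous in the C^1 norm can be differentiated along translates, because second-order Taylor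
  remainders of test functions are uniform.\<close>

lemma has_derivative_quadratic:
 fixes f :: "'a::real_normed_vector \<Rightarrow> 'b::real_normed_vector"
 assumes D: "bounded_linear D" and "\<And>w. norm (f (x + w) - f x - D w) \<le> C * (norm w)\<^sup>2"
 shows "(f has_derivative D) (at x)"
 unfolding has_derivative_at
proof (intro conjI D)
 have lim: "((%h. C * norm h) \<longlongrightarrow> 0) (at (0::'a))"
  by (auto intro!: tendsto_eq_intros)
 show "(%h. norm (f (x + h) - f x - D h) / norm h) \<midarrow>0\<rightarrow> 0"
 proof (rule tendsto_sandwich[OF _ _ tendsto_const lim])
  show "\<forall>\<^sub>F h in at 0. norm (f (x + h) - f x - D h) / norm h \<le> C * norm h"
   unfolding eventually_at
  proof (intro exI[of _ 1] conjI ballI impI)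
   fix h :: 'a assume "h \<noteq> 0 \<and> dist h 0 < 1"
   then show "norm (f (x + h) - f x - D h) / norm h \<le> C * norm h"
    using assms(2)[of h] by (simp add: divide_le_eq power2_eq_square mult.assoc)
  qed simp
 qed simp
qed

section \<open>Smoothness on the whole space and its closure properties\<close>

definition smooth :: "('a::real_normed_vector \<Rightarrow> 'b::real_normed_vector) \<Rightarrow> bool" where
 "smooth f \<longleftrightarrow> (\<forall>k. Ck_on k UNIV f)"

abbreviation dird :: "'a::real_normed_vector \<Rightarrow> ('a \<Rightarrow> 'b::real_normed_vector) \<Rightarrow> 'a \<Rightarrow> 'b" where
 "dird v f \<equiv> (%x. frechet_derivative f (at x) v)"

text \<open>Any class closed under directional differentiation consists of smooth functions.
  Choosing such a class replaces inductions over the order of differentiation, which would need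
  formulas for higher derivatives.\<close>

lemma smooth_coinduct:
 assumes "f \<in> S"
  and diff: "\<And>g. g \<in> S ==> \<exists>g'. (\<forall>x. (g has_derivative g' x) (at x)) \<and> (\<forall>v. (%x. g' x v) \<in> S)"
 shows "smooth f"
proof -
 have d: "g differentiable_on UNIV" if "g \<in> S" for g
  using diff[OF that] by (auto simp: differentiable_on_def differentiable_def)
 have dv: "dird v g \<in> S" if gS: "g \<in> S" for g v
 proof -
  obtain g' where g': "\<forall>x. (g has_derivative g' x) (at x)" "\<forall>v. (%x. g' x v) \<in> S"
   using diff[OF gS] by blast
  have "dird v g = (%x. g' x v)"
   using frechet_derivative_at[OF g'(1)[rule_format]] by simp
  then show ?thesis using g'(2) by simp
 qed
 have "Ck_on k UNIV g" if "g \<in> S" for g k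
  using that
 proof (induction k arbitrary: g)
  case 0
  then show ?case using d differentiable_imp_continuous_on by auto
 next
  case (Suc k)
  then show ?case using d dv by auto
 qed
 then show ?thesis using assms(1) by (auto simp: smooth_def)
qed

lemma smooth_dird: "smooth f ==> smooth (dird v f)"
 unfolding smooth_def using Ck_on.simps(2) by blast

lemma smooth_differentiable: "smooth f ==> f differentiable (at x)"
 unfolding smooth_def using Ck_on.simps(2)[of 0 UNIV f] by (auto simp: differentiable_on_def)

lemma smooth_has_derivative: "smooth f ==> (f has_derivative frechet_derivative f (at x)) (at x)"
 using smooth_differentiable frechet_derivative_works by blast

lemma smooth_continuous_on: "smooth f ==> continuous_on S f"
 by (rule continuous_at_imp_continuous_on, rule ballI,
  rule has_derivative_continuous[OF smooth_has_derivative])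

lemma smooth_const: "smooth (%x. c)"
 by (rule smooth_coinduct[of _ "range (%c x. c)"]) (auto intro!: exI[of _ "%x v. 0"])

lemma Ck_on_UNIV_Suc_D: "Ck_on (Suc k) UNIV f ==> Ck_on k UNIV f"
proof (induction k arbitrary: f)
 case 0
 then show ?case using differentiable_imp_continuous_on by auto
next
 case (Suc k)
 show ?case using Suc.prems Suc.IH by (subst Ck_on.simps(2)) (subst (asm) Ck_on.simps(2), blast)
qed

lemma Ck_on_UNIV_add: "Ck_on k UNIV f ==> Ck_on k UNIV g ==> Ck_on k UNIV (%x. f x + g x)"
proof (induction k arbitrary: f g)
 case 0
 then show ?case by (auto intro: continuous_on_add)
next
 case (Suc k)
 have d: "f differentiable (at x)" "g differentiable (at x)" for x
  using Suc.prems by (auto simp: differentiable_on_def)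
 have "dird v (%x. f x + g x) = (%x. dird v f x + dird v g x)" for v
  by (intro ext, subst frechet_derivative_at[OF has_derivative_add[OF
   d(1)[unfolded frechet_derivative_works] d(2)[unfolded frechet_derivative_works]], symmetric]) simp
 then show ?case using Suc d by (auto simp: differentiable_on_def)
qed

lemma smooth_add: "smooth f ==> smooth g ==> smooth (%x. f x + g x)"
 by (simp add: smooth_def Ck_on_UNIV_add)

lemma Ck_on_UNIV_scaleR:
 "Ck_on k UNIV f ==> Ck_on k UNIV g ==> Ck_on k UNIV (%x. f x *\<^sub>R g x)"
proof (induction k arbitrary: f g)
 case 0
 then show ?case by (auto intro: continuous_on_scaleR)
next
 case (Suc k)
 have d: "f differentiable (at x)" "g differentiable (at x)" for x
  using Suc.prems by (auto simp: differentiable_on_def)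
 have der: "((%x. f x *\<^sub>R g x) has_derivative
   (%v. f x *\<^sub>R dird v g x + dird v f x *\<^sub>R g x)) (at x)" for x
  using has_derivative_scaleR[OF d(1)[unfolded frechet_derivative_works]
   d(2)[unfolded frechet_derivative_works]] by simp
 have "dird v (%x. f x *\<^sub>R g x) = (%x. f x *\<^sub>R dird v g x + dird v f x *\<^sub>R g x)" for v
  by (intro ext, subst frechet_derivative_at[OF der, symmetric]) simp
 moreover have "(%x. f x *\<^sub>R g x) differentiable_on UNIV"
  using der by (auto simp: differentiable_on_def differentiable_def)
 \<comment> \<open>The Leibniz rule leaves one factor undifferentiated, so the factors themselves
   are needed at the lower order k too.\<close>
 moreover have "Ck_on k UNIV f" "Ck_on k UNIV g"
  by (rule Ck_on_UNIV_Suc_D[OF Suc.prems(1)], rule Ck_on_UNIV_Suc_D[OF Suc.prems(2)])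
 ultimately show ?case using Suc by (auto intro!: Ck_on_UNIV_add)
qed

lemma smooth_scaleR: "smooth f ==> smooth g ==> smooth (%x. f x *\<^sub>R g x)"
 by (simp add: smooth_def Ck_on_UNIV_scaleR)

lemma smooth_mult: "smooth f ==> smooth g ==> smooth (%x. f x * g x :: real)"
 using smooth_scaleR[of f g] by simp

lemma smooth_affine:
 assumes "smooth f" and L: "bounded_linear L"
 shows "smooth (%x. f (a + L x))"
proof (rule smooth_coinduct[of _ "{%x. f (a + L x) | f. smooth f}"])
 fix g assume "g \<in> {%x. f (a + L x) | f. smooth f}"
 then obtain f where g: "g = (%x. f (a + L x))" and f: "smooth f" by auto
 have 1: "((%x. a + L x) has_derivative L) (at x)" for x
  using bounded_linear_imp_has_derivative[OF L] has_derivative_add_const[of L L "at x" a]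
  by (simp add: add.commute)
 have "(g has_derivative (%v. dird (L v) f (a + L x))) (at x)" for x
  unfolding g by (rule has_derivative_compose[OF 1 smooth_has_derivative[OF f]])
 moreover have "(%x. dird (L v) f (a + L x)) \<in> {%x. f (a + L x) | f. smooth f}" for v
  by (intro CollectI exI[of _ "dird (L v) f"] conjI refl smooth_dird f)
 ultimately show "\<exists>g'. (\<forall>x. (g has_derivative g' x) (at x)) \<and>
   (\<forall>v. (%x. g' x v) \<in> {%x. f (a + L x) | f. smooth f})"
  by (intro exI[of _ "%x v. dird (L v) f (a + L x)"]) auto
qed (use assms in auto)

lemma frechet_derivative_affine:
 assumes "smooth f" and L: "bounded_linear L"
 shows "frechet_derivative (%x. f (a + L x)) (at x) v = frechet_derivative f (at (a + L x)) (L v)"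
proof -
 have 1: "((%x. a + L x) has_derivative L) (at x)" for x
  using bounded_linear_imp_has_derivative[OF L] has_derivative_add_const[of L L "at x" a]
  by (simp add: add.commute)
 have "((%x. f (a + L x)) has_derivative (%v. dird (L v) f (a + L x))) (at x)" for x
  by (rule has_derivative_compose[OF 1 smooth_has_derivative[OF assms(1)]])
 then show ?thesis by (subst frechet_derivative_at[symmetric]) auto
qed

lemma smooth_sum: "(\<And>i. i \<in> I ==> smooth (f i)) ==> smooth (%x. \<Sum>i\<in>I. f i x)"
 by (induction I rule: infinite_finite_induct) (auto intro: smooth_const smooth_add)

lemma frechet_derivative_scaleR_smooth:
 assumes "smooth f" "smooth g"
 shows "frechet_derivative (%x. f x *\<^sub>R g x) (at x) v = f x *\<^sub>R dird v g x + dird v f x *\<^sub>R g x"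
 by (subst frechet_derivative_at[OF has_derivative_scaleR[OF smooth_has_derivative[OF assms(1)]
  smooth_has_derivative[OF assms(2)]], symmetric]) simp

lemma frechet_derivative_bounded_linear_smooth:
 assumes "smooth f" "bounded_linear L"
 shows "frechet_derivative (%x. L (f x)) (at x) v = L (dird v f x)"
 by (subst frechet_derivative_at[OF bounded_linear.has_derivative[OF assms(2)
  smooth_has_derivative[OF assms(1)]], symmetric]) simp

lemma smooth_bounded_linear:
 assumes "smooth f" "bounded_linear L"
 shows "smooth (%x. L (f x))"
proof (rule smooth_coinduct[of _ "{%x. L (f x) | f. smooth f}"])
 fix g assume "g \<in> {%x. L (f x) | f. smooth f}"
 then obtain f where g: "g = (%x. L (f x))" and f: "smooth f" by auto
 have "(g has_derivative (%v. L (dird v f x))) (at x)" for x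
  unfolding g by (rule bounded_linear.has_derivative[OF assms(2) smooth_has_derivative[OF f]])
 moreover have "(%x. L (dird v f x)) \<in> {%x. L (f x) | f. smooth f}" for v
  by (intro CollectI exI[of _ "dird v f"] conjI refl smooth_dird f)
 ultimately show "\<exists>g'. (\<forall>x. (g has_derivative g' x) (at x)) \<and>
   (\<forall>v. (%x. g' x v) \<in> {%x. L (f x) | f. smooth f})"
  by (intro exI[of _ "%x v. L (dird v f x)"]) auto
qed (use assms in auto)

subsection \<open>The bump function\<close>

text \<open>The derivatives of exp (-1/t) are combinations of these functions; the index m makes the
  family closed under differentiation.\<close>

definition exp_pole :: "nat \<Rightarrow> real \<Rightarrow> real" where
 "exp_pole m t = (if 0 < t then exp (- 1 / t) / t ^ m else 0)"

text \<open>The single term of index m + 2 in the series of exp (1/t) already beats the pole. The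
  spare factor t^2 makes the function differentiable at 0 with derivative 0.\<close>

lemma exp_pole_quadratic: "\<bar>exp_pole m t\<bar> \<le> fact (m + 2) * t\<^sup>2"
proof (cases "0 < t")
 case True
 define F :: real where "F = fact (m + 2)"
 have "F > 0" by (simp add: F_def)
 have "(1/t) ^ (m + 2) / F \<le> exp (1/t)"
 proof -
  have "summable (%n. (1/t) ^ n /\<^sub>R fact n)" by (rule summable_exp_generic)
  then have "(\<Sum>n\<in>{m+2}. (1/t) ^ n /\<^sub>R fact n) \<le> (\<Sum>n. (1/t) ^ n /\<^sub>R fact n)"
   using True by (intro sum_le_suminf) auto
  then show ?thesis by (simp add: exp_def divide_inverse_commute F_def)
 qed
 then have "1 \<le> exp (1/t) * (F * t ^ (m + 2))"
  using True \<open>F > 0\<close> by (simp add: field_simps)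
 then have "exp (- (1/t)) \<le> F * t ^ (m + 2)"
  by (simp add: exp_minus field_simps)
 then show ?thesis using True
  by (simp add: exp_pole_def F_def[symmetric] field_simps power_add power2_eq_square
   del: fact_Suc add_2_eq_Suc')
qed (simp add: exp_pole_def)

lemma exp_pole_deriv:
 "(exp_pole m has_real_derivative exp_pole (m + 2) t - real m * exp_pole (m + 1) t) (at t)"
proof -
 consider "t < 0" | "t = 0" | "0 < t" by linarith
 then show ?thesis
 proof cases
  case 1
  have "((%_. 0) has_real_derivative 0) (at t)" by simp
  then have "(exp_pole m has_real_derivative 0) (at t)"
   by (rule has_field_derivative_transform_within_open[of _ _ _ "{..<0}"])
    (use 1 in \<open>auto simp: exp_pole_def\<close>)
  then show ?thesis using 1 by (simp add: exp_pole_def)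
 next
  case 2
  have "(exp_pole m has_derivative (%_. 0)) (at 0)"
   by (rule has_derivative_quadratic[where C="fact (m + 2)"])
    (use exp_pole_quadratic[of m] in \<open>auto simp: exp_pole_def\<close>)
  then show ?thesis using 2
   by (simp add: exp_pole_def has_field_derivative_def lambda_zero)
 next
  case 3
  have "((%t. exp (- 1 / t) / t ^ m) has_real_derivative
   exp_pole (m + 2) t - real m * exp_pole (m + 1) t) (at t)"
  proof -
   have e: "((%t. exp (- 1 / t)) has_real_derivative exp (- 1 / t) * (1 / t\<^sup>2)) (at t)"
    using 3 by (auto intro!: derivative_eq_intros simp: power2_eq_square)
   have p: "((%t. t ^ m) has_real_derivative real m * t ^ (m - 1)) (at t)"
    by (auto intro!: derivative_eq_intros)
   have "t ^ m \<noteq> 0" using 3 by simp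
   moreover have "(exp (- 1 / t) * (1 / t\<^sup>2) * t ^ m - exp (- 1 / t) * (real m * t ^ (m - 1)))
     / (t ^ m * t ^ m) = exp_pole (m + 2) t - real m * exp_pole (m + 1) t"
    using 3 by (cases m) (auto simp: exp_pole_def field_simps power2_eq_square)
   ultimately show ?thesis
    using DERIV_divide[OF e p] by simp
  qed
  then show ?thesis
   by (rule has_field_derivative_transform_within_open[of _ _ _ "{0<..}"])
    (use 3 in \<open>auto simp: exp_pole_def\<close>)
 qed
qed

text \<open>An algebra closed under differentiation that contains the bump function, as required by
  \<open>smooth_coinduct\<close>.\<close>

inductive_set bump_alg :: "('a::euclidean_space \<Rightarrow> real) set" where
 pole: "(%x. exp_pole m (1 - x \<bullet> x)) \<in> bump_alg"
| const: "(%x. c) \<in> bump_alg"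
| lin: "(%x. x \<bullet> v) \<in> bump_alg"
| add: "f \<in> bump_alg ==> g \<in> bump_alg ==> (%x. f x + g x) \<in> bump_alg"
| mult: "f \<in> bump_alg ==> g \<in> bump_alg ==> (%x. f x * g x) \<in> bump_alg"

lemma smooth_bump: "smooth (bump :: 'a::euclidean_space \<Rightarrow> real)"
proof (rule smooth_coinduct)
 have "bump x = exp_pole 0 (1 - x \<bullet> x)" for x :: 'a
  by (simp add: bump_def exp_pole_def power2_norm_eq_inner[symmetric] abs_square_less_1)
 then have "bump = (%x::'a. exp_pole 0 (1 - x \<bullet> x))" by auto
 then show "(bump :: 'a \<Rightarrow> real) \<in> bump_alg" using bump_alg.pole[where m=0 and 'a='a] by metis
next
 fix g :: "'a \<Rightarrow> real" assume "g \<in> bump_alg"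
 then show "\<exists>g'. (\<forall>x. (g has_derivative g' x) (at x)) \<and> (\<forall>v. (%x. g' x v) \<in> bump_alg)"
 proof induction
  case (pole m)
  let ?G = "%m x::'a. exp_pole m (1 - x \<bullet> x)"
  let ?g' = "%x v. (?G (m + 2) x + (- real m) * ?G (m + 1) x) * ((-2) * (x \<bullet> v))"
  have "(?G m has_derivative ?g' x) (at x)" for x
  proof -
   have 1: "((%x. 1 - x \<bullet> x) has_derivative (%v. - 2 * (x \<bullet> v))) (at x)"
    by (auto intro!: derivative_eq_intros simp: inner_commute)
   show ?thesis
    using has_derivative_compose[OF 1 exp_pole_deriv[unfolded has_field_derivative_def]] by simp
  qed
  moreover have "(%x. ?g' x v) \<in> bump_alg" for v
   by (intro bump_alg.intros)
  ultimately show ?case by (intro exI[of _ ?g'] conjI allI)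
 next
  case (const c)
  then show ?case by (intro exI[of _ "%x v. 0"]) (auto intro: bump_alg.intros)
 next
  case (lin w)
  then show ?case
   by (intro exI[of _ "%x v. v \<bullet> w"]) (auto intro!: bump_alg.intros derivative_eq_intros)
 next
  case (add f g)
  then obtain f' g' where
   "\<forall>x. (f has_derivative f' x) (at x)" "\<forall>v. (%x. f' x v) \<in> bump_alg"
   "\<forall>x. (g has_derivative g' x) (at x)" "\<forall>v. (%x. g' x v) \<in> bump_alg" by blast
  then show ?case
   by (intro exI[of _ "%x v. f' x v + g' x v"]) (auto intro!: bump_alg.add has_derivative_add)
 next
  case (mult f g)
  then obtain f' g' where
   "\<forall>x. (f has_derivative f' x) (at x)" "\<forall>v. (%x. f' x v) \<in> bump_alg"
   "\<forall>x. (g has_derivative g' x) (at x)" "\<forall>v. (%x. g' x v) \<in> bump_alg" by blast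
  with mult.hyps show ?case
   by (intro exI[of _ "%x v. f x * g' x v + f' x v * g x"])
    (auto intro!: bump_alg.add bump_alg.mult has_derivative_mult)
 qed
qed

section \<open>Restriction to lines and symmetry of second derivatives\<close>

lemma smooth_has_real_derivative_line:
 fixes f :: "'a::real_normed_vector \<Rightarrow> real"
 assumes "smooth f"
 shows "((%s. f (x + s *\<^sub>R v)) has_real_derivative dird v f (x + s *\<^sub>R v)) (at s within T)"
proof -
 have "((%s. x + s *\<^sub>R v) has_derivative (%s. s *\<^sub>R v)) (at s within T)"
  by (auto intro!: derivative_eq_intros)
 from has_derivative_compose[OF this smooth_has_derivative[OF assms]]
 show ?thesis
  by (simp add: has_field_derivative_def linear_simps(5)[OF has_derivative_bounded_linear[OF
    smooth_has_derivative[OF assms]]] mult_commute_abs)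
qed

text \<open>Schwarz's theorem. The second difference over a small parallelogram is symmetric in v
  and w; two applications of the mean value theorem, in either order, turn it into either mixed
  derivative at a nearby point. Continuity of both derivatives then excludes a gap at x.\<close>

lemma dird_commute:
 fixes f :: "'a::real_normed_vector \<Rightarrow> real"
 assumes f: "smooth f"
 shows "dird v (dird w f) x = dird w (dird v f) x"
proof (rule ccontr)
 assume neq: "dird v (dird w f) x \<noteq> dird w (dird v f) x"
 have key: "\<exists>s\<in>{0<..<e}. \<exists>t\<in>{0<..<e}.
   f (x + e *\<^sub>R v + e *\<^sub>R w) - f (x + e *\<^sub>R v) - f (x + e *\<^sub>R w) + f x
    = e * e * dird w (dird v f) (x + s *\<^sub>R v + t *\<^sub>R w)" if e: "0 < e" for e v w
 proof -
  define \<phi> where "\<phi> s = f ((x + e *\<^sub>R w) + s *\<^sub>R v) - f (x + s *\<^sub>R v)" for s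
  have "(\<phi> has_real_derivative dird v f ((x + e *\<^sub>R w) + s *\<^sub>R v) - dird v f (x + s *\<^sub>R v)) (at s within {0..e})" for s
   unfolding \<phi>_def by (intro DERIV_diff smooth_has_real_derivative_line[OF f])
  then have "\<exists>s\<in>{0<..<e}. \<phi> e - \<phi> 0 =
    (dird v f ((x + e *\<^sub>R w) + s *\<^sub>R v) - dird v f (x + s *\<^sub>R v)) * (e - 0)"
   by (intro mvt_simple[OF e]) (auto simp: has_field_derivative_def)
  then obtain s where s: "s \<in> {0<..<e}"
   "\<phi> e - \<phi> 0 = (dird v f ((x + e *\<^sub>R w) + s *\<^sub>R v) - dird v f (x + s *\<^sub>R v)) * (e - 0)" ..
  have "\<exists>t\<in>{0<..<e}. dird v f ((x + s *\<^sub>R v) + e *\<^sub>R w) - dird v f ((x + s *\<^sub>R v) + 0 *\<^sub>R w)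
    = dird w (dird v f) ((x + s *\<^sub>R v) + t *\<^sub>R w) * (e - 0)"
   by (rule mvt_simple[OF e smooth_has_real_derivative_line[OF smooth_dird[OF f],
    unfolded has_field_derivative_def]])
  then obtain t where t: "t \<in> {0<..<e}"
   "dird v f ((x + s *\<^sub>R v) + e *\<^sub>R w) - dird v f ((x + s *\<^sub>R v) + 0 *\<^sub>R w)
    = dird w (dird v f) ((x + s *\<^sub>R v) + t *\<^sub>R w) * (e - 0)" ..
  show ?thesis
   by (rule bexI[OF _ s(1)], rule bexI[OF _ t(1)])
    (use s(2) t(2) in \<open>simp add: \<phi>_def algebra_simps\<close>)
 qed
 \<comment> \<open>Half the supposed gap: two deviations, each below d, cannot bridge it.\<close>
 define d where "d = \<bar>dird v (dird w f) x - dird w (dird v f) x\<bar> / 2"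
 have "d > 0" using neq by (simp add: d_def)
 have near: "\<exists>r>0. \<forall>s t. 0 < s \<and> s < r \<and> 0 < t \<and> t < r \<longrightarrow> \<bar>g (x + s *\<^sub>R v + t *\<^sub>R w) - g x\<bar> < d"
  if "smooth g" for g :: "'a \<Rightarrow> real" and v w
 proof -
  have "continuous_on UNIV (%p. g (x + fst p *\<^sub>R v + snd p *\<^sub>R w))"
   by (rule continuous_on_compose2[OF smooth_continuous_on[OF that, of UNIV]])
    (auto intro!: continuous_intros)
  then have "\<exists>r>0. \<forall>p\<in>UNIV. dist p (0,0) < r \<longrightarrow>
    dist (g (x + fst p *\<^sub>R v + snd p *\<^sub>R w)) (g (x + fst (0::real,0::real) *\<^sub>R v + snd (0::real,0::real) *\<^sub>R w)) < d"
   using \<open>d > 0\<close> unfolding continuous_on_iff by blast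
  then obtain r where r: "r > 0" "\<And>p. dist p (0,0) < r ==>
    dist (g (x + fst p *\<^sub>R v + snd p *\<^sub>R w)) (g x) < d" by auto
  have "\<bar>g (x + s *\<^sub>R v + t *\<^sub>R w) - g x\<bar> < d" if "0 < s" "s < r/2" "0 < t" "t < r/2" for s t
  proof -
   have "dist (s,t) (0,0) \<le> s + t"
    using that sqrt_sum_squares_le_sum_abs[of s t] by (simp add: dist_Pair_Pair)
   then show ?thesis using r(2)[of "(s,t)"] that by (simp add: dist_real_def)
  qed
  then show ?thesis using \<open>r > 0\<close> by (intro exI[of _ "r/2"]) auto
 qed
 have "smooth (dird w (dird v f))" "smooth (dird v (dird w f))"
  by (intro smooth_dird f)+
 note sm = this
 from near[where g="dird w (dird v f)" and v=v and w=w, OF sm(1)]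
 obtain r1 where r1: "r1 > 0 \<and> (\<forall>s t. 0 < s \<and> s < r1 \<and> 0 < t \<and> t < r1 \<longrightarrow>
   \<bar>dird w (dird v f) (x + s *\<^sub>R v + t *\<^sub>R w) - dird w (dird v f) x\<bar> < d)" ..
 from near[where g="dird v (dird w f)" and v=w and w=v, OF sm(2)]
 obtain r2 where r2: "r2 > 0 \<and> (\<forall>s t. 0 < s \<and> s < r2 \<and> 0 < t \<and> t < r2 \<longrightarrow>
   \<bar>dird v (dird w f) (x + s *\<^sub>R w + t *\<^sub>R v) - dird v (dird w f) x\<bar> < d)" ..
 define e where "e = min r1 r2 / 2"
 have e: "e > 0" "e < r1" "e < r2" using r1 r2 by (auto simp: e_def)
 from key[where e=e and v=v and w=w, OF e(1)] obtain s where s: "s \<in> {0<..<e}" "\<exists>t\<in>{0<..<e}.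
   f (x + e *\<^sub>R v + e *\<^sub>R w) - f (x + e *\<^sub>R v) - f (x + e *\<^sub>R w) + f x
    = e * e * dird w (dird v f) (x + s *\<^sub>R v + t *\<^sub>R w)" ..
 from s(2) obtain t where t: "t \<in> {0<..<e}"
   "f (x + e *\<^sub>R v + e *\<^sub>R w) - f (x + e *\<^sub>R v) - f (x + e *\<^sub>R w) + f x
    = e * e * dird w (dird v f) (x + s *\<^sub>R v + t *\<^sub>R w)" ..
 from key[where e=e and v=w and w=v, OF e(1)] obtain s' where s': "s' \<in> {0<..<e}" "\<exists>t\<in>{0<..<e}.
   f (x + e *\<^sub>R w + e *\<^sub>R v) - f (x + e *\<^sub>R w) - f (x + e *\<^sub>R v) + f x
    = e * e * dird v (dird w f) (x + s' *\<^sub>R w + t *\<^sub>R v)" ..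
 from s'(2) obtain t' where t': "t' \<in> {0<..<e}"
   "f (x + e *\<^sub>R w + e *\<^sub>R v) - f (x + e *\<^sub>R w) - f (x + e *\<^sub>R v) + f x
    = e * e * dird v (dird w f) (x + s' *\<^sub>R w + t' *\<^sub>R v)" ..
 have "f (x + e *\<^sub>R w + e *\<^sub>R v) - f (x + e *\<^sub>R w) - f (x + e *\<^sub>R v) + f x
   = f (x + e *\<^sub>R v + e *\<^sub>R w) - f (x + e *\<^sub>R v) - f (x + e *\<^sub>R w) + f x"
  by (simp add: add.commute add.left_commute)
 from trans[OF sym[OF t'(2)] trans[OF this t(2)]]
 have "e * e * dird w (dird v f) (x + s *\<^sub>R v + t *\<^sub>R w)
   = e * e * dird v (dird w f) (x + s' *\<^sub>R w + t' *\<^sub>R v)"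
  by (rule sym)
 then have 1: "dird w (dird v f) (x + s *\<^sub>R v + t *\<^sub>R w) = dird v (dird w f) (x + s' *\<^sub>R w + t' *\<^sub>R v)"
  using e(1) by simp
 have 2: "\<bar>dird w (dird v f) (x + s *\<^sub>R v + t *\<^sub>R w) - dird w (dird v f) x\<bar> < d"
  using s(1) t(1) e by (intro r1[THEN conjunct2, rule_format]) auto
 have 3: "\<bar>dird v (dird w f) (x + s' *\<^sub>R w + t' *\<^sub>R v) - dird v (dird w f) x\<bar> < d"
  using s'(1) t'(1) e by (intro r2[THEN conjunct2, rule_format]) auto
 have "a' = b' ==> \<bar>a' - a\<bar> < d ==> \<bar>b' - b\<bar> < d ==> d = \<bar>b - a\<bar> / 2 ==> False" for a b a' b' :: real
  by (simp add: abs_if split: if_splits)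
 from this[OF 1 2 3 d_def] show False .
qed

text \<open>Derivatives within S are unique only if S accumulates at each of its points along every
  coordinate axis; \<open>fat\<close> supplies this. It holds for open sets, and also for the
  cylinder with closed time interval.\<close>

lemma Ck_on_of_UNIV:
 fixes f g :: "'a::euclidean_space \<Rightarrow> 'b::real_normed_vector"
 assumes fat: "\<And>x i e. x \<in> S ==> i \<in> Basis ==> 0 < e ==> \<exists>d. 0 < \<bar>d\<bar> \<and> \<bar>d\<bar> < e \<and> x + d *\<^sub>R i \<in> S"
 shows "Ck_on k UNIV g ==> (\<And>x. x \<in> S ==> f x = g x) ==> Ck_on k S f"
proof (induction k arbitrary: f g)
 case 0
 then show ?case by (auto intro: continuous_on_subset[of UNIV] continuous_on_eq[of S g])
next
 case (Suc k)
 have g: "(g has_derivative frechet_derivative g (at x)) (at x)" for x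
  using Suc.prems(1) by (auto simp: differentiable_on_def frechet_derivative_works)
 have f: "(f has_derivative frechet_derivative g (at x)) (at x within S)" if "x \<in> S" for x
  by (rule has_derivative_transform[OF that _ has_derivative_at_withinI[OF g]])
   (use Suc.prems(2) in auto)
 have eq: "frechet_derivative f (at x within S) = frechet_derivative g (at x)" if "x \<in> S" for x
 proof (rule frechet_derivative_unique_within[OF _ f[OF that]])
  show "(f has_derivative frechet_derivative f (at x within S)) (at x within S)"
   using f[OF that] frechet_derivative_works by (auto simp: differentiable_def)
 qed (use fat[OF that] in auto)
 have "Ck_on k S (%x. frechet_derivative f (at x within S) v)" for v
  by (rule Suc.IH[of "dird v g"]) (use Suc.prems(1) eq in auto)
 then show ?case using f by (auto simp: differentiable_on_def differentiable_def)
qed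

lemma smooth_imp_Ck_on_open:
 assumes "smooth f" "open S"
 shows "Ck_on k S (f :: 'a::euclidean_space \<Rightarrow> 'b::real_normed_vector)"
proof (rule Ck_on_of_UNIV[of S k f])
 fix x i :: 'a and e :: real assume "x \<in> S" "i \<in> Basis" "0 < e"
 obtain r where r: "r > 0" "ball x r \<subseteq> S" using \<open>open S\<close> \<open>x \<in> S\<close> openE by blast
 show "\<exists>d. 0 < \<bar>d\<bar> \<and> \<bar>d\<bar> < e \<and> x + d *\<^sub>R i \<in> S"
 proof (intro exI[of _ "min e r / 2"] conjI)
  have "x + (min e r / 2) *\<^sub>R i \<in> ball x r" using r(1) \<open>0 < e\<close> \<open>i \<in> Basis\<close> by (auto simp: dist_norm)
  then show "x + (min e r / 2) *\<^sub>R i \<in> S" using r(2) by blast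
 qed (use r(1) \<open>0 < e\<close> in auto)
qed (use assms in \<open>auto simp: smooth_def\<close>)

lemma Ck_on_cong: "Ck_on k S f ==> (\<And>x. x \<in> S ==> f x = g x) ==> Ck_on k S g"
proof (induction k arbitrary: f g)
 case 0
 then show ?case by (auto intro: continuous_on_eq[of S f])
next
 case (Suc k)
 have "(f has_derivative D) (at x within S) \<longleftrightarrow> (g has_derivative D) (at x within S)" if "x \<in> S" for D x
  using Suc.prems(2) that has_derivative_transform[of x S f g D] has_derivative_transform[of x S g f D]
  by auto
 then have 1: "x \<in> S ==> frechet_derivative f (at x within S) = frechet_derivative g (at x within S)"
  and 2: "x \<in> S ==> f differentiable (at x within S) ==> g differentiable (at x within S)" for x
  by (simp_all add: frechet_derivative_def differentiable_def)
 have "Ck_on k S (%x. frechet_derivative g (at x within S) v)" for v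
  by (rule Suc.IH[of "%x. frechet_derivative f (at x within S) v"]) (use Suc.prems(1) 1 in auto)
 then show ?case using 2 Suc.prems(1) by (auto simp: differentiable_on_def)
qed

text \<open>The open sets G and \<open>- C\<close> cover the space; on the second the function is
  zero with all its derivatives, so regularity on G extends globally.\<close>

lemma Ck_on_UNIV_of_support:
 fixes f :: "'a::euclidean_space \<Rightarrow> 'b::real_normed_vector"
 assumes "open G" "closed C" "C \<subseteq> G"
 shows "Ck_on k G f ==> (\<And>x. x \<notin> C ==> f x = 0) ==> Ck_on k UNIV f"
proof (induction k arbitrary: f)
 case 0
 have "continuous_on (G \<union> - C) f"
 proof (rule continuous_on_open_Un)
  show "continuous_on (- C) f"
   using 0(2) by (auto intro: continuous_on_eq[OF continuous_on_const[of _ 0]])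
 qed (use 0 assms in auto)
 moreover have "G \<union> - C = UNIV" using assms by auto
 ultimately show ?case by simp
next
 case (Suc k)
 have out: "(f has_derivative (%_. 0)) (at x)" if "x \<notin> C" for x
  by (rule has_derivative_transform_within_open[of "%_. 0" _ _ _ "- C"])
   (use that Suc.prems(2) assms in auto)
 have inn: "(f has_derivative frechet_derivative f (at x)) (at x)" if "x \<in> G" for x
 proof -
  have "f differentiable (at x within G)"
   using Suc.prems(1) that by (auto simp: differentiable_on_def)
  then show ?thesis by (simp add: at_within_open[OF that assms(1)] frechet_derivative_works)
 qed
 have d: "f differentiable (at x)" for x
  using inn[of x] out[of x] assms(3) by (auto simp: differentiable_def)
 have "Ck_on k UNIV (dird v f)" for v
 proof (rule Suc.IH)
  show "dird v f x = 0" if "x \<notin> C" for x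
   by (subst frechet_derivative_at[OF out[OF that], symmetric]) simp
  have "Ck_on k G (%x. frechet_derivative f (at x within G) v)" using Suc.prems(1) by simp
  then show "Ck_on k G (dird v f)"
   by (rule Ck_on_cong) (simp add: at_within_open[OF _ assms(1)])
 qed
 then show ?case using d by (auto simp: differentiable_on_def)
qed

text \<open>For open sets this exchanges derivatives within the set for ordinary ones, so that test
  functions can be handled as globally smooth functions.\<close>

lemma smooth_compact_iff:
 assumes "open G"
 shows "f \<in> smooth_compact G \<longleftrightarrow>
  smooth f \<and> compact (closure {x. f x \<noteq> 0}) \<and> closure {x. f x \<noteq> 0} \<subseteq> G"
proof
 assume f: "f \<in> smooth_compact G"
 have "Ck_on k UNIV f" for k
 proof (rule Ck_on_UNIV_of_support[OF assms closed_closure])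
  show "f x = 0" if "x \<notin> closure {x. f x \<noteq> 0}" for x
   using that closure_subset[of "{x. f x \<noteq> 0}"] by auto
 qed (use f in \<open>auto simp: smooth_compact_def\<close>)
 then show "smooth f \<and> compact (closure {x. f x \<noteq> 0}) \<and> closure {x. f x \<noteq> 0} \<subseteq> G"
  using f by (auto simp: smooth_compact_def smooth_def)
qed (use assms smooth_imp_Ck_on_open in \<open>auto simp: smooth_compact_def\<close>)

subsection \<open>Test functions and their translates\<close>

text \<open>Compactly supported smooth functions on the whole space; boundedness of the nonzero set
  is easier to propagate than compactness of its closure.\<close>

definition test_fn :: "('a::euclidean_space \<Rightarrow> real) \<Rightarrow> bool" where
 "test_fn \<kappa> \<longleftrightarrow> smooth \<kappa> \<and> bounded {x. \<kappa> x \<noteq> 0}"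

lemma dird_outside_support:
 fixes f :: "'a::real_normed_vector \<Rightarrow> 'b::real_normed_vector"
 assumes "x \<notin> closure {x. f x \<noteq> 0}"
 shows "dird v f x = 0"
proof -
 have "(f has_derivative (%_. 0)) (at x)"
  by (rule has_derivative_transform_within_open[of "%_. 0" _ _ _ "- closure {x. f x \<noteq> 0}"])
   (use assms closure_subset[of "{x. f x \<noteq> 0}"] in auto)
 then show ?thesis by (subst frechet_derivative_at[symmetric]) auto
qed

lemma test_fn_dird:
 assumes "test_fn \<kappa>" shows "test_fn (dird v \<kappa>)"
 unfolding test_fn_def
proof
 show "smooth (dird v \<kappa>)" using assms smooth_dird unfolding test_fn_def by blast
 have "{x. dird v \<kappa> x \<noteq> 0} \<subseteq> closure {x. \<kappa> x \<noteq> 0}" using dird_outside_support[of _ \<kappa> v] by blast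
 then show "bounded {x. dird v \<kappa> x \<noteq> 0}"
  using assms bounded_closure bounded_subset unfolding test_fn_def by blast
qed

lemma test_fn_add: "test_fn f ==> test_fn g ==> test_fn (%x. f x + g x)"
 unfolding test_fn_def using smooth_add[of f g]
 by (auto intro: bounded_subset[of "{x. f x \<noteq> 0} \<union> {x. g x \<noteq> 0}"])

lemma test_fn_mult: "smooth f ==> test_fn g ==> test_fn (%x. f x * g x)"
 unfolding test_fn_def using smooth_mult[of f g]
 by (auto intro: bounded_subset[of "{x. g x \<noteq> 0}"])

lemma test_fn_cmult: "test_fn g ==> test_fn (%x. c * g x)"
 by (rule test_fn_mult[OF smooth_const])

lemma test_fn_minus: "test_fn g ==> test_fn (%x. - g x)"
 using test_fn_cmult[of g "-1"] by simp

lemma test_fn_translate: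
 assumes "test_fn \<kappa>" shows "test_fn (%z. \<kappa> (z - y))"
proof -
 have "smooth (%z. \<kappa> (- y + z))"
  using smooth_affine[of \<kappa> "%z. z" "-y"] assms by (auto simp: test_fn_def bounded_linear_ident)
 moreover have "{z. \<kappa> (z - y) \<noteq> 0} \<subseteq> (+) y ` {x. \<kappa> x \<noteq> 0}"
  by (auto intro!: image_eqI[where x="_ - y"])
 ultimately show ?thesis
  using assms bounded_translation[of "{x. \<kappa> x \<noteq> 0}" y] bounded_subset
  by (auto simp: test_fn_def)
qed

lemma dird_translate: "smooth \<kappa> ==> dird v (%z. \<kappa> (z - y)) x = dird v \<kappa> (x - y)"
 using frechet_derivative_affine[of \<kappa> "%z. z" "-y" x v] by (simp add: bounded_linear_ident)

lemma dird_linear: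
 assumes "smooth f"
 shows "dird (v + w) f x = dird v f x + dird w f x" "dird (- v) f x = - dird v f x"
  "dird (c *\<^sub>R v) f x = c *\<^sub>R dird v f x"
 using linear_simps[OF has_derivative_bounded_linear[OF smooth_has_derivative[OF assms, of x]]] by auto

lemma test_fn_reflect:
 assumes "test_fn \<kappa>" shows "test_fn (%z. \<kappa> (y - z))"
proof -
 have "smooth (%z. \<kappa> (y + - z))"
  using smooth_affine[of \<kappa> "%z. - z" "y"] assms
  by (simp add: test_fn_def bounded_linear_minus bounded_linear_ident)
 moreover have "{z. \<kappa> (y - z) \<noteq> 0} \<subseteq> (%x. y - x) ` {x. \<kappa> x \<noteq> 0}"
  by (auto intro!: image_eqI[where x="y - _"])
 moreover have "bounded ((%x. y - x) ` {x. \<kappa> x \<noteq> 0})"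
 proof -
  have "(%x. y - x) ` {x. \<kappa> x \<noteq> 0} = (+) y ` uminus ` {x. \<kappa> x \<noteq> 0}"
   by (auto simp: image_image)
  then show ?thesis
   using assms by (simp add: test_fn_def bounded_translation)
 qed
 ultimately show ?thesis
  using assms bounded_subset by (auto simp: test_fn_def)
qed

lemma dird_reflect: "smooth \<kappa> ==> dird v (%z. \<kappa> (y - z)) x = - dird v \<kappa> (y - x)"
proof -
 assume k: "smooth \<kappa>"
 have "dird v (%z. \<kappa> (y + - z)) x = dird (- v) \<kappa> (y + - x)"
  by (rule frechet_derivative_affine[OF k bounded_linear_minus[OF bounded_linear_ident]])
 also have "\<dots> = - dird v \<kappa> (y - x)"
  by (simp add: dird_linear[OF k])
 finally show ?thesis by simp
qed

lemma dird_Basis: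
 fixes f :: "'a::euclidean_space \<Rightarrow> real"
 assumes "smooth f"
 shows "dird v f x = (\<Sum>b\<in>Basis. (v \<bullet> b) * dird b f x)"
proof -
 interpret bounded_linear "frechet_derivative f (at x)"
  using has_derivative_bounded_linear[OF smooth_has_derivative[OF assms]] .
 have "dird v f x = frechet_derivative f (at x) (\<Sum>b\<in>Basis. (v \<bullet> b) *\<^sub>R b)"
  by (simp add: euclidean_representation)
 then show "dird v f x = (\<Sum>b\<in>Basis. (v \<bullet> b) * dird b f x)"
  by (simp add: sum scaleR)
qed

lemma test_fn_bounded:
 assumes "test_fn (\<kappa> :: 'a::euclidean_space \<Rightarrow> real)"
 obtains B where "B \<ge> 0" "\<And>x. \<bar>\<kappa> x\<bar> \<le> B"
proof -
 let ?C = "closure {x. \<kappa> x \<noteq> 0}"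
 have "compact (\<kappa> ` ?C)"
  using assms by (intro compact_continuous_image smooth_continuous_on)
   (auto simp: test_fn_def compact_closure)
 then obtain B where B: "\<And>x. x \<in> ?C ==> \<bar>\<kappa> x\<bar> \<le> B"
  using compact_imp_bounded bounded_iff by (metis imageI real_norm_def)
 have "\<bar>\<kappa> x\<bar> \<le> max B 0" for x
  using B[of x] closure_subset[of "{x. \<kappa> x \<noteq> 0}"] by (cases "\<kappa> x = 0") auto
 then show thesis using that[of "max B 0"] by auto
qed

lemma test_fn_dird_bounded:
 assumes "test_fn (\<kappa> :: 'a::euclidean_space \<Rightarrow> real)"
 obtains B where "B \<ge> 0" "\<And>x v. \<bar>dird v \<kappa> x\<bar> \<le> B * norm v"
proof -
 have "\<exists>B\<ge>0. \<forall>x. \<bar>dird b \<kappa> x\<bar> \<le> B" for b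
  using test_fn_bounded[OF test_fn_dird[OF assms]] by metis
 then obtain B where B: "\<And>b. B b \<ge> 0" "\<And>b x. \<bar>dird b \<kappa> x\<bar> \<le> B b" by metis
 have sm: "smooth \<kappa>" using assms by (simp add: test_fn_def)
 have "\<bar>dird v \<kappa> x\<bar> \<le> (\<Sum>b\<in>Basis. B b) * norm v" for x v
 proof -
  have "\<bar>dird v \<kappa> x\<bar> \<le> (\<Sum>b\<in>Basis. \<bar>(v \<bullet> b) * dird b \<kappa> x\<bar>)"
   by (subst dird_Basis[OF sm]) (rule sum_abs)
  also have "\<dots> \<le> (\<Sum>b\<in>Basis. norm v * B b)"
   unfolding abs_mult by (intro sum_mono mult_mono B Basis_le_norm) auto
  finally show ?thesis by (simp add: sum_distrib_left mult.commute)
 qed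
 then show thesis using that[of "\<Sum>b\<in>Basis. B b"] B by (auto simp: sum_nonneg)
qed

text \<open>Two nested mean value theorems along the segment from x to x - w. The bound is uniform
  in x because second derivatives are again test functions, and symmetry of second derivatives
  reduces both directions to the basis.\<close>

lemma test_fn_second_order:
 assumes "test_fn (\<kappa> :: 'a::euclidean_space \<Rightarrow> real)"
 obtains B where "B \<ge> 0" "\<And>x w. \<bar>\<kappa> (x - w) - \<kappa> x + dird w \<kappa> x\<bar> \<le> B * (norm w)\<^sup>2"
proof -
 have sm: "smooth \<kappa>" using assms by (simp add: test_fn_def)
 have "\<exists>B\<ge>0. \<forall>x v. \<bar>dird v (dird b \<kappa>) x\<bar> \<le> B * norm v" for b
  using test_fn_dird_bounded[OF test_fn_dird[OF assms]] by metis
 then obtain B where B: "\<And>b. B b \<ge> 0" "\<And>b x v. \<bar>dird v (dird b \<kappa>) x\<bar> \<le> B b * norm v" by metis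
 define B' where "B' = (\<Sum>b\<in>Basis. B b)"
 have B': "\<bar>dird v (dird w \<kappa>) x\<bar> \<le> B' * norm w * norm v" for v w x
 proof -
  have "dird v (dird w \<kappa>) x = dird w (dird v \<kappa>) x" by (rule dird_commute[OF sm])
  also have "\<bar>\<dots>\<bar> \<le> (\<Sum>b\<in>Basis. \<bar>(w \<bullet> b) * dird b (dird v \<kappa>) x\<bar>)"
   by (subst dird_Basis[OF smooth_dird[OF sm]]) (rule sum_abs)
  also have "\<dots> = (\<Sum>b\<in>Basis. \<bar>(w \<bullet> b) * dird v (dird b \<kappa>) x\<bar>)"
   by (intro sum.cong refl, subst dird_commute[OF sm]) simp
  also have "\<dots> \<le> (\<Sum>b\<in>Basis. norm w * (B b * norm v))"
   unfolding abs_mult by (intro sum_mono mult_mono B Basis_le_norm) auto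
  finally show ?thesis by (simp add: B'_def sum_distrib_left sum_distrib_right mult_ac)
 qed
 have "\<bar>\<kappa> (x - w) - \<kappa> x + dird w \<kappa> x\<bar> \<le> B' * (norm w)\<^sup>2" for x w
 proof -
  have "\<exists>s\<in>{0<..<1}. \<kappa> (x + 1 *\<^sub>R (- w)) - \<kappa> (x + 0 *\<^sub>R (- w)) = dird (- w) \<kappa> (x + s *\<^sub>R (- w)) * (1 - 0)"
   by (rule mvt_simple[OF _ smooth_has_real_derivative_line[OF sm, unfolded has_field_derivative_def]]) simp
  then obtain s where s: "s \<in> {0<..<1}"
   "\<kappa> (x + 1 *\<^sub>R (- w)) - \<kappa> (x + 0 *\<^sub>R (- w)) = dird (- w) \<kappa> (x + s *\<^sub>R (- w)) * (1 - 0)" ..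
  have "0 < s" using s(1) by simp
  have "\<exists>t\<in>{0<..<s}. dird w \<kappa> (x + s *\<^sub>R (- w)) - dird w \<kappa> (x + 0 *\<^sub>R (- w))
    = dird (- w) (dird w \<kappa>) (x + t *\<^sub>R (- w)) * (s - 0)"
   by (rule mvt_simple[OF \<open>0 < s\<close> smooth_has_real_derivative_line[OF smooth_dird[OF sm], unfolded has_field_derivative_def]])
  then obtain t where t: "dird w \<kappa> (x + s *\<^sub>R (- w)) - dird w \<kappa> (x + 0 *\<^sub>R (- w))
    = dird (- w) (dird w \<kappa>) (x + t *\<^sub>R (- w)) * (s - 0)" ..
  have "\<kappa> (x - w) - \<kappa> x + dird w \<kappa> x = - (dird (- w) (dird w \<kappa>) (x + t *\<^sub>R (- w)) * s)"
   using s(2) t by (simp add: dird_linear[OF sm])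
  also have "\<bar>\<dots>\<bar> \<le> B' * norm w * norm (- w) * 1"
   unfolding abs_minus_cancel abs_mult
   by (intro mult_mono B') (use s(1) B(1) in \<open>auto simp: B'_def sum_nonneg\<close>)
  finally show ?thesis by (simp add: power2_eq_square mult_ac)
 qed
 then show thesis using that[of B'] B(1) by (auto simp: B'_def sum_nonneg)
qed

text \<open>A linear functional on test functions that is continuous in the \<open>C\<^sup>1\<close>-norm may be
 differentiated under along translates.\<close>

locale C1_functional =
 fixes \<Lambda> :: "('a::euclidean_space \<Rightarrow> real) \<Rightarrow> 'b::real_normed_vector" and C :: real
 assumes add: "test_fn f ==> test_fn g ==> \<Lambda> (%x. f x + g x) = \<Lambda> f + \<Lambda> g"
  and scale: "test_fn f ==> \<Lambda> (%x. c * f x) = c *\<^sub>R \<Lambda> f"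
  and bound: "test_fn f ==> (\<And>x. \<bar>f x\<bar> \<le> M) ==> (\<And>x v. \<bar>dird v f x\<bar> \<le> M * norm v)
   ==> norm (\<Lambda> f) \<le> C * M"
begin

text \<open>The Taylor remainder of \<kappa> in direction w is itself a test function. Its values
  and first derivatives are O(|w|^2) uniformly, by \<open>test_fn_second_order\<close> for \<kappa>
  and for its partial derivatives, so the C^1 bound of the functional gives a quadratic remainder.
  The minus sign arises because y enters as z - y.\<close>

lemma has_derivative_translate:
 assumes \<kappa>: "test_fn \<kappa>"
 shows "((%y. \<Lambda> (%z. \<kappa> (z - y))) has_derivative (%w. \<Lambda> (%z. - dird w \<kappa> (z - y)))) (at y)"
proof -
 have sm: "smooth \<kappa>" using \<kappa> by (simp add: test_fn_def)
 have tdw: "test_fn (%z. - dird w \<kappa> (z - y))" for w y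
  by (intro test_fn_minus test_fn_translate test_fn_dird \<kappa>)
 obtain B0 where B0: "B0 \<ge> 0" "\<And>x v. \<bar>dird v \<kappa> x\<bar> \<le> B0 * norm v"
  by (rule test_fn_dird_bounded[OF \<kappa>], rule that)
 have "\<exists>B\<ge>0. \<forall>x w. \<bar>dird b \<kappa> (x - w) - dird b \<kappa> x + dird w (dird b \<kappa>) x\<bar> \<le> B * (norm w)\<^sup>2" for b
  using test_fn_second_order[OF test_fn_dird[OF \<kappa>]] by metis
 then obtain B1 where B1: "\<And>b. B1 b \<ge> 0"
  "\<And>b x w. \<bar>dird b \<kappa> (x - w) - dird b \<kappa> x + dird w (dird b \<kappa>) x\<bar> \<le> B1 b * (norm w)\<^sup>2" by metis
 have "\<exists>B\<ge>0. \<forall>x v. \<bar>dird v (dird b \<kappa>) x\<bar> \<le> B * norm v" for b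
  using test_fn_dird_bounded[OF test_fn_dird[OF \<kappa>]] by metis
 then obtain B2 where B2: "\<And>b. B2 b \<ge> 0" "\<And>b x v. \<bar>dird v (dird b \<kappa>) x\<bar> \<le> B2 b * norm v" by metis
 obtain B3 where B3: "B3 \<ge> 0" "\<And>x w. \<bar>\<kappa> (x - w) - \<kappa> x + dird w \<kappa> x\<bar> \<le> B3 * (norm w)\<^sup>2"
  by (rule test_fn_second_order[OF \<kappa>], rule that)
 have basis_bound: "\<bar>\<Sum>b\<in>Basis. (v \<bullet> b) * F b\<bar> \<le> (\<Sum>b\<in>Basis. G b) * norm v"
  if "\<And>b. \<bar>F b\<bar> \<le> G b" for F G and v :: 'a
 proof -
  have "\<bar>\<Sum>b\<in>Basis. (v \<bullet> b) * F b\<bar> \<le> (\<Sum>b\<in>Basis. norm v * G b)"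
   by (rule order_trans[OF sum_abs], unfold abs_mult)
    (intro sum_mono mult_mono Basis_le_norm that, auto)
  then show ?thesis by (simp add: sum_distrib_left mult.commute)
 qed
 show ?thesis
 proof (rule has_derivative_quadratic)
  show "bounded_linear (%w. \<Lambda> (%z. - dird w \<kappa> (z - y)))"
  proof (rule bounded_linear_intro)
   show "\<Lambda> (%z. - dird (v + w) \<kappa> (z - y)) = \<Lambda> (%z. - dird v \<kappa> (z - y)) + \<Lambda> (%z. - dird w \<kappa> (z - y))" for v w
    using add[OF tdw[where w=v and y=y] tdw[where w=w and y=y]] by (simp add: dird_linear[OF sm])
   show "\<Lambda> (%z. - dird (r *\<^sub>R w) \<kappa> (z - y)) = r *\<^sub>R \<Lambda> (%z. - dird w \<kappa> (z - y))" for r w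
    using scale[OF tdw[where w=w and y=y], of r] by (simp add: dird_linear[OF sm])
   show "norm (\<Lambda> (%z. - dird w \<kappa> (z - y))) \<le> norm w * (C * (B0 + (\<Sum>b\<in>Basis. B2 b)))" for w
   proof -
    have "norm (\<Lambda> (%z. - dird w \<kappa> (z - y))) \<le> C * ((B0 + (\<Sum>b\<in>Basis. B2 b)) * norm w)"
    proof (rule bound[OF tdw])
     show "\<bar>- dird w \<kappa> (x - y)\<bar> \<le> (B0 + (\<Sum>b\<in>Basis. B2 b)) * norm w" for x
     proof -
      have "\<bar>- dird w \<kappa> (x - y)\<bar> \<le> B0 * norm w" using B0(2) by simp
      also have "\<dots> \<le> (B0 + (\<Sum>b\<in>Basis. B2 b)) * norm w"
       using B2(1) by (intro mult_right_mono) (auto simp: sum_nonneg)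
      finally show ?thesis .
     qed
     show "\<bar>dird v (%z. - dird w \<kappa> (z - y)) x\<bar> \<le> (B0 + (\<Sum>b\<in>Basis. B2 b)) * norm w * norm v" for x v
     proof -
      have "dird v (%z. - dird w \<kappa> (z - y)) x = - dird v (dird w \<kappa>) (x - y)"
       by (subst frechet_derivative_bounded_linear_smooth[OF _ bounded_linear_minus[OF bounded_linear_ident]])
        (use dird_translate[OF smooth_dird[OF sm]] test_fn_translate[OF test_fn_dird[OF \<kappa>]] in \<open>auto simp: test_fn_def\<close>)
      also have "\<dots> = - (\<Sum>b\<in>Basis. (w \<bullet> b) * dird v (dird b \<kappa>) (x - y))"
       by (subst dird_commute[OF sm], subst dird_Basis[OF smooth_dird[OF sm]], subst dird_commute[OF sm]) simp
      also have "\<bar>\<dots>\<bar> \<le> (\<Sum>b\<in>Basis. B2 b * norm v) * norm w"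
       unfolding abs_minus_cancel by (rule basis_bound[OF B2(2)])
      also have "\<dots> \<le> (B0 + (\<Sum>b\<in>Basis. B2 b)) * norm w * norm v"
       using B0(1) by (simp add: sum_distrib_right[symmetric] algebra_simps)
      finally show ?thesis .
     qed
    qed
    then show ?thesis by (simp add: mult_ac)
   qed
  qed
  show "norm (\<Lambda> (%z. \<kappa> (z - (y + w))) - \<Lambda> (%z. \<kappa> (z - y)) - \<Lambda> (%z. - dird w \<kappa> (z - y)))
    \<le> (C * (B3 + (\<Sum>b\<in>Basis. B1 b))) * (norm w)\<^sup>2" for w
  proof -
   \<comment> \<open>The Taylor remainder with y removed; the functional is applied to its translate
     by y.\<close>
   define r where "r = (%x. \<kappa> (x - w) - \<kappa> x + dird w \<kappa> x)"
   have r: "test_fn r"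
    using test_fn_add[OF test_fn_add[OF test_fn_translate[OF \<kappa>, of w] test_fn_minus[OF \<kappa>]] test_fn_dird[OF \<kappa>, of w]]
    by (simp add: r_def)
   have rs: "smooth r" using r by (simp add: test_fn_def)
   have dr: "dird v r x = dird v \<kappa> (x - w) - dird v \<kappa> x + dird w (dird v \<kappa>) x" for v x
   proof -
    have "frechet_derivative (%x. \<kappa> (x - w)) (at x) = frechet_derivative \<kappa> (at (x - w))"
     by (rule ext, rule dird_translate[OF sm])
    then have 1: "((%x. \<kappa> (x - w)) has_derivative (%v. dird v \<kappa> (x - w))) (at x)"
     using smooth_has_derivative[of "%x. \<kappa> (x - w)" x] test_fn_translate[OF \<kappa>, of w]
     by (simp add: test_fn_def)
    have "(r has_derivative (%v. dird v \<kappa> (x - w) - dird v \<kappa> x + dird v (dird w \<kappa>) x)) (at x)"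
     unfolding r_def
     by (intro has_derivative_add has_derivative_diff 1 smooth_has_derivative sm smooth_dird)
    then have "dird v r x = dird v \<kappa> (x - w) - dird v \<kappa> x + dird v (dird w \<kappa>) x"
     by (subst frechet_derivative_at[symmetric]) auto
    then show ?thesis by (subst (asm) dird_commute[OF sm]) simp
   qed
   have "\<Lambda> (%z. r (z - y)) = \<Lambda> (%z. \<kappa> (z - (y + w)) + (- 1) * \<kappa> (z - y) + (- 1) * (- dird w \<kappa> (z - y)))"
    by (simp add: r_def algebra_simps)
   also have "\<dots> = \<Lambda> (%z. \<kappa> (z - (y + w))) - \<Lambda> (%z. \<kappa> (z - y)) - \<Lambda> (%z. - dird w \<kappa> (z - y))"
   proof -
    have t: "test_fn (%z. \<kappa> (z - (y + w)))" "test_fn (%z. \<kappa> (z - y))" by (intro test_fn_translate \<kappa>)+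
    show ?thesis
     by (subst add[OF test_fn_add[OF t(1) test_fn_cmult[OF t(2)]] test_fn_cmult[OF tdw]],
       subst add[OF t(1) test_fn_cmult[OF t(2)]], subst scale[OF t(2)], subst scale[OF tdw]) simp
   qed
   finally have eq: "\<Lambda> (%z. \<kappa> (z - (y + w))) - \<Lambda> (%z. \<kappa> (z - y)) - \<Lambda> (%z. - dird w \<kappa> (z - y))
    = \<Lambda> (%z. r (z - y))" by simp
   have "norm (\<Lambda> (%z. r (z - y))) \<le> C * ((B3 + (\<Sum>b\<in>Basis. B1 b)) * (norm w)\<^sup>2)"
   proof (rule bound[OF test_fn_translate[OF r]])
    show "\<bar>r (x - y)\<bar> \<le> (B3 + (\<Sum>b\<in>Basis. B1 b)) * (norm w)\<^sup>2" for x
    proof -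
     have "\<bar>r (x - y)\<bar> \<le> B3 * (norm w)\<^sup>2" unfolding r_def by (rule B3(2))
     also have "\<dots> \<le> (B3 + (\<Sum>b\<in>Basis. B1 b)) * (norm w)\<^sup>2"
      using B1(1) by (intro mult_right_mono) (auto simp: sum_nonneg)
     finally show ?thesis .
    qed
    show "\<bar>dird v (%z. r (z - y)) x\<bar> \<le> (B3 + (\<Sum>b\<in>Basis. B1 b)) * (norm w)\<^sup>2 * norm v" for x v
    proof -
     have "dird v (%z. r (z - y)) x = (\<Sum>b\<in>Basis. (v \<bullet> b) *
       (dird b \<kappa> (x - y - w) - dird b \<kappa> (x - y) + dird w (dird b \<kappa>) (x - y)))"
      by (subst dird_translate[OF rs], subst dird_Basis[OF rs], subst dr) simp
     also have "\<bar>\<dots>\<bar> \<le> (\<Sum>b\<in>Basis. B1 b * (norm w)\<^sup>2) * norm v"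
      by (rule basis_bound[OF B1(2)])
     also have "\<dots> \<le> (B3 + (\<Sum>b\<in>Basis. B1 b)) * (norm w)\<^sup>2 * norm v"
      using B3(1) by (simp add: sum_distrib_right[symmetric] algebra_simps)
     finally show ?thesis .
    qed
   qed
   then show ?thesis unfolding eq by (simp add: mult_ac)
  qed
 qed
qed

text \<open>Differentiating in y only replaces \<kappa> by another test function, so the class of
  all such functions of y is closed under differentiation.\<close>

lemma smooth_translate:
 assumes "test_fn \<kappa>" shows "smooth (%y. \<Lambda> (%z. \<kappa> (z - y)))"
proof (rule smooth_coinduct[of _ "{%y. \<Lambda> (%z. \<kappa> (z - y)) | \<kappa>. test_fn \<kappa>}"])
 fix g assume "g \<in> {%y. \<Lambda> (%z. \<kappa> (z - y)) | \<kappa>. test_fn \<kappa>}"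
 then obtain \<kappa> where g: "g = (%y. \<Lambda> (%z. \<kappa> (z - y)))" and \<kappa>: "test_fn \<kappa>" by auto
 show "\<exists>g'. (\<forall>x. (g has_derivative g' x) (at x)) \<and>
   (\<forall>v. (%x. g' x v) \<in> {%y. \<Lambda> (%z. \<kappa> (z - y)) | \<kappa>. test_fn \<kappa>})"
 proof (intro exI[of _ "%y w. \<Lambda> (%z. - dird w \<kappa> (z - y))"] conjI allI)
  show "(g has_derivative (%w. \<Lambda> (%z. - dird w \<kappa> (z - x)))) (at x)" for x
   unfolding g by (rule has_derivative_translate[OF \<kappa>])
  show "(%x. \<Lambda> (%z. - dird v \<kappa> (z - x))) \<in> {%y. \<Lambda> (%z. \<kappa> (z - y)) | \<kappa>. test_fn \<kappa>}" for v
   by (intro CollectI exI[of _ "%z. - dird v \<kappa> z"] conjI refl test_fn_minus test_fn_dird \<kappa>)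
 qed
qed (use assms in auto)

end

subsection \<open>Convolution and mollification\<close>

lemma lborel_integral_affine:
 fixes f :: "'a::euclidean_space \<Rightarrow> 'b::{banach, second_countable_topology}"
 assumes [measurable]: "f \<in> borel_measurable borel" and "c \<noteq> 0"
 shows "(\<integral>x. f x \<partial>lborel) = \<bar>c\<bar> ^ DIM('a) *\<^sub>R (\<integral>x. f (t + c *\<^sub>R x) \<partial>lborel)"
 by (subst lborel_affine[OF \<open>c \<noteq> 0\<close>, of t])
  (simp add: integral_density integral_distr integral_real_density)

lemma test_fn_borel [measurable_dest]: "test_fn \<kappa> ==> \<kappa> \<in> borel_measurable borel"
 unfolding test_fn_def using smooth_continuous_on borel_measurable_continuous_onI by blast

lemma smooth_borel: "smooth f ==> f \<in> borel_measurable borel"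
 using smooth_continuous_on borel_measurable_continuous_onI by blast

lemma integrable_bounded_mult:
 fixes g :: "'a \<Rightarrow> 'b::{banach, second_countable_topology}"
 assumes "f \<in> borel_measurable M" "\<And>x. \<bar>f x\<bar> \<le> B" "integrable M g"
 shows "integrable M (%x. f x *\<^sub>R g x)"
proof (rule Bochner_Integration.integrable_bound)
 show "integrable M (%x. B * norm (g x))" using assms(3) by auto
 show "AE x in M. norm (f x *\<^sub>R g x) \<le> norm (B * norm (g x))"
 proof (rule AE_I2)
  fix x
  have "\<bar>f x\<bar> * norm (g x) \<le> B * norm (g x)" by (intro mult_right_mono assms) auto
  also have "\<dots> \<le> norm (B * norm (g x))" by simp
  finally show "norm (f x *\<^sub>R g x) \<le> norm (B * norm (g x))" by simp
 qed
qed (use assms in auto)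

lemma borel_measurable_lebesgueI: "f \<in> borel_measurable borel ==> f \<in> borel_measurable lebesgue"
 by (rule measurable_completion) simp

lemma test_fn_integrable_mult:
 fixes v :: "'a::euclidean_space \<Rightarrow> 'b::{banach, second_countable_topology}"
 assumes "test_fn \<kappa>" "integrable lebesgue v"
 shows "integrable lebesgue (%y. \<kappa> y *\<^sub>R v y)"
proof -
 obtain B where "\<And>x. \<bar>\<kappa> x\<bar> \<le> B" using test_fn_bounded[OF assms(1)] by metis
 then show ?thesis
  by (rule integrable_bounded_mult[OF borel_measurable_lebesgueI[OF test_fn_borel[OF assms(1)]] _ assms(2)])
qed

lemma test_fn_integrable_lborel: "test_fn (\<kappa> :: 'a::euclidean_space \<Rightarrow> real) ==> integrable lborel \<kappa>"
proof -
 assume k: "test_fn \<kappa>"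
 have "integrable lborel (%x. indicator (closure {x. \<kappa> x \<noteq> 0}) x *\<^sub>R \<kappa> x)"
  using k by (intro borel_integrable_compact smooth_continuous_on) (auto simp: test_fn_def compact_closure)
 moreover have "(%x. indicator (closure {x. \<kappa> x \<noteq> 0}) x *\<^sub>R \<kappa> x) = \<kappa>"
  using closure_subset[of "{x. \<kappa> x \<noteq> 0}"] by (auto simp: indicator_def fun_eq_iff)
 ultimately show ?thesis by (simp only:)
qed

lemma test_fn_integrable: "test_fn (\<kappa> :: 'a::euclidean_space \<Rightarrow> real) ==> integrable lebesgue \<kappa>"
 using test_fn_integrable_lborel test_fn_borel by (simp add: integrable_completion)

lemma C1_functional_integral:
 fixes v :: "'a::euclidean_space \<Rightarrow> 'b::euclidean_space"
 assumes "integrable lebesgue v"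
 shows "C1_functional (%\<psi>. LINT y|lebesgue. \<psi> y *\<^sub>R v y) (LINT y|lebesgue. norm (v y))"
proof
 show "(LINT y|lebesgue. (f y + g y) *\<^sub>R v y)
   = (LINT y|lebesgue. f y *\<^sub>R v y) + (LINT y|lebesgue. g y *\<^sub>R v y)" if "test_fn f" "test_fn g" for f g
  using test_fn_integrable_mult[OF that(1) assms] test_fn_integrable_mult[OF that(2) assms]
  by (simp add: scaleR_add_left)
 show "(LINT y|lebesgue. (c * f y) *\<^sub>R v y) = c *\<^sub>R (LINT y|lebesgue. f y *\<^sub>R v y)" if "test_fn f" for f c
  by (simp flip: scaleR_scaleR)
 show "norm (LINT y|lebesgue. f y *\<^sub>R v y) \<le> (LINT y|lebesgue. norm (v y)) * M"
  if "test_fn f" "\<And>x. \<bar>f x\<bar> \<le> M" for f and M :: real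
 proof -
  have "norm (LINT y|lebesgue. f y *\<^sub>R v y) \<le> (LINT y|lebesgue. norm (v y) * M)"
  proof (rule Bochner_Integration.integral_norm_bound_integral)
   show "norm (f x *\<^sub>R v x) \<le> norm (v x) * M" for x
    using that(2)[of x] by (simp add: mult.commute[of _ M] mult_right_mono)
  qed (use assms test_fn_integrable_mult[OF that(1) assms] in auto)
  then show ?thesis by simp
 qed
qed

text \<open>Integration against v, applied to the reflected kernel translated by x. This makes
  convolutions an instance of \<open>C1_functional\<close>.\<close>

lemma convolution_as_functional:
 "convolution \<kappa> v = (%x. (%\<psi>. LINT y|lebesgue. \<psi> y *\<^sub>R v y) (%y. (%z. \<kappa> (0 - z)) (y - x)))"
 by (simp add: convolution_def fun_eq_iff)

lemma smooth_convolution: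
 fixes v :: "'a::euclidean_space \<Rightarrow> 'b::euclidean_space"
 assumes "test_fn \<kappa>" "integrable lebesgue v"
 shows "smooth (convolution \<kappa> v)"
 unfolding convolution_as_functional
 by (rule C1_functional.smooth_translate[OF C1_functional_integral[OF assms(2)] test_fn_reflect[OF assms(1)]])

lemma dird_convolution:
 fixes v :: "'a::euclidean_space \<Rightarrow> 'b::euclidean_space"
 assumes "test_fn \<kappa>" "integrable lebesgue v"
 shows "dird w (convolution \<kappa> v) x = convolution (dird w \<kappa>) v x"
proof -
 have sm: "smooth \<kappa>" using assms(1) by (simp add: test_fn_def)
 have "(convolution \<kappa> v has_derivative
   (%w. LINT y|lebesgue. - dird w (%z. \<kappa> (0 - z)) (y - x) *\<^sub>R v y)) (at x)"
  unfolding convolution_as_functional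
  by (rule C1_functional.has_derivative_translate[OF C1_functional_integral[OF assms(2)] test_fn_reflect[OF assms(1)]])
 then have "dird w (convolution \<kappa> v) x = (LINT y|lebesgue. - dird w (%z. \<kappa> (0 - z)) (y - x) *\<^sub>R v y)"
  by (subst frechet_derivative_at[symmetric]) auto
 also have "\<dots> = convolution (dird w \<kappa>) v x"
  unfolding convolution_def
  by (subst dird_reflect[OF sm]) simp
 finally show ?thesis .
qed

lemma integrable_convolution_integrand:
 fixes v :: "'a::euclidean_space \<Rightarrow> 'b::euclidean_space"
 assumes "test_fn \<kappa>" "integrable lebesgue v"
 shows "integrable lebesgue (%y. \<kappa> (x - y) *\<^sub>R v y)"
 by (rule test_fn_integrable_mult[OF test_fn_reflect[OF assms(1)] assms(2)])

lemma bump_nonneg: "0 \<le> bump x"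
 and bump_le_1: "bump x \<le> 1"
 and bump_eq_0: "1 \<le> norm x ==> bump x = 0"
 and bump_pos: "norm x < 1 ==> 0 < bump x"
 by (auto simp: bump_def power_le_one)

lemma bump_uminus: "bump (- x) = bump x"
 by (simp add: bump_def)

lemma test_fn_bump: "test_fn bump"
 unfolding test_fn_def
proof (intro conjI smooth_bump)
 have "{x. bump x \<noteq> 0} \<subseteq> ball (0::'a) 1" using bump_eq_0 by force
 then show "bounded {x::'a. bump x \<noteq> 0}" using bounded_subset by blast
qed

lemma integral_bump_pos: "0 < (LINT y|lebesgue. bump (y :: 'a::euclidean_space))"
proof -
 have int: "integrable lebesgue (bump :: 'a \<Rightarrow> real)" by (rule test_fn_integrable[OF test_fn_bump])
 have "(LINT y|lebesgue. bump (y::'a)) \<noteq> 0"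
 proof
  assume "(LINT y|lebesgue. bump (y::'a)) = 0"
  then have "AE y::'a in lebesgue. bump y = 0"
   using integral_nonneg_eq_0_iff_AE[OF int] bump_nonneg by auto
  then have "AE y::'a in lebesgue. y \<notin> ball 0 1"
   by eventually_elim (use bump_pos in force)
  then have "emeasure lebesgue (ball (0::'a) 1) = 0"
   by (subst (asm) AE_iff_measurable[where N="ball (0::'a) 1"]) auto
  then have "measure lebesgue (ball (0::'a) 1) = 0" by (simp add: measure_def)
  then show False using content_ball_pos[of 1 "0::'a"] by simp
 qed
 moreover have "0 \<le> (LINT y|lebesgue. bump (y::'a))"
  by (rule Bochner_Integration.integral_nonneg) (rule bump_nonneg)
 ultimately show ?thesis by linarith
qed

lemma test_fn_scale:
 assumes "test_fn \<kappa>" "h > 0" shows "test_fn (%x. \<kappa> (x /\<^sub>R h))"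
 unfolding test_fn_def
proof
 show "smooth (%x. \<kappa> (x /\<^sub>R h))"
  using smooth_affine[of \<kappa> "%x. x /\<^sub>R h" 0] assms
  by (simp add: test_fn_def bounded_linear_scaleR_right)
 have "{x. \<kappa> (x /\<^sub>R h) \<noteq> 0} \<subseteq> (%x. h *\<^sub>R x) ` {x. \<kappa> x \<noteq> 0}"
  using assms(2) by (auto intro!: image_eqI[where x="_ /\<^sub>R h"])
 then show "bounded {x. \<kappa> (x /\<^sub>R h) \<noteq> 0}"
  using assms(1) bounded_scaling[of "{x. \<kappa> x \<noteq> 0}" h] bounded_subset by (auto simp: test_fn_def)
qed

lemma test_fn_mollifier:
 assumes "h > 0" shows "test_fn (mollifier h :: 'a::euclidean_space \<Rightarrow> real)"
proof -
 have "(mollifier h :: 'a \<Rightarrow> real) = (%x. inverse (h ^ DIM('a) * (LINT y|lebesgue. bump (y::'a))) * bump (x /\<^sub>R h))"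
  by (simp add: mollifier_def fun_eq_iff divide_inverse mult.commute)
 then show ?thesis using test_fn_cmult[OF test_fn_scale[OF test_fn_bump assms]] by simp
qed

lemma mollifier_nonneg: "h > 0 ==> 0 \<le> mollifier h x"
 using integral_bump_pos[where 'a='a] bump_nonneg by (auto simp: mollifier_def intro!: divide_nonneg_pos mult_pos_pos)

lemma mollifier_eq_0: "h > 0 ==> h \<le> norm x ==> mollifier h x = 0"
 by (simp add: mollifier_def bump_eq_0 field_simps)

lemma mollifier_uminus: "mollifier h (- x) = mollifier h x"
 by (simp add: mollifier_def bump_uminus)

lemma mollifier_bound:
 "\<exists>C>0. \<forall>h>0. (\<forall>x::'a::euclidean_space. \<bar>mollifier h x\<bar> \<le> C / h ^ DIM('a)) \<and>
  (\<forall>x v::'a. \<bar>dird v (mollifier h) x\<bar> \<le> C / h ^ DIM('a) / h * norm v)"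
proof -
 let ?I = "LINT y|lebesgue. bump (y::'a)"
 obtain B where B: "B \<ge> 0" "\<And>x v::'a. \<bar>dird v bump x\<bar> \<le> B * norm v"
  using test_fn_dird_bounded[OF test_fn_bump] by metis
 show ?thesis
 \<comment> \<open>The numerator dominates both the bound 1 of the bump and the bound B of its
   derivative, and is positive even if B = 0.\<close>
 proof (intro exI[of _ "(B + 1) / ?I"] conjI allI impI)
  show "0 < (B + 1) / ?I" using B(1) integral_bump_pos[where 'a='a] by (auto intro!: divide_pos_pos)
  fix h :: real and x v :: 'a assume h: "0 < h"
  note I = integral_bump_pos[where 'a='a]
  have "\<bar>mollifier h x\<bar> = bump (x /\<^sub>R h) / (h ^ DIM('a) * ?I)"
   using I h bump_nonneg[of "x /\<^sub>R h"] by (simp add: mollifier_def abs_mult)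
  also have "\<dots> \<le> (B + 1) / (h ^ DIM('a) * ?I)"
   using bump_le_1[of "x /\<^sub>R h"] B(1) I h by (intro divide_right_mono) auto
  finally show "\<bar>mollifier h x\<bar> \<le> (B + 1) / ?I / h ^ DIM('a)" by (simp add: mult.commute)
  have "dird v (mollifier h) x = inverse (h ^ DIM('a) * ?I) * dird (v /\<^sub>R h) bump (x /\<^sub>R h)"
  proof -
   have m: "(mollifier h :: 'a \<Rightarrow> real) = (%x. inverse (h ^ DIM('a) * ?I) * (%x. bump (x /\<^sub>R h)) x)"
    by (simp add: mollifier_def fun_eq_iff divide_inverse mult.commute)
   have "dird v (%x. bump (0 + x /\<^sub>R h)) x = dird (v /\<^sub>R h) bump (0 + x /\<^sub>R h)"
    by (rule frechet_derivative_affine[OF smooth_bump bounded_linear_scaleR_right])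
   then have d: "dird v (%x. bump (x /\<^sub>R h)) x = dird (v /\<^sub>R h) bump (x /\<^sub>R h)" by simp
   show ?thesis unfolding m
    by (subst frechet_derivative_bounded_linear_smooth[OF _ bounded_linear_mult_right])
     (use test_fn_scale[OF test_fn_bump h] d in \<open>auto simp: test_fn_def\<close>)
  qed
  then have "\<bar>dird v (mollifier h) x\<bar> = \<bar>dird (v /\<^sub>R h) bump (x /\<^sub>R h)\<bar> / (h ^ DIM('a) * ?I)"
   using I h by (simp add: abs_mult divide_inverse mult.commute)
  also have "\<dots> \<le> (B + 1) * norm (v /\<^sub>R h) / (h ^ DIM('a) * ?I)"
  proof (intro divide_right_mono)
   have "\<bar>dird (v /\<^sub>R h) bump (x /\<^sub>R h)\<bar> \<le> B * norm (v /\<^sub>R h)" by (rule B(2))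
   also have "\<dots> \<le> (B + 1) * norm (v /\<^sub>R h)" by (intro mult_right_mono) auto
   finally show "\<bar>dird (v /\<^sub>R h) bump (x /\<^sub>R h)\<bar> \<le> (B + 1) * norm (v /\<^sub>R h)" .
  qed (use I h in auto)
  finally show "\<bar>dird v (mollifier h) x\<bar> \<le> (B + 1) / ?I / h ^ DIM('a) / h * norm v"
   using h I by (simp add: field_simps)
 qed
qed

lemma integral_mollifier:
 assumes h: "h > 0" shows "(LINT y|lebesgue. mollifier h (x - y :: 'a::euclidean_space)) = 1"
  and "(LINT y|lebesgue. mollifier h (y :: 'a)) = 1"
proof -
 let ?m = "mollifier h :: 'a \<Rightarrow> real"
 have [measurable]: "?m \<in> borel_measurable borel" "bump \<in> borel_measurable (borel :: 'a measure)"
  using test_fn_mollifier[OF h] test_fn_bump test_fn_borel by auto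
 have leb: "(LINT y|lebesgue. f y) = (LINT y|lborel. f y)" if "f \<in> borel_measurable borel" for f :: "'a \<Rightarrow> real"
  using that by (simp add: integral_completion)
 have "(LINT y|lebesgue. ?m y) = h ^ DIM('a) * (LINT y|lborel. ?m (h *\<^sub>R y))"
  using lborel_integral_affine[of ?m h 0] h by (simp add: leb)
 also have "(LINT y|lborel. ?m (h *\<^sub>R y)) = (LINT y|lborel. bump (y::'a)) / (h ^ DIM('a) * (LINT y|lebesgue. bump (y::'a)))"
  using h by (simp add: mollifier_def)
 also have "h ^ DIM('a) * \<dots> = 1"
  using h integral_bump_pos[where 'a='a] by (simp add: leb)
 finally show 1: "(LINT y|lebesgue. ?m y) = 1" .
 have "(LINT y|lebesgue. ?m y) = (LINT y|lborel. ?m (x - y))"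
  using lborel_integral_affine[of ?m "-1" x] by (simp add: leb)
 then show "(LINT y|lebesgue. mollifier h (x - y)) = 1"
  using 1 by (simp add: leb)
qed

subsection \<open>The cut-off function\<close>

text \<open>A segment from x to a point outside meets the frontier, so it cannot be shorter than the
  distance of x to the frontier.\<close>

lemma bdist_ball:
 assumes "x \<in> \<Omega>" "dist x y < bdist \<Omega> x"
 shows "y \<in> \<Omega>"
proof (rule ccontr)
 assume "y \<notin> \<Omega>"
 then have "closed_segment x y \<inter> frontier \<Omega> \<noteq> {}"
  using assms(1) by (intro connected_Int_frontier) auto
 then obtain z where z: "z \<in> closed_segment x y" "z \<in> frontier \<Omega>" by auto
 then have "bdist \<Omega> x \<le> dist x z" by (simp add: bdist_def infdist_le)
 also have "\<dots> \<le> dist x y"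
  using segment_bound[OF z(1)] by (simp add: dist_norm norm_minus_commute)
 finally show False using assms(2) by simp
qed

lemma bdist_diff: "bdist \<Omega> x \<le> bdist \<Omega> y + dist x y"
 by (simp add: bdist_def infdist_triangle)

lemma continuous_on_bdist: "continuous_on S (bdist \<Omega>)"
 unfolding bdist_def by (intro continuous_intros)

lemma open_inner_part: "open \<Omega> ==> open (inner_part \<Omega> \<delta>)"
proof -
 assume "open \<Omega>"
 have "inner_part \<Omega> \<delta> = \<Omega> \<inter> {x. \<delta> < bdist \<Omega> x}" by (auto simp: inner_part_def)
 then show ?thesis
  by (simp add: open_Int \<open>open \<Omega>\<close> open_Collect_less continuous_on_bdist continuous_on_const)
qed

text \<open>A limit point lost from the open set would lie on the frontier, where the distance is 0
  and thus below \<delta>.\<close>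

lemma closed_inner_part:
 assumes "open \<Omega>" "0 < \<delta>"
 shows "closed {x \<in> \<Omega>. \<delta> \<le> bdist \<Omega> x}"
proof -
 have "{x \<in> \<Omega>. \<delta> \<le> bdist \<Omega> x} = closure \<Omega> \<inter> {x. \<delta> \<le> bdist \<Omega> x}"
 proof -
  have "x \<in> \<Omega>" if "x \<in> closure \<Omega>" "\<delta> \<le> bdist \<Omega> x" for x
  proof (rule ccontr)
   assume "x \<notin> \<Omega>"
   then have "x \<in> frontier \<Omega>" using that(1) assms(1) by (simp add: frontier_def interior_open)
   then show False using that(2) assms(2) by (simp add: bdist_def)
  qed
  then show ?thesis using closure_subset by auto
 qed
 then show ?thesis
  by (simp add: closed_Int closed_Collect_le continuous_on_bdist continuous_on_const)
qed

context
 fixes \<Omega> :: "'a::euclidean_space set" and h :: real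
 assumes op: "open \<Omega>" and bd: "bounded \<Omega>" and h: "0 < h"
begin

lemma integrable_indicator_inner_part: "integrable lebesgue (indicator (inner_part \<Omega> \<delta>) :: 'a \<Rightarrow> real)"
proof -
 have "bounded (inner_part \<Omega> \<delta>)"
  using bd bounded_subset[of \<Omega>] by (auto simp: inner_part_def)
 then have "inner_part \<Omega> \<delta> \<in> lmeasurable"
  by (intro bounded_set_imp_lmeasurable) (auto simp: open_inner_part op)
 then show ?thesis by (simp add: lmeasurable_iff_integrable)
qed

lemma smooth_cutoff: "smooth (cutoff \<Omega> h)"
 unfolding cutoff_def using h
 by (intro smooth_convolution test_fn_mollifier integrable_indicator_inner_part) auto

lemma cutoff_eq: "cutoff \<Omega> h x = (LINT y|lebesgue. mollifier (h/2) (x - y) * indicator (inner_part \<Omega> (5 * h / 2)) y)"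
 by (simp add: cutoff_def convolution_def)

lemma integrable_cutoff: "integrable lebesgue (%y. mollifier (h/2) (x - y) * indicator (inner_part \<Omega> (5 * h / 2)) y :: real)"
 using integrable_convolution_integrand[OF test_fn_mollifier integrable_indicator_inner_part, of "h/2" x "5 * h / 2"] h
 by simp

lemma cutoff_nonneg: "0 \<le> cutoff \<Omega> h x"
 unfolding cutoff_eq
 by (intro Bochner_Integration.integral_nonneg mult_nonneg_nonneg mollifier_nonneg) (use h in auto)

lemma cutoff_le_1: "cutoff \<Omega> h x \<le> 1"
proof -
 have "cutoff \<Omega> h x \<le> (LINT y|lebesgue. mollifier (h/2) (x - y))"
  unfolding cutoff_eq
 proof (rule Bochner_Integration.integral_mono[OF integrable_cutoff])
  show "integrable lebesgue (%y. mollifier (h / 2) (x - y))"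
   by (rule test_fn_integrable[OF test_fn_reflect[OF test_fn_mollifier]]) (use h in auto)
  show "mollifier (h / 2) (x - y) * indicator (inner_part \<Omega> (5 * h / 2)) y \<le> mollifier (h / 2) (x - y)" for y
   using mollifier_nonneg[of "h/2" "x - y"] h by (auto simp: indicator_def)
 qed
 then show ?thesis using integral_mollifier(1)[of "h/2" x] h by simp
qed

text \<open>The kernel has radius h/2: from distance 3h it sees only points at distance above 5h/2,
  and from distance at most 2h it sees none of them. The transition therefore happens between 2h and
  3h.\<close>

lemma cutoff_eq_1:
 assumes "x \<in> \<Omega>" "3 * h \<le> bdist \<Omega> x" shows "cutoff \<Omega> h x = 1"
proof -
 have *: "mollifier (h/2) (x - y) * indicator (inner_part \<Omega> (5 * h / 2)) y = mollifier (h/2) (x - y)" for y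
 proof (cases "dist x y < h / 2")
  case True
  then have "y \<in> inner_part \<Omega> (5 * h / 2)"
   using assms h bdist_ball[OF assms(1), of y] bdist_diff[of \<Omega> x y] by (auto simp: inner_part_def)
  then show ?thesis by simp
 qed (use h in \<open>simp add: mollifier_eq_0 dist_norm\<close>)
 show ?thesis unfolding cutoff_eq * using integral_mollifier(1)[of "h/2" x] h by simp
qed

lemma cutoff_nonzeroD:
 assumes "cutoff \<Omega> h x \<noteq> 0" shows "x \<in> \<Omega>" "2 * h < bdist \<Omega> x"
proof -
 have "\<not> (x \<notin> \<Omega> \<or> bdist \<Omega> x \<le> 2 * h)"
 proof
  assume *: "x \<notin> \<Omega> \<or> bdist \<Omega> x \<le> 2 * h"
  have 0: "mollifier (h/2) (x - y) * indicator (inner_part \<Omega> (5 * h / 2)) y = (0::real)" for y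
  proof (cases "dist x y < h / 2")
   case True
   then have "y \<notin> inner_part \<Omega> (5 * h / 2)"
    using * h bdist_ball[of y \<Omega> x] bdist_diff[of \<Omega> y x] by (auto simp: inner_part_def dist_commute)
   then show ?thesis by simp
  qed (use h in \<open>simp add: mollifier_eq_0 dist_norm\<close>)
  show False using assms unfolding cutoff_eq 0 by simp
 qed
 then show "x \<in> \<Omega>" "2 * h < bdist \<Omega> x" by auto
qed

lemma closure_support_cutoff: "closure {x. cutoff \<Omega> h x \<noteq> 0} \<subseteq> {x \<in> \<Omega>. 2 * h \<le> bdist \<Omega> x}"
 by (rule closure_minimal) (use cutoff_nonzeroD closed_inner_part[OF op, of "2 * h"] h in force)+

lemma test_fn_cutoff: "test_fn (cutoff \<Omega> h)"
 unfolding test_fn_def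
proof (intro conjI smooth_cutoff)
 show "bounded {x. cutoff \<Omega> h x \<noteq> 0}"
  by (rule bounded_subset[OF bd]) (use cutoff_nonzeroD(1) in auto)
qed

lemma cutoff_smooth_compact: "cutoff \<Omega> h \<in> smooth_compact \<Omega>"
 unfolding smooth_compact_iff[OF op] compact_closure
 using test_fn_cutoff closure_support_cutoff by (auto simp: test_fn_def)

lemma dird_cutoff_nonzeroD:
 assumes "dird v (cutoff \<Omega> h) x \<noteq> 0"
 shows "x \<in> \<Omega>" "2 * h \<le> bdist \<Omega> x" "bdist \<Omega> x \<le> 3 * h"
proof -
 have "x \<in> closure {x. cutoff \<Omega> h x \<noteq> 0}" using assms dird_outside_support by blast
 then show x: "x \<in> \<Omega>" "2 * h \<le> bdist \<Omega> x" using closure_support_cutoff by auto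
 show "bdist \<Omega> x \<le> 3 * h"
 proof (rule ccontr)
  assume "\<not> bdist \<Omega> x \<le> 3 * h"
  then have x3: "x \<in> inner_part \<Omega> (3 * h)" using x by (simp add: inner_part_def)
  have "(cutoff \<Omega> h has_derivative (%_. 0)) (at x)"
   by (rule has_derivative_transform_within_open[OF has_derivative_const[of 1] open_inner_part[OF op] x3])
    (auto simp: inner_part_def cutoff_eq_1)
  then have "dird v (cutoff \<Omega> h) x = 0" by (subst frechet_derivative_at[symmetric]) auto
  with assms show False by simp
 qed
qed

end

lemma norm_convolution_le:
 fixes v :: "'a::euclidean_space \<Rightarrow> 'b::euclidean_space"
 assumes "test_fn \<kappa>" "integrable lebesgue v"
 shows "norm (convolution \<kappa> v x) \<le> (LINT y|lebesgue. \<bar>\<kappa> (x - y)\<bar> * norm (v y))"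
 unfolding convolution_def
 using integral_norm_bound[of lebesgue "%y. \<kappa> (x - y) *\<^sub>R v y"] by simp

text \<open>The derivative of the kernel has size h^(-n-1) on a ball of volume of order h^n. The
  constant depends neither on the domain nor on h; the remaining 1/h is later cancelled by the strip
  estimate.\<close>

lemma dird_cutoff_bound:
 "\<exists>C>0. \<forall>\<Omega> h x v. open \<Omega> \<and> bounded \<Omega> \<and> 0 < h \<longrightarrow> \<bar>dird v (cutoff (\<Omega> :: 'a::euclidean_space set) h) x\<bar> \<le> C / h * norm v"
proof -
 obtain C where C: "C > 0" "\<And>h (x::'a) v. 0 < h ==> \<bar>dird v (mollifier h) x\<bar> \<le> C / h ^ DIM('a) / h * norm v"
  using mollifier_bound[where 'a='a] by metis
 let ?V = "unit_ball_vol (real DIM('a))"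
 have "\<bar>dird v (cutoff \<Omega> h) x\<bar> \<le> (2 * C * ?V + 1) / h * norm v" if "open \<Omega>" "bounded \<Omega>" "0 < h" for \<Omega> h and x v :: 'a
 proof -
  note int = integrable_indicator_inner_part[OF that]
  have h2: "h / 2 > 0" using that by simp
  have m: "test_fn (mollifier (h/2) :: 'a \<Rightarrow> real)" by (rule test_fn_mollifier[OF h2])
  have "dird v (cutoff \<Omega> h) x = convolution (dird v (mollifier (h/2))) (indicator (inner_part \<Omega> (5 * h / 2))) x"
   unfolding cutoff_def by (rule dird_convolution[OF m int])
  also have "\<bar>\<dots>\<bar> \<le> (LINT y|lebesgue. \<bar>dird v (mollifier (h/2)) (x - y)\<bar> * norm (indicator (inner_part \<Omega> (5 * h / 2)) y :: real))"
   using norm_convolution_le[OF test_fn_dird[OF m] int] by simp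
  also have "\<dots> \<le> (LINT y|lebesgue. (C / (h/2) ^ DIM('a) / (h/2) * norm v) * indicator (cball x (h/2)) y)"
  proof (rule integral_mono_AE')
   show "integrable lebesgue (%y. C / (h / 2) ^ DIM('a) / (h / 2) * norm v * indicat_real (cball x (h / 2)) y)"
    by (intro integrable_mult_right) (use lmeasurable_cball in \<open>auto simp: lmeasurable_iff_integrable\<close>)
   have "\<bar>dird v (mollifier (h/2)) (x - y)\<bar> * norm (indicator (inner_part \<Omega> (5 * h / 2)) y :: real)
     \<le> C / (h / 2) ^ DIM('a) / (h / 2) * norm v * indicat_real (cball x (h / 2)) y" for y
   proof (cases "y \<in> cball x (h/2)")
    case True
    then show ?thesis using C(2)[OF h2, where v=v and x="x - y"] C(1) that(3) by (auto simp: indicator_def)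
   next
    case False
    have "x - y \<notin> closure {x. mollifier (h/2) x \<noteq> 0}"
    proof
     have "closure {x. mollifier (h/2) x \<noteq> 0} \<subseteq> cball (0::'a) (h/2)"
      by (rule closure_minimal) (use mollifier_eq_0[OF h2] in \<open>force simp: not_le\<close>)+
     moreover assume "x - y \<in> closure {x. mollifier (h/2) x \<noteq> 0}"
     ultimately have "x - y \<in> cball 0 (h/2)" by blast
     then show False using False by (simp add: dist_norm norm_minus_commute)
    qed
    then have "dird v (mollifier (h/2)) (x - y) = 0" by (rule dird_outside_support)
    then show ?thesis using False by simp
   qed
   then show "AE y in lebesgue. \<bar>dird v (mollifier (h/2)) (x - y)\<bar> * norm (indicator (inner_part \<Omega> (5 * h / 2)) y :: real)
     \<le> C / (h / 2) ^ DIM('a) / (h / 2) * norm v * indicat_real (cball x (h / 2)) y" by simp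
   show "AE y in lebesgue. 0 \<le> C / (h / 2) ^ DIM('a) / (h / 2) * norm v * indicat_real (cball x (h / 2)) y"
    using C(1) that(3) by simp
  qed
  also have "\<dots> = C / (h/2) ^ DIM('a) / (h/2) * norm v * measure lebesgue (cball x (h/2))"
   by simp
  also have "measure lebesgue (cball x (h/2)) = ?V * (h/2) ^ DIM('a)"
   using content_cball[of "h/2" x] h2 by simp
  also have "C / (h/2) ^ DIM('a) / (h/2) * norm v * (?V * (h/2) ^ DIM('a)) = (2 * C * ?V) / h * norm v"
   using that(3) by (simp add: field_simps)
  also have "\<dots> \<le> (2 * C * ?V + 1) / h * norm v"
   using that(3) by (intro mult_right_mono divide_right_mono) auto
  finally show ?thesis by simp
 qed
 moreover have "2 * C * ?V + 1 > 0" using C(1) by (simp add: add_nonneg_pos)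
 ultimately show ?thesis by blast
qed

section \<open>Distributional symmetric gradients\<close>

subsection \<open>A countable family of test functions that determines locally integrable functions\<close>

definition rational_vec :: "'a::euclidean_space \<Rightarrow> bool" where
 "rational_vec a \<longleftrightarrow> (\<forall>i\<in>Basis. a \<bullet> i \<in> \<rat>)"

lemma countable_rational_vec: "countable {a::'a::euclidean_space. rational_vec a}"
proof (rule countable_image_inj_on[where f="%a. \<lambda>i\<in>Basis. a \<bullet> i"])
 have "(%a::'a. \<lambda>i\<in>Basis. a \<bullet> i) ` {a. rational_vec a} \<subseteq> Basis \<rightarrow>\<^sub>E \<rat>"
  by (auto simp: rational_vec_def)
 moreover have "countable (Basis \<rightarrow>\<^sub>E \<rat> :: ('a \<Rightarrow> real) set)"
  by (intro countable_PiE) (auto intro: countable_rat)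
 ultimately show "countable ((%a::'a. \<lambda>i\<in>Basis. a \<bullet> i) ` {a. rational_vec a})"
  by (rule countable_subset)
 show "inj_on (%a::'a. \<lambda>i\<in>Basis. a \<bullet> i) {a. rational_vec a}"
  by (rule inj_onI, rule euclidean_eqI) (metis restrict_apply')
qed

definition rational_boxes_set :: "'a::euclidean_space set set" where
 "rational_boxes_set = {box a b | a b. rational_vec a \<and> rational_vec b}"

lemma borel_eq_rational_boxes: "borel = sigma UNIV (rational_boxes_set :: 'a::euclidean_space set set)"
  (is "_ = ?SIGMA")
proof -
 have "borel = sigma UNIV ((%A. A) ` (rational_boxes_set :: 'a set set))"
 proof (rule borel_eq_sigmaI1[OF borel_def])
  fix M :: "'a set" assume "M \<in> {S. open S}"
  then have "open M" by simp
  show "M \<in> sets (sigma UNIV ((%A. A) ` rational_boxes_set))"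
   apply (subst open_UNION_box[OF \<open>open M\<close>])
   apply (safe intro!: sets.countable_UN' countable_PiE countable_Collect)
     apply (auto intro: countable_rat)
   apply (rule sigma_sets.Basic)
   apply (auto simp: rational_boxes_set_def rational_vec_def PiE_iff inner_sum_left inner_Basis if_distrib sum.delta cong: if_cong)
   apply (intro exI conjI, rule refl)
    apply (force simp: inner_sum_left inner_Basis if_distrib sum.delta cong: if_cong)+
   done
 qed (auto simp: rational_boxes_set_def)
 then show ?thesis by simp
qed

text \<open>Since \<open>ennreal\<close> truncates negative numbers to 0, the two densities are the
  positive and negative parts of f. The measures agree on rational boxes, a generator stable under
  intersection, hence coincide, and so do their densities.\<close>

lemma AE_zero_if_box_integrals_zero:
 fixes f :: "'a::euclidean_space \<Rightarrow> real"
 assumes f: "integrable lborel f"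
  and zero: "\<And>a b. rational_vec a ==> rational_vec b ==> (LINT x|lborel. indicator (box a b) x * f x) = 0"
 shows "AE x in lborel. f x = 0"
proof -
 have [measurable]: "f \<in> borel_measurable borel" using f by simp
 let ?M = "density lborel (%x. ennreal (f x))" and ?N = "density lborel (%x. ennreal (- f x))"
 have fin: "(\<integral>\<^sup>+x. ennreal (f x) * indicator A x \<partial>lborel) = ennreal (LINT x|lborel. indicator A x * max (f x) 0)"
  "(\<integral>\<^sup>+x. ennreal (- f x) * indicator A x \<partial>lborel) = ennreal (LINT x|lborel. indicator A x * max (- f x) 0)"
  "integrable lborel (%x. indicator A x * max (f x) 0)" "integrable lborel (%x. indicator A x * max (- f x) 0)"
  if [measurable]: "A \<in> sets borel" for A
 proof -
  have i: "integrable lborel (%x. max (f x) 0)" "integrable lborel (%x. max (- f x) 0)"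
   using f by (auto intro!: integrable_max)
  show 1: "integrable lborel (%x. indicator A x * max (f x) 0)" "integrable lborel (%x. indicator A x * max (- f x) 0)"
   using integrable_mult_indicator[of A lborel "%x. max (f x) 0"]
    integrable_mult_indicator[of A lborel "%x. max (- f x) 0"] i by auto
  show "(\<integral>\<^sup>+x. ennreal (f x) * indicator A x \<partial>lborel) = ennreal (LINT x|lborel. indicator A x * max (f x) 0)"
   by (subst nn_integral_eq_integral[OF 1(1), symmetric])
    (auto intro!: nn_integral_cong simp: indicator_def max_def ennreal_neg)
  show "(\<integral>\<^sup>+x. ennreal (- f x) * indicator A x \<partial>lborel) = ennreal (LINT x|lborel. indicator A x * max (- f x) 0)"
   by (subst nn_integral_eq_integral[OF 1(2), symmetric])
    (auto intro!: nn_integral_cong simp: indicator_def max_def ennreal_neg)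
 qed
 have "?M = ?N"
 proof (rule measure_eqI_generator_eq[where E="rational_boxes_set" and \<Omega>=UNIV and A="%n. box (- real n *\<^sub>R One) (real n *\<^sub>R One)"])
  show "Int_stable (rational_boxes_set :: 'a set set)"
  proof (rule Int_stableI)
   fix A B :: "'a set" assume "A \<in> rational_boxes_set" "B \<in> rational_boxes_set"
   then obtain a b c d where *: "A = box a b" "B = box c d"
    "rational_vec a" "rational_vec b" "rational_vec c" "rational_vec d"
    unfolding rational_boxes_set_def by blast
   have "rational_vec (\<Sum>i\<in>Basis. max (a\<bullet>i) (c\<bullet>i) *\<^sub>R i)" "rational_vec (\<Sum>i\<in>Basis. min (b\<bullet>i) (d\<bullet>i) *\<^sub>R i)"
    using *(3-) by (auto simp: rational_vec_def max_def min_def)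
   then show "A \<inter> B \<in> rational_boxes_set"
    unfolding * box_Int_box rational_boxes_set_def by blast
  qed
  show "emeasure ?M X = emeasure ?N X" if "X \<in> rational_boxes_set" for X
  proof -
   obtain a b where X: "X = box a b" "rational_vec a" "rational_vec b"
    using \<open>X \<in> rational_boxes_set\<close> by (auto simp: rational_boxes_set_def)
   have m: "X \<in> sets borel" by (simp add: X(1))
   have "0 = (LINT x|lborel. indicator X x * f x)" using zero[OF X(2,3)] X(1) by simp
   also have "\<dots> = (LINT x|lborel. indicator X x * max (f x) 0 - indicator X x * max (- f x) 0)"
    by (intro Bochner_Integration.integral_cong) (auto simp: max_def indicator_def)
   also have "\<dots> = (LINT x|lborel. indicator X x * max (f x) 0) - (LINT x|lborel. indicator X x * max (- f x) 0)"
    by (rule Bochner_Integration.integral_diff[OF fin(3,4)[OF m]])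
   finally show ?thesis
    using fin(1,2)[OF m] m by (simp add: emeasure_density)
  qed
  show "sets ?M = sigma_sets UNIV rational_boxes_set" "sets ?N = sigma_sets UNIV rational_boxes_set"
   using arg_cong[OF borel_eq_rational_boxes, of sets] by simp_all
  show "range (%n. box (- real n *\<^sub>R One) (real n *\<^sub>R One)) \<subseteq> (rational_boxes_set :: 'a set set)"
   by (auto simp: rational_boxes_set_def rational_vec_def intro!: exI)
  show "(\<Union>n::nat. box (- real n *\<^sub>R One) (real n *\<^sub>R One)) = (UNIV :: 'a set)"
   using UN_box_eq_UNIV[where 'a='a] by simp
  show "emeasure ?M (box (- real n *\<^sub>R One) (real n *\<^sub>R One)) \<noteq> \<infinity>" for n :: nat
   using fin(1)[of "box (- real n *\<^sub>R One) (real n *\<^sub>R One)"] by (simp add: emeasure_density)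
 qed auto
 then have "AE x in lborel. ennreal (f x) = ennreal (- f x)"
  by (subst (asm) finite_density_unique) (use fin(1)[of UNIV] in auto)
 then show ?thesis
 proof eventually_elim
  case (elim x)
  then show ?case by (cases "0 \<le> f x") (auto simp: ennreal_neg)
 qed
qed

text \<open>Smooth approximations of indicators of rational boxes. Countability is the purpose:
  statements holding for almost every t can be collected over all of them.\<close>

definition box_tests :: "'a::euclidean_space set \<Rightarrow> ('a \<Rightarrow> real) set" where
 "box_tests G = {cutoff (box a b) (1 / Suc n) | a b n.
   rational_vec a \<and> rational_vec b \<and> cbox a b \<subseteq> G}"

lemma countable_box_tests: "countable (box_tests (G :: 'a::euclidean_space set))"
proof (rule countable_subset)
 show "box_tests G \<subseteq> (%(a, b, n). cutoff (box a b) (1 / Suc n)) `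
   ({a. rational_vec a} \<times> {b. rational_vec b} \<times> UNIV)"
 proof
  fix \<phi> assume "\<phi> \<in> box_tests G"
  then obtain a b n where "\<phi> = cutoff (box a b) (1 / Suc n)" "rational_vec a" "rational_vec b"
   by (auto simp: box_tests_def)
  then show "\<phi> \<in> (%(a, b, n). cutoff (box a b) (1 / Suc n)) `
   ({a. rational_vec a} \<times> {b. rational_vec b} \<times> UNIV)"
   by (intro image_eqI[where x="(a, b, n)"]) auto
 qed
 show "countable ((%(a::'a, b, n). cutoff (box a b) (1 / Suc n)) `
   ({a. rational_vec a} \<times> {b. rational_vec b} \<times> UNIV))"
  by (intro countable_image countable_SIGMA countable_rational_vec) auto
qed

lemma smooth_compact_mono: "open A ==> open B ==> A \<subseteq> B ==> smooth_compact A \<subseteq> smooth_compact B"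
 unfolding smooth_compact_iff subset_iff by blast

lemma box_tests_smooth_compact:
 assumes "open G" shows "box_tests G \<subseteq> smooth_compact G"
proof
 fix \<phi> assume "\<phi> \<in> box_tests G"
 then obtain a b n where \<phi>: "\<phi> = cutoff (box a b) (1 / Suc n)" "cbox a b \<subseteq> G"
  by (auto simp: box_tests_def)
 have "\<phi> \<in> smooth_compact (box a b)" unfolding \<phi>(1) by (rule cutoff_smooth_compact) auto
 moreover have "box a b \<subseteq> G" using \<phi>(2) box_subset_cbox by blast
 ultimately show "\<phi> \<in> smooth_compact G" using smooth_compact_mono[of "box a b" G] assms by auto
qed

lemma cutoff_tendsto_indicator:
 assumes "open \<Omega>" "bounded \<Omega>"
 shows "(%n. cutoff \<Omega> (1 / Suc n) x) \<longlonglongrightarrow> indicator \<Omega> x"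
proof (cases "x \<in> \<Omega>")
 case True
 have "0 < bdist \<Omega> x"
 proof (cases "frontier \<Omega> = {}")
  case True
  then have "\<Omega> = {} \<or> \<Omega> = UNIV" using frontier_eq_empty by blast
  then show ?thesis using \<open>x \<in> \<Omega>\<close> assms(2) not_bounded_UNIV by auto
 next
  case False
  have "x \<notin> frontier \<Omega>" using True assms(1) by (simp add: frontier_def interior_open)
  then show ?thesis
   unfolding bdist_def using False infdist_pos_not_in_closed[of "frontier \<Omega>" x] by simp
 qed
 moreover have "(%n. 3 * (1 / real (Suc n))) \<longlonglongrightarrow> 3 * 0"
  by (intro tendsto_mult tendsto_const LIMSEQ_Suc lim_1_over_n)
 ultimately have "eventually (%n. 3 * (1 / real (Suc n)) < bdist \<Omega> x) sequentially"
  by (intro order_tendstoD(2)[of _ "0"]) auto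
 then have "eventually (%n. cutoff \<Omega> (1 / Suc n) x = 1) sequentially"
  by eventually_elim (rule cutoff_eq_1, use assms True in auto)
 then show ?thesis using True by (simp add: tendsto_eventually)
next
 case False
 then have "cutoff \<Omega> (1 / Suc n) x = 0" for n
  using cutoff_nonzeroD(1)[OF assms, of "1 / Suc n" x] by auto
 then show ?thesis using False by simp
qed

text \<open>By dominated convergence the test integrals pass to integrals over rational boxes inside
  G. On each box the function then vanishes almost everywhere, and countably many such boxes exhaust
  G.\<close>

lemma fundamental_lemma:
 fixes g :: "'a::euclidean_space \<Rightarrow> real"
 assumes G: "open G" and g: "locally_integrable G g"
  and zero: "\<And>\<phi>. \<phi> \<in> box_tests G ==> (LINT z|lebesgue_on G. g z * \<phi> z) = 0"
 shows "AE z in lebesgue_on G. g z = 0"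
proof -
 have box0: "(LINT x|lebesgue. indicator (box a b) x * g x) = 0"
  if ab: "rational_vec a" "rational_vec b" "cbox a b \<subseteq> G" for a b
 proof -
  let ?c = "%n. cutoff (box a b) (1 / Suc n)"
  have i: "integrable lebesgue (%x. indicator (cbox a b) x * g x)"
  proof -
   have "integrable (lebesgue_on (cbox a b)) g" using g ab(3) by (simp add: locally_integrable_def)
   then show ?thesis by (simp add: integrable_restrict_space)
  qed
  have m: "?c n \<in> borel_measurable lebesgue" for n
   by (intro borel_measurable_lebesgueI smooth_borel smooth_cutoff) auto
  have nz: "?c n x \<noteq> 0 ==> x \<in> box a b" for n x
   using cutoff_nonzeroD(1)[of "box a b" "1 / Suc n" x] by auto
  have c01: "\<bar>?c n x\<bar> \<le> 1" for n x
  proof -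
   have "0 \<le> ?c n x" by (rule cutoff_nonneg) auto
   moreover have "?c n x \<le> 1" by (rule cutoff_le_1) auto
   ultimately show ?thesis by linarith
  qed
  have "(%n. LINT x|lebesgue. indicator (cbox a b) x * g x * ?c n x)
    \<longlonglongrightarrow> (LINT x|lebesgue. indicator (cbox a b) x * g x * indicator (box a b) x)"
  proof (rule integral_dominated_convergence[where w="%x. \<bar>indicator (cbox a b) x * g x\<bar>"])
   show "AE x in lebesgue. (%n. indicator (cbox a b) x * g x * ?c n x)
     \<longlonglongrightarrow> indicator (cbox a b) x * g x * indicator (box a b) x"
    by (intro AE_I2 tendsto_mult tendsto_const cutoff_tendsto_indicator) auto
   show "AE x in lebesgue. norm (indicator (cbox a b) x * g x * ?c n x) \<le> \<bar>indicator (cbox a b) x * g x\<bar>" for n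
    using c01 by (intro AE_I2) (simp add: abs_mult mult_left_le)
   show "(%x. indicator (cbox a b) x * g x * indicator (box a b) x) \<in> borel_measurable lebesgue"
    using i by (intro borel_measurable_times[of "%x. indicator (cbox a b) x * g x"] borel_measurable_indicator) auto
   show "(%x. indicator (cbox a b) x * g x * ?c n x) \<in> borel_measurable lebesgue" for n
    using i m by (intro borel_measurable_times[of "%x. indicator (cbox a b) x * g x"]) auto
  qed (use i in auto)
  moreover have "(LINT x|lebesgue. indicator (cbox a b) x * g x * ?c n x) = 0" for n
  proof -
   have "?c n \<in> box_tests G" using ab by (auto simp: box_tests_def)
   then have a1: "(LINT x|lebesgue_on G. g x * ?c n x) = 0" by (rule zero)
   have a2: "(LINT x|lebesgue_on G. g x * ?c n x) = (LINT x|lebesgue. indicator G x * (g x * ?c n x))"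
    using G by (simp add: integral_restrict_space)
   have a3: "indicator G x * (g x * ?c n x) = indicator (cbox a b) x * g x * ?c n x" for x
    using nz[of n x] box_subset_cbox[of a b] ab(3) by (auto simp: indicator_def)
   show ?thesis using a1 unfolding a2 a3 .
  qed
  ultimately have "(LINT x|lebesgue. indicator (cbox a b) x * g x * indicator (box a b) x) = 0"
   using LIMSEQ_unique[OF _ tendsto_const] by simp
  moreover have "indicator (cbox a b) x * g x * indicator (box a b) x = indicator (box a b) x * g x" for x
   using box_subset_cbox[of a b] by (auto simp: indicator_def)
  ultimately show ?thesis by simp
 qed
 have boxAE: "AE x in lebesgue. x \<in> box a b \<longrightarrow> g x = 0"
  if ab: "rational_vec a" "rational_vec b" "cbox a b \<subseteq> G" for a b
 proof -
  define gc where "gc x = indicator (box a b) x * g x" for x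
  have "integrable (lebesgue_on (cbox a b)) g" using g ab(3) by (simp add: locally_integrable_def)
  then have "integrable lebesgue (%x. indicator (box a b) x *\<^sub>R (indicator (cbox a b) x * g x))"
   by (intro integrable_mult_indicator) (simp_all add: integrable_restrict_space)
  moreover have "indicator (box a b) x *\<^sub>R (indicator (cbox a b) x * g x) = gc x" for x
   using box_subset_cbox[of a b] by (auto simp: indicator_def gc_def)
  ultimately have gc: "integrable lebesgue gc" by simp
  obtain f where f: "f \<in> borel_measurable lborel" "AE x in lborel. gc x = f x"
   using completion_ex_borel_measurable_real[OF borel_measurable_integrable[OF gc]] by blast
  then have AE': "AE x in lebesgue. gc x = f x" by (simp add: AE_completion)
  have "integrable lebesgue f"
   by (rule integrable_cong_AE_imp[OF gc]) (use f AE' in \<open>auto simp: eq_commute measurable_completion\<close>)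
  then have "integrable lborel f" using f(1) by (simp add: integrable_completion)
  then have "AE x in lborel. f x = 0"
  proof (rule AE_zero_if_box_integrals_zero)
   fix c d :: 'a assume cd: "rational_vec c" "rational_vec d"
   \<comment> \<open>The intersection of two rational boxes is again rational, and it lies inside G
     because (a, b) does; this tests the localised function against arbitrary boxes.\<close>
   let ?u = "\<Sum>i\<in>Basis. max (c\<bullet>i) (a\<bullet>i) *\<^sub>R i" and ?w = "\<Sum>i\<in>Basis. min (d\<bullet>i) (b\<bullet>i) *\<^sub>R i"
   have r: "rational_vec ?u" "rational_vec ?w"
    using cd ab by (auto simp: rational_vec_def max_def min_def)
   have "cbox ?u ?w \<subseteq> G" using ab(3) Int_interval[of c d a b] by blast
   from box0[OF r this] have "(LINT x|lebesgue. indicator (box c d \<inter> box a b) x * g x) = 0"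
    by (simp add: box_Int_box)
   also have "(%x. indicator (box c d \<inter> box a b) x * g x) = (%x. indicator (box c d) x * gc x)"
    by (auto simp: gc_def indicator_def)
   finally have "0 = (LINT x|lebesgue. indicator (box c d) x * gc x)" by simp
   also have "\<dots> = (LINT x|lebesgue. indicator (box c d) x * f x)"
    using f(1) gc AE' by (intro integral_cong_AE borel_measurable_times borel_measurable_indicator)
     (auto simp: measurable_completion)
   also have "\<dots> = (LINT x|lborel. indicator (box c d) x * f x)"
    using f(1) by (intro integral_completion) auto
   finally show "(LINT x|lborel. indicator (box c d) x * f x) = 0" by simp
  qed
  then have "AE x in lebesgue. f x = 0" by (rule AE_completion)
  with AE' show ?thesis by eventually_elim (auto simp: gc_def)
 qed
 let ?I = "{(a,b). rational_vec a \<and> rational_vec b \<and> cbox a b \<subseteq> G}"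
 have cI: "countable ?I"
  by (rule countable_subset[of _ "{a. rational_vec a} \<times> {b. rational_vec b}"])
   (auto intro: countable_rational_vec)
 have "AE x in lebesgue. \<forall>(a,b)\<in>?I. x \<in> box a b \<longrightarrow> g x = 0"
  using boxAE by (subst AE_ball_countable[OF cI]) auto
 then have "AE x in lebesgue. x \<in> G \<longrightarrow> g x = 0"
 proof eventually_elim
  case (elim x)
  show ?case
  proof
   assume "x \<in> G"
   then obtain e where e: "e > 0" "cball x e \<subseteq> G" using G open_contains_cball by blast
   obtain a b where ab: "\<forall>i\<in>Basis. a \<bullet> i \<in> \<rat> \<and> b \<bullet> i \<in> \<rat>" "x \<in> box a b" "box a b \<subseteq> ball x e"
    using rational_boxes[OF e(1)] by metis
   have "cbox a b = closure (box a b)" using ab(2) closure_box[of a b] by fastforce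
   also have "\<dots> \<subseteq> cball x e" using ab(3) ball_subset_cball closure_minimal closed_cball by (metis order_trans)
   finally have "(a,b) \<in> ?I" using ab(1) e(2) by (auto simp: rational_vec_def)
   then show "g x = 0" using elim ab(2) by blast
  qed
 qed
 then show ?thesis using G by (simp add: AE_restrict_space_iff)
qed

subsection \<open>Locally integrable functions and uniqueness\<close>

lemma locally_integrable_bounded_linear:
 fixes f :: "'a::euclidean_space \<Rightarrow> 'b::euclidean_space" and L :: "'b \<Rightarrow> 'c::euclidean_space"
 assumes "bounded_linear L" "locally_integrable G f"
 shows "locally_integrable G (%z. L (f z))"
 using assms integrable_bounded_linear unfolding locally_integrable_def by blast

lemma locally_integrable_component:
 fixes u :: "'a::euclidean_space \<Rightarrow> real^'n"
 shows "locally_integrable G u ==> locally_integrable G (%z. u z $ i)"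
 by (rule locally_integrable_bounded_linear[OF bounded_linear_vec_nth])

lemma locally_integrable_component2:
 fixes E :: "'a::euclidean_space \<Rightarrow> real^'n^'n"
 assumes "locally_integrable G E" shows "locally_integrable G (%z. E z $ i $ j)"
 by (rule locally_integrable_bounded_linear[OF bounded_linear_vec_nth
  locally_integrable_bounded_linear[OF bounded_linear_vec_nth assms]])

lemma locally_integrable_add:
 "locally_integrable G f ==> locally_integrable G g ==> locally_integrable G (%z. f z + g z)"
 by (auto simp: locally_integrable_def)

lemma locally_integrable_diff:
 "locally_integrable G f ==> locally_integrable G g ==> locally_integrable G (%z. f z - g z)"
 by (auto simp: locally_integrable_def)

lemma locally_integrable_scaleR:
 "locally_integrable G f ==> locally_integrable G (%z. c *\<^sub>R f z)"
 by (auto simp: locally_integrable_def)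

text \<open>G is a countable union of compact boxes, and measurability is checked on each of
  them.\<close>

lemma locally_integrable_measurable:
 fixes f :: "'a::euclidean_space \<Rightarrow> 'b::euclidean_space"
 assumes "open G" "locally_integrable G f"
 shows "f \<in> borel_measurable (lebesgue_on G)"
proof -
 obtain \<D> where \<D>: "countable \<D>" "\<D> \<subseteq> Pow G" "\<And>X. X \<in> \<D> ==> \<exists>a b. X = cbox a b" "\<Union>\<D> = G"
  using open_countable_Union_open_cbox[OF assms(1)] by metis
 show ?thesis
 proof (rule measurable_piecewise_restrict[OF \<D>(1)])
  show "X \<inter> space (lebesgue_on G) \<in> sets (lebesgue_on G)" if "X \<in> \<D>" for X
   using \<D>(3)[OF that] \<D>(2) that assms(1) by (auto simp: sets_restrict_space_iff Int_absorb2)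
  show "space (lebesgue_on G) \<subseteq> \<Union>\<D>" using \<D>(4) by simp
  fix X assume X: "X \<in> \<D>"
  obtain a b where "X = cbox a b" using \<D>(3)[OF X] by blast
  then have "integrable (lebesgue_on X) f"
   using assms(2) X \<D>(2) by (auto simp: locally_integrable_def)
  moreover have "restrict_space (lebesgue_on G) X = lebesgue_on X"
   using X \<D>(2) assms(1) \<open>X = cbox a b\<close>
   by (subst restrict_restrict_space) (auto simp: Int_absorb1)
  ultimately show "f \<in> measurable (restrict_space (lebesgue_on G) X) borel" by auto
 qed
qed

lemma locally_integrable_mult:
 fixes f g :: "'a::euclidean_space \<Rightarrow> real"
 assumes G: "G \<in> sets lebesgue" and f: "locally_integrable G f" and g: "continuous_on UNIV g"
  and K: "compact K" "K \<subseteq> G" "\<And>z. z \<notin> K ==> g z = 0"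
 shows "integrable (lebesgue_on G) (%z. f z * g z)"
proof -
 have "integrable (lebesgue_on K) f" using f K by (simp add: locally_integrable_def)
 then have i: "integrable lebesgue (%z. indicator K z * f z)"
  using K(1) by (simp add: integrable_restrict_space compact_imp_closed)
 have "bounded (g ` K)" using K(1) g by (intro compact_imp_bounded compact_continuous_image)
  (auto intro: continuous_on_subset)
 then obtain B where B: "\<And>z. z \<in> K ==> \<bar>g z\<bar> \<le> B" by (auto simp: bounded_iff)
 have "\<bar>g z\<bar> \<le> max B 0" for z using B[of z] K(3)[of z] by (cases "z \<in> K") auto
 then have "integrable lebesgue (%z. g z *\<^sub>R (indicator K z * f z))"
  by (intro integrable_bounded_mult[OF _ _ i] borel_measurable_lebesgueI borel_measurable_continuous_onI g)
 moreover have "(%z. g z *\<^sub>R (indicator K z * f z)) = (%z. indicator G z *\<^sub>R (f z * g z))"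
  using K by (auto simp: indicator_def fun_eq_iff)
 ultimately have "integrable lebesgue (%z. indicator G z *\<^sub>R (f z * g z))" by (simp only:)
 then show ?thesis using G by (simp add: integrable_restrict_space)
qed

lemma smooth_compactD:
 assumes "\<phi> \<in> smooth_compact G" "open G"
 shows "smooth \<phi>" "compact (closure {x. \<phi> x \<noteq> 0})" "closure {x. \<phi> x \<noteq> 0} \<subseteq> G"
 using assms by (auto simp: smooth_compact_iff)

lemma smooth_compact_test_fn: "\<phi> \<in> smooth_compact G ==> open G ==> test_fn \<phi>"
 by (auto simp: smooth_compact_iff test_fn_def)

lemma smooth_compact_zero_outside: "\<phi> \<in> smooth_compact G ==> x \<notin> G ==> \<phi> x = 0"
 using closure_subset[of "{x. \<phi> x \<noteq> 0}"] by (auto simp: smooth_compact_def)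

lemma integrable_test:
 fixes f :: "'a::euclidean_space \<Rightarrow> real"
 assumes G: "open G" and f: "locally_integrable G f" and \<phi>: "\<phi> \<in> smooth_compact G"
 shows "integrable (lebesgue_on G) (%z. f z * \<phi> z)" "integrable (lebesgue_on G) (%z. f z * dird v \<phi> z)"
proof -
 note \<phi>' = smooth_compactD[OF \<phi> G]
 have m: "G \<in> sets lebesgue" using G by simp
 show "integrable (lebesgue_on G) (%z. f z * \<phi> z)"
  by (rule locally_integrable_mult[OF m f smooth_continuous_on[OF \<phi>'(1)] \<phi>'(2,3)])
   (use closure_subset[of "{x. \<phi> x \<noteq> 0}"] in auto)
 show "integrable (lebesgue_on G) (%z. f z * dird v \<phi> z)"
  by (rule locally_integrable_mult[OF m f smooth_continuous_on[OF smooth_dird[OF \<phi>'(1)]] \<phi>'(2,3)])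
   (rule dird_outside_support)
qed

text \<open>Works with the countable family alone, so that it applies to a time slice for which the
  weak identity has been verified only against these tests.\<close>

lemma sym_grad_determined:
 fixes E E' :: "'a::euclidean_space \<Rightarrow> real^'n^'n"
 assumes G: "open G" and E: "locally_integrable G E" "locally_integrable G E'"
  and eq: "\<And>\<phi> i j. \<phi> \<in> box_tests G ==>
   (LINT z|lebesgue_on G. E z $ i $ j * \<phi> z) = (LINT z|lebesgue_on G. E' z $ i $ j * \<phi> z)"
 shows "AE z in lebesgue_on G. E z = E' z"
proof -
 have "AE z in lebesgue_on G. E z $ i $ j - E' z $ i $ j = 0" for i j
 proof (rule fundamental_lemma[OF G])
  note l = locally_integrable_component2[OF E(1), of i j] locally_integrable_component2[OF E(2), of i j]
  show "locally_integrable G (%z. E z $ i $ j - E' z $ i $ j)"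
   by (rule locally_integrable_diff[OF l])
  fix \<phi> assume \<phi>: "\<phi> \<in> box_tests G"
  then have \<phi>': "\<phi> \<in> smooth_compact G" using box_tests_smooth_compact[OF G] by blast
  show "(LINT z|lebesgue_on G. (E z $ i $ j - E' z $ i $ j) * \<phi> z) = 0"
   using eq[OF \<phi>] integrable_test(1)[OF G l(1) \<phi>'] integrable_test(1)[OF G l(2) \<phi>']
   by (simp add: left_diff_distrib)
 qed
 then have "AE z in lebesgue_on G. \<forall>i j. E z $ i $ j - E' z $ i $ j = 0"
  by (simp add: AE_all_countable)
 then show ?thesis by eventually_elim (simp add: vec_eq_iff)
qed

lemma has_sym_grad_unique:
 assumes "open G" "has_sym_grad D G u E" "has_sym_grad D G u E'"
 shows "AE z in lebesgue_on G. E z = E' z"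
 by (rule sym_grad_determined[OF assms(1)])
  (use assms box_tests_smooth_compact[OF assms(1)] in \<open>auto simp: has_sym_grad_def subset_iff\<close>)

lemma has_sym_grad_sym_grad:
 assumes "open G" "has_sym_grad D G u E"
 shows "has_sym_grad D G u (sym_grad D G u)" "AE z in lebesgue_on G. sym_grad D G u z = E z"
proof -
 show 1: "has_sym_grad D G u (sym_grad D G u)"
  unfolding sym_grad_def by (rule someI[of "has_sym_grad D G u", OF assms(2)])
 show "AE z in lebesgue_on G. sym_grad D G u z = E z"
  by (rule has_sym_grad_unique[OF assms(1) 1 assms(2)])
qed

lemma has_sym_gradI:
 fixes u :: "'a::euclidean_space \<Rightarrow> real^'n"
 assumes "locally_integrable G u" "locally_integrable G E" "\<And>z. z \<in> G ==> transpose (E z) = E z"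
  and "\<And>\<phi> i j. \<phi> \<in> smooth_compact G ==>
   (LINT z|lebesgue_on G. E z $ i $ j * \<phi> z) = - (1/2) * ((LINT z|lebesgue_on G. u z $ i * dird (D j) \<phi> z) +
    (LINT z|lebesgue_on G. u z $ j * dird (D i) \<phi> z))"
  and G: "open G"
 shows "has_sym_grad D G u E"
 unfolding has_sym_grad_def
proof (intro conjI assms ballI allI)
 fix \<phi> :: "'a \<Rightarrow> real" and i j assume \<phi>: "\<phi> \<in> smooth_compact G"
 show "(LINT z|lebesgue_on G. E z $ i $ j * \<phi> z) = - (1/2) *
   (LINT z|lebesgue_on G. u z $ i * dird (D j) \<phi> z + u z $ j * dird (D i) \<phi> z)"
  by (subst Bochner_Integration.integral_add)
   (use integrable_test(2)[OF G locally_integrable_component[OF assms(1)] \<phi>] assms(4)[OF \<phi>] in auto)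
qed auto

lemma has_sym_gradD:
 fixes u :: "'a::euclidean_space \<Rightarrow> real^'n"
 assumes "has_sym_grad D G u E" "open G"
 shows "locally_integrable G u" "locally_integrable G E" "\<And>z. z \<in> G ==> transpose (E z) = E z"
  and "\<And>\<phi> i j. \<phi> \<in> smooth_compact G ==>
   (LINT z|lebesgue_on G. E z $ i $ j * \<phi> z) = - (1/2) * ((LINT z|lebesgue_on G. u z $ i * dird (D j) \<phi> z) +
    (LINT z|lebesgue_on G. u z $ j * dird (D i) \<phi> z))"
proof -
 show 1: "locally_integrable G u" "locally_integrable G E" "\<And>z. z \<in> G ==> transpose (E z) = E z"
  using assms by (auto simp: has_sym_grad_def)
 fix \<phi> :: "'a \<Rightarrow> real" and i j assume \<phi>: "\<phi> \<in> smooth_compact G"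
 show "(LINT z|lebesgue_on G. E z $ i $ j * \<phi> z) = - (1/2) * ((LINT z|lebesgue_on G. u z $ i * dird (D j) \<phi> z) +
    (LINT z|lebesgue_on G. u z $ j * dird (D i) \<phi> z))"
  by (subst Bochner_Integration.integral_add[symmetric])
   (use integrable_test(2)[OF assms(2) locally_integrable_component[OF 1(1)] \<phi>] assms(1) \<phi> in
    \<open>auto simp: has_sym_grad_def\<close>)
qed

lemma has_sym_grad_add:
 fixes u :: "'a::euclidean_space \<Rightarrow> real^'n"
 assumes G: "open G" and u: "has_sym_grad D G u E" and v: "has_sym_grad D G v F"
 shows "has_sym_grad D G (%z. u z + v z) (%z. E z + F z)"
proof (rule has_sym_gradI[OF _ _ _ _ G])
 note U = has_sym_gradD[OF u G] and V = has_sym_gradD[OF v G]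
 show "locally_integrable G (%z. u z + v z)" "locally_integrable G (%z. E z + F z)"
  using U V by (auto intro: locally_integrable_add)
 show "transpose (E z + F z) = E z + F z" if "z \<in> G" for z
  using U(3)[OF that] V(3)[OF that] by (simp add: transpose_def vec_eq_iff)
 fix \<phi> :: "'a \<Rightarrow> real" and i j assume \<phi>: "\<phi> \<in> smooth_compact G"
 have iu: "integrable (lebesgue_on G) (%z. u z $ k * dird w \<phi> z)" "integrable (lebesgue_on G) (%z. v z $ k * dird w \<phi> z)" for k w
  using integrable_test(2)[OF G locally_integrable_component \<phi>] U(1) V(1) by auto
 have iE: "integrable (lebesgue_on G) (%z. E z $ i $ j * \<phi> z)" "integrable (lebesgue_on G) (%z. F z $ i $ j * \<phi> z)"
  using integrable_test(1)[OF G locally_integrable_component2 \<phi>] U(2) V(2) by auto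
 show "(LINT z|lebesgue_on G. (E z + F z) $ i $ j * \<phi> z) =
   - (1/2) * ((LINT z|lebesgue_on G. (u z + v z) $ i * dird (D j) \<phi> z) +
    (LINT z|lebesgue_on G. (u z + v z) $ j * dird (D i) \<phi> z))"
  using U(4)[OF \<phi>, of i j] V(4)[OF \<phi>, of i j] by (simp add: distrib_right iu iE add_divide_distrib)
qed

lemma has_sym_grad_scaleR:
 fixes u :: "'a::euclidean_space \<Rightarrow> real^'n"
 assumes G: "open G" and u: "has_sym_grad D G u E"
 shows "has_sym_grad D G (%z. c *\<^sub>R u z) (%z. c *\<^sub>R E z)"
proof (rule has_sym_gradI[OF _ _ _ _ G])
 note U = has_sym_gradD[OF u G]
 show "locally_integrable G (%z. c *\<^sub>R u z)" "locally_integrable G (%z. c *\<^sub>R E z)"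
  using U by (auto intro: locally_integrable_scaleR)
 show "transpose (c *\<^sub>R E z) = c *\<^sub>R E z" if "z \<in> G" for z
  using U(3)[OF that] by (simp add: transpose_def vec_eq_iff)
 fix \<phi> :: "'a \<Rightarrow> real" and i j assume \<phi>: "\<phi> \<in> smooth_compact G"
 show "(LINT z|lebesgue_on G. (c *\<^sub>R E z) $ i $ j * \<phi> z) =
   - (1/2) * ((LINT z|lebesgue_on G. (c *\<^sub>R u z) $ i * dird (D j) \<phi> z) +
    (LINT z|lebesgue_on G. (c *\<^sub>R u z) $ j * dird (D i) \<phi> z))"
  by (simp add: mult.assoc U(4)[OF \<phi>, of i j] distrib_left right_diff_distrib)
qed

subsection \<open>Integration by parts\<close>

text \<open>Convolution of f with the indicator of a large ball is constant near 0, since every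
  translate of f by a vector shorter than 1 stays inside the ball of radius R + 1. Its derivative at
  0 is therefore zero, and it equals the integral of the derivative of f up to reflection.\<close>

lemma integral_dird_test_fn:
 fixes f :: "'a::euclidean_space \<Rightarrow> real"
 assumes f: "test_fn f" shows "(LINT x|lebesgue. dird v f x) = 0"
proof -
 obtain R where R: "\<And>x. f x \<noteq> 0 ==> norm x \<le> R"
  using f by (auto simp: test_fn_def bounded_iff)
 let ?B = "indicator (cball 0 (R + 1)) :: 'a \<Rightarrow> real"
 have iB: "integrable lebesgue ?B"
  using lmeasurable_cball lmeasurable_iff_integrable by blast
 have zero: "dird v f x = 0" if "R < norm x" for x
 proof (rule dird_outside_support)
  have "closure {x. f x \<noteq> 0} \<subseteq> cball 0 R" by (rule closure_minimal) (use R in auto)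
  then show "x \<notin> closure {x. f x \<noteq> 0}" using that by auto
 qed
 have const: "convolution f ?B x = (LINT y|lebesgue. f (- y))" if "x \<in> ball 0 1" for x
 proof -
  have fB: "f (x - y) * ?B y = f (x - y)" for y
  proof (cases "f (x - y) = 0")
   case False
   then have "norm y \<le> norm x + norm (x - y)" using norm_triangle_ineq4[of x "x - y"] by simp
   then show ?thesis using R[OF False] that by (auto simp: indicator_def)
  qed simp
  have "convolution f ?B x = (LINT y|lebesgue. f (x - y))"
   unfolding convolution_def real_scaleR_def fB ..
  also have "\<dots> = (LINT y|lborel. f (x - y))"
   using test_fn_borel[OF test_fn_reflect[OF f]] by (simp add: integral_completion)
  also have "\<dots> = (LINT y|lborel. f (- y))"
   using lborel_integral_affine[of "%y. f (x - y)" 1 x] test_fn_borel[OF test_fn_reflect[OF f]] by simp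
  also have "\<dots> = (LINT y|lebesgue. f (- y))"
   using test_fn_borel[OF test_fn_reflect[OF f, of 0]] by (simp add: integral_completion)
  finally show ?thesis .
 qed
 have "(convolution f ?B has_derivative (%_. 0)) (at 0)"
  by (rule has_derivative_transform_within_open[of "%_. LINT y|lebesgue. f (- y)" _ _ _ "ball 0 1"])
   (use const in auto)
 then have "0 = dird v (convolution f ?B) 0" by (subst frechet_derivative_at[symmetric]) auto
 also have "\<dots> = (LINT y|lebesgue. dird v f (0 - y) * ?B y)"
  using dird_convolution[OF f iB, where w=v and x=0] by (simp add: convolution_def)
 also have "\<dots> = (LINT y|lebesgue. dird v f (- y))"
  using zero by (intro Bochner_Integration.integral_cong) (auto simp: indicator_def)
 also have "\<dots> = (LINT y|lborel. dird v f (- y))"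
  using test_fn_borel[OF test_fn_reflect[OF test_fn_dird[OF f, of v], of 0]] by (simp add: integral_completion)
 also have "\<dots> = (LINT y|lborel. dird v f y)"
  using lborel_integral_affine[of "%y. dird v f y" "-1" 0] test_fn_borel[OF test_fn_dird[OF f, of v]] by simp
 also have "\<dots> = (LINT y|lebesgue. dird v f y)"
  using test_fn_borel[OF test_fn_dird[OF f, of v]] by (simp add: integral_completion)
 finally show ?thesis by simp
qed

lemma integral_by_parts:
 fixes f :: "'a::euclidean_space \<Rightarrow> real"
 assumes G: "open G" and f: "smooth f" and \<phi>: "\<phi> \<in> smooth_compact G"
 shows "(LINT z|lebesgue_on G. dird v f z * \<phi> z) = - (LINT z|lebesgue_on G. f z * dird v \<phi> z)"
proof -
 note \<phi>' = smooth_compactD[OF \<phi> G]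
 have t: "test_fn \<phi>" by (rule smooth_compact_test_fn[OF \<phi> G])
 have d: "dird v (%z. f z * \<phi> z) z = f z * dird v \<phi> z + dird v f z * \<phi> z" for z
  using frechet_derivative_scaleR_smooth[OF f \<phi>'(1), of z v] by simp
 have i: "integrable lebesgue (%z. f z * dird v \<phi> z)" "integrable lebesgue (%z. dird v f z * \<phi> z)"
  by (intro test_fn_integrable test_fn_mult f smooth_dird test_fn_dird t)+
 have z: "x \<notin> G ==> \<phi> x = 0" "x \<notin> G ==> dird v \<phi> x = 0" for x
  using smooth_compact_zero_outside[OF \<phi>, of x] \<phi>'(3) dird_outside_support[of x \<phi> v] by auto
 have restr: "(LINT z|lebesgue_on G. g z) = (LINT z|lebesgue. g z)" if "\<And>z. z \<notin> G ==> g z = 0" for g :: "'a \<Rightarrow> real"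
  using G that by (simp add: integral_restrict_space) (intro Bochner_Integration.integral_cong, auto simp: indicator_def)
 have "0 = (LINT z|lebesgue. dird v (%z. f z * \<phi> z) z)"
  by (rule integral_dird_test_fn[symmetric, OF test_fn_mult[OF f t]])
 also have "\<dots> = (LINT z|lebesgue. f z * dird v \<phi> z) + (LINT z|lebesgue. dird v f z * \<phi> z)"
  unfolding d by (rule Bochner_Integration.integral_add[OF i])
 finally show ?thesis by (subst (1 2) restr) (auto simp: z)
qed

lemma continuous_locally_integrable:
 fixes f :: "'a::euclidean_space \<Rightarrow> 'b::euclidean_space"
 assumes "continuous_on UNIV g" "\<And>z. z \<in> G ==> f z = g z"
 shows "locally_integrable G f"
 unfolding locally_integrable_def
proof (intro allI impI)
 fix K assume K: "compact K \<and> K \<subseteq> G"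
 have "integrable lborel (%x. indicator K x *\<^sub>R g x)"
  using K assms(1) by (intro borel_integrable_compact) (auto intro: continuous_on_subset)
 then have "integrable lebesgue (%x. indicator K x *\<^sub>R g x)"
  by (subst integrable_completion) auto
 moreover have "(%x. indicator K x *\<^sub>R g x) = (%x. indicator K x *\<^sub>R f x)"
  using K assms(2) by (auto simp: indicator_def fun_eq_iff)
 ultimately show "integrable (lebesgue_on K) f"
  using K by (simp add: integrable_restrict_space compact_imp_closed)
qed

definition classical_sym_grad ::
 "('n::finite \<Rightarrow> 'a::euclidean_space) \<Rightarrow> ('a \<Rightarrow> real^'n) \<Rightarrow> 'a \<Rightarrow> real^'n^'n" where
 "classical_sym_grad D W z =
  (\<chi> i j. 1/2 * (dird (D j) (%z. W z $ i) z + dird (D i) (%z. W z $ j) z))"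

lemma has_sym_grad_smooth:
 fixes W :: "'a::euclidean_space \<Rightarrow> real^'n"
 assumes G: "open G" and W: "smooth W" and u: "\<And>z. z \<in> G ==> u z = W z"
  and E: "\<And>z. z \<in> G ==> E z = classical_sym_grad D W z"
 shows "has_sym_grad D G u E"
proof (rule has_sym_gradI[OF _ _ _ _ G])
 have Wi: "smooth (%z. W z $ i)" for i by (rule smooth_bounded_linear[OF W bounded_linear_vec_nth])
 show lu: "locally_integrable G u"
  by (rule continuous_locally_integrable[OF smooth_continuous_on[OF W] u])
 have "continuous_on UNIV (classical_sym_grad D W)"
  unfolding classical_sym_grad_def
  by (intro continuous_on_vec_lambda continuous_intros smooth_continuous_on smooth_dird Wi)
 then show lE: "locally_integrable G E" using E by (rule continuous_locally_integrable)
 show "transpose (E z) = E z" if "z \<in> G" for z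
  unfolding E[OF that] by (simp add: classical_sym_grad_def transpose_def vec_eq_iff add.commute)
 fix \<phi> :: "'a \<Rightarrow> real" and i j assume \<phi>: "\<phi> \<in> smooth_compact G"
 have loc: "locally_integrable G (%z. dird v (%z. W z $ i) z)" for v i
  by (rule continuous_locally_integrable[OF smooth_continuous_on[OF smooth_dird[OF Wi]]]) auto
 have int: "integrable (lebesgue_on G) (%z. dird v (%z. W z $ i) z * \<phi> z)" for v i
  by (rule integrable_test(1)[OF G loc \<phi>])
 have "(LINT z|lebesgue_on G. E z $ i $ j * \<phi> z) =
   (LINT z|lebesgue_on G. 1/2 * (dird (D j) (%z. W z $ i) z * \<phi> z + dird (D i) (%z. W z $ j) z * \<phi> z))"
  by (intro Bochner_Integration.integral_cong) (auto simp: E classical_sym_grad_def algebra_simps)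
 also have "\<dots> = 1/2 * ((LINT z|lebesgue_on G. dird (D j) (%z. W z $ i) z * \<phi> z) +
   (LINT z|lebesgue_on G. dird (D i) (%z. W z $ j) z * \<phi> z))"
  by (subst Bochner_Integration.integral_mult_right_zero) (simp add: int)
 also have "\<dots> = - (1/2) * ((LINT z|lebesgue_on G. W z $ i * dird (D j) \<phi> z) +
   (LINT z|lebesgue_on G. W z $ j * dird (D i) \<phi> z))"
  unfolding integral_by_parts[OF G Wi \<phi>] by argo
 also have "\<dots> = - (1/2) * ((LINT z|lebesgue_on G. u z $ i * dird (D j) \<phi> z) +
    (LINT z|lebesgue_on G. u z $ j * dird (D i) \<phi> z))"
  by (intro arg_cong2[of _ _ _ _ "(*)"] arg_cong2[of _ _ _ _ "(+)"] refl Bochner_Integration.integral_cong)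
   (auto simp: u)
 finally show "(LINT z|lebesgue_on G. E z $ i $ j * \<phi> z) = - (1/2) * ((LINT z|lebesgue_on G. u z $ i * dird (D j) \<phi> z) +
    (LINT z|lebesgue_on G. u z $ j * dird (D i) \<phi> z))" .
qed

section \<open>Variable exponent Lebesgue spaces\<close>

lemma powr_convex_nonneg:
 fixes a b s p :: real
 assumes "0 \<le> a" "0 \<le> b" "0 \<le> s" "s \<le> 1" "1 \<le> p"
 shows "(s * a + (1 - s) * b) powr p \<le> s * a powr p + (1 - s) * b powr p"
proof -
 have le: "t powr p \<le> t" if "0 \<le> t" "t \<le> 1" for t
  using powr_mono'[of 1 p t] that assms(5) by simp
 consider "a = 0" | "b = 0" | "0 < a" "0 < b" using assms by linarith
 then show ?thesis
 proof cases
  case 1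
  then show ?thesis using assms le[of "1 - s"] by (auto simp: powr_mult intro!: mult_right_mono)
 next
  case 2
  then show ?thesis using assms le[of s] by (auto simp: powr_mult intro!: mult_right_mono)
 next
  case 3
  have "((1 - (1 - s)) *\<^sub>R a + (1 - s) *\<^sub>R b) powr p \<le> (1 - (1 - s)) * a powr p + (1 - s) * b powr p"
   by (rule convex_onD[OF powr_convex[OF assms(5)]]) (use 3 assms in auto)
  then show ?thesis by simp
 qed
qed

section \<open>Modular and Luxemburg norm for a bounded exponent on a set of finite measure\<close>

locale variable_exponent =
 fixes G :: "'a::euclidean_space set" and p :: "'a \<Rightarrow> real" and P :: real
 assumes G: "G \<in> lmeasurable" and p_meas: "p \<in> borel_measurable (lebesgue_on G)"
  and p1: "\<And>x. x \<in> G ==> 1 \<le> p x" and pP: "\<And>x. x \<in> G ==> p x \<le> P"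
begin

abbreviation "vol \<equiv> measure lebesgue G"

lemma G_sets: "G \<in> sets lebesgue"
 using G by (rule fmeasurableD)

lemma emeasure_space_G: "emeasure (lebesgue_on G) (space (lebesgue_on G)) = ennreal vol"
 using G G_sets by (simp add: emeasure_restrict_space emeasure_eq_measure2)

lemma emeasure_G: "emeasure (lebesgue_on G) G = ennreal vol"
 using emeasure_space_G by simp

lemma powr_measurable:
 fixes f :: "'a \<Rightarrow> 'b::euclidean_space"
 shows "f \<in> borel_measurable (lebesgue_on G) ==> (%x. norm (f x) powr p x) \<in> borel_measurable (lebesgue_on G)"
proof -
 assume [measurable]: "f \<in> borel_measurable (lebesgue_on G)"
 note p_meas[measurable]
 show ?thesis by measurable
qed

lemma modular_mono:
 assumes "AE x in lebesgue_on G. norm (f x) \<le> norm (g x)"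
 shows "modular G p f \<le> modular G p g"
 unfolding modular_def
proof (rule nn_integral_mono_AE)
 show "AE x in lebesgue_on G. ennreal (norm (f x) powr p x) \<le> ennreal (norm (g x) powr p x)"
  using assms AE_space by eventually_elim (use p1 in \<open>force intro!: ennreal_leI powr_mono2\<close>)
qed

lemma modular_cong: "AE x in lebesgue_on G. f x = g x ==> modular G p f = modular G p g"
 unfolding modular_def by (rule nn_integral_cong_AE) auto

lemma modular_scaleR_le:
 fixes f :: "'a \<Rightarrow> 'b::euclidean_space"
 assumes f: "f \<in> borel_measurable (lebesgue_on G)" and "0 \<le> c" "c \<le> 1"
 shows "modular G p (%x. c *\<^sub>R f x) \<le> ennreal c * modular G p f"
proof -
 have "modular G p (%x. c *\<^sub>R f x) \<le> (\<integral>\<^sup>+x. ennreal c * ennreal (norm (f x) powr p x) \<partial>lebesgue_on G)"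
  unfolding modular_def
 proof (rule nn_integral_mono)
  fix x assume "x \<in> space (lebesgue_on G)"
  then have "1 \<le> p x" using p1 by simp
  then have "c powr p x \<le> c" using powr_mono'[of 1 "p x" c] assms by simp
  then show "ennreal (norm (c *\<^sub>R f x) powr p x) \<le> ennreal c * ennreal (norm (f x) powr p x)"
   using assms by (simp add: powr_mult ennreal_mult'[symmetric] ennreal_leI mult_right_mono)
 qed
 also have "\<dots> = ennreal c * modular G p f"
  unfolding modular_def by (rule nn_integral_cmult) (use powr_measurable[OF f] in measurable)
 finally show ?thesis .
qed

lemma modular_scaleR_ge1_le:
 fixes f :: "'a \<Rightarrow> 'b::euclidean_space"
 assumes f: "f \<in> borel_measurable (lebesgue_on G)" and "1 \<le> c"
 shows "modular G p (%x. c *\<^sub>R f x) \<le> ennreal (c powr P) * modular G p f"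
proof -
 have "modular G p (%x. c *\<^sub>R f x) \<le> (\<integral>\<^sup>+x. ennreal (c powr P) * ennreal (norm (f x) powr p x) \<partial>lebesgue_on G)"
  unfolding modular_def
 proof (rule nn_integral_mono)
  fix x assume "x \<in> space (lebesgue_on G)"
  then have "c powr p x \<le> c powr P" using pP assms by (intro powr_mono) auto
  then show "ennreal (norm (c *\<^sub>R f x) powr p x) \<le> ennreal (c powr P) * ennreal (norm (f x) powr p x)"
   using assms by (simp add: powr_mult ennreal_mult'[symmetric] ennreal_leI mult_right_mono)
 qed
 also have "\<dots> = ennreal (c powr P) * modular G p f"
  unfolding modular_def by (rule nn_integral_cmult) (use powr_measurable[OF f] in measurable)
 finally show ?thesis .
qed

lemma modular_convex:
 fixes f g :: "'a \<Rightarrow> 'b::euclidean_space"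
 assumes f: "f \<in> borel_measurable (lebesgue_on G)" and g: "g \<in> borel_measurable (lebesgue_on G)"
  and s: "0 \<le> s" "s \<le> 1"
 shows "modular G p (%x. s *\<^sub>R f x + (1 - s) *\<^sub>R g x) \<le> ennreal s * modular G p f + ennreal (1 - s) * modular G p g"
proof -
 have "modular G p (%x. s *\<^sub>R f x + (1 - s) *\<^sub>R g x)
   \<le> (\<integral>\<^sup>+x. ennreal s * ennreal (norm (f x) powr p x) + ennreal (1 - s) * ennreal (norm (g x) powr p x) \<partial>lebesgue_on G)"
  unfolding modular_def
 proof (rule nn_integral_mono)
  fix x assume "x \<in> space (lebesgue_on G)"
  then have p: "1 \<le> p x" using p1 by simp
  have "norm (s *\<^sub>R f x + (1 - s) *\<^sub>R g x) \<le> s * norm (f x) + (1 - s) * norm (g x)"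
   using norm_triangle_ineq[of "s *\<^sub>R f x" "(1 - s) *\<^sub>R g x"] s by simp
  then have "norm (s *\<^sub>R f x + (1 - s) *\<^sub>R g x) powr p x \<le> (s * norm (f x) + (1 - s) * norm (g x)) powr p x"
   using p by (intro powr_mono2) auto
  also have "\<dots> \<le> s * norm (f x) powr p x + (1 - s) * norm (g x) powr p x"
   by (rule powr_convex_nonneg) (use s p in auto)
  finally show "ennreal (norm (s *\<^sub>R f x + (1 - s) *\<^sub>R g x) powr p x)
    \<le> ennreal s * ennreal (norm (f x) powr p x) + ennreal (1 - s) * ennreal (norm (g x) powr p x)"
   using s by (simp add: ennreal_mult'[symmetric] ennreal_plus[symmetric] ennreal_leI del: ennreal_plus)
 qed
 also have "\<dots> = ennreal s * modular G p f + ennreal (1 - s) * modular G p g"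
  unfolding modular_def using powr_measurable[OF f] powr_measurable[OF g]
  by (subst nn_integral_add) (auto simp: nn_integral_cmult)
 finally show ?thesis .
qed

lemma Lp_space_measurable: "f \<in> Lp_space G p ==> f \<in> borel_measurable (lebesgue_on G)"
 by (simp add: Lp_space_def)

lemma Lp_space_scaleR:
 fixes f :: "'a \<Rightarrow> 'b::euclidean_space"
 assumes "f \<in> Lp_space G p" shows "(%x. c *\<^sub>R f x) \<in> Lp_space G p"
proof -
 have f: "f \<in> borel_measurable (lebesgue_on G)" "modular G p f < \<infinity>" using assms by (auto simp: Lp_space_def)
 have "modular G p (%x. c *\<^sub>R f x) \<le> modular G p (%x. max 1 \<bar>c\<bar> *\<^sub>R f x)"
  by (rule modular_mono) (auto intro!: mult_right_mono)
 also have "\<dots> \<le> ennreal (max 1 \<bar>c\<bar> powr P) * modular G p f"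
  by (rule modular_scaleR_ge1_le[OF f(1)]) auto
 also have "\<dots> < \<infinity>" using f(2) by (simp add: ennreal_mult_less_top)
 finally show ?thesis using f(1) by (simp add: Lp_space_def)
qed

lemma Lp_space_add:
 fixes f g :: "'a \<Rightarrow> 'b::euclidean_space"
 assumes "f \<in> Lp_space G p" "g \<in> Lp_space G p" shows "(%x. f x + g x) \<in> Lp_space G p"
proof -
 have 2: "(%x. 2 *\<^sub>R f x) \<in> Lp_space G p" "(%x. 2 *\<^sub>R g x) \<in> Lp_space G p"
  using assms Lp_space_scaleR by auto
 have "modular G p (%x. (1/2) *\<^sub>R (2 *\<^sub>R f x) + (1 - 1/2) *\<^sub>R (2 *\<^sub>R g x))
   \<le> ennreal (1/2) * modular G p (%x. 2 *\<^sub>R f x) + ennreal (1 - 1/2) * modular G p (%x. 2 *\<^sub>R g x)"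
  by (rule modular_convex) (use 2 in \<open>auto dest: Lp_space_measurable\<close>)
 also have "\<dots> < \<infinity>"
  using 2 ennreal_less_top[of "1/2"] by (simp add: Lp_space_def ennreal_mult_less_top)
 finally show ?thesis using assms by (auto simp: Lp_space_def)
qed

lemma Lp_norm_le: "0 < l ==> modular G p (%x. f x /\<^sub>R l) \<le> 1 ==> Lp_norm G p f \<le> l"
 unfolding Lp_norm_def by (intro cInf_lower) (auto intro!: bdd_belowI[of _ 0])

text \<open>Dividing by K at least 1 lowers the modular at least by the factor 1/K because every
  exponent is at least 1. This converts modular bounds into norm bounds.\<close>

lemma modular_le_imp_Lp_norm_le:
 fixes f :: "'a \<Rightarrow> 'b::euclidean_space"
 assumes f: "f \<in> borel_measurable (lebesgue_on G)" "modular G p f \<le> ennreal K" and "1 \<le> K"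
 shows "modular G p (%x. f x /\<^sub>R K) \<le> 1" "Lp_norm G p f \<le> K"
proof -
 have "modular G p (%x. f x /\<^sub>R K) \<le> ennreal (inverse K) * modular G p f"
  by (rule modular_scaleR_le[OF f(1)]) (use assms in \<open>auto simp: field_simps\<close>)
 also have "\<dots> \<le> ennreal (inverse K) * ennreal K" by (intro mult_left_mono f) auto
 also have "\<dots> = 1" using assms(3) by (simp add: ennreal_mult'[symmetric])
 finally show "modular G p (%x. f x /\<^sub>R K) \<le> 1" .
 then show "Lp_norm G p f \<le> K" using assms(3) by (intro Lp_norm_le) auto
qed

lemma Lp_norm_set_nonempty:
 fixes f :: "'a \<Rightarrow> 'b::euclidean_space"
 assumes "f \<in> Lp_space G p" shows "{l. 0 < l \<and> modular G p (%x. f x /\<^sub>R l) \<le> 1} \<noteq> {}"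
proof -
 have "modular G p f \<le> ennreal (max 1 (enn2real (modular G p f)))"
  using assms by (cases "modular G p f") (auto simp: Lp_space_def max_def ennreal_leI)
 then show ?thesis
  using modular_le_imp_Lp_norm_le(1)[of f "max 1 (enn2real (modular G p f))"] assms
  by (auto simp: Lp_space_def intro!: exI[of _ "max 1 (enn2real (modular G p f))"])
qed

lemma Lp_norm_nonneg:
 fixes f :: "'a \<Rightarrow> 'b::euclidean_space"
 assumes "f \<in> Lp_space G p" shows "0 \<le> Lp_norm G p f"
 unfolding Lp_norm_def by (rule cInf_greatest[OF Lp_norm_set_nonempty[OF assms]]) auto

text \<open>With a strict inequality some admissible l' lies below l, and attainment of the infimum
  need not be discussed.\<close>

lemma modular_le_1:
 fixes f :: "'a \<Rightarrow> 'b::euclidean_space"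
 assumes f: "f \<in> Lp_space G p" and l: "Lp_norm G p f < l"
 shows "modular G p (%x. f x /\<^sub>R l) \<le> 1"
proof -
 obtain l' where l': "0 < l'" "modular G p (%x. f x /\<^sub>R l') \<le> 1" "l' < l"
  using cInf_lessD[OF Lp_norm_set_nonempty[OF f] l[unfolded Lp_norm_def]] by auto
 have "norm (f x /\<^sub>R l) \<le> norm (f x /\<^sub>R l')" for x
  using l' by (auto simp: field_simps intro!: mult_right_mono)
 then have "modular G p (%x. f x /\<^sub>R l) \<le> modular G p (%x. f x /\<^sub>R l')" by (intro modular_mono) auto
 then show ?thesis using l'(2) by simp
qed

text \<open>Norm inequalities are reduced to implications between modulars at a common scale l,
  where pointwise estimates can be used.\<close>

lemma Lp_norm_leI:
 fixes f :: "'a \<Rightarrow> 'b::euclidean_space" and g :: "'a \<Rightarrow> 'c::euclidean_space"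
 assumes f: "f \<in> Lp_space G p" and "0 < K"
  and *: "\<And>l. 0 < l ==> modular G p (%x. f x /\<^sub>R l) \<le> 1 ==> modular G p (%x. g x /\<^sub>R (K * l)) \<le> 1"
 shows "Lp_norm G p g \<le> K * Lp_norm G p f"
proof (rule dense_ge)
 fix y assume y: "K * Lp_norm G p f < y"
 then have "Lp_norm G p f < y / K" using assms(2) by (simp add: field_simps)
 moreover from this have "0 < y / K" using Lp_norm_nonneg[OF f] by linarith
 ultimately have "modular G p (%x. g x /\<^sub>R (K * (y / K))) \<le> 1" using modular_le_1[OF f] * by blast
 then show "Lp_norm G p g \<le> y" using assms(2) \<open>0 < y / K\<close> by (intro Lp_norm_le) (auto simp: zero_less_divide_iff)
qed

lemma Lp_norm_cong:
 fixes f g :: "'a \<Rightarrow> 'b::euclidean_space"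
 assumes "AE x in lebesgue_on G. f x = g x"
 shows "Lp_norm G p f = Lp_norm G p g"
proof -
 have "modular G p (%x. f x /\<^sub>R l) = modular G p (%x. g x /\<^sub>R l)" for l
  by (rule modular_cong) (use assms in auto)
 then show ?thesis by (simp add: Lp_norm_def)
qed

lemma Lp_space_cong:
 fixes f g :: "'a \<Rightarrow> 'b::euclidean_space"
 assumes "f \<in> Lp_space G p" "AE x in lebesgue_on G. f x = g x" "g \<in> borel_measurable (lebesgue_on G)"
 shows "g \<in> Lp_space G p"
 using modular_cong[OF assms(2)] assms by (simp add: Lp_space_def)

lemma Lp_norm_zero: "Lp_norm G p (%x. 0::'b::euclidean_space) = 0"
proof -
 have "modular G p (%x. 0::'b) = 0" by (simp add: modular_def)
 then have "{l. 0 < l \<and> modular G p (%x. (0::'b) /\<^sub>R l) \<le> 1} = {0<..}" by auto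
 then show ?thesis by (simp add: Lp_norm_def)
qed

lemma Lp_norm_scaleR:
 fixes f :: "'a \<Rightarrow> 'b::euclidean_space"
 assumes f: "f \<in> Lp_space G p" shows "Lp_norm G p (%x. c *\<^sub>R f x) = \<bar>c\<bar> * Lp_norm G p f"
proof -
 have le: "Lp_norm G p (%x. c *\<^sub>R f x) \<le> \<bar>c\<bar> * Lp_norm G p f" if f: "f \<in> Lp_space G p" "c \<noteq> 0" for f :: "'a \<Rightarrow> 'b" and c
 proof (rule Lp_norm_leI[OF f(1)])
  fix l :: real assume l: "0 < l" "modular G p (%x. f x /\<^sub>R l) \<le> 1"
  have "modular G p (%x. c *\<^sub>R f x /\<^sub>R (\<bar>c\<bar> * l)) \<le> modular G p (%x. f x /\<^sub>R l)"
   using f(2) l(1) by (intro modular_mono) (auto simp: abs_mult field_simps)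
  then show "modular G p (%x. c *\<^sub>R f x /\<^sub>R (\<bar>c\<bar> * l)) \<le> 1" using l(2) by simp
 qed (use f in auto)
 show ?thesis
 proof (cases "c = 0")
  case True
  then show ?thesis using Lp_norm_zero by simp
 next
  case False
  have "Lp_norm G p (%x. inverse c *\<^sub>R (c *\<^sub>R f x)) \<le> \<bar>inverse c\<bar> * Lp_norm G p (%x. c *\<^sub>R f x)"
   by (rule le[OF Lp_space_scaleR[OF f]]) (use False in auto)
  then have "\<bar>c\<bar> * Lp_norm G p f \<le> Lp_norm G p (%x. c *\<^sub>R f x)"
   using False by (simp add: field_simps)
  then show ?thesis using le[OF f False] by simp
 qed
qed

lemma Lp_norm_triangle:
 fixes f g :: "'a \<Rightarrow> 'b::euclidean_space"
 assumes f: "f \<in> Lp_space G p" and g: "g \<in> Lp_space G p"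
 shows "Lp_norm G p (%x. f x + g x) \<le> Lp_norm G p f + Lp_norm G p g"
proof (rule field_le_epsilon)
 fix e :: real assume e: "0 < e"
 define l where "l = Lp_norm G p f + e / 2"
 define m where "m = Lp_norm G p g + e / 2"
 have lm: "0 < l" "0 < m" "modular G p (%x. f x /\<^sub>R l) \<le> 1" "modular G p (%x. g x /\<^sub>R m) \<le> 1"
  using e Lp_norm_nonneg[OF f] Lp_norm_nonneg[OF g] modular_le_1[OF f, of l] modular_le_1[OF g, of m]
  by (auto simp: l_def m_def)
 \<comment> \<open>Weights for which the scaled sum becomes a convex combination of two functions of
   modular at most 1.\<close>
 define s where "s = l / (l + m)"
 have s: "0 \<le> s" "s \<le> 1" "1 - s = m / (l + m)" using lm by (auto simp: s_def field_simps)
 have "(f x + g x) /\<^sub>R (l + m) = s *\<^sub>R (f x /\<^sub>R l) + (1 - s) *\<^sub>R (g x /\<^sub>R m)" for x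
 proof -
  have "s * inverse l = inverse (l + m)" "(1 - s) * inverse m = inverse (l + m)"
   unfolding s(3) s_def using lm(1,2) by (auto simp: field_simps)
  then show ?thesis by (simp add: scaleR_add_right)
 qed
 then have "modular G p (%x. (f x + g x) /\<^sub>R (l + m))
   \<le> ennreal s * modular G p (%x. f x /\<^sub>R l) + ennreal (1 - s) * modular G p (%x. g x /\<^sub>R m)"
  by (simp only:) (rule modular_convex, use f g s in \<open>auto dest: Lp_space_measurable\<close>)
 also have "\<dots> \<le> ennreal s * 1 + ennreal (1 - s) * 1" by (intro add_mono mult_left_mono lm) auto
 also have "\<dots> = 1" using s by (simp add: ennreal_plus[symmetric] del: ennreal_plus)
 finally have "Lp_norm G p (%x. f x + g x) \<le> l + m" using lm by (intro Lp_norm_le) auto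
 then show "Lp_norm G p (%x. f x + g x) \<le> Lp_norm G p f + Lp_norm G p g + e" by (simp add: l_def m_def)
qed

lemma Lp_integrable_powr:
 fixes f :: "'a \<Rightarrow> 'b::euclidean_space"
 assumes f: "f \<in> Lp_space G p"
 shows "integrable (lebesgue_on G) (%x. norm (f x) powr p x)"
  "modular G p f = ennreal (LINT x|lebesgue_on G. norm (f x) powr p x)"
proof -
 show 1: "integrable (lebesgue_on G) (%x. norm (f x) powr p x)"
  using f powr_measurable[of f] by (intro integrableI_bounded) (auto simp: Lp_space_def modular_def)
 show "modular G p f = ennreal (LINT x|lebesgue_on G. norm (f x) powr p x)"
  unfolding modular_def by (rule nn_integral_eq_integral[OF 1]) auto
qed

text \<open>Rests on a \<le> 1 + a^p; integrating the 1 costs the volume, which is where the factor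
  1 + \<open>vol\<close> comes from.\<close>

lemma L1_bound:
 fixes f :: "'a \<Rightarrow> 'b::euclidean_space"
 assumes f: "f \<in> Lp_space G p"
 shows "integrable (lebesgue_on G) f" "(LINT x|lebesgue_on G. norm (f x)) \<le> (1 + vol) * Lp_norm G p f"
proof -
 note m = Lp_space_measurable[OF f]
 have key: "(\<integral>\<^sup>+x. ennreal (norm (f x)) \<partial>lebesgue_on G) \<le> ennreal ((1 + vol) * l)"
  if l: "0 < l" "modular G p (%x. f x /\<^sub>R l) \<le> 1" for l
 proof -
  have "(\<integral>\<^sup>+x. ennreal (norm (f x)) \<partial>lebesgue_on G)
    \<le> (\<integral>\<^sup>+x. ennreal l * (1 + ennreal (norm (f x /\<^sub>R l) powr p x)) \<partial>lebesgue_on G)"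
  proof (rule nn_integral_mono)
   fix x assume "x \<in> space (lebesgue_on G)"
   then have p: "1 \<le> p x" using p1 by simp
   have "a \<le> 1 + a powr p x" if "0 \<le> a" for a :: real
    using powr_mono[of 1 "p x" a] p that by (cases "a \<le> 1") (auto intro: add_increasing2)
   from this[of "norm (f x /\<^sub>R l)"]
   have "norm (f x) \<le> l * (1 + norm (f x /\<^sub>R l) powr p x)" using l(1) by (simp add: field_simps)
   then show "ennreal (norm (f x)) \<le> ennreal l * (1 + ennreal (norm (f x /\<^sub>R l) powr p x))"
    using l(1) by (simp add: ennreal_mult'[symmetric] ennreal_leI flip: ennreal_1 ennreal_plus)
  qed
  also have "\<dots> = ennreal l * (emeasure (lebesgue_on G) (space (lebesgue_on G)) + modular G p (%x. f x /\<^sub>R l))"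
   using powr_measurable[of "%x. f x /\<^sub>R l"] m unfolding modular_def
   by (subst nn_integral_cmult) (auto simp: nn_integral_add)
  also have "\<dots> \<le> ennreal l * (ennreal vol + 1)"
   unfolding emeasure_space_G using l by (intro mult_left_mono add_mono) auto
  also have "\<dots> = ennreal ((1 + vol) * l)"
   using l(1) by (simp add: ennreal_mult'[symmetric] algebra_simps flip: ennreal_1 ennreal_plus)
  finally show ?thesis .
 qed
 obtain l0 where l0: "0 < l0" "modular G p (%x. f x /\<^sub>R l0) \<le> 1" using Lp_norm_set_nonempty[OF f] by auto
 show 1: "integrable (lebesgue_on G) f"
  using key[OF l0] m by (intro integrableI_bounded) (auto simp: top_unique intro: le_less_trans)
 have "(LINT x|lebesgue_on G. norm (f x)) / (1 + vol) \<le> Lp_norm G p f"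
 proof (rule dense_ge)
  fix l assume l: "Lp_norm G p f < l"
  then have "0 < l" using Lp_norm_nonneg[OF f] by simp
  have "ennreal (LINT x|lebesgue_on G. norm (f x)) \<le> ennreal ((1 + vol) * l)"
   using key[OF \<open>0 < l\<close> modular_le_1[OF f l]] by (subst nn_integral_eq_integral[symmetric]) (use 1 in auto)
  then show "(LINT x|lebesgue_on G. norm (f x)) / (1 + vol) \<le> l"
   using \<open>0 < l\<close> by (simp add: divide_le_eq mult.commute add_pos_nonneg)
 qed
 then show "(LINT x|lebesgue_on G. norm (f x)) \<le> (1 + vol) * Lp_norm G p f"
  by (simp add: divide_le_eq mult.commute add_pos_nonneg)
qed

text \<open>After scaling, the function is at most 1 / (1 + \<open>vol\<close>), hence so is its
  power, and the modular is at most \<open>vol\<close> / (1 + \<open>vol\<close>).\<close>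

lemma bounded_Lp:
 fixes f :: "'a \<Rightarrow> 'b::euclidean_space"
 assumes f: "f \<in> borel_measurable (lebesgue_on G)" and M: "AE x in lebesgue_on G. norm (f x) \<le> M" "0 \<le> M"
 shows "f \<in> Lp_space G p" "Lp_norm G p f \<le> (1 + vol) * M"
proof -
 have key: "modular G p (%x. f x /\<^sub>R ((1 + vol) * M')) \<le> 1" if M': "M \<le> M'" "0 < M'" for M'
 proof -
  have "modular G p (%x. f x /\<^sub>R ((1 + vol) * M')) \<le> (\<integral>\<^sup>+x. ennreal (1 / (1 + vol)) \<partial>lebesgue_on G)"
   unfolding modular_def
  proof (rule nn_integral_mono_AE)
   show "AE x in lebesgue_on G. ennreal (norm (f x /\<^sub>R ((1 + vol) * M')) powr p x) \<le> ennreal (1 / (1 + vol))"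
    using M(1) AE_space
   proof eventually_elim
    case (elim x)
    let ?a = "norm (f x /\<^sub>R ((1 + vol) * M'))"
    have "?a \<le> 1 / (1 + vol)"
    proof -
     have "norm (f x) / M' \<le> 1" using elim(1) M' by simp
     then have "norm (f x) / M' / (1 + vol) \<le> 1 / (1 + vol)" by (intro divide_right_mono) auto
     then show ?thesis using M' by (simp add: abs_mult divide_inverse mult_ac)
    qed
    moreover have "1 / (1 + vol) \<le> 1" using measure_nonneg[of lebesgue G] by (simp add: divide_le_eq)
    moreover have "?a powr p x \<le> ?a powr 1"
     using p1[of x] elim(2) calculation by (intro powr_mono') auto
    ultimately show ?case by (intro ennreal_leI) simp
   qed
  qed
  also have "\<dots> = ennreal (1 / (1 + vol)) * ennreal vol" by (simp add: emeasure_G)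
  also have "\<dots> \<le> 1" by (simp add: ennreal_mult'[symmetric] divide_le_eq add_pos_nonneg)
  finally show ?thesis .
 qed
 define c where "c = (1 + vol) * (M + 1)"
 have c: "c \<noteq> 0" using M(2) by (simp add: c_def add_nonneg_eq_0_iff)
 have "(%x. c *\<^sub>R (f x /\<^sub>R c)) \<in> Lp_space G p"
  by (rule Lp_space_scaleR)
   (use key[of "M + 1"] f M(2) in \<open>auto simp: Lp_space_def c_def[symmetric] intro: le_less_trans\<close>)
 then show "f \<in> Lp_space G p" using c by simp
 have "Lp_norm G p f / (1 + vol) \<le> M"
 proof (rule dense_ge)
  fix M' assume "M < M'"
  then have "Lp_norm G p f \<le> (1 + vol) * M'"
   using M(2) by (intro Lp_norm_le key) (auto intro!: mult_pos_pos add_pos_nonneg)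
  then show "Lp_norm G p f / (1 + vol) \<le> M'" by (simp add: divide_le_eq mult.commute add_pos_nonneg)
 qed
 then show "Lp_norm G p f \<le> (1 + vol) * M" by (simp add: divide_le_eq mult.commute add_pos_nonneg)
qed

text \<open>The scale 2 is strictly above the norm, as \<open>modular_le_1\<close> demands; undoing
  the scaling costs 2^P.\<close>

lemma modular_le_of_norm_le_1:
 fixes f :: "'a \<Rightarrow> 'b::euclidean_space"
 assumes f: "f \<in> Lp_space G p" and "Lp_norm G p f \<le> 1"
 shows "(LINT x|lebesgue_on G. norm (f x) powr p x) \<le> 2 powr P"
proof -
 have "modular G p (%x. 2 *\<^sub>R (f x /\<^sub>R 2)) \<le> ennreal (2 powr P) * modular G p (%x. f x /\<^sub>R 2)"
  by (rule modular_scaleR_ge1_le) (use f in \<open>auto dest: Lp_space_measurable\<close>)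
 also have "\<dots> \<le> ennreal (2 powr P) * 1"
  using modular_le_1[OF f, of 2] assms(2) by (intro mult_left_mono) auto
 finally show ?thesis using Lp_integrable_powr(2)[OF f] by simp
qed

text \<open>A lower bound of the exponent above 1 makes the modular grow superlinearly in the norm.
  Beyond the threshold L, chosen so that C \<le> L^(p0 - 1), the modular is at least l^p0 for every
  l > L below the norm, hence at least C * l. Below L the constant C * L suffices. This bounds
  energy minus functional from below.\<close>

lemma modular_coercive:
 assumes p0: "1 < p0" "\<And>x. x \<in> G ==> p0 \<le> p x" and "0 \<le> C"
 shows "\<exists>K. \<forall>f :: 'a \<Rightarrow> 'b::euclidean_space. f \<in> Lp_space G p \<longrightarrow>
  C * Lp_norm G p f \<le> (LINT x|lebesgue_on G. norm (f x) powr p x) + K"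
proof -
 define L where "L = max 1 (C powr (1 / (p0 - 1)))"
 have L: "1 \<le> L" "C \<le> l powr (p0 - 1)" if "L \<le> l" for l
 proof -
  show "1 \<le> L" by (simp add: L_def)
  have "C = (C powr (1 / (p0 - 1))) powr (p0 - 1)" using p0(1) assms(3) by (simp add: powr_powr)
  also have "\<dots> \<le> l powr (p0 - 1)" using that p0(1) by (intro powr_mono2) (auto simp: L_def)
  finally show "C \<le> l powr (p0 - 1)" .
 qed
 have "C * Lp_norm G p f \<le> (LINT x|lebesgue_on G. norm (f x) powr p x) + C * L"
  if f: "f \<in> Lp_space G p" for f :: "'a \<Rightarrow> 'b"
 proof (cases "Lp_norm G p f \<le> L")
  case True
  then have "C * Lp_norm G p f \<le> C * L" using assms(3) by (intro mult_left_mono)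
  moreover have "0 \<le> (LINT x|lebesgue_on G. norm (f x) powr p x)" by (intro Bochner_Integration.integral_nonneg) auto
  ultimately show ?thesis by linarith
 next
  case False
  have 1: "C * l \<le> (LINT x|lebesgue_on G. norm (f x) powr p x)" if l: "L < l" "l < Lp_norm G p f" for l
  proof -
   have l1: "1 \<le> l" using L(1)[of L] l by simp
   have "\<not> modular G p (%x. f x /\<^sub>R l) \<le> 1" using Lp_norm_le[of l f] l l1 by auto
   moreover have "modular G p (%x. inverse l *\<^sub>R f x) \<le> ennreal (l powr (- p0)) * modular G p f"
   proof -
    have "modular G p (%x. inverse l *\<^sub>R f x) \<le> (\<integral>\<^sup>+x. ennreal (l powr (- p0)) * ennreal (norm (f x) powr p x) \<partial>lebesgue_on G)"
     unfolding modular_def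
    proof (rule nn_integral_mono)
     fix x assume "x \<in> space (lebesgue_on G)"
     then have "l powr (- p x) \<le> l powr (- p0)" using p0(2) l1 by (intro powr_mono) auto
     moreover have "inverse l powr p x = l powr (- p x)" using l1 by (simp add: powr_minus inverse_powr)
     ultimately show "ennreal (norm (inverse l *\<^sub>R f x) powr p x) \<le> ennreal (l powr (- p0)) * ennreal (norm (f x) powr p x)"
      using l1 by (simp add: powr_mult ennreal_mult'[symmetric] ennreal_leI mult_right_mono)
    qed
    also have "\<dots> = ennreal (l powr (- p0)) * modular G p f"
     unfolding modular_def by (rule nn_integral_cmult) (use powr_measurable[OF Lp_space_measurable[OF f]] in measurable)
    finally show ?thesis .
   qed
   ultimately have "1 < ennreal (l powr (- p0)) * modular G p f" by (meson not_le order_trans)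
   then have "1 \<le> l powr (- p0) * (LINT x|lebesgue_on G. norm (f x) powr p x)"
    unfolding Lp_integrable_powr(2)[OF f]
    by (simp add: ennreal_mult'[symmetric] ennreal_less_iff flip: ennreal_1)
   then have "l powr p0 \<le> (LINT x|lebesgue_on G. norm (f x) powr p x)"
    using l1 by (simp add: powr_minus field_simps)
   moreover have "C * l \<le> l powr (p0 - 1) * l" using L(2)[of l] l l1 by (intro mult_right_mono) auto
   moreover have "l powr (p0 - 1) * l = l powr p0" using l1 by (simp add: powr_diff)
   ultimately show ?thesis by linarith
  qed
  have "C * Lp_norm G p f \<le> (LINT x|lebesgue_on G. norm (f x) powr p x)"
  proof (cases "C = 0")
   case True
   then show ?thesis by (simp add: Bochner_Integration.integral_nonneg)
  next
   case C0: False
   have "Lp_norm G p f \<le> (LINT x|lebesgue_on G. norm (f x) powr p x) / C"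
   proof (rule dense_le_bounded[of L])
    show "L < Lp_norm G p f" using False by simp
    fix l assume "L < l" "l < Lp_norm G p f"
    then show "l \<le> (LINT x|lebesgue_on G. norm (f x) powr p x) / C"
     using 1[of l] C0 assms(3) by (simp add: le_divide_eq mult.commute)
   qed
   then show ?thesis using C0 assms(3) by (simp add: le_divide_eq mult.commute)
  qed
  moreover have "0 \<le> C * L" using assms(3) by (simp add: L_def)
  ultimately show ?thesis by linarith
 qed
 then show ?thesis by blast
qed

end

subsection \<open>Averages over balls\<close>

text \<open>Compares the logarithm of the largest average that occurs with the logarithm in the
  log-Hoelder modulus at scale R * h, with constants valid for all h.\<close>

lemma ln_one_plus_le:
 fixes h R :: real
 assumes "0 < h" "1 \<le> R"
 shows "ln (1 + 1 / h ^ n) \<le> real n * (ln R + 1) * ln (exp 1 + 1 / (R * h)) + ln 2"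
proof -
 let ?E = "exp 1 + 1 / (R * h)"
 have E1: "1 \<le> ln ?E"
  using assms by (subst ln_ge_iff) (auto intro: add_pos_pos)
 have E0: "0 < ?E" using assms by (simp add: add_pos_pos)
 have "1 / h \<le> R * ?E"
  using assms by (simp add: distrib_left)
 moreover have "1 \<le> R * ?E"
 proof -
  have "0 \<le> 1 / (R * h)" "(1::real) \<le> exp 1" using assms by auto
  then have "1 * 1 \<le> R * ?E" using assms by (intro mult_mono) linarith+
  then show ?thesis by simp
 qed
 ultimately have "(1 / h) ^ n \<le> (R * ?E) ^ n" "1 \<le> (R * ?E) ^ n"
  using assms by (auto intro!: power_mono one_le_power)
 then have "1 + 1 / h ^ n \<le> 2 * (R * ?E) ^ n" by (simp add: power_divide)
 then have "ln (1 + 1 / h ^ n) \<le> ln (2 * (R * ?E) ^ n)"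
  using assms E0 by (subst ln_le_cancel_iff) (auto intro!: mult_pos_pos add_pos_pos)
 also have "\<dots> = ln 2 + real n * (ln R + ln ?E)"
  using assms E0 by (simp add: ln_mult ln_realpow)
 also have "\<dots> \<le> ln 2 + real n * ((ln R + 1) * ln ?E)"
 proof -
  have "ln R * 1 \<le> ln R * ln ?E" using E1 assms by (intro mult_left_mono) auto
  then show ?thesis by (intro add_left_mono mult_left_mono) (auto simp: algebra_simps)
 qed
 finally show ?thesis by (simp add: mult_ac)
qed

lemma integrable_indicator_mult:
 fixes f :: "'a::euclidean_space \<Rightarrow> real"
 assumes "A \<in> sets lebesgue" "integrable (lebesgue_on G) f"
 shows "integrable (lebesgue_on G) (%y. indicator A y * f y)"
proof (rule Bochner_Integration.integrable_bound[OF assms(2)])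
 have "(indicator A :: 'a \<Rightarrow> real) \<in> borel_measurable (lebesgue_on G)"
  by (intro measurable_restrict_space1 borel_measurable_indicator assms)
 then show "(%y. indicator A y * f y) \<in> borel_measurable (lebesgue_on G)"
  using assms(2) by auto
qed (auto simp: indicator_def)

lemma measurable_ident_lebesgue_on: "(%x. x) \<in> borel_measurable (lebesgue_on G)"
 by (intro measurable_restrict_space1 measurable_completion) simp

locale log_hoelder_exponent = variable_exponent G p P
 for G :: "'a::euclidean_space set" and p P +
 fixes c1 :: real
 assumes c1: "0 < c1" and log_hoelder: "\<And>x y. x \<in> G ==> y \<in> G ==> x \<noteq> y ==>
  \<bar>p x - p y\<bar> \<le> c1 / ln (exp 1 + 1 / norm (x - y))"
begin

lemma finite_measure_lebesgue_on: "finite_measure (lebesgue_on G)"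
 by (rule finite_measureI) (simp add: emeasure_G)

definition osc_const :: "real \<Rightarrow> real" where
 "osc_const R = exp (c1 * (real DIM('a) * (ln R + 1) + ln 2))"

text \<open>At distance below R * h the exponent oscillates by at most c1 / ln E, while ln s is at
  most a multiple of ln E plus ln 2, with E = e + 1/(R h). The logarithms cancel, leaving the
  h-independent \<open>osc_const\<close>.\<close>

lemma powr_osc_le:
 assumes x: "x \<in> G" "y \<in> G" "norm (x - y) < R * h" and h: "0 < h" "1 \<le> R"
  and s: "1 \<le> s" "s \<le> 1 + 1 / h ^ DIM('a)"
 shows "s powr (p x - p y) \<le> osc_const R"
proof (cases "x = y")
 case True
 have "0 \<le> c1 * (real DIM('a) * (ln R + 1) + ln 2)" using c1 h by simp
 then show ?thesis using True s by (simp add: osc_const_def)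
next
 case False
 let ?E = "exp 1 + 1 / (R * h)"
 have E1: "1 \<le> ln ?E"
  using h by (subst ln_ge_iff) (auto intro: add_pos_pos)
 have "0 < norm (x - y)" using False by simp
 then have "?E \<le> exp 1 + 1 / norm (x - y)" using x h by (intro add_left_mono divide_left_mono) auto
 then have "ln ?E \<le> ln (exp 1 + 1 / norm (x - y))"
  using h by (subst ln_le_cancel_iff) (auto intro!: add_pos_pos add_pos_nonneg)
 then have "c1 / ln (exp 1 + 1 / norm (x - y)) \<le> c1 / ln ?E"
  using E1 c1 by (intro divide_left_mono mult_pos_pos) auto
 then have d: "\<bar>p x - p y\<bar> \<le> c1 / ln ?E" using log_hoelder[OF x(1,2) False] by linarith
 have "(p x - p y) * ln s \<le> \<bar>p x - p y\<bar> * ln s" using s by (intro mult_right_mono) auto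
 also have "\<dots> \<le> c1 / ln ?E * ln (1 + 1 / h ^ DIM('a))"
  using d s c1 E1 by (intro mult_mono) auto
 also have "\<dots> \<le> c1 / ln ?E * (real DIM('a) * (ln R + 1) * ln ?E + ln 2)"
  using ln_one_plus_le[OF h] c1 E1 by (intro mult_left_mono) auto
 also have "\<dots> = c1 * (real DIM('a) * (ln R + 1) + ln 2 / ln ?E)"
  using E1 by (simp add: field_simps)
 also have "\<dots> \<le> c1 * (real DIM('a) * (ln R + 1) + ln 2)"
  using E1 c1 by (intro mult_left_mono add_left_mono) (auto simp: divide_le_eq mult_le_cancel_left1)
 finally show ?thesis using s by (simp add: osc_const_def powr_def)
qed

text \<open>A Jensen-type inequality for variable exponents. Values of |g| up to \<open>lam\<close>
  are kept; larger ones satisfy |g| \<le> |g|^p(y) * lam^(1 - p(y)), where p(y) is exchanged for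
  p(x) at the price \<open>osc_const\<close>. The summand 1 in S gives \<open>lam\<close> \<ge> 1,
  and unit modular keeps S within the range of \<open>powr_osc_le\<close>.\<close>

lemma average_pointwise:
 fixes g :: "'a \<Rightarrow> 'b::euclidean_space"
 assumes g: "g \<in> Lp_space G p" "modular G p g \<le> 1" and x: "x \<in> G" and h: "0 < h" "1 \<le> R"
 defines "S \<equiv> 1 + (LINT y|lebesgue_on G. indicator (ball x (R * h)) y * norm (g y) powr p y) / h ^ DIM('a)"
 shows "(LINT y|lebesgue_on G. indicator (ball x (R * h)) y * norm (g y)) / h ^ DIM('a)
   \<le> (unit_ball_vol (real DIM('a)) * R ^ DIM('a) + osc_const R) * S powr (1 / p x)"
  and "1 \<le> S"
proof -
 let ?N = "DIM('a)" and ?B = "ball x (R * h)" and ?V = "unit_ball_vol (real DIM('a))"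
 let ?M = "lebesgue_on G"
 define Q where "Q = (LINT y|?M. indicator ?B y * norm (g y) powr p y)"
 have iQ: "integrable ?M (%y. indicator ?B y * norm (g y) powr p y)"
  by (rule integrable_indicator_mult[OF _ Lp_integrable_powr(1)[OF g(1)]]) simp
 have ig: "integrable ?M (%y. indicator ?B y * norm (g y))"
  by (rule integrable_indicator_mult[OF _ integrable_norm[OF L1_bound(1)[OF g(1)]]]) simp
 interpret fm: finite_measure ?M by (rule finite_measure_lebesgue_on)
 have iB: "integrable ?M (indicator ?B :: 'a \<Rightarrow> real)"
  using integrable_indicator_mult[of ?B G "%_. 1"] by simp
 have mB: "(LINT y|?M. indicat_real ?B y) \<le> ?V * (R * h) ^ ?N"
 proof -
  have "(LINT y|?M. indicat_real ?B y) = (LINT y|lebesgue. indicat_real G y * indicat_real ?B y)"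
   using integral_restrict_space[of G lebesgue "indicat_real ?B"] G_sets by simp
  also have "\<dots> \<le> (LINT y|lebesgue. indicat_real ?B y)"
   by (rule integral_mono_AE'[OF lmeasurable_ball[unfolded lmeasurable_iff_integrable]])
    (auto simp: indicator_def)
  also have "\<dots> = ?V * (R * h) ^ ?N" using content_ball[of "R * h" x] h by simp
  finally show ?thesis .
 qed
 have Q: "0 \<le> Q" unfolding Q_def by (intro Bochner_Integration.integral_nonneg) auto
 have "Q \<le> (LINT y|?M. norm (g y) powr p y)" unfolding Q_def
  by (rule integral_mono_AE'[OF Lp_integrable_powr(1)[OF g(1)]]) (auto simp: indicator_def)
 also have "\<dots> \<le> 1" using g(2) Lp_integrable_powr(2)[OF g(1)] by (simp flip: ennreal_1)
 finally have Q1: "Q \<le> 1" .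
 have S_eq: "S = 1 + Q / h ^ ?N" by (simp add: S_def Q_def)
 show S1: "1 \<le> S" using Q h by (simp add: S_eq)
 have S2: "S \<le> 1 + 1 / h ^ ?N" unfolding S_eq using Q1 h by (intro add_left_mono divide_right_mono) auto
 \<comment> \<open>Chosen so that lam^p(x) = S: the part above the threshold then also contributes a
   multiple of \<open>lam\<close>.\<close>
 define lam where "lam = S powr (1 / p x)"
 have px: "1 \<le> p x" using p1 x by simp
 have l1: "1 \<le> lam" unfolding lam_def using S1 px by (intro ge_one_powr_ge_zero) auto
 have lS: "lam \<le> S" unfolding lam_def using S1 px powr_mono[of "1 / p x" 1 S] by simp
 have lp: "lam powr p x = S" unfolding lam_def using px S1 by (simp add: powr_powr)
 define D where "D = osc_const R * lam powr (1 - p x)"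
 have pt: "indicator ?B y * norm (g y) \<le> lam * indicator ?B y + D * (indicator ?B y * norm (g y) powr p y)"
  if y: "y \<in> G" for y
 proof (cases "y \<in> ?B")
  case True
  have py: "1 \<le> p y" using p1 y by simp
  have "norm (g y) \<le> lam + norm (g y) powr p y * lam powr (1 - p y)"
  proof (cases "norm (g y) \<le> lam")
   case False
   then have "lam powr (p y - 1) \<le> norm (g y) powr (p y - 1)" using l1 py by (intro powr_mono2) auto
   then have "norm (g y) * lam powr (p y - 1) \<le> norm (g y) * norm (g y) powr (p y - 1)"
    by (intro mult_left_mono) auto
   also have "\<dots> = norm (g y) powr p y"
    using powr_mult_base[of "norm (g y)" "p y - 1"] by simp
   finally have "norm (g y) \<le> norm (g y) powr p y / lam powr (p y - 1)"
    using l1 by (simp add: pos_le_divide_eq)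
   also have "\<dots> = norm (g y) powr p y * lam powr (1 - p y)"
    using powr_minus_divide[of lam "p y - 1"] by simp
   finally show ?thesis using l1 by linarith
  qed (simp add: add_increasing2)
  moreover have "lam powr (1 - p y) \<le> D"
  proof -
   have "lam powr (1 - p y) = lam powr (p x - p y) * lam powr (1 - p x)"
    using l1 by (simp flip: powr_add)
   also have "\<dots> \<le> D" unfolding D_def
    using True lS S2 l1 by (intro mult_right_mono powr_osc_le[OF x y _ h]) (auto simp: dist_norm)
   finally show ?thesis .
  qed
  then have "norm (g y) powr p y * lam powr (1 - p y) \<le> norm (g y) powr p y * D"
   by (intro mult_left_mono) auto
  ultimately show ?thesis using True by (simp add: mult.commute)
 qed simp
 have "(LINT y|?M. indicator ?B y * norm (g y))
   \<le> (LINT y|?M. lam * indicator ?B y + D * (indicator ?B y * norm (g y) powr p y))"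
  by (rule integral_mono_AE) (use ig iB iQ pt in \<open>auto intro!: AE_I2\<close>)
 also have "\<dots> = lam * (LINT y|?M. indicator ?B y) + D * Q"
  unfolding Q_def using iB iQ by (subst Bochner_Integration.integral_add) auto
 also have "\<dots> \<le> lam * (?V * (R * h) ^ ?N) + D * (h ^ ?N * S)"
 proof (intro add_mono mult_left_mono mB)
  show "Q \<le> h ^ ?N * S" unfolding S_eq using h by (simp add: distrib_left)
 qed (use l1 in \<open>auto simp: D_def osc_const_def\<close>)
 also have "D * (h ^ ?N * S) = h ^ ?N * (osc_const R * lam)"
 proof -
  have "lam powr (1 - p x) * S = lam" using l1 by (simp add: lp[symmetric] powr_add[symmetric])
  then show ?thesis by (simp add: D_def mult_ac)
 qed
 also have "lam * (?V * (R * h) ^ ?N) + h ^ ?N * (osc_const R * lam) = h ^ ?N * ((?V * R ^ ?N + osc_const R) * lam)"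
  by (simp add: power_mult_distrib algebra_simps)
 finally show "(LINT y|?M. indicator ?B y * norm (g y)) / h ^ ?N \<le> (?V * R ^ ?N + osc_const R) * S powr (1 / p x)"
  using h by (simp add: divide_le_eq mult.commute lam_def)
qed

text \<open>Raising the pointwise bound to the power p(x) leaves a constant plus an average of
  |g|^p. Fubini turns the integral of this average into the volume of a ball of radius R * h times
  the modular, and h^n cancels.\<close>

lemma average_modular:
 fixes g :: "'a \<Rightarrow> 'b::euclidean_space" and f :: "'a \<Rightarrow> 'c::euclidean_space"
 assumes g: "g \<in> Lp_space G p" "modular G p g \<le> 1" and h: "0 < h" "1 \<le> R" and "0 \<le> A"
  and f: "AE x in lebesgue_on G. norm (f x) \<le>
   A * ((LINT y|lebesgue_on G. indicator (ball x (R * h)) y * norm (g y)) / h ^ DIM('a))"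
 defines "K \<equiv> max 1 (A * (unit_ball_vol (real DIM('a)) * R ^ DIM('a) + osc_const R)) powr P"
 shows "modular G p f \<le> ennreal (K * (vol + unit_ball_vol (real DIM('a)) * R ^ DIM('a)))"
proof -
 let ?N = "DIM('a)" and ?V = "unit_ball_vol (real DIM('a))" and ?M = "lebesgue_on G"
 let ?T = "%x. LINT y|?M. indicator (ball x (R * h)) y * norm (g y) powr p y"
 define A' where "A' = max 1 (A * (?V * R ^ ?N + osc_const R))"
 have iT: "integrable ?M (%y. indicator (ball x (R * h)) y * norm (g y) powr p y)" for x
  by (rule integrable_indicator_mult[OF _ Lp_integrable_powr(1)[OF g(1)]]) simp
 have "modular G p f \<le> (\<integral>\<^sup>+x. ennreal (K * (1 + ?T x / h ^ ?N)) \<partial>?M)"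
  unfolding modular_def
 proof (rule nn_integral_mono_AE)
  show "AE x in ?M. ennreal (norm (f x) powr p x) \<le> ennreal (K * (1 + ?T x / h ^ ?N))"
   using f AE_space
  proof eventually_elim
   case (elim x)
   then have x: "x \<in> G" by simp
   define S where "S = 1 + ?T x / h ^ ?N"
   note pt = average_pointwise[OF g x h, folded S_def]
   have px: "1 \<le> p x" using p1 x by simp
   have "norm (f x) \<le> A * ((?V * R ^ ?N + osc_const R) * S powr (1 / p x))"
    by (rule order_trans[OF elim(1)]) (intro mult_left_mono pt(1) \<open>0 \<le> A\<close>)
   also have "\<dots> \<le> A' * S powr (1 / p x)"
    unfolding A'_def mult.assoc[symmetric] by (intro mult_right_mono) auto
   finally have "norm (f x) powr p x \<le> (A' * S powr (1 / p x)) powr p x"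
    using px by (intro powr_mono2) auto
   also have "\<dots> = A' powr p x * S"
    using px pt(2) by (simp add: powr_mult powr_powr A'_def)
   also have "\<dots> \<le> K * S"
    unfolding K_def A'_def[symmetric] using pt(2) pP[OF x]
    by (intro mult_right_mono powr_mono) (auto simp: A'_def)
   finally show ?case unfolding S_def by (rule ennreal_leI)
  qed
 qed
 also have "\<dots> = (\<integral>\<^sup>+x. ennreal K + ennreal (K / h ^ ?N) * (\<integral>\<^sup>+y. ennreal (indicator (ball x (R * h)) y * norm (g y) powr p y) \<partial>?M) \<partial>?M)"
 proof (rule nn_integral_cong)
  fix x
  have "(\<integral>\<^sup>+y. ennreal (indicator (ball x (R * h)) y * norm (g y) powr p y) \<partial>?M) = ennreal (?T x)"
   by (rule nn_integral_eq_integral[OF iT]) auto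
  moreover have "0 \<le> ?T x" by (intro Bochner_Integration.integral_nonneg) auto
  moreover have "0 \<le> K" by (simp add: K_def)
  ultimately show "ennreal (K * (1 + ?T x / h ^ ?N)) = ennreal K + ennreal (K / h ^ ?N) *
    (\<integral>\<^sup>+y. ennreal (indicator (ball x (R * h)) y * norm (g y) powr p y) \<partial>?M)"
   using h by (simp add: ennreal_mult'[symmetric] ennreal_plus[symmetric] distrib_left del: ennreal_plus)
 qed
 also have "\<dots> = ennreal K * ennreal vol + ennreal (K / h ^ ?N) *
   (\<integral>\<^sup>+x. \<integral>\<^sup>+y. ennreal (indicator (ball x (R * h)) y * norm (g y) powr p y) \<partial>?M \<partial>?M)"
 proof -
  interpret fm: finite_measure ?M by (rule finite_measure_lebesgue_on)
  have [measurable]: "(%x. x) \<in> borel_measurable ?M" by (rule measurable_ident_lebesgue_on)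
  have [measurable]: "(%y. norm (g y) powr p y) \<in> borel_measurable ?M"
   by (rule powr_measurable[OF Lp_space_measurable[OF g(1)]])
  have "(%(x, y). ennreal (indicator (ball x (R * h)) y * norm (g y) powr p y)) =
   (%(x, y). ennreal ((if dist x y < R * h then 1 else 0) * norm (g y) powr p y))"
   by (auto simp: indicator_def fun_eq_iff)
  also have "\<dots> \<in> borel_measurable (?M \<Otimes>\<^sub>M ?M)" by measurable
  finally have m: "(%(x, y). ennreal (indicator (ball x (R * h)) y * norm (g y) powr p y)) \<in> borel_measurable (?M \<Otimes>\<^sub>M ?M)" .
  then have "(%x. \<integral>\<^sup>+y. ennreal (indicator (ball x (R * h)) y * norm (g y) powr p y) \<partial>?M) \<in> borel_measurable ?M"
   by (rule fm.borel_measurable_nn_integral)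
  then show ?thesis
   by (subst nn_integral_add) (auto simp: nn_integral_cmult emeasure_G)
 qed
 also have "(\<integral>\<^sup>+x. \<integral>\<^sup>+y. ennreal (indicator (ball x (R * h)) y * norm (g y) powr p y) \<partial>?M \<partial>?M)
   \<le> ennreal (?V * (R * h) ^ ?N)"
 proof -
  interpret fm: finite_measure ?M by (rule finite_measure_lebesgue_on)
  interpret pair_sigma_finite ?M ?M ..
  have [measurable]: "(%x. x) \<in> borel_measurable ?M" by (rule measurable_ident_lebesgue_on)
  have [measurable]: "(%y. norm (g y) powr p y) \<in> borel_measurable ?M"
   by (rule powr_measurable[OF Lp_space_measurable[OF g(1)]])
  have "(%(x, y). ennreal (indicator (ball x (R * h)) y * norm (g y) powr p y)) =
   (%(x, y). ennreal ((if dist x y < R * h then 1 else 0) * norm (g y) powr p y))"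
   by (auto simp: indicator_def fun_eq_iff)
  also have "\<dots> \<in> borel_measurable (?M \<Otimes>\<^sub>M ?M)" by measurable
  finally have m: "(%(x, y). ennreal (indicator (ball x (R * h)) y * norm (g y) powr p y)) \<in> borel_measurable (?M \<Otimes>\<^sub>M ?M)" .
  have "(\<integral>\<^sup>+x. \<integral>\<^sup>+y. ennreal (indicator (ball x (R * h)) y * norm (g y) powr p y) \<partial>?M \<partial>?M)
   = (\<integral>\<^sup>+y. \<integral>\<^sup>+x. ennreal (indicator (ball x (R * h)) y * norm (g y) powr p y) \<partial>?M \<partial>?M)"
   using Fubini'[OF m] by simp
  also have "\<dots> \<le> (\<integral>\<^sup>+y. ennreal (?V * (R * h) ^ ?N) * ennreal (norm (g y) powr p y) \<partial>?M)"
  proof (rule nn_integral_mono)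
   fix y
   have "(\<integral>\<^sup>+x. ennreal (indicator (ball x (R * h)) y * norm (g y) powr p y) \<partial>?M)
     = (\<integral>\<^sup>+x. indicator (ball y (R * h)) x * ennreal (norm (g y) powr p y) \<partial>?M)"
    by (intro nn_integral_cong) (auto simp: indicator_def dist_commute)
   also have "\<dots> \<le> (\<integral>\<^sup>+x. indicator (ball y (R * h)) x * ennreal (norm (g y) powr p y) \<partial>lebesgue)"
    using G_sets by (subst nn_integral_restrict_space) (auto intro!: nn_integral_mono simp: indicator_def)
   also have "\<dots> = emeasure lebesgue (ball y (R * h)) * ennreal (norm (g y) powr p y)"
    by (subst nn_integral_multc) (auto intro!: borel_measurable_indicator)
   also have "emeasure lebesgue (ball y (R * h)) = ennreal (?V * (R * h) ^ ?N)"
    using h by (simp add: emeasure_ball)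
   finally show "(\<integral>\<^sup>+x. ennreal (indicator (ball x (R * h)) y * norm (g y) powr p y) \<partial>?M)
     \<le> ennreal (?V * (R * h) ^ ?N) * ennreal (norm (g y) powr p y)" .
  qed
  also have "\<dots> = ennreal (?V * (R * h) ^ ?N) * modular G p g"
   unfolding modular_def by (rule nn_integral_cmult) measurable
  also have "\<dots> \<le> ennreal (?V * (R * h) ^ ?N) * 1" by (intro mult_left_mono g(2)) auto
  finally show ?thesis by simp
 qed
 also have "ennreal K * ennreal vol + ennreal (K / h ^ ?N) * ennreal (?V * (R * h) ^ ?N)
   = ennreal (K * (vol + ?V * R ^ ?N))"
  using h by (simp add: K_def ennreal_mult'[symmetric] ennreal_plus[symmetric] distrib_left power_mult_distrib
    del: ennreal_plus)
 finally show ?thesis by (simp add: add_left_mono mult_left_mono)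
qed

text \<open>Uniformity in h is the essential content. Averages at one scale suffice, so no maximal
  function appears; homogeneity passes from unit modular to arbitrary g.\<close>

lemma average_bounded:
 assumes "0 \<le> A" "1 \<le> R"
 shows "\<exists>K\<ge>1. \<forall>h>0. \<forall>(g :: 'a \<Rightarrow> 'b::euclidean_space) (f :: 'a \<Rightarrow> 'c::euclidean_space).
   g \<in> Lp_space G p \<longrightarrow> f \<in> borel_measurable (lebesgue_on G) \<longrightarrow>
   (AE x in lebesgue_on G. norm (f x) \<le>
    A * ((LINT y|lebesgue_on G. indicator (ball x (R * h)) y * norm (g y)) / h ^ DIM('a))) \<longrightarrow>
   Lp_norm G p f \<le> K * Lp_norm G p g"
proof -
 let ?V = "unit_ball_vol (real DIM('a))"
 define K0 where "K0 = max 1 (A * (?V * R ^ DIM('a) + osc_const R)) powr P * (vol + ?V * R ^ DIM('a))"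
 define K where "K = max 1 K0"
 have "Lp_norm G p f \<le> K * Lp_norm G p g"
  if h: "0 < h" and g: "g \<in> Lp_space G p" and f: "f \<in> borel_measurable (lebesgue_on G)"
   and le: "AE x in lebesgue_on G. norm (f x) \<le>
    A * ((LINT y|lebesgue_on G. indicator (ball x (R * h)) y * norm (g y)) / h ^ DIM('a))"
  for h and g :: "'a \<Rightarrow> 'b" and f :: "'a \<Rightarrow> 'c"
 proof (rule Lp_norm_leI[OF g])
  fix l :: real assume l: "0 < l" "modular G p (%x. g x /\<^sub>R l) \<le> 1"
  have "modular G p (%x. f x /\<^sub>R l) \<le> ennreal K0"
   unfolding K0_def
  proof (rule average_modular[OF Lp_space_scaleR[OF g] l(2) h assms(2,1)])
   show "AE x in lebesgue_on G. norm (f x /\<^sub>R l) \<le> A * ((LINT y|lebesgue_on G.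
     indicator (ball x (R * h)) y * norm (g y /\<^sub>R l)) / h ^ DIM('a))"
    using le
   proof eventually_elim
    case (elim x)
    have "(LINT y|lebesgue_on G. indicator (ball x (R * h)) y * norm (g y /\<^sub>R l))
      = (LINT y|lebesgue_on G. inverse l * (indicator (ball x (R * h)) y * norm (g y)))"
     using l(1) by (intro Bochner_Integration.integral_cong) auto
    also have "\<dots> = inverse l * (LINT y|lebesgue_on G. indicator (ball x (R * h)) y * norm (g y))"
     by simp
    finally show ?case using mult_left_mono[OF elim, of "inverse l"] l(1) by (simp add: mult_ac)
   qed
  qed
  also have "\<dots> \<le> ennreal K" by (intro ennreal_leI) (simp add: K_def)
  finally have "modular G p (%x. (f x /\<^sub>R l) /\<^sub>R K) \<le> 1"
   using f by (intro modular_le_imp_Lp_norm_le(1)) (auto simp: K_def)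
  then show "modular G p (%x. f x /\<^sub>R (K * l)) \<le> 1" by simp
 qed (simp add: K_def)
 then show ?thesis by (intro exI[of _ K]) (auto simp: K_def)
qed

end

section \<open>Sobolev-type spaces of symmetric gradients\<close>

lemma continuous_bounded_on_bounded:
 fixes f :: "'a::euclidean_space \<Rightarrow> 'b::real_normed_vector"
 assumes "continuous_on UNIV f" "bounded S"
 obtains B where "0 \<le> B" "\<And>x. x \<in> S ==> norm (f x) \<le> B"
proof -
 have "compact (f ` closure S)"
  using assms by (intro compact_continuous_image continuous_on_subset[OF assms(1)]) (auto simp: compact_closure)
 then obtain B where B: "\<And>x. x \<in> closure S ==> norm (f x) \<le> B"
  using compact_imp_bounded bounded_iff by (metis imageI)
 show thesis
  by (rule that[of "max B 0"]) (use B closure_subset[of S] in \<open>auto intro: max.coboundedI1\<close>)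
qed

lemma smooth_compact_add:
 fixes \<phi> \<psi> :: "'a::euclidean_space \<Rightarrow> 'b::real_normed_vector"
 assumes "open G" "\<phi> \<in> smooth_compact G" "\<psi> \<in> smooth_compact G"
 shows "(%x. \<phi> x + \<psi> x) \<in> smooth_compact G"
proof -
 have "closure {x. \<phi> x + \<psi> x \<noteq> 0} \<subseteq> closure ({x. \<phi> x \<noteq> 0} \<union> {x. \<psi> x \<noteq> 0})"
  by (rule closure_mono) auto
 moreover have "bounded {x. \<phi> x + \<psi> x \<noteq> 0}"
  by (rule bounded_subset[of "{x. \<phi> x \<noteq> 0} \<union> {x. \<psi> x \<noteq> 0}"])
   (use assms in \<open>auto simp: smooth_compact_iff compact_closure\<close>)
 ultimately show ?thesis
  using assms unfolding smooth_compact_iff[OF assms(1)] closure_Un compact_closure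
  by (auto intro: smooth_add)
qed

lemma smooth_compact_scaleR:
 fixes \<phi> :: "'a::euclidean_space \<Rightarrow> 'b::real_normed_vector"
 assumes "open G" "\<phi> \<in> smooth_compact G"
 shows "(%x. c *\<^sub>R \<phi> x) \<in> smooth_compact G"
proof -
 have s: "{x. c *\<^sub>R \<phi> x \<noteq> 0} \<subseteq> {x. \<phi> x \<noteq> 0}" by auto
 show ?thesis
  using assms closure_mono[OF s] bounded_subset[OF _ s] smooth_scaleR[OF smooth_const, of \<phi> c]
  unfolding smooth_compact_iff[OF assms(1)] compact_closure by blast
qed

text \<open>Instantiated twice: on \<Omega> with all coordinate directions, and on the cylinder with
  the spatial directions only.\<close>

locale eps_setting = q: variable_exponent G q P + p: variable_exponent G p P
 for G :: "'a::euclidean_space set" and q p P +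
 fixes D :: "'n::finite \<Rightarrow> 'a"
 assumes open_G: "open G"
begin

lemma eps_spaceD:
 assumes "u \<in> eps_space D G q p"
 shows "u \<in> Lp_space G q" "sym_grad D G u \<in> Lp_space G p" "has_sym_grad D G u (sym_grad D G u)"
proof -
 obtain E where E: "u \<in> Lp_space G q" "E \<in> Lp_space G p" "has_sym_grad D G u E"
  using assms by (auto simp: eps_space_def)
 note s = has_sym_grad_sym_grad[OF open_G E(3)]
 show "u \<in> Lp_space G q" "has_sym_grad D G u (sym_grad D G u)" by fact+
 show "sym_grad D G u \<in> Lp_space G p"
  by (rule p.Lp_space_cong[OF E(2)])
   (use s(2) locally_integrable_measurable[OF open_G has_sym_gradD(2)[OF s(1) open_G]] in \<open>auto simp: eq_commute\<close>)
qed

lemma eps_spaceI: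
 assumes "u \<in> Lp_space G q" "E \<in> Lp_space G p" "has_sym_grad D G u E"
 shows "u \<in> eps_space D G q p" "eps_norm D G q p u = Lp_norm G q u + Lp_norm G p E"
  and "AE z in lebesgue_on G. sym_grad D G u z = E z"
 using assms has_sym_grad_sym_grad[OF open_G assms(3)] p.Lp_norm_cong[of "sym_grad D G u" E]
 by (auto simp: eps_space_def eps_norm_def)

lemma eps_norm_nonneg: "u \<in> eps_space D G q p ==> 0 \<le> eps_norm D G q p u"
 unfolding eps_norm_def by (intro add_nonneg_nonneg q.Lp_norm_nonneg p.Lp_norm_nonneg eps_spaceD)

lemma eps_space_add:
 assumes u: "u \<in> eps_space D G q p" and v: "v \<in> eps_space D G q p"
 shows "(%x. u x + v x) \<in> eps_space D G q p"
  "AE z in lebesgue_on G. sym_grad D G (%x. u x + v x) z = sym_grad D G u z + sym_grad D G v z"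
  "eps_norm D G q p (%x. u x + v x) \<le> eps_norm D G q p u + eps_norm D G q p v"
proof -
 note U = eps_spaceD[OF u] and V = eps_spaceD[OF v]
 note I = eps_spaceI[OF q.Lp_space_add[OF U(1) V(1)] p.Lp_space_add[OF U(2) V(2)]
   has_sym_grad_add[OF open_G U(3) V(3)]]
 show "(%x. u x + v x) \<in> eps_space D G q p"
  "AE z in lebesgue_on G. sym_grad D G (%x. u x + v x) z = sym_grad D G u z + sym_grad D G v z"
  by (rule I)+
 show "eps_norm D G q p (%x. u x + v x) \<le> eps_norm D G q p u + eps_norm D G q p v"
  unfolding I(2) using q.Lp_norm_triangle[OF U(1) V(1)] p.Lp_norm_triangle[OF U(2) V(2)]
  by (simp add: eps_norm_def)
qed

lemma eps_space_scaleR: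
 assumes u: "u \<in> eps_space D G q p"
 shows "(%x. c *\<^sub>R u x) \<in> eps_space D G q p"
  "AE z in lebesgue_on G. sym_grad D G (%x. c *\<^sub>R u x) z = c *\<^sub>R sym_grad D G u z"
  "eps_norm D G q p (%x. c *\<^sub>R u x) = \<bar>c\<bar> * eps_norm D G q p u"
proof -
 note U = eps_spaceD[OF u]
 note I = eps_spaceI[OF q.Lp_space_scaleR[OF U(1)] p.Lp_space_scaleR[OF U(2)]
   has_sym_grad_scaleR[OF open_G U(3)]]
 show "(%x. c *\<^sub>R u x) \<in> eps_space D G q p"
  "AE z in lebesgue_on G. sym_grad D G (%x. c *\<^sub>R u x) z = c *\<^sub>R sym_grad D G u z"
  by (rule I)+
 show "eps_norm D G q p (%x. c *\<^sub>R u x) = \<bar>c\<bar> * eps_norm D G q p u"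
  unfolding I(2) using q.Lp_norm_scaleR[OF U(1)] p.Lp_norm_scaleR[OF U(2)]
  by (simp add: eps_norm_def distrib_left)
qed

lemma eps_space_diff:
 assumes u: "u \<in> eps_space D G q p" and v: "v \<in> eps_space D G q p"
 shows "(%x. u x - v x) \<in> eps_space D G q p"
  "eps_norm D G q p (%x. u x - v x) \<le> eps_norm D G q p u + eps_norm D G q p v"
 using eps_space_add[OF u eps_space_scaleR(1)[OF v, of "-1"]] eps_space_scaleR(3)[OF v, of "-1"] by auto

lemma norm_matrix_le:
 fixes A :: "real^'n^'n"
 assumes "\<And>i j. \<bar>A $ i $ j\<bar> \<le> M"
 shows "norm A \<le> real CARD('n) * (real CARD('n) * M)"
proof -
 have "norm (A $ i) \<le> real CARD('n) * M" for i
 proof -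
  have "norm (A $ i) \<le> (\<Sum>j\<in>UNIV. \<bar>A $ i $ j\<bar>)" by (rule norm_le_l1_cart)
  also have "\<dots> \<le> (\<Sum>j\<in>(UNIV::'n set). M)" by (intro sum_mono assms)
  finally show ?thesis by simp
 qed
 then have "(\<Sum>i\<in>UNIV. norm (A $ i)) \<le> (\<Sum>i\<in>(UNIV::'n set). real CARD('n) * M)" by (intro sum_mono)
 moreover have "norm A \<le> (\<Sum>i\<in>UNIV. norm (A $ i))"
  unfolding norm_vec_def by (rule L2_set_le_sum) auto
 ultimately show ?thesis by simp
qed

text \<open>Agreement with a smooth W is required on G alone, because \<open>R_star\<close> is cut
  to zero outside the cylinder and is not globally smooth.\<close>

lemma smooth_eps_space:
 assumes W: "smooth W" and u: "\<And>z. z \<in> G ==> u z = W z" and bd: "bounded G"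
 shows "u \<in> eps_space D G q p"
  "AE z in lebesgue_on G. sym_grad D G u z = classical_sym_grad D W z"
  "eps_norm D G q p u = Lp_norm G q W + Lp_norm G p (classical_sym_grad D W)"
  "classical_sym_grad D W \<in> Lp_space G p" "W \<in> Lp_space G q"
proof -
 have Wi: "smooth (%z. W z $ i)" for i by (rule smooth_bounded_linear[OF W bounded_linear_vec_nth])
 have cE: "continuous_on UNIV (classical_sym_grad D W)"
  unfolding classical_sym_grad_def
  by (intro continuous_on_vec_lambda continuous_intros smooth_continuous_on smooth_dird Wi)
 have cW: "continuous_on UNIV W" by (rule smooth_continuous_on[OF W])
 have m: "f \<in> borel_measurable (lebesgue_on G)" if "continuous_on UNIV f" for f :: "'a \<Rightarrow> 'c::euclidean_space"
  by (intro measurable_restrict_space1 borel_measurable_lebesgueI borel_measurable_continuous_onI that)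
 obtain B1 where B1: "0 \<le> B1" "\<And>x. x \<in> G ==> norm (W x) \<le> B1"
  using continuous_bounded_on_bounded[OF cW bd] by metis
 obtain B2 where B2: "0 \<le> B2" "\<And>x. x \<in> G ==> norm (classical_sym_grad D W x) \<le> B2"
  using continuous_bounded_on_bounded[OF cE bd] by metis
 show WL: "W \<in> Lp_space G q"
  by (rule q.bounded_Lp(1)[OF m[OF cW] _ B1(1)]) (auto intro!: AE_I2 B1)
 show EL: "classical_sym_grad D W \<in> Lp_space G p"
  by (rule p.bounded_Lp(1)[OF m[OF cE] _ B2(1)]) (auto intro!: AE_I2 B2)
 have um: "u \<in> borel_measurable (lebesgue_on G)"
  using m[OF cW] by (subst measurable_cong[of _ u W]) (auto simp: u)
 have uW: "AE z in lebesgue_on G. W z = u z" using u by (auto intro!: AE_I2)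
 have uL: "u \<in> Lp_space G q" by (rule q.Lp_space_cong[OF WL uW um])
 have hs: "has_sym_grad D G u (classical_sym_grad D W)" by (rule has_sym_grad_smooth[OF open_G W u]) auto
 show "u \<in> eps_space D G q p"
  "AE z in lebesgue_on G. sym_grad D G u z = classical_sym_grad D W z"
  "eps_norm D G q p u = Lp_norm G q W + Lp_norm G p (classical_sym_grad D W)"
  using eps_spaceI[OF uL EL hs] q.Lp_norm_cong[OF uW] by auto
qed

text \<open>The C^1 norm controls the energy norm; this is what makes dual functionals
  \<open>C1_functional\<close> on suitable smooth fields.\<close>

lemma smooth_eps_norm_le:
 assumes W: "smooth W" and u: "\<And>z. z \<in> G ==> u z = W z" and bd: "bounded G" and "0 \<le> M"
  and M: "\<And>z. z \<in> G ==> norm (W z) \<le> M"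
  "\<And>z i j. z \<in> G ==> \<bar>dird (D j) (%z. W z $ i) z\<bar> \<le> M"
 shows "eps_norm D G q p u \<le> (1 + q.vol) * (1 + real CARD('n) * real CARD('n)) * M"
proof -
 note S = smooth_eps_space[OF W u bd]
 have "Lp_norm G q W \<le> (1 + q.vol) * M"
  by (rule q.bounded_Lp(2)[OF q.Lp_space_measurable[OF S(5)] _ assms(4)]) (auto intro!: AE_I2 M)
 moreover have "Lp_norm G p (classical_sym_grad D W) \<le> (1 + q.vol) * (real CARD('n) * (real CARD('n) * M))"
 proof (rule p.bounded_Lp(2)[OF p.Lp_space_measurable[OF S(4)] AE_I2])
  fix z assume "z \<in> space (lebesgue_on G)"
  then have z: "z \<in> G" by simp
  show "norm (classical_sym_grad D W z) \<le> real CARD('n) * (real CARD('n) * M)"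
  proof (rule norm_matrix_le)
   show "\<bar>classical_sym_grad D W z $ i $ j\<bar> \<le> M" for i j
    using M(2)[OF z, of j i] M(2)[OF z, of i j] by (simp add: classical_sym_grad_def)
  qed
 qed (use assms(4) in auto)
 ultimately show ?thesis using S(3) by (simp add: algebra_simps)
qed

end

locale slice_setting = eps_setting \<Omega> q p P sp_dir
 for \<Omega> :: "(real^'n::finite) set" and q p P +
 assumes bounded_\<Omega>: "bounded \<Omega>"
begin

lemma smooth_compact_eps_space: "\<phi> \<in> smooth_compact \<Omega> ==> \<phi> \<in> eps_space sp_dir \<Omega> q p"
 by (rule smooth_eps_space(1)[OF _ refl bounded_\<Omega>]) (simp add: smooth_compact_iff[OF open_G])

lemma smooth_in_X_sp:
 assumes \<phi>: "\<phi> \<in> smooth_compact \<Omega>" and u: "\<And>x. x \<in> \<Omega> ==> u x = \<phi> x"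
 shows "u \<in> X_sp \<Omega> q p"
 unfolding X_sp_def
proof (intro CollectI conjI allI impI bexI[OF _ \<phi>])
 have sm: "smooth \<phi>" using \<phi> by (simp add: smooth_compact_iff[OF open_G])
 show ue: "u \<in> eps_space sp_dir \<Omega> q p"
  by (rule smooth_eps_space(1)[OF sm u bounded_\<Omega>])
 have "eps_norm sp_dir \<Omega> q p (%x. u x - \<phi> x) = Lp_norm \<Omega> q (%x. 0::real^'n) + Lp_norm \<Omega> p (classical_sym_grad sp_dir (%x::real^'n. 0::real^'n))"
  by (rule smooth_eps_space(3)[OF smooth_const _ bounded_\<Omega>]) (simp add: u)
 also have "classical_sym_grad sp_dir (%x::real^'n. 0::real^'n) = (%x. 0)"
  by (auto simp: classical_sym_grad_def vec_eq_iff fun_eq_iff)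
 finally show "eps_norm sp_dir \<Omega> q p (%x. u x - \<phi> x) < e" if "0 < e" for e
  using that by (simp add: q.Lp_norm_zero p.Lp_norm_zero)
qed

lemma X_sp_add:
 assumes u: "u \<in> X_sp \<Omega> q p" and v: "v \<in> X_sp \<Omega> q p" shows "(%x. u x + v x) \<in> X_sp \<Omega> q p"
 unfolding X_sp_def
proof (intro CollectI conjI allI impI)
 have uv: "u \<in> eps_space sp_dir \<Omega> q p" "v \<in> eps_space sp_dir \<Omega> q p" using u v by (auto simp: X_sp_def)
 show "(%x. u x + v x) \<in> eps_space sp_dir \<Omega> q p" by (rule eps_space_add(1)[OF uv])
 fix e :: real assume e: "0 < e"
 obtain \<phi> where \<phi>: "\<phi> \<in> smooth_compact \<Omega>" "eps_norm sp_dir \<Omega> q p (%x. u x - \<phi> x) < e/2"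
  using u e by (auto simp: X_sp_def dest!: spec[of _ "e/2"])
 obtain \<psi> where \<psi>: "\<psi> \<in> smooth_compact \<Omega>" "eps_norm sp_dir \<Omega> q p (%x. v x - \<psi> x) < e/2"
  using v e by (auto simp: X_sp_def dest!: spec[of _ "e/2"])
 have "(%x. u x + v x - (\<phi> x + \<psi> x)) = (%x. (u x - \<phi> x) + (v x - \<psi> x))" by auto
 then have "eps_norm sp_dir \<Omega> q p (%x. u x + v x - (\<phi> x + \<psi> x))
   \<le> eps_norm sp_dir \<Omega> q p (%x. u x - \<phi> x) + eps_norm sp_dir \<Omega> q p (%x. v x - \<psi> x)"
  using eps_space_add(3)[OF eps_space_diff(1)[OF uv(1) smooth_compact_eps_space[OF \<phi>(1)]]
   eps_space_diff(1)[OF uv(2) smooth_compact_eps_space[OF \<psi>(1)]]] by simp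
 then have "eps_norm sp_dir \<Omega> q p (%x. u x + v x - (\<phi> x + \<psi> x)) < e" using \<phi>(2) \<psi>(2) by linarith
 then show "\<exists>\<phi>\<in>smooth_compact \<Omega>. eps_norm sp_dir \<Omega> q p (%x. u x + v x - \<phi> x) < e"
  by (intro bexI[of _ "%x. \<phi> x + \<psi> x"]) (auto intro: smooth_compact_add[OF open_G \<phi>(1) \<psi>(1)])
qed

lemma X_sp_scaleR:
 assumes u: "u \<in> X_sp \<Omega> q p" shows "(%x. c *\<^sub>R u x) \<in> X_sp \<Omega> q p"
 unfolding X_sp_def
proof (intro CollectI conjI allI impI)
 have uv: "u \<in> eps_space sp_dir \<Omega> q p" using u by (auto simp: X_sp_def)
 show "(%x. c *\<^sub>R u x) \<in> eps_space sp_dir \<Omega> q p" by (rule eps_space_scaleR(1)[OF uv])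
 fix e :: real assume e: "0 < e"
 define d where "d = e / (\<bar>c\<bar> + 1)"
 have d: "0 < d" "\<bar>c\<bar> * d < e" using e by (auto simp: d_def field_simps)
 obtain \<phi> where \<phi>: "\<phi> \<in> smooth_compact \<Omega>" "eps_norm sp_dir \<Omega> q p (%x. u x - \<phi> x) < d"
  using u d(1) by (auto simp: X_sp_def)
 have "eps_norm sp_dir \<Omega> q p (%x. c *\<^sub>R u x - c *\<^sub>R \<phi> x) = \<bar>c\<bar> * eps_norm sp_dir \<Omega> q p (%x. u x - \<phi> x)"
  using eps_space_scaleR(3)[OF eps_space_diff(1)[OF uv smooth_compact_eps_space[OF \<phi>(1)]], of c]
  by (simp add: scaleR_diff_right)
 also have "\<dots> \<le> \<bar>c\<bar> * d" using \<phi>(2) by (intro mult_left_mono) auto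
 finally show "\<exists>\<phi>\<in>smooth_compact \<Omega>. eps_norm sp_dir \<Omega> q p (%x. c *\<^sub>R u x - \<phi> x) < e"
  using d(2) by (intro bexI[of _ "%x. c *\<^sub>R \<phi> x"]) (auto intro: smooth_compact_scaleR[OF open_G \<phi>(1)])
qed

lemma Lp_norm_1_le:
 fixes f :: "real^'n \<Rightarrow> 'b::euclidean_space"
 assumes v: "variable_exponent \<Omega> r P" and f: "f \<in> Lp_space \<Omega> r"
 shows "f \<in> Lp_space \<Omega> (%_. 1)" "Lp_norm \<Omega> (%_. 1) f \<le> (1 + q.vol) * Lp_norm \<Omega> r f"
proof -
 interpret r: variable_exponent \<Omega> r P by (rule v)
 note L = r.L1_bound[OF f]
 have mod: "modular \<Omega> (%_. 1) (%x. f x /\<^sub>R l) = ennreal ((LINT x|lebesgue_on \<Omega>. norm (f x)) / l)" if "0 < l" for l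
 proof -
  have i: "integrable (lebesgue_on \<Omega>) (%x. norm (f x) / l)" using L(1) by auto
  have "modular \<Omega> (%_. 1) (%x. f x /\<^sub>R l) = (\<integral>\<^sup>+x. ennreal (norm (f x) / l) \<partial>lebesgue_on \<Omega>)"
   unfolding modular_def using that by (intro nn_integral_cong) (simp add: divide_inverse mult.commute)
  also have "\<dots> = ennreal (LINT x|lebesgue_on \<Omega>. norm (f x) / l)"
   by (rule nn_integral_eq_integral[OF i]) (use that in auto)
  finally show ?thesis by simp
 qed
 show "f \<in> Lp_space \<Omega> (%_. 1)"
  using mod[of 1] r.Lp_space_measurable[OF f] by (simp add: Lp_space_def)
 have "Lp_norm \<Omega> (%_. 1) f \<le> (LINT x|lebesgue_on \<Omega>. norm (f x))"
 proof (rule dense_ge)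
  fix l assume l: "(LINT x|lebesgue_on \<Omega>. norm (f x)) < l"
  moreover have "0 \<le> (LINT x|lebesgue_on \<Omega>. norm (f x))" by (intro Bochner_Integration.integral_nonneg) auto
  ultimately have "0 < l" by linarith
  with l have "modular \<Omega> (%_. 1) (%x. f x /\<^sub>R l) \<le> 1" by (simp add: mod ennreal_le_1)
  then show "Lp_norm \<Omega> (%_. 1) f \<le> l"
   unfolding Lp_norm_def using \<open>0 < l\<close> by (intro cInf_lower) (auto intro!: bdd_belowI[of _ 0])
 qed
 then show "Lp_norm \<Omega> (%_. 1) f \<le> (1 + q.vol) * Lp_norm \<Omega> r f" using L(2) by linarith
qed

text \<open>Finite measure embeds both Lebesgue spaces into L^1, so approximating test functions
  still approximate. It makes the strip estimate, formulated for exponent 1, applicable to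
  slices.\<close>

lemma X_sp_subset_1:
 assumes u: "u \<in> X_sp \<Omega> q p" shows "u \<in> X_sp \<Omega> (%_. 1) (%_. 1)"
proof -
 note v = q.variable_exponent_axioms p.variable_exponent_axioms
 have e1: "w \<in> eps_space sp_dir \<Omega> (%_. 1) (%_. 1)"
  "eps_norm sp_dir \<Omega> (%_. 1) (%_. 1) w \<le> (1 + q.vol) * eps_norm sp_dir \<Omega> q p w"
  if w: "w \<in> eps_space sp_dir \<Omega> q p" for w
  using eps_spaceD[OF w] Lp_norm_1_le[OF v(1) eps_spaceD(1)[OF w]] Lp_norm_1_le[OF v(2) eps_spaceD(2)[OF w]]
  by (auto simp: eps_space_def eps_norm_def distrib_left)
 have ue: "u \<in> eps_space sp_dir \<Omega> q p" using u by (auto simp: X_sp_def)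
 show ?thesis
  unfolding X_sp_def
 proof (intro CollectI conjI allI impI e1(1)[OF ue])
  fix e :: real assume e: "0 < e"
  then have d: "0 < e / (1 + q.vol)" by (intro divide_pos_pos add_pos_nonneg) auto
  obtain \<phi> where \<phi>: "\<phi> \<in> smooth_compact \<Omega>" "eps_norm sp_dir \<Omega> q p (%x. u x - \<phi> x) < e / (1 + q.vol)"
   using u d by (auto simp: X_sp_def)
  have "eps_norm sp_dir \<Omega> (%_. 1) (%_. 1) (%x. u x - \<phi> x) \<le> (1 + q.vol) * eps_norm sp_dir \<Omega> q p (%x. u x - \<phi> x)"
   by (rule e1(2)[OF eps_space_diff(1)[OF ue smooth_compact_eps_space[OF \<phi>(1)]]])
  also have "\<dots> < e" using \<phi>(2) by (simp add: less_divide_eq mult.commute add_pos_nonneg)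
  finally show "\<exists>\<phi>\<in>smooth_compact \<Omega>. eps_norm sp_dir \<Omega> (%_. 1) (%_. 1) (%x. u x - \<phi> x) < e"
   using \<phi>(1) by blast
 qed
qed

end

section \<open>Smoothing on the space-time cylinder\<close>

text \<open>Continuity makes every time slice of the exponent measurable, not only almost every one,
  and later upgrades the essential lower bound to a pointwise one.\<close>

lemma (in log_hoelder_exponent) continuous_on_exponent: "continuous_on G p"
 unfolding continuous_on_iff
proof (intro ballI allI impI)
 fix x e assume x: "x \<in> G" and e: "(0::real) < e"
 show "\<exists>d>0. \<forall>y\<in>G. dist y x < d \<longrightarrow> dist (p y) (p x) < e"
 \<comment> \<open>Below this distance d the logarithm of 1/d exceeds c1 / e, so the modulus drops
   below e.\<close>
 proof (intro exI[of _ "exp (- (c1 / e))"] conjI ballI impI)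
  fix y assume y: "y \<in> G" "dist y x < exp (- (c1 / e))"
  show "dist (p y) (p x) < e"
  proof (cases "y = x")
   case False
   define d where "d = norm (y - x)"
   have d: "0 < d" "d < exp (- (c1 / e))" using False y by (auto simp: d_def dist_norm)
   have "ln d < - (c1 / e)" using d ln_less_cancel_iff[of d "exp (- (c1 / e))"] by simp
   then have "c1 / e < ln (1 / d)" using d(1) by (simp add: ln_div)
   also have "\<dots> < ln (exp 1 + 1 / d)" using d(1) by (subst ln_less_cancel_iff) (auto intro!: add_pos_pos)
   finally have l: "c1 / e < ln (exp 1 + 1 / d)" .
   have "0 < c1 / e" using c1 e by simp
   have "c1 < e * ln (exp 1 + 1 / d)" using l e by (simp add: field_simps)
   moreover have "0 < ln (exp 1 + 1 / d)" using l \<open>0 < c1 / e\<close> by linarith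
   ultimately have "c1 / ln (exp 1 + 1 / d) < e" by (simp add: pos_divide_less_eq)
   then show ?thesis using log_hoelder[OF y(1) x False] by (simp add: dist_real_def d_def)
  qed (use e in simp)
 qed simp
qed

lemma zero_ext_eq: "zero_ext G v z = indicator G z *\<^sub>R v z"
 by (simp add: zero_ext_def indicator_def)

lemma integrable_zero_ext:
 fixes v :: "'a::euclidean_space \<Rightarrow> 'b::euclidean_space"
 assumes "G \<in> sets lebesgue" "integrable (lebesgue_on G) v"
 shows "integrable lebesgue (zero_ext G v)"
 unfolding zero_ext_eq[abs_def] using assms by (simp add: integrable_restrict_space)

lemma integral_zero_ext_mult:
 fixes v :: "'a::euclidean_space \<Rightarrow> real"
 assumes "G \<in> sets lebesgue"
 shows "(LINT z|lebesgue. k z * zero_ext G v z) = (LINT z|lebesgue_on G. v z * k z)"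
 using assms by (simp add: zero_ext_eq integral_restrict_space mult_ac)

locale parabolic =
 fixes \<Omega> :: "(real^'n::finite) set" and T :: real and q p :: "real \<times> (real^'n) \<Rightarrow> real" and P c1 :: real
 assumes open_\<Omega>: "open \<Omega>" and bounded_\<Omega>: "bounded \<Omega>" and T_pos: "0 < T"
  and q_exp: "log_hoelder_exponent (cylinder T \<Omega>) q P c1"
  and p_exp: "log_hoelder_exponent (cylinder T \<Omega>) p P c1"
begin

abbreviation "Q \<equiv> cylinder T \<Omega>"
abbreviation "X \<equiv> X_st T \<Omega> q p"
abbreviation "N \<equiv> X_st_norm T \<Omega> q p"
abbreviation "\<epsilon> \<equiv> sym_grad st_dir Q"

lemma open_Q: "open Q"
 by (simp add: cylinder_def open_Times open_\<Omega>)

lemma bounded_Q: "bounded Q"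
 by (simp add: cylinder_def bounded_Times bounded_\<Omega>)

lemma Q_sets: "Q \<in> sets lebesgue"
 using open_Q by simp

end

sublocale parabolic \<subseteq> q: log_hoelder_exponent "cylinder T \<Omega>" q P c1
 by (rule q_exp)

sublocale parabolic \<subseteq> p: log_hoelder_exponent "cylinder T \<Omega>" p P c1
 by (rule p_exp)

sublocale parabolic \<subseteq> st: eps_setting "cylinder T \<Omega>" q p P st_dir
 by unfold_locales (rule open_Q)

context parabolic
begin

lemma slice_setting:
 assumes t: "t \<in> {0<..<T}"
 shows "slice_setting \<Omega> (%x. q (t, x)) (%x. p (t, x)) P"
proof -
 have *: "variable_exponent \<Omega> (%x. r (t, x)) P" if r: "log_hoelder_exponent Q r P c1" for r
 proof -
  interpret r: log_hoelder_exponent Q r P c1 by (rule r)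
  show ?thesis
  proof
   show "\<Omega> \<in> lmeasurable" using bounded_set_imp_lmeasurable[OF bounded_\<Omega>] open_\<Omega> by simp
   have "continuous_on \<Omega> (%x. r (t, x))"
    by (rule continuous_on_compose2[OF r.continuous_on_exponent])
     (use t in \<open>auto intro!: continuous_intros simp: cylinder_def\<close>)
   then show "(%x. r (t, x)) \<in> borel_measurable (lebesgue_on \<Omega>)"
    using open_\<Omega> by (intro continuous_imp_measurable_on_sets_lebesgue) auto
  qed (use t r.p1 r.pP in \<open>auto simp: cylinder_def\<close>)
 qed
 show ?thesis
  by (intro slice_setting.intro eps_setting.intro *[OF q_exp] *[OF p_exp]
   eps_setting_axioms.intro slice_setting_axioms.intro open_\<Omega> bounded_\<Omega>)
qed

lemma X_eps_space: "u \<in> X ==> u \<in> eps_space st_dir Q q p"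
 by (simp add: X_st_def)

lemma X_slices: "u \<in> X ==> AE t in lebesgue_on {0<..<T}.
  t \<in> {0<..<T} \<and> (%x. u (t, x)) \<in> X_sp \<Omega> (%x. q (t, x)) (%x. p (t, x))"
 using AE_space[of "lebesgue_on {0<..<T}"] by (auto simp: X_st_def)

lemma XI:
 assumes "u \<in> eps_space st_dir Q q p"
  and "AE t in lebesgue_on {0<..<T}. (%x. u (t, x)) \<in> X_sp \<Omega> (%x. q (t, x)) (%x. p (t, x))"
 shows "u \<in> X"
 using assms by (simp add: X_st_def)

lemma X_add:
 assumes u: "u \<in> X" and v: "v \<in> X" shows "(%z. u z + v z) \<in> X"
proof (rule XI)
 show "(%z. u z + v z) \<in> eps_space st_dir Q q p"
  by (rule st.eps_space_add(1)[OF X_eps_space[OF u] X_eps_space[OF v]])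
 show "AE t in lebesgue_on {0<..<T}. (%x. u (t, x) + v (t, x)) \<in> X_sp \<Omega> (%x. q (t, x)) (%x. p (t, x))"
  using X_slices[OF u] X_slices[OF v]
  by eventually_elim (auto intro: slice_setting.X_sp_add[OF slice_setting])
qed

lemma X_scaleR:
 assumes u: "u \<in> X" shows "(%z. c *\<^sub>R u z) \<in> X"
proof (rule XI)
 show "(%z. c *\<^sub>R u z) \<in> eps_space st_dir Q q p"
  by (rule st.eps_space_scaleR(1)[OF X_eps_space[OF u]])
 show "AE t in lebesgue_on {0<..<T}. (%x. c *\<^sub>R u (t, x)) \<in> X_sp \<Omega> (%x. q (t, x)) (%x. p (t, x))"
  using X_slices[OF u]
  by eventually_elim (auto intro: slice_setting.X_sp_scaleR[OF slice_setting])
qed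

lemma X_diff: "u \<in> X ==> v \<in> X ==> (%z. u z - v z) \<in> X"
 using X_add[OF _ X_scaleR[of v "-1"], of u] by simp

lemma N_scaleR: "u \<in> X ==> N (%z. c *\<^sub>R u z) = \<bar>c\<bar> * N u"
 unfolding X_st_norm_def by (intro st.eps_space_scaleR(3) X_eps_space)

lemma N_nonneg: "u \<in> X ==> 0 \<le> N u"
 unfolding X_st_norm_def by (intro st.eps_norm_nonneg X_eps_space)

lemma N_eq: "N u = Lp_norm Q q u + Lp_norm Q p (\<epsilon> u)"
 by (simp add: X_st_norm_def eps_norm_def)

lemmas X_D = st.eps_spaceD[OF X_eps_space]

lemma X_integrable:
 assumes "u \<in> X"
 shows "integrable (lebesgue_on Q) u" "integrable (lebesgue_on Q) (\<epsilon> u)"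
  "(LINT z|lebesgue_on Q. norm (u z)) \<le> (1 + q.vol) * N u"
  "(LINT z|lebesgue_on Q. norm (\<epsilon> u z)) \<le> (1 + q.vol) * N u"
proof -
 show "integrable (lebesgue_on Q) u" "integrable (lebesgue_on Q) (\<epsilon> u)"
  by (intro q.L1_bound(1) p.L1_bound(1) X_D assms)+
 have "Lp_norm Q q u \<le> N u" "Lp_norm Q p (\<epsilon> u) \<le> N u"
  using q.Lp_norm_nonneg[OF X_D(1)[OF assms]] p.Lp_norm_nonneg[OF X_D(2)[OF assms]] by (auto simp: N_eq)
 then show "(LINT z|lebesgue_on Q. norm (u z)) \<le> (1 + q.vol) * N u"
  "(LINT z|lebesgue_on Q. norm (\<epsilon> u z)) \<le> (1 + q.vol) * N u"
  using q.L1_bound(2)[OF X_D(1)[OF assms]] p.L1_bound(2)[OF X_D(2)[OF assms]]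
   mult_left_mono[of _ "N u" "1 + q.vol"] by (meson add_nonneg_nonneg measure_nonneg order_trans zero_le_one)+
qed

text \<open>Only the spatial support is confined, so fields that do not vanish at the initial and
  final times are covered.\<close>

lemma smooth_in_X:
 assumes W: "smooth W" and u: "\<And>z. z \<in> Q ==> u z = W z"
  and K: "compact K" "K \<subseteq> \<Omega>" "\<And>t x. x \<notin> K ==> W (t, x) = 0"
 shows "u \<in> X"
proof (rule XI)
 show "u \<in> eps_space st_dir Q q p" by (rule st.smooth_eps_space(1)[OF W u bounded_Q])
 have "(%x. u (t, x)) \<in> X_sp \<Omega> (%x. q (t, x)) (%x. p (t, x))" if t: "t \<in> {0<..<T}" for t
 proof (rule slice_setting.smooth_in_X_sp[OF slice_setting[OF t]])
  have "smooth (%x. W ((t, 0) + (0, x)))"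
   by (rule smooth_affine[OF W]) (auto intro!: bounded_linear_Pair bounded_linear_zero bounded_linear_ident)
  moreover have "{x. W (t, x) \<noteq> 0} \<subseteq> K" using K(3) by auto
  then have "closure {x. W (t, x) \<noteq> 0} \<subseteq> K" "bounded {x. W (t, x) \<noteq> 0}"
   using K(1) compact_imp_closed closure_minimal compact_imp_bounded bounded_subset by metis+
  ultimately show "(%x. W (t, x)) \<in> smooth_compact \<Omega>"
   using K(2) by (auto simp: smooth_compact_iff[OF open_\<Omega>] compact_closure)
  show "u (t, x) = W (t, x)" if "x \<in> \<Omega>" for x using u[of "(t, x)"] t that by (simp add: cylinder_def)
 qed
 then show "AE t in lebesgue_on {0<..<T}. (%x. u (t, x)) \<in> X_sp \<Omega> (%x. q (t, x)) (%x. p (t, x))"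
  by (auto intro!: AE_I2)
qed

text \<open>The globally smooth function whose restriction to the cylinder, extended by zero, is
  \<open>R_star\<close>.\<close>

definition smoothed :: "real \<Rightarrow> (real \<times> (real^'n) \<Rightarrow> real^'n) \<Rightarrow> real \<times> (real^'n) \<Rightarrow> real^'n" where
 "smoothed h v z = cutoff \<Omega> h (snd z) *\<^sub>R convolution (mollifier h) (zero_ext Q v) z"

lemma R_star_eq: "R_star T \<Omega> h v = zero_ext Q (smoothed h v)"
 by (simp add: R_star_def smoothed_def[abs_def])

definition inner_compact :: "real \<Rightarrow> (real^'n) set" where
 "inner_compact h = {x \<in> \<Omega>. h \<le> bdist \<Omega> x}"

lemma inner_compact: "0 < h ==> compact (inner_compact h)" "inner_compact h \<subseteq> \<Omega>"
 using closed_inner_part[OF open_\<Omega>, of h] bounded_subset[OF bounded_\<Omega>, of "inner_compact h"]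
 by (auto simp: inner_compact_def compact_eq_bounded_closed)

lemma smooth_cutoff_snd:
 assumes "0 < h"
 shows "smooth (%z::real \<times> (real^'n). cutoff \<Omega> h (snd z))"
  "dird v (%z::real \<times> (real^'n). cutoff \<Omega> h (snd z)) z = dird (snd v) (cutoff \<Omega> h) (snd z)"
 using smooth_affine[OF smooth_cutoff[OF open_\<Omega> bounded_\<Omega> assms] bounded_linear_snd, of 0]
  frechet_derivative_affine[OF smooth_cutoff[OF open_\<Omega> bounded_\<Omega> assms] bounded_linear_snd, of 0 z v]
 by auto

lemma smooth_smoothed:
 assumes "0 < h" "integrable (lebesgue_on Q) v" shows "smooth (smoothed h v)"
proof -
 have "smooth (convolution (mollifier h) (zero_ext Q v))"
  by (intro smooth_convolution test_fn_mollifier integrable_zero_ext Q_sets assms)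
 then show ?thesis
  unfolding smoothed_def[abs_def] by (intro smooth_scaleR smooth_cutoff_snd assms)
qed

lemma smoothed_zero: "0 < h ==> x \<notin> inner_compact (2 * h) ==> smoothed h v (t, x) = 0"
 using cutoff_nonzeroD[OF open_\<Omega> bounded_\<Omega>, of h x]
 by (cases "cutoff \<Omega> h x = 0") (auto simp: smoothed_def inner_compact_def)

lemma R_star_in_X:
 assumes "0 < h" "v \<in> X" shows "R_star T \<Omega> h v \<in> X"
proof (rule smooth_in_X[OF smooth_smoothed[OF assms(1) X_integrable(1)[OF assms(2)]]])
 show "R_star T \<Omega> h v z = smoothed h v z" if "z \<in> Q" for z using that by (simp add: R_star_eq zero_ext_def)
 show "compact (inner_compact (2 * h))" "inner_compact (2 * h) \<subseteq> \<Omega>" using inner_compact assms by auto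
qed (rule smoothed_zero[OF assms(1)])

subsection \<open>Testing with functions that do not vanish at the initial and final time\<close>

text \<open>The kernel omega_h(z - .) need not vanish at the initial and final times. Multiplying by
  time cut-offs gives admissible tests; only spatial derivatives occur in the identity, so none
  falls on the cut-offs, and dominated convergence removes them.\<close>

lemma weak_identity_ext:
 assumes hs: "has_sym_grad st_dir Q u E" and int: "integrable (lebesgue_on Q) u" "integrable (lebesgue_on Q) E"
  and \<psi>: "test_fn \<psi>" and K: "compact K" "K \<subseteq> \<Omega>" "\<And>t x. x \<notin> K ==> \<psi> (t, x) = 0"
 shows "(LINT z|lebesgue_on Q. E z $ i $ j * \<psi> z) = - (1/2) *
  ((LINT z|lebesgue_on Q. u z $ i * dird (st_dir j) \<psi> z) + (LINT z|lebesgue_on Q. u z $ j * dird (st_dir i) \<psi> z))"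
proof -
 define tc :: "nat \<Rightarrow> real \<Rightarrow> real" where "tc k = cutoff {0<..<T} (1 / Suc k)" for k
 define \<phi> where "\<phi> k z = tc k (fst z) * \<psi> z" for k and z :: "real \<times> (real^'n)"
 have op: "open {0<..<T}" by simp
 have bd: "bounded {0<..<T}" by (rule bounded_subset[of "{0..T}"]) auto
 have sm\<psi>: "smooth \<psi>" using \<psi> by (simp add: test_fn_def)
 have smtc: "smooth (tc k)" for k unfolding tc_def by (rule smooth_cutoff) auto
 have smf: "smooth (%z::real \<times> (real^'n). tc k (fst z))" for k
  using smooth_affine[OF smtc bounded_linear_fst, of k 0] by simp
 have d0: "dird 0 (tc k) y = 0" for k y
  using dird_linear(3)[OF smtc, where c=0 and v=0 and x=y] by simp
 have df: "dird (st_dir j) (%z::real \<times> (real^'n). tc k (fst z)) z = 0" for k z j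
  using frechet_derivative_affine[OF smtc bounded_linear_fst, of k 0 z "st_dir j"] d0
  by (simp add: st_dir_def)
 have d\<phi>: "dird (st_dir j) (\<phi> k) z = tc k (fst z) * dird (st_dir j) \<psi> z" for k z j
  using frechet_derivative_scaleR_smooth[OF smf sm\<psi>, of k z "st_dir j"]
  unfolding \<phi>_def[abs_def] by (simp add: df)
 have \<phi>_sc: "\<phi> k \<in> smooth_compact Q" for k
 proof -
  define J where "J = {t \<in> {0<..<T}. 2 * (1 / Suc k) \<le> bdist {0<..<T} t}"
  have "closed J" unfolding J_def by (rule closed_inner_part) auto
  moreover have "bounded J" by (rule bounded_subset[OF bd]) (auto simp: J_def)
  ultimately have J: "compact J" by (simp add: compact_eq_bounded_closed)
  have sub: "{z. \<phi> k z \<noteq> 0} \<subseteq> J \<times> K"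
  proof
   fix z assume z: "z \<in> {z. \<phi> k z \<noteq> 0}"
   then have "tc k (fst z) \<noteq> 0" "\<psi> (fst z, snd z) \<noteq> 0" by (auto simp: \<phi>_def)
   then have "fst z \<in> J" "snd z \<in> K"
    using cutoff_nonzeroD[OF op bd, of "1 / Suc k" "fst z"] K(3)[of "snd z" "fst z"] by (auto simp: tc_def J_def)
   then show "z \<in> J \<times> K" by (simp add: mem_Times_iff)
  qed
  have JK: "compact (J \<times> K)" by (rule compact_Times[OF J K(1)])
  have "closure {z. \<phi> k z \<noteq> 0} \<subseteq> J \<times> K" by (rule closure_minimal[OF sub compact_imp_closed[OF JK]])
  moreover have "J \<times> K \<subseteq> Q" using K(2) by (auto simp: J_def cylinder_def)
  moreover have "bounded {z. \<phi> k z \<noteq> 0}" by (rule bounded_subset[OF compact_imp_bounded[OF JK] sub])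
  moreover have "smooth (\<phi> k)" unfolding \<phi>_def[abs_def] by (rule smooth_mult[OF smf sm\<psi>])
  ultimately show ?thesis by (auto simp: smooth_compact_iff[OF open_Q] compact_closure)
 qed
 have lim: "(%k. LINT z|lebesgue_on Q. g z * (tc k (fst z) * \<theta> z)) \<longlonglongrightarrow> (LINT z|lebesgue_on Q. g z * \<theta> z)"
  if g: "integrable (lebesgue_on Q) g" and \<theta>: "test_fn \<theta>" for g :: "real \<times> (real^'n) \<Rightarrow> real" and \<theta>
 proof -
  obtain B where B: "0 \<le> B" "\<And>z. \<bar>\<theta> z\<bar> \<le> B" using test_fn_bounded[OF \<theta>] by metis
  have m\<theta>: "\<theta> \<in> borel_measurable (lebesgue_on Q)"
   by (intro measurable_restrict_space1 borel_measurable_lebesgueI test_fn_borel \<theta>)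
  have mtc: "(%z. tc k (fst z)) \<in> borel_measurable (lebesgue_on Q)" for k
   by (intro measurable_restrict_space1 borel_measurable_lebesgueI smooth_borel smf)
  have tc1: "0 \<le> tc k t" "tc k t \<le> 1" for k t
   unfolding tc_def by (auto intro!: cutoff_nonneg cutoff_le_1)
  show ?thesis
  proof (rule integral_dominated_convergence[where w="%z. \<bar>g z\<bar> * B"])
   show "AE z in lebesgue_on Q. (%k. g z * (tc k (fst z) * \<theta> z)) \<longlonglongrightarrow> g z * \<theta> z"
   proof (rule AE_I2)
    fix z assume "z \<in> space (lebesgue_on Q)"
    then have "fst z \<in> {0<..<T}" by (auto simp: cylinder_def)
    then have "(%k. tc k (fst z)) \<longlonglongrightarrow> 1"
     using cutoff_tendsto_indicator[OF op bd, of "fst z"] by (simp add: tc_def)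
    then have "(%k. g z * (tc k (fst z) * \<theta> z)) \<longlonglongrightarrow> g z * (1 * \<theta> z)"
     by (intro tendsto_mult tendsto_const)
    then show "(%k. g z * (tc k (fst z) * \<theta> z)) \<longlonglongrightarrow> g z * \<theta> z" by simp
   qed
   show "AE z in lebesgue_on Q. norm (g z * (tc k (fst z) * \<theta> z)) \<le> \<bar>g z\<bar> * B" for k
   proof (rule AE_I2)
    fix z
    have "\<bar>tc k (fst z)\<bar> * \<bar>\<theta> z\<bar> \<le> 1 * B" using tc1 B by (intro mult_mono) auto
    then show "norm (g z * (tc k (fst z) * \<theta> z)) \<le> \<bar>g z\<bar> * B"
     by (simp add: abs_mult mult_left_mono)
   qed
  qed (use g m\<theta> mtc in auto)
 qed
 have intc: "integrable (lebesgue_on Q) (%z. u z $ i)" "integrable (lebesgue_on Q) (%z. E z $ i $ j)" for i j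
  using integrable_bounded_linear[OF bounded_linear_vec_nth int(1)]
   integrable_bounded_linear[OF bounded_linear_vec_nth integrable_bounded_linear[OF bounded_linear_vec_nth int(2)]] .
 have id: "(LINT z|lebesgue_on Q. E z $ i $ j * (tc k (fst z) * \<psi> z)) = - (1/2) *
  ((LINT z|lebesgue_on Q. u z $ i * (tc k (fst z) * dird (st_dir j) \<psi> z)) +
   (LINT z|lebesgue_on Q. u z $ j * (tc k (fst z) * dird (st_dir i) \<psi> z)))" for k
  using has_sym_gradD(4)[OF hs open_Q \<phi>_sc, of i j k] unfolding d\<phi> by (simp add: \<phi>_def)
 have "(%k. - (1/2) *
  ((LINT z|lebesgue_on Q. u z $ i * (tc k (fst z) * dird (st_dir j) \<psi> z)) +
   (LINT z|lebesgue_on Q. u z $ j * (tc k (fst z) * dird (st_dir i) \<psi> z)))) \<longlonglongrightarrow>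
   - (1/2) * ((LINT z|lebesgue_on Q. u z $ i * dird (st_dir j) \<psi> z) + (LINT z|lebesgue_on Q. u z $ j * dird (st_dir i) \<psi> z))"
  by (intro tendsto_mult tendsto_add tendsto_const lim intc test_fn_dird \<psi>)
 then show ?thesis
  unfolding id[symmetric] using lim[OF intc(2) \<psi>] LIMSEQ_unique by blast
qed

subsection \<open>The symmetric gradient of the smoothed function\<close>

text \<open>The product rule gives eta_h times the mollified gradient plus the symmetrised product
  of the mollified function with the gradient of eta_h. Mollification and symmetric gradient commute
  only where the kernel stays inside \<Omega> in space, which is where eta_h is nonzero.\<close>

lemma classical_sym_grad_smoothed:
 assumes u: "u \<in> X" and h: "0 < h"
 shows "classical_sym_grad st_dir (smoothed h u) z = (\<chi> i j.
  cutoff \<Omega> h (snd z) * convolution (mollifier h) (zero_ext Q (%z. \<epsilon> u z $ i $ j)) z +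
  1/2 * (convolution (mollifier h) (zero_ext Q u) z $ i * dird (axis j 1) (cutoff \<Omega> h) (snd z) +
      convolution (mollifier h) (zero_ext Q u) z $ j * dird (axis i 1) (cutoff \<Omega> h) (snd z)))"
proof -
 let ?w = "convolution (mollifier h) (zero_ext Q u)" and ?\<eta> = "%z::real \<times> (real^'n). cutoff \<Omega> h (snd z)"
 note int = X_integrable(1,2)[OF u]
 note iz = integrable_zero_ext[OF Q_sets int(1)]
 have m: "test_fn (mollifier h :: real \<times> (real^'n) \<Rightarrow> real)" by (rule test_fn_mollifier[OF h])
 have sw: "smooth ?w" by (rule smooth_convolution[OF m iz])
 have swi: "smooth (%z. ?w z $ i)" for i by (rule smooth_bounded_linear[OF sw bounded_linear_vec_nth])
 have d1: "dird v (%z. smoothed h u z $ i) z = ?\<eta> z * dird v (%z. ?w z $ i) z + dird (snd v) (cutoff \<Omega> h) (snd z) * ?w z $ i" for v i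
  using frechet_derivative_scaleR_smooth[OF smooth_cutoff_snd(1)[OF h] swi, where x=z and v=v and i1=i] smooth_cutoff_snd(2)[OF h, where v=v and z=z]
  by (simp add: smoothed_def)
 \<comment> \<open>The derivative is moved from the centre z of the kernel to the integration
   variable, with a change of sign, so that the weak identity can be applied.\<close>
 have d2: "dird v (%z. ?w z $ i) z = - (LINT y|lebesgue_on Q. u y $ i * dird v (%y. mollifier h (z - y)) y)" for v i
 proof -
  have "dird v (%z. ?w z $ i) z = dird v ?w z $ i"
   by (rule frechet_derivative_bounded_linear_smooth[OF sw bounded_linear_vec_nth])
  also have "\<dots> = (LINT y|lebesgue. dird v (mollifier h) (z - y) *\<^sub>R zero_ext Q u y) $ i"
   by (subst dird_convolution[OF m iz]) (simp add: convolution_def)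
  also have "\<dots> = (LINT y|lebesgue. (dird v (mollifier h) (z - y) *\<^sub>R zero_ext Q u y) $ i)"
   by (rule integral_bounded_linear[symmetric, OF bounded_linear_vec_nth
    integrable_convolution_integrand[OF test_fn_dird[OF m] iz]])
  also have "\<dots> = (LINT y|lebesgue. dird v (mollifier h) (z - y) * zero_ext Q (%y. u y $ i) y)"
   by (intro Bochner_Integration.integral_cong) (auto simp: zero_ext_def)
  also have "\<dots> = (LINT y|lebesgue_on Q. u y $ i * dird v (mollifier h) (z - y))"
   by (rule integral_zero_ext_mult[OF Q_sets])
  also have "\<dots> = (LINT y|lebesgue_on Q. - (u y $ i * dird v (%y. mollifier h (z - y)) y))"
   using m by (intro Bochner_Integration.integral_cong refl) (simp add: dird_reflect test_fn_def)
  finally show ?thesis by simp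
 qed
 have d3: "?\<eta> z * (1/2 * (dird (st_dir j) (%z. ?w z $ i) z + dird (st_dir i) (%z. ?w z $ j) z)) =
   ?\<eta> z * convolution (mollifier h) (zero_ext Q (%z. \<epsilon> u z $ i $ j)) z" for i j
 proof (cases "?\<eta> z = 0")
  case False
  \<comment> \<open>Distance above 2h at z leaves distance at least h on the spatial support of the
    kernel, which is therefore contained in \<open>inner_compact h\<close>.\<close>
  note nz = cutoff_nonzeroD[OF open_\<Omega> bounded_\<Omega> h False]
  have "(LINT y|lebesgue_on Q. \<epsilon> u y $ i $ j * mollifier h (z - y)) = - (1/2) *
   ((LINT y|lebesgue_on Q. u y $ i * dird (st_dir j) (%y. mollifier h (z - y)) y) +
    (LINT y|lebesgue_on Q. u y $ j * dird (st_dir i) (%y. mollifier h (z - y)) y))"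
  proof (rule weak_identity_ext[OF X_D(3)[OF u] int test_fn_reflect[OF m] inner_compact(1)[OF h] inner_compact(2)])
   fix t x assume x: "x \<notin> inner_compact h"
   have "h \<le> norm (snd z - x)"
   proof (rule ccontr)
    assume "\<not> h \<le> norm (snd z - x)"
    then have d: "dist (snd z) x < h" by (simp add: dist_norm)
    then have "x \<in> \<Omega>" using bdist_ball[OF nz(1), of x] nz(2) h by linarith
    moreover have "h \<le> bdist \<Omega> x" using bdist_diff[of \<Omega> "snd z" x] nz(2) d by linarith
    ultimately show False using x by (simp add: inner_compact_def)
   qed
   also have "\<dots> \<le> norm (z - (t, x))" using norm_snd_le[of "snd z - x" "fst z - t"] by (cases z) simp
   finally show "mollifier h (z - (t, x)) = 0" by (rule mollifier_eq_0[OF h])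
  qed
  then have "1/2 * (dird (st_dir j) (%z. ?w z $ i) z + dird (st_dir i) (%z. ?w z $ j) z)
    = (LINT y|lebesgue_on Q. \<epsilon> u y $ i $ j * mollifier h (z - y))"
   unfolding d2 by argo
  also have "\<dots> = convolution (mollifier h) (zero_ext Q (%z. \<epsilon> u z $ i $ j)) z"
   unfolding convolution_def real_scaleR_def by (rule integral_zero_ext_mult[OF Q_sets, symmetric])
  finally show ?thesis by simp
 qed simp
 have "classical_sym_grad st_dir (smoothed h u) z $ i $ j =
  ?\<eta> z * (1/2 * (dird (st_dir j) (%z. ?w z $ i) z + dird (st_dir i) (%z. ?w z $ j) z)) +
  1/2 * (?w z $ i * dird (axis j 1) (cutoff \<Omega> h) (snd z) + ?w z $ j * dird (axis i 1) (cutoff \<Omega> h) (snd z))" for i j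
  unfolding classical_sym_grad_def d1 by (simp add: st_dir_def algebra_simps)
 then show ?thesis unfolding d3 by (simp add: vec_eq_iff)
qed

end

subsection \<open>Time slices of the symmetric gradient\<close>

text \<open>Slicing uses the product structure of \<open>lborel\<close>, which its completion does
  not share; integrable functions are first replaced by Borel ones.\<close>

lemma borel_representative:
 fixes f :: "'a::euclidean_space \<Rightarrow> 'b::euclidean_space"
 assumes f: "integrable lebesgue f"
 obtains f' where "f' \<in> borel_measurable borel" "AE x in lborel. f x = f' x" "integrable lborel f'"
proof -
 have "\<exists>g. g \<in> borel_measurable lborel \<and> (AE x in lborel. f x \<bullet> b = g x)" for b
  using completion_ex_borel_measurable_real[of "%x. f x \<bullet> b" lborel] f
  by (metis borel_measurable_integrable integrable_inner_left)
 then obtain g where g: "\<And>b. g b \<in> borel_measurable lborel" "\<And>b. AE x in lborel. f x \<bullet> b = g b x"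
  by metis
 define f' where "f' x = (\<Sum>b\<in>Basis. g b x *\<^sub>R b)" for x
 have m: "f' \<in> borel_measurable borel" unfolding f'_def[abs_def] using g(1) by simp
 have "AE x in lborel. \<forall>b\<in>Basis. f x \<bullet> b = g b x"
  by (rule AE_finite_allI) (auto simp: g)
 then have ae: "AE x in lborel. f x = f' x"
  by eventually_elim (subst euclidean_representation[symmetric], simp add: f'_def)
 have "integrable lebesgue f'"
  by (rule integrable_cong_AE_imp[OF f])
   (use m ae in \<open>auto simp: AE_completion_iff borel_measurable_lebesgueI eq_commute\<close>)
 then have "integrable lborel f'" using m by (simp add: integrable_completion)
 with m ae show thesis using that by blast
qed

lemma lborel_prod_slices: "(AE z in (lborel :: ('a::euclidean_space \<times> 'b::euclidean_space) measure). R z) ==>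
  AE t in lborel. AE x in lborel. R (t, x)"
 unfolding lborel_prod[symmetric] by (rule lborel_pair.AE_pair)

lemma measurable_snd_comp:
 fixes \<theta> :: "'b::euclidean_space \<Rightarrow> 'c::euclidean_space"
 assumes "\<theta> \<in> borel_measurable borel"
 shows "(%z::'a::euclidean_space \<times> 'b. \<theta> (snd z)) \<in> borel_measurable borel"
 by (rule measurable_compose[OF _ assms]) (intro borel_measurable_continuous_onI continuous_intros)

lemma measurable_fst_comp:
 fixes \<theta> :: "'a::euclidean_space \<Rightarrow> 'c::euclidean_space"
 assumes "\<theta> \<in> borel_measurable borel"
 shows "(%z::'a \<times> 'b::euclidean_space. \<theta> (fst z)) \<in> borel_measurable borel"
 by (rule measurable_compose[OF _ assms]) (intro borel_measurable_continuous_onI continuous_intros)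

lemma integral_lebesgue_on_eq_lborel:
 fixes f g :: "'a::euclidean_space \<Rightarrow> real"
 assumes "G \<in> sets lebesgue" "g \<in> borel_measurable borel" "AE x in lborel. indicator G x * f x = g x"
  and "f \<in> borel_measurable (lebesgue_on G)"
 shows "(LINT x|lebesgue_on G. f x) = (LINT x|lborel. g x)"
proof -
 have "(LINT x|lebesgue_on G. f x) = (LINT x|lebesgue. indicator G x * f x)"
  using assms(1) by (simp add: integral_restrict_space)
 also have "\<dots> = (LINT x|lebesgue. g x)"
 proof (rule integral_cong_AE)
  show "(%x. indicator G x * f x) \<in> borel_measurable lebesgue"
   using borel_measurable_restrict_space_iff[of G lebesgue f] assms(1,4) by simp
  show "AE x in lebesgue. indicator G x * f x = g x" using assms(3) by (simp add: AE_completion_iff)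
 qed (rule borel_measurable_lebesgueI[OF assms(2)])
 also have "\<dots> = (LINT x|lborel. g x)" using assms(2) by (simp add: integral_completion)
 finally show ?thesis .
qed

lemma integral_test_eq_lborel:
 fixes f g :: "'a::euclidean_space \<Rightarrow> real"
 assumes G: "open G" and g: "g \<in> borel_measurable borel" "AE x in lborel. indicator G x * f x = g x"
  and f: "f \<in> borel_measurable (lebesgue_on G)" and k: "continuous_on UNIV k"
 shows "(LINT x|lebesgue_on G. f x * k x) = (LINT x|lborel. g x * k x)"
proof (rule integral_lebesgue_on_eq_lborel)
 have [measurable]: "k \<in> borel_measurable borel" using k by (rule borel_measurable_continuous_onI)
 show "(%x. g x * k x) \<in> borel_measurable borel" using g(1) by measurable
 show "AE x in lborel. indicator G x * (f x * k x) = g x * k x"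
  using g(2) by eventually_elim auto
 show "(%x. f x * k x) \<in> borel_measurable (lebesgue_on G)"
 proof -
  have "k \<in> borel_measurable (lebesgue_on G)"
   by (intro measurable_restrict_space1 borel_measurable_lebesgueI) simp
  then show ?thesis by (rule borel_measurable_times[OF f])
 qed
qed (use G in simp)

context parabolic
begin

lemma product_test:
 fixes a :: "real \<Rightarrow> real" and \<psi> :: "real^'n \<Rightarrow> real"
 assumes "a \<in> smooth_compact {0<..<T}" "\<psi> \<in> smooth_compact \<Omega>"
 defines "\<phi> \<equiv> %z. a (fst z) * \<psi> (snd z)"
 shows "\<phi> \<in> smooth_compact Q" "dird (st_dir j) \<phi> z = a (fst z) * dird (axis j 1) \<psi> (snd z)"
proof -
 have op: "open {0<..<T}" by simp
 note a = smooth_compactD[OF assms(1) op] and \<psi> = smooth_compactD[OF assms(2) open_\<Omega>]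
 have s1: "smooth (%z::real \<times> (real^'n). a (fst z))"
  using smooth_affine[OF a(1) bounded_linear_fst, of 0] by simp
 have s2: "smooth (%z::real \<times> (real^'n). \<psi> (snd z))"
  using smooth_affine[OF \<psi>(1) bounded_linear_snd, of 0] by simp
 have sub: "{z. \<phi> z \<noteq> 0} \<subseteq> closure {t. a t \<noteq> 0} \<times> closure {x. \<psi> x \<noteq> 0}"
 proof
  fix z assume "z \<in> {z. \<phi> z \<noteq> 0}"
  then have nz: "fst z \<in> {t. a t \<noteq> 0}" "snd z \<in> {x. \<psi> x \<noteq> 0}" by (auto simp: \<phi>_def)
  show "z \<in> closure {t. a t \<noteq> 0} \<times> closure {x. \<psi> x \<noteq> 0}"
   unfolding mem_Times_iff
   by (intro conjI subsetD[OF closure_subset nz(1)] subsetD[OF closure_subset nz(2)])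
 qed
 have JK: "compact (closure {t. a t \<noteq> 0} \<times> closure {x. \<psi> x \<noteq> 0})" by (rule compact_Times[OF a(2) \<psi>(2)])
 have "closure {z. \<phi> z \<noteq> 0} \<subseteq> closure {t. a t \<noteq> 0} \<times> closure {x. \<psi> x \<noteq> 0}"
  by (rule closure_minimal[OF sub compact_imp_closed[OF JK]])
 moreover have "closure {t. a t \<noteq> 0} \<times> closure {x. \<psi> x \<noteq> 0} \<subseteq> Q"
  using a(3) \<psi>(3) by (auto simp: cylinder_def)
 moreover have "bounded {z. \<phi> z \<noteq> 0}" by (rule bounded_subset[OF compact_imp_bounded[OF JK] sub])
 moreover have "smooth \<phi>" unfolding \<phi>_def by (rule smooth_mult[OF s1 s2])
 ultimately show "\<phi> \<in> smooth_compact Q" by (auto simp: smooth_compact_iff[OF open_Q] compact_closure)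
 have d0: "dird 0 a y = 0" for y
  using dird_linear(3)[OF a(1), where c=0 and v=0 and x=y] by simp
 have d1: "dird (st_dir j) (%z::real \<times> (real^'n). a (fst z)) z = 0"
  using frechet_derivative_affine[OF a(1) bounded_linear_fst, of 0 z "st_dir j"] d0 by (simp add: st_dir_def)
 have d2: "dird (st_dir j) (%z::real \<times> (real^'n). \<psi> (snd z)) z = dird (axis j 1) \<psi> (snd z)"
  using frechet_derivative_affine[OF \<psi>(1) bounded_linear_snd, of 0 z "st_dir j"] by (simp add: st_dir_def)
 show "dird (st_dir j) \<phi> z = a (fst z) * dird (axis j 1) \<psi> (snd z)"
  using frechet_derivative_scaleR_smooth[OF s1 s2, where x=z and v="st_dir j"] unfolding \<phi>_def
  by (simp add: d1 d2)
qed

text \<open>Tests a(t) * \<psi>(x) are inserted into the space-time identity. For fixed \<psi> the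
  fundamental lemma in t yields the spatial identity for almost every t; countably many \<psi> give
  a common null set, and they determine the gradient of the slice. Since \<open>sym_grad\<close> is
  a choice on the slice and on the cylinder separately, this link has to be proved.\<close>

lemma slice_sym_grad:
 assumes u: "u \<in> X"
  and u': "u' \<in> borel_measurable borel" "AE z in lborel. zero_ext Q u z = u' z" "integrable lborel u'"
  and E': "E' \<in> borel_measurable borel" "AE z in lborel. zero_ext Q (\<epsilon> u) z = E' z" "integrable lborel E'"
 shows "AE t in lborel. t \<in> {0<..<T} \<longrightarrow> (%x. u (t, x)) \<in> X_sp \<Omega> (%_. 1) (%_. 1) \<and>
  (AE x in lebesgue_on \<Omega>. sym_grad sp_dir \<Omega> (%x. u (t, x)) x = E' (t, x))"
proof -
 note int = X_integrable(1,2)[OF u]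
 have mu: "(%z. u z $ i) \<in> borel_measurable (lebesgue_on Q)" for i
  using integrable_bounded_linear[OF bounded_linear_vec_nth int(1)] by blast
 have mE: "(%z. \<epsilon> u z $ i $ j) \<in> borel_measurable (lebesgue_on Q)" for i j
  using integrable_bounded_linear[OF bounded_linear_vec_nth integrable_bounded_linear[OF bounded_linear_vec_nth int(2)]]
  by blast
 have mu': "(%z. u' z $ i) \<in> borel_measurable borel" and mE': "(%z. E' z $ i $ j) \<in> borel_measurable borel" for i j
  using borel_measurable_integrable[OF integrable_bounded_linear[OF bounded_linear_vec_nth u'(3)]]
   borel_measurable_integrable[OF integrable_bounded_linear[OF bounded_linear_vec_nth integrable_bounded_linear[OF bounded_linear_vec_nth E'(3)]]]
  by simp_all
 have ae_u: "AE z in lborel. indicator Q z * u z $ i = u' z $ i" for i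
  using u'(2)
 proof eventually_elim
  case (elim z)
  show ?case using arg_cong[OF elim, of "%v. v $ i"] by (simp add: zero_ext_eq)
 qed
 have ae_E: "AE z in lborel. indicator Q z * \<epsilon> u z $ i $ j = E' z $ i $ j" for i j
  using E'(2)
 proof eventually_elim
  case (elim z)
  show ?case using arg_cong[OF elim, of "%v. v $ i $ j"] by (simp add: zero_ext_eq)
 qed
 \<comment> \<open>All terms of the weak identity on one side; the spatial integral \<open>g\<close>
   of \<open>F\<close> vanishes exactly when the identity for \<psi>, i, j holds at time t.\<close>
 define F where "F \<psi> i j z = E' z $ i $ j * \<psi> (snd z) +
  1/2 * (u' z $ i * dird (axis j 1) \<psi> (snd z) + u' z $ j * dird (axis i 1) \<psi> (snd z))"
  for \<psi> :: "real^'n \<Rightarrow> real" and i j and z :: "real \<times> (real^'n)"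
 define g where "g \<psi> i j t = (LINT x|lborel. F \<psi> i j (t, x))" for \<psi> i j t
 have key: "AE t in lebesgue_on {0<..<T}. g \<psi> i j t = 0" if \<psi>: "\<psi> \<in> box_tests \<Omega>" for \<psi> i j
 proof (rule fundamental_lemma)
  have \<psi>s: "\<psi> \<in> smooth_compact \<Omega>" using \<psi> box_tests_smooth_compact[OF open_\<Omega>] by blast
  have t\<psi>: "test_fn \<psi>" by (rule smooth_compact_test_fn[OF \<psi>s open_\<Omega>])
  have bm: "integrable lborel (%z. f z * \<theta> (snd z))"
   if f: "integrable lborel f" and \<theta>: "test_fn \<theta>" for f :: "real \<times> (real^'n) \<Rightarrow> real" and \<theta> :: "real^'n \<Rightarrow> real"
  proof -
   obtain B where "\<And>x. \<bar>\<theta> x\<bar> \<le> B" using test_fn_bounded[OF \<theta>] by metis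
   then have "integrable lborel (%z. \<theta> (snd z) *\<^sub>R f z)"
    using measurable_snd_comp[OF test_fn_borel[OF \<theta>]] by (intro integrable_bounded_mult[OF _ _ f]) auto
   then show ?thesis by (simp add: mult.commute)
  qed
  have iE: "integrable lborel (%z. E' z $ i $ j)" for i j
   by (rule integrable_bounded_linear[OF bounded_linear_vec_nth integrable_bounded_linear[OF bounded_linear_vec_nth E'(3)]])
  have iu: "integrable lborel (%z. u' z $ i)" for i
   by (rule integrable_bounded_linear[OF bounded_linear_vec_nth u'(3)])
  have iF: "integrable lborel (F \<psi> i j)"
   unfolding F_def[abs_def]
   by (intro Bochner_Integration.integrable_add integrable_mult_right bm iE iu t\<psi> test_fn_dird)
  then have iF': "integrable (lborel \<Otimes>\<^sub>M lborel) (F \<psi> i j)" by (simp add: lborel_prod)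
  have ig: "integrable lborel (g \<psi> i j)" unfolding g_def[abs_def] by (rule lborel_pair.integrable_fst'[OF iF'])
  then have igl: "integrable lebesgue (g \<psi> i j)" by (subst integrable_completion) auto
  show op: "open {0<..<T}" by simp
  show "locally_integrable {0<..<T} (g \<psi> i j)"
   unfolding locally_integrable_def using igl
   by (auto simp: integrable_restrict_space compact_imp_closed intro!: integrable_mult_indicator[where 'b=real, unfolded real_scaleR_def])
  fix a assume a: "a \<in> box_tests {0<..<T}"
  have as: "a \<in> smooth_compact {0<..<T}" using a box_tests_smooth_compact[OF op] by blast
  have ac: "continuous_on UNIV a" using smooth_compactD(1)[OF as op] by (rule smooth_continuous_on)
  have az: "a t = 0" if "t \<notin> {0<..<T}" for t by (rule smooth_compact_zero_outside[OF as that])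
  note pt = product_test[OF as \<psi>s]
  let ?\<phi> = "%z::real \<times> (real^'n). a (fst z) * \<psi> (snd z)"
  have c\<phi>: "continuous_on UNIV ?\<phi>" "continuous_on UNIV (dird (st_dir k) ?\<phi>)" for k
   using smooth_compactD(1)[OF pt(1) open_Q] by (auto intro: smooth_continuous_on smooth_dird)
  have ib: "integrable lborel (%z. f z * \<phi> z)" if f: "integrable lborel f" and \<phi>: "test_fn \<phi>" for f \<phi> :: "real \<times> (real^'n) \<Rightarrow> real"
  proof -
   obtain B where "\<And>x. \<bar>\<phi> x\<bar> \<le> B" using test_fn_bounded[OF \<phi>] by metis
   then have "integrable lborel (%z. \<phi> z *\<^sub>R f z)"
    using test_fn_borel[OF \<phi>] by (intro integrable_bounded_mult[OF _ _ f]) auto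
   then show ?thesis by (simp add: mult.commute)
  qed
  have t\<phi>: "test_fn ?\<phi>" by (rule smooth_compact_test_fn[OF pt(1) open_Q])
  have "(LINT t|lebesgue_on {0<..<T}. g \<psi> i j t * a t) = (LINT t|lborel. g \<psi> i j t * a t)"
   by (rule integral_lebesgue_on_eq_lborel) (use ig ac az in \<open>auto simp: indicator_def measurable_restrict_space1
    borel_measurable_lebesgueI borel_measurable_continuous_onI intro!: borel_measurable_times\<close>)
  also have "\<dots> = (LINT t|lborel. LINT x|lborel. F \<psi> i j (t, x) * a t)"
   unfolding g_def by simp
  also have "\<dots> = (LINT z|lborel. F \<psi> i j z * a (fst z))"
  proof -
   obtain B where B: "\<And>t. \<bar>a t\<bar> \<le> B" using test_fn_bounded[OF smooth_compact_test_fn[OF as op]] by metis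
   have "integrable lborel (%z. a (fst z) *\<^sub>R F \<psi> i j z)"
    using measurable_fst_comp[OF borel_measurable_continuous_onI[OF ac]] B by (intro integrable_bounded_mult[OF _ _ iF]) auto
   then have "integrable (lborel \<Otimes>\<^sub>M lborel) (%z. F \<psi> i j z * a (fst z))" by (simp add: lborel_prod mult.commute)
   from lborel_pair.integral_fst'[OF this] show ?thesis by (simp add: lborel_prod)
  qed
  also have "\<dots> = (LINT z|lborel. E' z $ i $ j * ?\<phi> z + 1/2 * (u' z $ i * dird (st_dir j) ?\<phi> z + u' z $ j * dird (st_dir i) ?\<phi> z))"
   by (intro Bochner_Integration.integral_cong refl, subst (1 2) pt(2)) (simp add: F_def algebra_simps)
  also have "\<dots> = (LINT z|lborel. E' z $ i $ j * ?\<phi> z) +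
    1/2 * ((LINT z|lborel. u' z $ i * dird (st_dir j) ?\<phi> z) + (LINT z|lborel. u' z $ j * dird (st_dir i) ?\<phi> z))"
   using ib[OF iE t\<phi>, of i j] ib[OF iu test_fn_dird[OF t\<phi>], of i "st_dir j"] ib[OF iu test_fn_dird[OF t\<phi>], of j "st_dir i"]
   by simp
  also have "\<dots> = (LINT z|lebesgue_on Q. \<epsilon> u z $ i $ j * ?\<phi> z) + 1/2 *
    ((LINT z|lebesgue_on Q. u z $ i * dird (st_dir j) ?\<phi> z) + (LINT z|lebesgue_on Q. u z $ j * dird (st_dir i) ?\<phi> z))"
   by (simp only: integral_test_eq_lborel[OF open_Q mE' ae_E mE c\<phi>(1)] integral_test_eq_lborel[OF open_Q mu' ae_u mu c\<phi>(2)])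
  also have "\<dots> = 0"
   unfolding has_sym_gradD(4)[OF X_D(3)[OF u] open_Q pt(1), of i j] by argo
  finally show "(LINT t|lebesgue_on {0<..<T}. g \<psi> i j t * a t) = 0" .
 qed
 have cI: "AE t in lebesgue_on {0<..<T}. \<forall>\<psi>\<in>box_tests \<Omega>. \<forall>i j. g \<psi> i j t = 0"
  using key by (subst AE_ball_countable[OF countable_box_tests]) (auto simp: AE_all_countable)
 have good: "AE t in lebesgue_on {0<..<T}. t \<in> {0<..<T} \<and> (%x. u (t, x)) \<in> X_sp \<Omega> (%x. q (t, x)) (%x. p (t, x)) \<and>
   (\<forall>\<psi>\<in>box_tests \<Omega>. \<forall>i j. g \<psi> i j t = 0)"
  using cI X_slices[OF u] by eventually_elim auto
 have Ts: "{0<..<T} \<inter> space lebesgue \<in> sets lebesgue" by simp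
 have "AE t in lborel. t \<in> {0<..<T} \<longrightarrow> t \<in> {0<..<T} \<and> (%x. u (t, x)) \<in> X_sp \<Omega> (%x. q (t, x)) (%x. p (t, x)) \<and>
   (\<forall>\<psi>\<in>box_tests \<Omega>. \<forall>i j. g \<psi> i j t = 0)"
  using good unfolding AE_restrict_space_iff[OF Ts] AE_completion_iff .
 moreover have "AE t in lborel. AE x in lborel. zero_ext Q u (t, x) = u' (t, x)" by (rule lborel_prod_slices[OF u'(2)])
 moreover have "AE t in lborel. integrable lborel (%x. E' (t, x))"
  using lborel_pair.AE_integrable_fst'[of E'] E'(3) by (simp add: lborel_prod)
 moreover have "AE t in lborel. integrable lborel (%x. u' (t, x))"
  using lborel_pair.AE_integrable_fst'[of u'] u'(3) by (simp add: lborel_prod)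
 moreover have "AE t in lborel. AE x in lborel. zero_ext Q (\<epsilon> u) (t, x) = E' (t, x)" by (rule lborel_prod_slices[OF E'(2)])
 ultimately show ?thesis
 proof eventually_elim
  case (elim t)
  show ?case
  proof
   assume t: "t \<in> {0<..<T}"
   interpret sl: slice_setting \<Omega> "%x. q (t, x)" "%x. p (t, x)" P by (rule slice_setting[OF t])
   have Xu: "(%x. u (t, x)) \<in> X_sp \<Omega> (%x. q (t, x)) (%x. p (t, x))" using elim(1) t by blast
   then have ue: "(%x. u (t, x)) \<in> eps_space sp_dir \<Omega> (%x. q (t, x)) (%x. p (t, x))" by (simp add: X_sp_def)
   note S = sl.eps_spaceD(3)[OF ue]
   let ?s = "sym_grad sp_dir \<Omega> (%x. u (t, x))"
   have mut: "(%x. u (t, x) $ i) \<in> borel_measurable (lebesgue_on \<Omega>)" for i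
    by (rule locally_integrable_measurable[OF open_\<Omega> locally_integrable_component[OF has_sym_gradD(1)[OF S open_\<Omega>]]])
   have mu't: "(%x. u' (t, x) $ i) \<in> borel_measurable borel" for i
    using borel_measurable_integrable[OF integrable_bounded_linear[OF bounded_linear_vec_nth elim(4)]] by simp
   have aet: "AE x in lborel. indicator \<Omega> x * u (t, x) $ i = u' (t, x) $ i" for i
    using elim(2)
   proof eventually_elim
    case (elim x)
    show ?case using arg_cong[OF elim, of "%v. v $ i"] t
     by (simp add: zero_ext_eq cylinder_def indicator_def)
   qed
   have iEt: "integrable lborel (%x. E' (t, x) $ i $ j)" for i j
    by (rule integrable_bounded_linear[OF bounded_linear_vec_nth integrable_bounded_linear[OF bounded_linear_vec_nth elim(3)]])
   have iut: "integrable lborel (%x. u' (t, x) $ i)" for i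
    by (rule integrable_bounded_linear[OF bounded_linear_vec_nth elim(4)])
   have ib: "integrable lborel (%z. f z * \<phi> z)" if f: "integrable lborel f" and \<phi>: "test_fn \<phi>" for f \<phi> :: "real^'n \<Rightarrow> real"
   proof -
    obtain B where "\<And>x. \<bar>\<phi> x\<bar> \<le> B" using test_fn_bounded[OF \<phi>] by metis
    then have "integrable lborel (%z. \<phi> z *\<^sub>R f z)"
     using test_fn_borel[OF \<phi>] by (intro integrable_bounded_mult[OF _ _ f]) auto
    then show ?thesis by (simp add: mult.commute)
   qed
   have "AE x in lebesgue_on \<Omega>. ?s x = E' (t, x)"
   proof (rule sym_grad_determined[OF open_\<Omega> has_sym_gradD(2)[OF S open_\<Omega>]])
    have "integrable lebesgue (%x. E' (t, x))"
     using elim(3) by (subst integrable_completion) auto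
    then show "locally_integrable \<Omega> (%x. E' (t, x))"
     unfolding locally_integrable_def by (auto simp: integrable_restrict_space compact_imp_closed intro!: integrable_mult_indicator)
    fix \<psi> i j assume \<psi>: "\<psi> \<in> box_tests \<Omega>"
    have \<psi>s: "\<psi> \<in> smooth_compact \<Omega>" using \<psi> box_tests_smooth_compact[OF open_\<Omega>] by blast
    have t\<psi>: "test_fn \<psi>" by (rule smooth_compact_test_fn[OF \<psi>s open_\<Omega>])
    have sm: "smooth \<psi>" using t\<psi> by (simp add: test_fn_def)
    have "0 = g \<psi> i j t" using elim(1) t \<psi> by simp
    also have "\<dots> = (LINT x|lborel. E' (t, x) $ i $ j * \<psi> x) +
     1/2 * ((LINT x|lborel. u' (t, x) $ i * dird (axis j 1) \<psi> x) + (LINT x|lborel. u' (t, x) $ j * dird (axis i 1) \<psi> x))"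
     unfolding g_def F_def
     using ib[OF iEt t\<psi>, of i j] ib[OF iut test_fn_dird[OF t\<psi>], of i "axis j 1"] ib[OF iut test_fn_dird[OF t\<psi>], of j "axis i 1"]
     by simp
    also have "(LINT x|lborel. E' (t, x) $ i $ j * \<psi> x) = (LINT x|lebesgue_on \<Omega>. E' (t, x) $ i $ j * \<psi> x)"
     by (rule integral_lebesgue_on_eq_lborel[symmetric])
      (use open_\<Omega> iEt t\<psi> smooth_compact_zero_outside[OF \<psi>s] in \<open>auto simp: indicator_def measurable_restrict_space1
       borel_measurable_lebesgueI test_fn_borel intro!: borel_measurable_times AE_I2\<close>)
    also have "(LINT x|lborel. u' (t, x) $ i * dird (axis j 1) \<psi> x) = (LINT x|lebesgue_on \<Omega>. u (t, x) $ i * dird (sp_dir j) \<psi> x)"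
     unfolding sp_dir_def
     by (rule integral_test_eq_lborel[symmetric, OF open_\<Omega> mu't aet mut smooth_continuous_on[OF smooth_dird[OF sm]]])
    also have "(LINT x|lborel. u' (t, x) $ j * dird (axis i 1) \<psi> x) = (LINT x|lebesgue_on \<Omega>. u (t, x) $ j * dird (sp_dir i) \<psi> x)"
     unfolding sp_dir_def
     by (rule integral_test_eq_lborel[symmetric, OF open_\<Omega> mu't aet mut smooth_continuous_on[OF smooth_dird[OF sm]]])
    finally show "(LINT x|lebesgue_on \<Omega>. ?s x $ i $ j * \<psi> x) = (LINT x|lebesgue_on \<Omega>. E' (t, x) $ i $ j * \<psi> x)"
     unfolding has_sym_gradD(4)[OF S open_\<Omega> \<psi>s, of i j] by argo
   qed
   then show "(%x. u (t, x)) \<in> X_sp \<Omega> (%_. 1) (%_. 1) \<and> (AE x in lebesgue_on \<Omega>. ?s x = E' (t, x))"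
    using sl.X_sp_subset_1[OF Xu] by blast
  qed
 qed
qed

end

subsection \<open>The boundary strip\<close>

lemma pred_mem_ball [measurable]: "Measurable.pred borel (%y::'a::euclidean_space. y \<in> ball x r)"
 unfolding pred_def by simp

text \<open>Dyadic decomposition: on the shell between radii s/2 and s the kernel is at most
  (s/2)^(1-d), the ball of radius s has volume of order s^d, and the contributions of order s = r /
  2^k form a geometric series.\<close>

lemma riesz_kernel_bound:
 "\<exists>J\<ge>0. \<forall>r>0. \<forall>x::real^'n::finite. (\<integral>\<^sup>+\<xi>. indicator (ball x r) \<xi> * ennreal (norm (x - \<xi>) powr (1 - real CARD('n))) \<partial>lborel) \<le> ennreal (J * r)"
proof (intro exI[of _ "2 * (unit_ball_vol (real CARD('n)) * 2 powr (real CARD('n) - 1))"] conjI allI impI)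
 let ?d = "real CARD('n)" and ?V = "unit_ball_vol (real CARD('n))"
 show "0 \<le> 2 * (?V * 2 powr (?d - 1))" by simp
 have d1: "1 \<le> ?d" by (simp add: Suc_leI)
 fix r :: real and x :: "real^'n" assume r: "0 < r"
 define s where "s k = r / 2 ^ k" for k
 have s0: "0 < s k" for k using r by (simp add: s_def)
 have s2: "s (Suc k) = s k / 2" for k by (simp add: s_def)
 have pt: "indicator (ball x r) \<xi> * ennreal (norm (x - \<xi>) powr (1 - ?d))
   \<le> (\<Sum>k. indicator (ball x (s k)) \<xi> * ennreal (s (Suc k) powr (1 - ?d)))" for \<xi>
 \<comment> \<open>At the centre the kernel takes the value 0, because \<open>0 powr a\<close> is 0,
   so the singularity needs no treatment.\<close>
 proof (cases "\<xi> \<in> ball x r \<and> \<xi> \<noteq> x")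
  case True
  define D where "D = norm (x - \<xi>)"
  have D: "0 < D" "D < r" using True by (auto simp: D_def dist_norm)
  have "\<exists>n. s (Suc n) \<le> D"
  proof -
   obtain n where "(1/2) ^ n < D / r" using real_arch_pow_inv[of "D / r" "1/2"] D r by auto
   then have "s n < D" using r by (simp add: s_def field_simps power_divide)
   then have "s (Suc n) \<le> D" using s2[of n] s0[of n] by simp
   then show ?thesis ..
  qed
  \<comment> \<open>The first dyadic radius not exceeding D; minimality places D in the shell
    between \<open>s (Suc k)\<close> and \<open>s k\<close>.\<close>
  define k where "k = (LEAST n. s (Suc n) \<le> D)"
  have k1: "s (Suc k) \<le> D" unfolding k_def by (rule LeastI_ex) fact
  have k2: "D < s k"
  proof (cases k)
   case 0
   then show ?thesis using D by (simp add: s_def)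
  next
   case (Suc m)
   have "\<not> s (Suc m) \<le> D" using not_less_Least[of m "%n. s (Suc n) \<le> D"] Suc by (simp add: k_def)
   then show ?thesis using Suc by simp
  qed
  have "D powr (1 - ?d) \<le> s (Suc k) powr (1 - ?d)"
   by (rule powr_mono2'[OF _ s0 k1]) (use d1 in simp)
  then have "indicator (ball x r) \<xi> * ennreal (norm (x - \<xi>) powr (1 - ?d))
   \<le> indicator (ball x (s k)) \<xi> * ennreal (s (Suc k) powr (1 - ?d))"
   using True k2 by (simp add: D_def dist_norm ennreal_leI)
  also have "\<dots> \<le> (\<Sum>k. indicator (ball x (s k)) \<xi> * ennreal (s (Suc k) powr (1 - ?d)))"
  proof -
   have "F k \<le> (\<Sum>k. F k)" for F :: "nat \<Rightarrow> ennreal" using sum_le_suminf[of F "{k}"] by simp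
   then show ?thesis .
  qed
  finally show ?thesis .
 qed (auto simp: indicator_def)
 have "(\<integral>\<^sup>+\<xi>. indicator (ball x r) \<xi> * ennreal (norm (x - \<xi>) powr (1 - ?d)) \<partial>lborel)
   \<le> (\<integral>\<^sup>+\<xi>. (\<Sum>k. indicator (ball x (s k)) \<xi> * ennreal (s (Suc k) powr (1 - ?d))) \<partial>lborel)"
  by (intro nn_integral_mono pt)
 also have "\<dots> = (\<Sum>k. \<integral>\<^sup>+\<xi>. indicator (ball x (s k)) \<xi> * ennreal (s (Suc k) powr (1 - ?d)) \<partial>lborel)"
  by (rule nn_integral_suminf) measurable
 also have "\<dots> = (\<Sum>k. ennreal (?V * 2 powr (?d - 1) * r * (1/2) ^ k))"
 proof (rule suminf_cong)
  fix k
  have "(\<integral>\<^sup>+\<xi>. indicator (ball x (s k)) \<xi> * ennreal (s (Suc k) powr (1 - ?d)) \<partial>lborel)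
   = emeasure lborel (ball x (s k)) * ennreal (s (Suc k) powr (1 - ?d))"
   by (subst nn_integral_multc) auto
  also have "\<dots> = ennreal (?V * s k ^ CARD('n) * (s k / 2) powr (1 - ?d))"
   using s0[of k] by (simp add: emeasure_ball s2 ennreal_mult'[symmetric])
  also have "?V * s k ^ CARD('n) * (s k / 2) powr (1 - ?d) = ?V * 2 powr (?d - 1) * r * (1/2) ^ k"
  proof -
   have "s k ^ CARD('n) * (s k / 2) powr (1 - ?d) = s k powr ?d * (s k powr (1 - ?d) / 2 powr (1 - ?d))"
    using s0[of k] by (simp add: powr_realpow powr_divide)
   also have "\<dots> = (s k powr ?d * s k powr (1 - ?d)) * (1 / 2 powr (1 - ?d))" by simp
   also have "s k powr ?d * s k powr (1 - ?d) = s k" using s0[of k] by (simp add: powr_add[symmetric])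
   also have "1 / 2 powr (1 - ?d) = 2 powr (?d - 1)" using powr_minus_divide[of "2::real" "1 - ?d"] by simp
   finally have e: "s k ^ CARD('n) * (s k / 2) powr (1 - ?d) = s k * 2 powr (?d - 1)" .
   show ?thesis unfolding mult.assoc e by (simp add: s_def power_divide)
  qed
  finally show "(\<integral>\<^sup>+\<xi>. indicator (ball x (s k)) \<xi> * ennreal (s (Suc k) powr (1 - ?d)) \<partial>lborel)
   = ennreal (?V * 2 powr (?d - 1) * r * (1/2) ^ k)" .
 qed
 also have "\<dots> = ennreal (?V * 2 powr (?d - 1) * r * 2)"
 proof (rule suminf_ennreal_eq)
  show "(%k. ?V * 2 powr (?d - 1) * r * (1/2) ^ k) sums (?V * 2 powr (?d - 1) * r * 2)"
   using sums_mult[OF geometric_sums[of "1/2::real"], of "?V * 2 powr (?d - 1) * r"] by simp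
 qed (use r in simp)
 finally show "(\<integral>\<^sup>+\<xi>. indicator (ball x r) \<xi> * ennreal (norm (x - \<xi>) powr (1 - ?d)) \<partial>lborel)
   \<le> ennreal (2 * (?V * 2 powr (?d - 1)) * r)" by (simp add: mult_ac)
qed

lemma nn_integral_ball_lborel:
 fixes g g' :: "'a::euclidean_space \<Rightarrow> 'b::euclidean_space"
 assumes G: "G \<in> sets lebesgue" and g: "integrable (lebesgue_on G) g"
  and g': "g' \<in> borel_measurable borel" "AE y in lborel. zero_ext G g y = g' y"
 shows "(\<integral>\<^sup>+y. indicator (ball z r) y * ennreal (norm (g' y)) \<partial>lborel)
  = ennreal (LINT y|lebesgue_on G. indicator (ball z r) y * norm (g y))"
proof -
 have "(\<integral>\<^sup>+y. indicator (ball z r) y * ennreal (norm (g' y)) \<partial>lborel)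
   = (\<integral>\<^sup>+y. indicator (ball z r) y * ennreal (norm (zero_ext G g y)) \<partial>lborel)"
  by (rule nn_integral_cong_AE) (use g'(2) in \<open>eventually_elim, simp\<close>)
 also have "\<dots> = (\<integral>\<^sup>+y. indicator (ball z r) y * ennreal (norm (zero_ext G g y)) \<partial>lebesgue)"
  by (simp add: nn_integral_completion)
 also have "\<dots> = (\<integral>\<^sup>+y. ennreal (indicator (ball z r) y * norm (g y)) * indicator G y \<partial>lebesgue)"
  by (intro nn_integral_cong) (auto simp: zero_ext_def indicator_def)
 also have "\<dots> = (\<integral>\<^sup>+y. ennreal (indicator (ball z r) y * norm (g y)) \<partial>lebesgue_on G)"
  using G by (simp add: nn_integral_restrict_space)
 also have "\<dots> = ennreal (LINT y|lebesgue_on G. indicator (ball z r) y * norm (g y))"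
  by (rule nn_integral_eq_integral[OF integrable_indicator_mult[OF _ integrable_norm[OF g]]]) auto
 finally show ?thesis .
qed

context parabolic
begin

text \<open>The strip estimate is integrated over a ball of radius h and the order of integration
  exchanged. Integrating the kernel over radius 8h yields J * 8h, the decisive factor h; the points
  y that matter lie within h + 8h of x.\<close>

lemma strip_slice_bound:
 fixes us :: "real^'n \<Rightarrow> real^'n" and Es :: "real^'n \<Rightarrow> real^'n^'n" and s0 :: "real^'n \<Rightarrow> real^'n^'n"
 assumes "0 < c0" "0 < h" "4 * h \<le> h0" and x: "x \<in> \<Omega>" "bdist \<Omega> x \<le> 3 * h"
  and J: "0 \<le> J" "\<And>r x::real^'n. 0 < r ==> (\<integral>\<^sup>+\<xi>. indicator (ball x r) \<xi> * ennreal (norm (x - \<xi>) powr (1 - real CARD('n))) \<partial>lborel) \<le> ennreal (J * r)"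
  and est: "AE \<xi> in lebesgue_on \<Omega>. bdist \<Omega> \<xi> \<le> h0 \<longrightarrow> ennreal (norm (us0 \<xi>)) \<le> ennreal c0 *
     (\<integral>\<^sup>+y. ennreal (norm (s0 y) * norm (\<xi> - y) powr (1 - real CARD('n))) \<partial>lebesgue_on (ball \<xi> (2 * bdist \<Omega> \<xi>) \<inter> \<Omega>))"
  and us: "AE \<xi> in lborel. (if \<xi> \<in> \<Omega> then us0 \<xi> else 0) = us \<xi>"
  and s0: "AE y in lebesgue_on \<Omega>. s0 y = Es y" and Es [measurable]: "Es \<in> borel_measurable borel"
 shows "(\<integral>\<^sup>+\<xi>. indicator (ball x h) \<xi> * ennreal (norm (us \<xi>)) \<partial>lborel)
   \<le> ennreal (c0 * (J * (8 * h))) * (\<integral>\<^sup>+y. indicator (ball x (9 * h)) y * ennreal (norm (Es y)) \<partial>lborel)"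
proof -
 let ?k = "%\<xi> y::real^'n. ennreal (norm (\<xi> - y) powr (1 - real CARD('n)))"
 \<comment> \<open>A Borel majorant of the double integrand, with fixed radii in place of the radius
   depending on \<xi>, so that Fubini applies.\<close>
 define H where "H \<xi> y = (if dist x \<xi> < h \<and> dist \<xi> y < 8 * h then ennreal (norm (Es y)) * ?k \<xi> y else 0)" for \<xi> y
 have Hm: "(%(\<xi>, y). H \<xi> y) \<in> borel_measurable (lborel \<Otimes>\<^sub>M lborel)"
  unfolding H_def by measurable
 have O: "\<Omega> \<inter> space lebesgue \<in> sets lebesgue" using open_\<Omega> by simp
 have s0': "AE y in lebesgue. y \<in> \<Omega> \<longrightarrow> s0 y = Es y" using s0 unfolding AE_restrict_space_iff[OF O] .
 have est': "AE \<xi> in lborel. \<xi> \<in> \<Omega> \<longrightarrow> bdist \<Omega> \<xi> \<le> h0 \<longrightarrow> ennreal (norm (us0 \<xi>)) \<le> ennreal c0 *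
     (\<integral>\<^sup>+y. ennreal (norm (s0 y) * norm (\<xi> - y) powr (1 - real CARD('n))) \<partial>lebesgue_on (ball \<xi> (2 * bdist \<Omega> \<xi>) \<inter> \<Omega>))"
  using est unfolding AE_restrict_space_iff[OF O] AE_completion_iff .
 have "(\<integral>\<^sup>+\<xi>. indicator (ball x h) \<xi> * ennreal (norm (us \<xi>)) \<partial>lborel) \<le> (\<integral>\<^sup>+\<xi>. ennreal c0 * (\<integral>\<^sup>+y. H \<xi> y \<partial>lborel) \<partial>lborel)"
 proof (rule nn_integral_mono_AE)
  show "AE \<xi> in lborel. indicator (ball x h) \<xi> * ennreal (norm (us \<xi>)) \<le> ennreal c0 * (\<integral>\<^sup>+y. H \<xi> y \<partial>lborel)"
   using est' us
  proof eventually_elim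
   case (elim \<xi>)
   show ?case
   proof (cases "\<xi> \<in> ball x h \<and> \<xi> \<in> \<Omega>")
    case True
    \<comment> \<open>The strip has width 3h and the ball adds h. Hence \<xi> is within h0 of the
      boundary, and the ball in the estimate has radius at most 8h.\<close>
    have b: "bdist \<Omega> \<xi> \<le> 4 * h" using bdist_diff[of \<Omega> \<xi> x] True x(2) by (simp add: dist_commute)
    then have "ennreal (norm (us \<xi>)) \<le> ennreal c0 *
     (\<integral>\<^sup>+y. ennreal (norm (s0 y) * norm (\<xi> - y) powr (1 - real CARD('n))) \<partial>lebesgue_on (ball \<xi> (2 * bdist \<Omega> \<xi>) \<inter> \<Omega>))"
     using elim True assms(3) by simp
    also have "(\<integral>\<^sup>+y. ennreal (norm (s0 y) * norm (\<xi> - y) powr (1 - real CARD('n))) \<partial>lebesgue_on (ball \<xi> (2 * bdist \<Omega> \<xi>) \<inter> \<Omega>))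
      = (\<integral>\<^sup>+y. ennreal (norm (s0 y) * norm (\<xi> - y) powr (1 - real CARD('n))) * indicator (ball \<xi> (2 * bdist \<Omega> \<xi>) \<inter> \<Omega>) y \<partial>lebesgue)"
     using open_\<Omega> by (subst nn_integral_restrict_space) auto
    also have "\<dots> \<le> (\<integral>\<^sup>+y. H \<xi> y \<partial>lebesgue)"
    proof (rule nn_integral_mono_AE)
     show "AE y in lebesgue. ennreal (norm (s0 y) * norm (\<xi> - y) powr (1 - real CARD('n))) *
       indicator (ball \<xi> (2 * bdist \<Omega> \<xi>) \<inter> \<Omega>) y \<le> H \<xi> y"
      using s0' by eventually_elim (use True b in \<open>auto simp: H_def indicator_def ennreal_mult\<close>)
    qed
    also have "\<dots> = (\<integral>\<^sup>+y. H \<xi> y \<partial>lborel)" by (simp add: nn_integral_completion)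
    finally show ?thesis using True by (simp add: mult_left_mono)
   next
    case False
    then have "\<xi> \<notin> ball x h \<or> us \<xi> = 0" using elim(2) by auto
    then show ?thesis by auto
   qed
  qed
 qed
 also have "\<dots> = ennreal c0 * (\<integral>\<^sup>+\<xi>. \<integral>\<^sup>+y. H \<xi> y \<partial>lborel \<partial>lborel)"
  using lborel.borel_measurable_nn_integral[OF Hm] by (intro nn_integral_cmult) simp
 also have "(\<integral>\<^sup>+\<xi>. \<integral>\<^sup>+y. H \<xi> y \<partial>lborel \<partial>lborel) = (\<integral>\<^sup>+y. \<integral>\<^sup>+\<xi>. H \<xi> y \<partial>lborel \<partial>lborel)"
  using lborel_pair.Fubini'[OF Hm] by simp
 also have "\<dots> \<le> (\<integral>\<^sup>+y. ennreal (J * (8 * h)) * (indicator (ball x (9 * h)) y * ennreal (norm (Es y))) \<partial>lborel)"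
 proof (rule nn_integral_mono)
  fix y
  have "(\<integral>\<^sup>+\<xi>. H \<xi> y \<partial>lborel) \<le> (\<integral>\<^sup>+\<xi>. (indicator (ball x (9 * h)) y * ennreal (norm (Es y))) * (indicator (ball y (8 * h)) \<xi> * ?k y \<xi>) \<partial>lborel)"
  proof (rule nn_integral_mono)
   fix \<xi>
   have "dist x y < 9 * h" if "dist x \<xi> < h" "dist \<xi> y < 8 * h"
    using that dist_triangle[of x y \<xi>] by linarith
   then show "H \<xi> y \<le> (indicator (ball x (9 * h)) y * ennreal (norm (Es y))) * (indicator (ball y (8 * h)) \<xi> * ?k y \<xi>)"
    by (auto simp: H_def indicator_def dist_commute norm_minus_commute)
  qed
  also have "\<dots> = (indicator (ball x (9 * h)) y * ennreal (norm (Es y))) * (\<integral>\<^sup>+\<xi>. indicator (ball y (8 * h)) \<xi> * ?k y \<xi> \<partial>lborel)"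
  proof (rule nn_integral_cmult)
   have a: "(%\<xi>. ?k y \<xi>) \<in> borel_measurable borel" by measurable
   have b: "(indicator (ball y (8 * h)) :: real^'n \<Rightarrow> ennreal) \<in> borel_measurable borel"
    by (rule borel_measurable_indicator) simp
   show "(%\<xi>. indicator (ball y (8 * h)) \<xi> * ?k y \<xi>) \<in> borel_measurable lborel"
    using borel_measurable_times_ennreal[OF b a] by simp
  qed
  also have "\<dots> \<le> (indicator (ball x (9 * h)) y * ennreal (norm (Es y))) * ennreal (J * (8 * h))"
   by (intro mult_left_mono J(2)) (use assms(2) in auto)
  finally show "(\<integral>\<^sup>+\<xi>. H \<xi> y \<partial>lborel) \<le> ennreal (J * (8 * h)) * (indicator (ball x (9 * h)) y * ennreal (norm (Es y)))"
   by (simp add: mult.commute)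
 qed
 also have "\<dots> = ennreal (J * (8 * h)) * (\<integral>\<^sup>+y. indicator (ball x (9 * h)) y * ennreal (norm (Es y)) \<partial>lborel)"
  by (rule nn_integral_cmult) measurable
 finally show ?thesis
  using assms(1,2) J(1) by (simp add: ennreal_mult mult.assoc mult_left_mono)
qed

text \<open>The slice bound integrated in time. A ball of radius h lies in a product of balls of
  radius h, and radius h in time with 9h in space fits into a ball of radius 10h. The gained factor
  h is to cancel the 1/h of the gradient of eta_h.\<close>

lemma strip_average:
 assumes bse: "boundary_strip_estimate \<Omega> h0 c0" and "0 < c0"
 shows "\<exists>A\<ge>0. \<forall>u\<in>X. \<forall>h z. 0 < h \<and> 4 * h \<le> h0 \<and> z \<in> Q \<and> bdist \<Omega> (snd z) \<le> 3 * h \<longrightarrow>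
  (LINT y|lebesgue_on Q. indicator (ball z h) y * norm (u y))
   \<le> A * h * (LINT y|lebesgue_on Q. indicator (ball z (10 * h)) y * norm (\<epsilon> u y))"
proof -
 obtain J where J: "0 \<le> J" "\<And>r x::real^'n. 0 < r ==>
   (\<integral>\<^sup>+\<xi>. indicator (ball x r) \<xi> * ennreal (norm (x - \<xi>) powr (1 - real CARD('n))) \<partial>lborel) \<le> ennreal (J * r)"
  using riesz_kernel_bound[where 'n='n] by blast
 show ?thesis
 proof (intro exI[of _ "c0 * (J * 8)"] conjI ballI allI impI)
  show "0 \<le> c0 * (J * 8)" using J(1) assms(2) by simp
  fix u h z assume u: "u \<in> X" and hz: "0 < h \<and> 4 * h \<le> h0 \<and> z \<in> Q \<and> bdist \<Omega> (snd z) \<le> 3 * h"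
  obtain t x where z: "z = (t, x)" by (cases z)
  have x: "x \<in> \<Omega>" using hz z by (simp add: cylinder_def)
  note int = X_integrable(1,2)[OF u]
  obtain u' where u': "u' \<in> borel_measurable borel" "AE z in lborel. zero_ext Q u z = u' z" "integrable lborel u'"
   using borel_representative[OF integrable_zero_ext[OF Q_sets int(1)]] by blast
  obtain E' where E': "E' \<in> borel_measurable borel" "AE z in lborel. zero_ext Q (\<epsilon> u) z = E' z" "integrable lborel E'"
   using borel_representative[OF integrable_zero_ext[OF Q_sets int(2)]] by blast
  have [measurable]: "u' \<in> borel_measurable (borel \<Otimes>\<^sub>M borel)" "E' \<in> borel_measurable (borel \<Otimes>\<^sub>M borel)"
   using u'(1) E'(1) by (simp_all add: borel_prod)
  define L where "L s y = (if dist t s < h \<and> dist x y < h then ennreal (norm (u' (s, y))) else 0)" for s y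
  define M where "M s y = (if dist t s < h \<and> dist x y < 9 * h then ennreal (norm (E' (s, y))) else 0)" for s y
  have Lm: "(%(s, y). L s y) \<in> borel_measurable (lborel \<Otimes>\<^sub>M lborel)" unfolding L_def by measurable
  have Mm: "(%(s, y). M s y) \<in> borel_measurable (lborel \<Otimes>\<^sub>M lborel)" unfolding M_def by measurable
  have "ennreal (LINT y|lebesgue_on Q. indicator (ball z h) y * norm (u y))
    = (\<integral>\<^sup>+y. indicator (ball z h) y * ennreal (norm (u' y)) \<partial>lborel)"
   by (rule nn_integral_ball_lborel[symmetric, OF Q_sets int(1) u'(1,2)])
  also have "\<dots> \<le> (\<integral>\<^sup>+y. L (fst y) (snd y) \<partial>(lborel \<Otimes>\<^sub>M lborel))"
   unfolding lborel_prod
  proof (rule nn_integral_mono)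
   fix y :: "real \<times> (real^'n)"
   have "dist t (fst y) < h \<and> dist x (snd y) < h" if "dist z y < h"
    using that dist_fst_le[of z y] dist_snd_le[of z y] by (auto simp: z)
   then show "indicator (ball z h) y * ennreal (norm (u' y)) \<le> L (fst y) (snd y)"
    by (cases y) (auto simp: L_def indicator_def)
  qed
  also have "\<dots> = (\<integral>\<^sup>+s. \<integral>\<^sup>+y. L s y \<partial>lborel \<partial>lborel)"
   using lborel.nn_integral_fst[OF Lm] by (simp add: case_prod_unfold)
  also have "\<dots> \<le> (\<integral>\<^sup>+s. ennreal (c0 * (J * (8 * h))) * (\<integral>\<^sup>+y. M s y \<partial>lborel) \<partial>lborel)"
  proof (rule nn_integral_mono_AE)
   show "AE s in lborel. (\<integral>\<^sup>+y. L s y \<partial>lborel) \<le> ennreal (c0 * (J * (8 * h))) * (\<integral>\<^sup>+y. M s y \<partial>lborel)"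
    using slice_sym_grad[OF u u' E'] lborel_prod_slices[OF u'(2)]
   proof eventually_elim
    case (elim s)
    show ?case
    proof (cases "dist t s < h")
     case True
     have Ls: "(\<integral>\<^sup>+y. L s y \<partial>lborel) = (\<integral>\<^sup>+\<xi>. indicator (ball x h) \<xi> * ennreal (norm (u' (s, \<xi>))) \<partial>lborel)"
      by (intro nn_integral_cong) (auto simp: L_def True indicator_def)
     have Ms: "(\<integral>\<^sup>+y. M s y \<partial>lborel) = (\<integral>\<^sup>+\<xi>. indicator (ball x (9 * h)) \<xi> * ennreal (norm (E' (s, \<xi>))) \<partial>lborel)"
      by (intro nn_integral_cong) (auto simp: M_def True indicator_def)
     show ?thesis
     proof (cases "s \<in> {0<..<T}")
      case sT: True
      have Xs: "(%x. u (s, x)) \<in> X_sp \<Omega> (%_. 1) (%_. 1)"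
       and ae: "AE x in lebesgue_on \<Omega>. sym_grad sp_dir \<Omega> (%x. u (s, x)) x = E' (s, x)"
       using elim(1) sT by blast+
      show ?thesis
       unfolding Ls Ms
      proof (rule strip_slice_bound[OF assms(2) _ _ x _ J])
       show "AE \<xi> in lebesgue_on \<Omega>. bdist \<Omega> \<xi> \<le> h0 \<longrightarrow> ennreal (norm (u (s, \<xi>))) \<le> ennreal c0 *
        (\<integral>\<^sup>+y. ennreal (norm (sym_grad sp_dir \<Omega> (%x. u (s, x)) y) * norm (\<xi> - y) powr (1 - real CARD('n)))
         \<partial>lebesgue_on (ball \<xi> (2 * bdist \<Omega> \<xi>) \<inter> \<Omega>))"
        using bse Xs by (simp add: boundary_strip_estimate_def)
       show "AE \<xi> in lborel. (if \<xi> \<in> \<Omega> then u (s, \<xi>) else 0) = u' (s, \<xi>)"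
        using elim(2) by eventually_elim (use sT in \<open>simp add: zero_ext_def cylinder_def\<close>)
       show "(%x. E' (s, x)) \<in> borel_measurable borel" by measurable
      qed (use hz z ae in auto)
     next
      case False
      have "(\<integral>\<^sup>+\<xi>. indicator (ball x h) \<xi> * ennreal (norm (u' (s, \<xi>))) \<partial>lborel) = (\<integral>\<^sup>+\<xi>. 0 \<partial>(lborel :: (real^'n) measure))"
      proof (rule nn_integral_cong_AE)
       show "AE \<xi> in lborel. indicator (ball x h) \<xi> * ennreal (norm (u' (s, \<xi>))) = 0"
        using elim(2)
       proof eventually_elim
        case (elim \<xi>)
        have "u' (s, \<xi>) = 0" using elim False by (auto simp: zero_ext_def cylinder_def)
        then show ?case by simp
       qed
      qed
      then show ?thesis unfolding Ls by simp
     qed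
    qed (simp add: L_def)
   qed
  qed
  also have "\<dots> = ennreal (c0 * (J * (8 * h))) * (\<integral>\<^sup>+s. \<integral>\<^sup>+y. M s y \<partial>lborel \<partial>lborel)"
   using lborel.borel_measurable_nn_integral[OF Mm] by (intro nn_integral_cmult) simp
  also have "(\<integral>\<^sup>+s. \<integral>\<^sup>+y. M s y \<partial>lborel \<partial>lborel) = (\<integral>\<^sup>+y. M (fst y) (snd y) \<partial>(lborel \<Otimes>\<^sub>M lborel))"
   using lborel.nn_integral_fst[OF Mm] by (simp add: case_prod_unfold)
  also have "\<dots> \<le> (\<integral>\<^sup>+y. indicator (ball z (10 * h)) y * ennreal (norm (E' y)) \<partial>lborel)"
   unfolding lborel_prod
  proof (rule nn_integral_mono)
   fix y :: "real \<times> (real^'n)"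
   have "dist z y < 10 * h" if "dist t (fst y) < h" "dist x (snd y) < 9 * h"
   proof -
    have "dist z y = sqrt ((dist t (fst y))\<^sup>2 + (dist x (snd y))\<^sup>2)" by (simp add: z dist_prod_def)
    also have "\<dots> \<le> dist t (fst y) + dist x (snd y)"
     using sqrt_sum_squares_le_sum[of "dist t (fst y)" "dist x (snd y)"] by simp
    finally show ?thesis using that by linarith
   qed
   then show "M (fst y) (snd y) \<le> indicator (ball z (10 * h)) y * ennreal (norm (E' y))"
    by (cases y) (auto simp: M_def indicator_def)
  qed
  also have "\<dots> = ennreal (LINT y|lebesgue_on Q. indicator (ball z (10 * h)) y * norm (\<epsilon> u y))"
   by (rule nn_integral_ball_lborel[OF Q_sets int(2) E'(1,2)])
  finally have "ennreal (LINT y|lebesgue_on Q. indicator (ball z h) y * norm (u y))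
    \<le> ennreal (c0 * (J * (8 * h)) * (LINT y|lebesgue_on Q. indicator (ball z (10 * h)) y * norm (\<epsilon> u y)))"
   using J(1) assms(2) hz by (simp add: ennreal_mult mult_left_mono)
  then show "(LINT y|lebesgue_on Q. indicator (ball z h) y * norm (u y))
   \<le> c0 * (J * 8) * h * (LINT y|lebesgue_on Q. indicator (ball z (10 * h)) y * norm (\<epsilon> u y))"
   using J(1) assms(2) hz
   by (subst (asm) ennreal_le_iff) (auto simp: mult_ac intro!: mult_nonneg_nonneg Bochner_Integration.integral_nonneg)
 qed
qed

end

subsection \<open>Interchanging a functional with a convolution\<close>

lemma test_fn_translate_diff:
 fixes \<kappa> :: "'a::euclidean_space \<Rightarrow> real"
 assumes \<kappa>: "test_fn \<kappa>"
 obtains B where "0 \<le> B" "\<And>a b. \<bar>\<kappa> a - \<kappa> b\<bar> \<le> B * norm (a - b)"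
  "\<And>v a b. \<bar>dird v \<kappa> a - dird v \<kappa> b\<bar> \<le> B * norm (a - b) * norm v"
proof -
 have lip: "\<exists>B\<ge>0. \<forall>a b. \<bar>f a - f b\<bar> \<le> B * norm (a - b)" if f: "test_fn f" for f :: "'a \<Rightarrow> real"
 proof -
  have sm: "smooth f" using f by (simp add: test_fn_def)
  obtain B where B: "0 \<le> B" "\<And>x v. \<bar>dird v f x\<bar> \<le> B * norm v" using test_fn_dird_bounded[OF f] by metis
  have "\<bar>f a - f b\<bar> \<le> B * norm (a - b)" for a b
  proof -
   have "\<exists>s\<in>{0<..<1}. f (b + 1 *\<^sub>R (a - b)) - f (b + 0 *\<^sub>R (a - b)) = dird (a - b) f (b + s *\<^sub>R (a - b)) * (1 - 0)"
    by (rule mvt_simple[OF _ smooth_has_real_derivative_line[OF sm, unfolded has_field_derivative_def]]) simp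
   then obtain s where "f (b + 1 *\<^sub>R (a - b)) - f (b + 0 *\<^sub>R (a - b)) = dird (a - b) f (b + s *\<^sub>R (a - b)) * (1 - 0)" ..
   then show ?thesis using B(2)[where v="a - b" and x="b + s *\<^sub>R (a - b)"] by simp
  qed
  then show ?thesis using B(1) by blast
 qed
 obtain B0 where B0: "0 \<le> B0" "\<And>a b. \<bar>\<kappa> a - \<kappa> b\<bar> \<le> B0 * norm (a - b)" using lip[OF \<kappa>] by metis
 have "\<exists>B\<ge>0. \<forall>a c. \<bar>dird b \<kappa> a - dird b \<kappa> c\<bar> \<le> B * norm (a - c)" for b by (rule lip[OF test_fn_dird[OF \<kappa>]])
 then obtain B1 where B1: "\<And>b. 0 \<le> B1 b" "\<And>b a c. \<bar>dird b \<kappa> a - dird b \<kappa> c\<bar> \<le> B1 b * norm (a - c)" by metis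
 have sm: "smooth \<kappa>" using \<kappa> by (simp add: test_fn_def)
 have "\<bar>dird v \<kappa> a - dird v \<kappa> c\<bar> \<le> (\<Sum>b\<in>Basis. B1 b) * norm (a - c) * norm v" for v a c
 proof -
  have "dird v \<kappa> a - dird v \<kappa> c = (\<Sum>b\<in>Basis. (v \<bullet> b) * (dird b \<kappa> a - dird b \<kappa> c))"
   by (subst (1 2) dird_Basis[OF sm]) (simp add: sum_subtractf right_diff_distrib)
  also have "\<bar>\<dots>\<bar> \<le> (\<Sum>b\<in>Basis. \<bar>v \<bullet> b\<bar> * \<bar>dird b \<kappa> a - dird b \<kappa> c\<bar>)"
   unfolding abs_mult[symmetric] by (rule sum_abs)
  also have "\<dots> \<le> (\<Sum>b\<in>Basis. norm v * (B1 b * norm (a - c)))"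
   by (intro sum_mono mult_mono B1 Basis_le_norm) auto
  finally show ?thesis by (simp add: sum_distrib_left sum_distrib_right mult_ac)
 qed
 note d = this
 show thesis
 proof (rule that[of "B0 + (\<Sum>b\<in>Basis. B1 b)"])
  have s: "0 \<le> (\<Sum>b\<in>Basis. B1 b)" using B1(1) by (intro sum_nonneg)
  then show "0 \<le> B0 + (\<Sum>b\<in>Basis. B1 b)" using B0(1) by simp
  show "\<bar>\<kappa> a - \<kappa> b\<bar> \<le> (B0 + (\<Sum>b\<in>Basis. B1 b)) * norm (a - b)" for a b
   by (rule order_trans[OF B0(2)]) (use s in \<open>auto intro!: mult_right_mono\<close>)
  show "\<bar>dird v \<kappa> a - dird v \<kappa> b\<bar> \<le> (B0 + (\<Sum>b\<in>Basis. B1 b)) * norm (a - b) * norm v" for v a b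
   by (rule order_trans[OF d]) (use B0(1) in \<open>auto intro!: mult_right_mono\<close>)
 qed
qed

text \<open>A finite cover by small balls made disjoint; the sample points y serve Riemann-type
  sums.\<close>

lemma finite_partition:
 fixes S :: "'a::euclidean_space set"
 assumes "bounded S" "0 < d"
 obtains m :: nat and A :: "nat \<Rightarrow> 'a set" and y :: "nat \<Rightarrow> 'a"
 where "\<And>k. A k \<in> sets borel" "\<And>x. x \<in> S ==> (\<Sum>k<m. indicator (A k) x) = (1::real)" "\<And>k x. x \<in> A k ==> norm (x - y k) < d"
proof -
 have "\<exists>D. finite D \<and> closure S \<subseteq> (\<Union>c\<in>D. ball c d)"
 proof -
  have c: "compact (closure S)" using assms(1) by (simp add: compact_closure)
  obtain D where "D \<subseteq> closure S" "finite D" "closure S \<subseteq> (\<Union>c\<in>D. ball c d)"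
   by (rule compactE_image[OF c, of "closure S" "%c. ball c d"]) (use assms(2) in auto)
  then show ?thesis by blast
 qed
 then obtain D where D: "finite D" "closure S \<subseteq> (\<Union>c\<in>D. ball c d)" by blast
 obtain y where y: "bij_betw y {..<card D} D" using ex_bij_betw_nat_finite[OF D(1)] by (auto simp: atLeast0LessThan)
 define m where "m = card D"
 define A where "A k = ball (y k) d - (\<Union>i<k. ball (y i) d)" for k
 show thesis
 proof (rule that[of A m y])
  show "A k \<in> sets borel" for k unfolding A_def by (intro sets.Diff borel_open open_UN) auto
  show "norm (x - y k) < d" if "x \<in> A k" for k x using that by (auto simp: A_def dist_norm norm_minus_commute)
  fix x assume "x \<in> S"
  then have "x \<in> (\<Union>c\<in>D. ball c d)" using D(2) closure_subset by blast
  then obtain c where c: "c \<in> D" "x \<in> ball c d" by auto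
  have "c \<in> y ` {..<card D}" using c(1) bij_betw_imp_surj_on[OF y] by simp
  then have ex: "\<exists>k. k < m \<and> x \<in> ball (y k) d" using c(2) by (auto simp: m_def)
  define k where "k = (LEAST k. k < m \<and> x \<in> ball (y k) d)"
  have k: "k < m" "x \<in> ball (y k) d" using LeastI_ex[OF ex] by (auto simp: k_def)
  have min: "x \<notin> ball (y i) d" if "i < k" for i
  proof
   assume "x \<in> ball (y i) d"
   then have "k \<le> i" unfolding k_def using that k(1) by (intro Least_le) auto
   then show False using that by simp
  qed
  have "indicator (A j) x = (if j = k then 1 else 0 :: real)" if "j < m" for j
  proof (cases j k rule: linorder_cases)
   case less then show ?thesis using min by (auto simp: A_def)
  next
   case equal then show ?thesis using k min by (auto simp: A_def)
  next
   case greater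
   then have "x \<notin> A j" using k unfolding A_def by blast
   then show ?thesis using greater by simp
  qed
  then have "(\<Sum>j<m. indicator (A j) x) = (\<Sum>j<m. if j = k then 1 else 0 :: real)" by (intro sum.cong) auto
  then show "(\<Sum>j<m. indicator (A j) x) = (1::real)" using k(1) by simp
 qed
qed

text \<open>The sums of a_k \<kappa>(. - y_k), with a_k the integral of g over a small cell,
  converge to the convolution together with first derivatives. The functional commutes with finite
  sums and is C^1-continuous, so it passes under the integral without integrating function-valued
  maps.\<close>

lemma C1_functional_convolution:
 fixes \<Lambda> :: "('a::euclidean_space \<Rightarrow> real) \<Rightarrow> real" and g :: "'a \<Rightarrow> real"
 assumes "C1_functional \<Lambda> C" and C: "0 \<le> C" and \<kappa>: "test_fn \<kappa>" and g: "integrable lebesgue g"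
  and S: "bounded S" "\<And>y. y \<notin> S ==> g y = 0"
 shows "\<Lambda> (convolution \<kappa> g) = (LINT y|lebesgue. \<Lambda> (%z. \<kappa> (z - y)) * g y)"
proof -
 interpret C1_functional \<Lambda> C by fact
 have sm: "smooth \<kappa>" using \<kappa> by (simp add: test_fn_def)
 define \<theta> where "\<theta> y = \<Lambda> (%z. \<kappa> (z - y))" for y
 obtain B where B: "0 \<le> B" "\<And>a b. \<bar>\<kappa> a - \<kappa> b\<bar> \<le> B * norm (a - b)"
  "\<And>v a b. \<bar>dird v \<kappa> a - dird v \<kappa> b\<bar> \<le> B * norm (a - b) * norm v"
  using test_fn_translate_diff[OF \<kappa>] by metis
 obtain M1 where M1: "0 \<le> M1" "\<And>x. \<bar>\<kappa> x\<bar> \<le> M1" using test_fn_bounded[OF \<kappa>] by metis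
 obtain M2 where M2: "0 \<le> M2" "\<And>x v. \<bar>dird v \<kappa> x\<bar> \<le> M2 * norm v" using test_fn_dird_bounded[OF \<kappa>] by metis
 have t: "test_fn (%z. \<kappa> (z - y))" for y by (rule test_fn_translate[OF \<kappa>])
 have \<theta>_bd: "\<bar>\<theta> y\<bar> \<le> C * (M1 + M2)" for y
 proof -
  have "norm (\<theta> y) \<le> C * (M1 + M2)"
   unfolding \<theta>_def
  proof (rule bound[OF t])
   show "\<bar>\<kappa> (x - y)\<bar> \<le> M1 + M2" for x using M1(2)[of "x - y"] M2(1) by linarith
   show "\<bar>dird v (%z. \<kappa> (z - y)) x\<bar> \<le> (M1 + M2) * norm v" for x v
    unfolding dird_translate[OF sm] by (rule order_trans[OF M2(2)]) (use M1(1) in \<open>auto intro!: mult_right_mono\<close>)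
  qed
  then show ?thesis by simp
 qed
 have \<theta>_lip: "\<bar>\<theta> y - \<theta> y'\<bar> \<le> C * (B * norm (y - y'))" for y y'
 proof -
  have "\<Lambda> (%z. \<kappa> (z - y) + (- 1) * \<kappa> (z - y')) = \<theta> y - \<theta> y'"
   using add[OF t test_fn_cmult[OF t], of y "-1" y'] scale[OF t, of "-1" y'] by (simp add: \<theta>_def)
  moreover have "norm (\<Lambda> (%z. \<kappa> (z - y) + (- 1) * \<kappa> (z - y'))) \<le> C * (B * norm (y - y'))"
  proof (rule bound[OF test_fn_add[OF t test_fn_cmult[OF t]]])
   show "\<bar>\<kappa> (x - y) + - 1 * \<kappa> (x - y')\<bar> \<le> B * norm (y - y')" for x
    using B(2)[of "x - y" "x - y'"] by (simp add: norm_minus_commute)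
   have "((%z. \<kappa> (z - y) + - 1 * \<kappa> (z - y')) has_derivative
     (%v. dird v (%z. \<kappa> (z - y)) x + - 1 * dird v (%z. \<kappa> (z - y')) x)) (at x)" for x
    by (intro has_derivative_add has_derivative_mult_right smooth_has_derivative t[unfolded test_fn_def, THEN conjunct1])
   then have "dird v (%z. \<kappa> (z - y) + - 1 * \<kappa> (z - y')) x = dird v \<kappa> (x - y) - dird v \<kappa> (x - y')" for v x
    by (subst frechet_derivative_at[symmetric]) (auto simp: dird_translate[OF sm])
   then show "\<bar>dird v (%z. \<kappa> (z - y) + - 1 * \<kappa> (z - y')) x\<bar> \<le> B * norm (y - y') * norm v" for x v
    using B(3)[where v=v and a="x - y" and b="x - y'"] by (simp add: norm_minus_commute)
  qed
  ultimately show ?thesis by simp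
 qed
 have \<theta>_meas: "\<theta> \<in> borel_measurable borel"
  using smooth_borel[OF smooth_translate[OF \<kappa>]] by (simp add: \<theta>_def[abs_def])
 let ?I = "LINT y|lebesgue. \<bar>g y\<bar>"
 have I0: "0 \<le> ?I" by (rule Bochner_Integration.integral_nonneg) simp
 have close: "\<bar>\<Lambda> (convolution \<kappa> g) - (LINT y|lebesgue. \<theta> y * g y)\<bar> \<le> 2 * (C * (B * d * ?I))" if d: "0 < d" for d
 proof -
  obtain m :: nat and A :: "nat \<Rightarrow> 'a set" and y :: "nat \<Rightarrow> 'a" where A: "\<And>k. A k \<in> sets borel" "\<And>x. x \<in> S ==> (\<Sum>k<m. indicator (A k) x) = (1::real)"
   "\<And>k x. x \<in> A k ==> norm (x - y k) < d"
   using finite_partition[OF S(1) d] by metis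
  define a where "a k = (LINT x|lebesgue. indicator (A k) x * g x)" for k
  have iA: "integrable lebesgue (%x. indicator (A k) x * g x)" for k
   using integrable_mult_indicator[of "A k" lebesgue g] A(1)[of k] g by simp
  \<comment> \<open>Cell-wise Riemann error for integrals against g. It is used three times: for the
    kernel, for its directional derivatives, and for \<open>\<theta>\<close>.\<close>
  have approx: "\<bar>(LINT x|lebesgue. f x * g x) - (\<Sum>k<m. a k * f (y k))\<bar> \<le> L * ?I"
   if f: "f \<in> borel_measurable borel" "\<And>x. \<bar>f x\<bar> \<le> F" and L: "\<And>x x'. norm (x - x') < d ==> \<bar>f x - f x'\<bar> \<le> L" for f F L
  proof -
   have fm: "f \<in> borel_measurable lebesgue" by (rule borel_measurable_lebesgueI[OF f(1)])
   have ifg: "integrable lebesgue (%x. f x * g x)"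
    using integrable_bounded_mult[OF fm f(2) g] by simp
   have ifA: "integrable lebesgue (%x. (f x - f (y k)) * (indicator (A k) x * g x))" for k
   proof -
    have "integrable lebesgue (%x. f x *\<^sub>R (indicator (A k) x * g x) - f (y k) *\<^sub>R (indicator (A k) x * g x))"
     by (intro Bochner_Integration.integrable_diff integrable_bounded_mult[OF fm f(2) iA]
      integrable_scaleR_right iA)
    then show ?thesis by (simp add: left_diff_distrib)
   qed
   have "f x * g x = (\<Sum>k<m. f x * (indicator (A k) x * g x))" for x
   proof (cases "x \<in> S")
    case True
    have "(\<Sum>k<m. f x * (indicator (A k) x * g x)) = f x * g x * (\<Sum>k<m. indicator (A k) x)"
     by (simp add: sum_distrib_left mult_ac)
    also have "\<dots> = f x * g x" by (simp only: A(2)[OF True] mult_1_right)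
    finally show ?thesis by (rule sym)
   qed (simp add: S(2))
   then have "(LINT x|lebesgue. f x * g x) - (\<Sum>k<m. a k * f (y k))
     = (LINT x|lebesgue. f x * g x) - (LINT x|lebesgue. (\<Sum>k<m. f (y k) * (indicator (A k) x * g x)))"
    unfolding a_def using iA by (subst Bochner_Integration.integral_sum) (auto simp: mult.commute)
   also have "\<dots> = (LINT x|lebesgue. f x * g x - (\<Sum>k<m. f (y k) * (indicator (A k) x * g x)))"
    using ifg iA by (subst Bochner_Integration.integral_diff) auto
   also have "\<bar>\<dots>\<bar> \<le> (LINT x|lebesgue. L * \<bar>g x\<bar>)"
    unfolding real_norm_def[symmetric]
   proof (rule Bochner_Integration.integral_norm_bound_integral)
    show "integrable lebesgue (%x. f x * g x - (\<Sum>k<m. f (y k) * (indicator (A k) x * g x)))"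
     using ifg iA by (intro Bochner_Integration.integrable_diff Bochner_Integration.integrable_sum integrable_mult_right)
    show "integrable lebesgue (%x. L * norm (g x))" using g by auto
    fix x
    show "norm (f x * g x - (\<Sum>k<m. f (y k) * (indicator (A k) x * g x))) \<le> L * norm (g x)"
    proof (cases "x \<in> S")
     case True
     have e1: "(\<Sum>k<m. indicator (A k) x * (f x * g x)) = f x * g x"
      by (simp only: sum_distrib_right[symmetric] A(2)[OF True] mult_1_left)
     have "f x * g x - (\<Sum>k<m. f (y k) * (indicator (A k) x * g x))
       = (\<Sum>k<m. indicator (A k) x * (f x * g x)) - (\<Sum>k<m. indicator (A k) x * (f (y k) * g x))"
      unfolding e1 by (simp add: mult_ac)
     also have "\<dots> = (\<Sum>k<m. indicator (A k) x * ((f x - f (y k)) * g x))"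
      by (simp add: sum_subtractf[symmetric] algebra_simps)
     also have "norm \<dots> \<le> (\<Sum>k<m. indicator (A k) x * (L * norm (g x)))"
     proof (rule order_trans[OF norm_sum sum_mono])
      fix k
      show "norm (indicator (A k) x * ((f x - f (y k)) * g x)) \<le> indicator (A k) x * (L * norm (g x))"
       using L[OF A(3)[of x k]] by (auto simp: indicator_def abs_mult intro!: mult_right_mono)
     qed
     also have "\<dots> = L * norm (g x)"
      by (simp only: sum_distrib_right[symmetric] A(2)[OF True] mult_1_left)
     finally show ?thesis .
    qed (simp add: S(2))
   qed
   finally show ?thesis by simp
  qed
  define G where "G z = (\<Sum>k<m. a k * \<kappa> (z - y k))" for z
  have tG: "test_fn G \<and> \<Lambda> G = (\<Sum>k<m. a k * \<theta> (y k)) \<and> (\<forall>v z. dird v G z = (\<Sum>k<m. a k * dird v \<kappa> (z - y k)))"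
  proof -
   have "test_fn (%z. \<Sum>k<j. a k * \<kappa> (z - y k)) \<and> \<Lambda> (%z. \<Sum>k<j. a k * \<kappa> (z - y k)) = (\<Sum>k<j. a k * \<theta> (y k)) \<and>
    (\<forall>v z. dird v (%z. \<Sum>k<j. a k * \<kappa> (z - y k)) z = (\<Sum>k<j. a k * dird v \<kappa> (z - y k)))" for j
   proof (induction j)
    case 0
    have z: "test_fn (%z::'a. 0)" by (simp add: test_fn_def smooth_const)
    have "((%z::'a. 0::real) has_derivative (%v. 0)) (at x)" for x by simp
    then have "dird v (%z::'a. 0::real) x = 0" for v x by (subst frechet_derivative_at[symmetric]) auto
    then show ?case using z scale[OF z, of 0] by simp
   next
    case (Suc j)
    let ?S = "%z. \<Sum>k<j. a k * \<kappa> (z - y k)"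
    have tS: "test_fn ?S" and tj: "test_fn (%z. a j * \<kappa> (z - y j))"
     using Suc by (auto intro: test_fn_cmult t)
    have "((%z. ?S z + a j * \<kappa> (z - y j)) has_derivative (%v. dird v ?S z + a j * dird v (%z. \<kappa> (z - y j)) z)) (at z)" for z
     by (intro has_derivative_add has_derivative_mult_right smooth_has_derivative
       tS[unfolded test_fn_def, THEN conjunct1] t[unfolded test_fn_def, THEN conjunct1])
    then have "dird v (%z. ?S z + a j * \<kappa> (z - y j)) z = dird v ?S z + a j * dird v \<kappa> (z - y j)" for v z
     by (subst frechet_derivative_at[symmetric]) (auto simp: dird_translate[OF sm])
    then show ?case
     using Suc test_fn_add[OF tS tj] add[OF tS tj] scale[OF t, of "a j" "y j"] by (simp add: \<theta>_def)
   qed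
   then show ?thesis unfolding G_def[abs_def] by blast
  qed
  have cs: "smooth (convolution \<kappa> g)" by (rule smooth_convolution[OF \<kappa> g])
  have ct: "test_fn (convolution \<kappa> g)"
  proof -
   obtain R1 where R1: "\<And>x. \<kappa> x \<noteq> 0 ==> norm x \<le> R1" using \<kappa> by (auto simp: test_fn_def bounded_iff)
   obtain R2 where R2: "\<And>x. x \<in> S ==> norm x \<le> R2" using S(1) by (auto simp: bounded_iff)
   have "norm x \<le> R1 + R2" if "convolution \<kappa> g x \<noteq> 0" for x
   proof (rule ccontr)
    assume n: "\<not> norm x \<le> R1 + R2"
    have z: "\<kappa> (x - y) * g y = 0" for y
     using R1[of "x - y"] R2[of y] S(2)[of y] n norm_triangle_ineq[of "x - y" y] by fastforce
    show False using that unfolding convolution_def real_scaleR_def z by simp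
   qed
   then have "bounded {x. convolution \<kappa> g x \<noteq> 0}" by (auto simp: bounded_iff)
   then show ?thesis using cs by (simp add: test_fn_def)
  qed
  have "\<Lambda> (convolution \<kappa> g) - \<Lambda> G = \<Lambda> (%z. convolution \<kappa> g z + (- 1) * G z)"
   using add[OF ct test_fn_cmult[of G "-1"]] scale[of G "-1"] tG by simp
  also have "norm \<dots> \<le> C * (B * d * ?I)"
  proof (rule bound[OF test_fn_add[OF ct test_fn_cmult]])
   show "test_fn G" using tG by blast
   show "\<bar>convolution \<kappa> g x + - 1 * G x\<bar> \<le> B * d * ?I" for x
   proof -
    have "\<bar>(LINT y|lebesgue. \<kappa> (x - y) * g y) - (\<Sum>k<m. a k * \<kappa> (x - y k))\<bar> \<le> B * d * ?I"
    proof (rule approx)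
     show "(%y. \<kappa> (x - y)) \<in> borel_measurable borel" by (rule test_fn_borel[OF test_fn_reflect[OF \<kappa>]])
     show "\<bar>\<kappa> (x - y)\<bar> \<le> M1" for y by (rule M1)
     fix y y' :: 'a assume "norm (y - y') < d"
     then have "B * norm (y - y') \<le> B * d" using B(1) by (intro mult_left_mono) auto
     then show "\<bar>\<kappa> (x - y) - \<kappa> (x - y')\<bar> \<le> B * d"
      using B(2)[of "x - y" "x - y'"] by (simp add: norm_minus_commute)
    qed
    then show ?thesis by (simp add: convolution_def G_def)
   qed
   show "\<bar>dird v (%z. convolution \<kappa> g z + - 1 * G z) x\<bar> \<le> B * d * ?I * norm v" for x v
   proof -
    have "((%z. convolution \<kappa> g z + - 1 * G z) has_derivative (%v. dird v (convolution \<kappa> g) x + - 1 * dird v G x)) (at x)"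
     using tG by (intro has_derivative_add has_derivative_mult_right smooth_has_derivative cs) (simp add: test_fn_def)
    then have "dird v (%z. convolution \<kappa> g z + - 1 * G z) x = dird v (convolution \<kappa> g) x - dird v G x"
     by (subst frechet_derivative_at[symmetric]) auto
    also have "\<dots> = (LINT y|lebesgue. dird v \<kappa> (x - y) * g y) - (\<Sum>k<m. a k * dird v \<kappa> (x - y k))"
     using tG dird_convolution[OF \<kappa> g, where w=v and x=x] by (simp add: convolution_def)
    also have "\<bar>\<dots>\<bar> \<le> (B * d * norm v) * ?I"
    proof (rule approx)
     show "(%y. dird v \<kappa> (x - y)) \<in> borel_measurable borel"
      by (rule test_fn_borel[OF test_fn_reflect[OF test_fn_dird[OF \<kappa>]]])
     show "\<bar>dird v \<kappa> (x - y)\<bar> \<le> M2 * norm v" for y by (rule M2)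
     fix y y' :: 'a assume "norm (y - y') < d"
     then have "B * norm (y - y') * norm v \<le> B * d * norm v" using B(1) by (intro mult_left_mono mult_right_mono) auto
     then show "\<bar>dird v \<kappa> (x - y) - dird v \<kappa> (x - y')\<bar> \<le> B * d * norm v"
      using B(3)[where v=v and a="x - y" and b="x - y'"] by (simp add: norm_minus_commute)
    qed
    finally show ?thesis by (simp add: mult_ac)
   qed
  qed
  finally have 1: "\<bar>\<Lambda> (convolution \<kappa> g) - (\<Sum>k<m. a k * \<theta> (y k))\<bar> \<le> C * (B * d * ?I)" using tG by simp
  have 2: "\<bar>(LINT y|lebesgue. \<theta> y * g y) - (\<Sum>k<m. a k * \<theta> (y k))\<bar> \<le> (C * (B * d)) * ?I"
  proof (rule approx[OF \<theta>_meas \<theta>_bd])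
   fix y y' :: 'a assume "norm (y - y') < d"
   then have "C * (B * norm (y - y')) \<le> C * (B * d)" using B(1) C by (intro mult_left_mono) auto
   then show "\<bar>\<theta> y - \<theta> y'\<bar> \<le> C * (B * d)" using \<theta>_lip[of y y'] by linarith
  qed
  show ?thesis using 1 2 by (simp add: mult_ac)
 qed
 have "\<bar>\<Lambda> (convolution \<kappa> g) - (LINT y|lebesgue. \<theta> y * g y)\<bar> \<le> 0"
 proof (rule field_le_epsilon)
  fix e :: real assume e: "0 < e"
  \<comment> \<open>The mesh that makes the error at most e; the added 1 keeps the denominator
    positive when C, B or the integral of |g| vanishes.\<close>
  define d where "d = e / (2 * C * B * ?I + 1)"
  have den: "0 < 2 * C * B * ?I + 1" using C B(1) I0 by (intro add_nonneg_pos mult_nonneg_nonneg) auto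
  have "\<bar>\<Lambda> (convolution \<kappa> g) - (LINT y|lebesgue. \<theta> y * g y)\<bar> \<le> 2 * (C * (B * d * ?I))"
   by (rule close) (use e den in \<open>simp add: d_def\<close>)
  also have "\<dots> = (2 * C * B * ?I) / (2 * C * B * ?I + 1) * e" by (simp add: d_def)
  also have "\<dots> \<le> 1 * e" using den e by (intro mult_right_mono) (auto simp: divide_le_eq)
  finally show "\<bar>\<Lambda> (convolution \<kappa> g) - (LINT y|lebesgue. \<theta> y * g y)\<bar> \<le> 0 + e" by simp
 qed
 then show ?thesis by (simp add: \<theta>_def)
qed

subsection \<open>The uniform bound for the smoothing operators\<close>

context parabolic
begin

text \<open>The mollifier is at most C h^(-N) and vanishes off the ball of radius h, which brings
  convolutions into the form treated by \<open>average_bounded\<close>.\<close>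

lemma convolution_average:
 obtains C where "0 < C" "\<And>h z (g :: real \<times> (real^'n) \<Rightarrow> 'c::euclidean_space). 0 < h ==> integrable (lebesgue_on Q) g ==>
  norm (convolution (mollifier h) (zero_ext Q g) z) \<le>
   C * ((LINT y|lebesgue_on Q. indicator (ball z (1 * h)) y * norm (g y)) / h ^ DIM(real \<times> (real^'n)))"
proof -
 obtain C where C: "C > 0" "\<And>h (x::real \<times> (real^'n)). 0 < h ==> \<bar>mollifier h x\<bar> \<le> C / h ^ DIM(real \<times> (real^'n))"
  using mollifier_bound[where 'a="real \<times> (real^'n)"] by metis
 show thesis
 proof (rule that[OF C(1)])
  fix h :: real and z and g :: "real \<times> (real^'n) \<Rightarrow> 'c"
  assume h: "0 < h" and g: "integrable (lebesgue_on Q) g"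
  let ?N = "DIM(real \<times> (real^'n))"
  have m: "test_fn (mollifier h :: real \<times> (real^'n) \<Rightarrow> real)" by (rule test_fn_mollifier[OF h])
  have "norm (convolution (mollifier h) (zero_ext Q g) z) \<le> (LINT y|lebesgue. \<bar>mollifier h (z - y)\<bar> * norm (zero_ext Q g y))"
   by (rule norm_convolution_le[OF m integrable_zero_ext[OF Q_sets g]])
  also have "\<dots> = (LINT y|lebesgue. \<bar>mollifier h (z - y)\<bar> * zero_ext Q (%y. norm (g y)) y)"
   by (intro Bochner_Integration.integral_cong) (auto simp: zero_ext_def)
  also have "\<dots> = (LINT y|lebesgue_on Q. norm (g y) * \<bar>mollifier h (z - y)\<bar>)"
   by (rule integral_zero_ext_mult[OF Q_sets])
  also have "\<dots> \<le> (LINT y|lebesgue_on Q. C / h ^ ?N * (indicator (ball z h) y * norm (g y)))"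
  proof (rule integral_mono_AE')
   show "integrable (lebesgue_on Q) (%y. C / h ^ ?N * (indicator (ball z h) y * norm (g y)))"
    by (intro integrable_mult_right integrable_indicator_mult integrable_norm g) auto
   have "norm (g y) * \<bar>mollifier h (z - y)\<bar> \<le> C / h ^ ?N * (indicator (ball z h) y * norm (g y))" for y
   proof (cases "y \<in> ball z h")
    case True
    then show ?thesis using mult_left_mono[OF C(2)[OF h, of "z - y"], of "norm (g y)"] by (simp add: mult.commute)
   next
    case False
    then show ?thesis using mollifier_eq_0[OF h, of "z - y"] by (simp add: dist_norm)
   qed
   then show "AE y in lebesgue_on Q. norm (g y) * \<bar>mollifier h (z - y)\<bar> \<le> C / h ^ ?N * (indicator (ball z h) y * norm (g y))"
    by simp
   show "AE y in lebesgue_on Q. 0 \<le> C / h ^ ?N * (indicator (ball z h) y * norm (g y))" using C(1) h by simp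
  qed
  finally show "norm (convolution (mollifier h) (zero_ext Q g) z) \<le>
   C * ((LINT y|lebesgue_on Q. indicator (ball z (1 * h)) y * norm (g y)) / h ^ ?N)" by simp
 qed
qed

text \<open>The value of the smoothed function is dominated by averages of |v|. Its gradient is
  dominated by averages of |\<epsilon>(v)| alone: where the gradient of eta_h is nonzero,
  \<open>strip_average\<close> exchanges |v| for h |\<epsilon>(v)|. Both are then covered by
  \<open>average_bounded\<close>.\<close>

lemma uniform_bound:
 assumes bse: "boundary_strip_estimate \<Omega> h0 c0" and c0: "0 < c0"
 shows "\<exists>c>0. \<forall>v\<in>X. \<forall>h. 0 < h \<and> h < h0 / 4 \<longrightarrow> N (R_star T \<Omega> h v) \<le> c * N v"
proof -
 let ?N = "DIM(real \<times> (real^'n))" and ?n = "real CARD('n)"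
 let ?av = "%z r g. (LINT y|lebesgue_on Q. indicator (ball z r) y * norm (g y))"
 obtain C1 where C1: "0 < C1" "\<And>h z (g :: real \<times> (real^'n) \<Rightarrow> real^'n). 0 < h ==> integrable (lebesgue_on Q) g ==>
  norm (convolution (mollifier h) (zero_ext Q g) z) \<le>
   C1 * ((LINT y|lebesgue_on Q. indicator (ball z (1 * h)) y * norm (g y)) / h ^ ?N)"
  by (rule convolution_average[where 'c="real^'n"], rule that)
 obtain C2 where C2: "0 < C2" "\<And>h z (g :: real \<times> (real^'n) \<Rightarrow> real). 0 < h ==> integrable (lebesgue_on Q) g ==>
  norm (convolution (mollifier h) (zero_ext Q g) z) \<le>
   C2 * ((LINT y|lebesgue_on Q. indicator (ball z (1 * h)) y * norm (g y)) / h ^ ?N)"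
  by (rule convolution_average[where 'c=real], rule that)
 define R3 where "R3 C \<longleftrightarrow> (\<forall>(G0::(real^'n) set) h x v. open G0 \<and> bounded G0 \<and> 0 < h \<longrightarrow> \<bar>dird v (cutoff G0 h) x\<bar> \<le> C / h * norm v)" for C
 have "\<exists>C>0. R3 C" unfolding R3_def by (rule dird_cutoff_bound)
 then obtain C3 where C3': "C3 > 0" "R3 C3" by blast
 have C3: "C3 > 0" "\<And>h x v. 0 < h ==> \<bar>dird v (cutoff \<Omega> h) x\<bar> \<le> C3 / h * norm v"
  using C3'(1) C3'(2)[unfolded R3_def, rule_format, of \<Omega>] open_\<Omega> bounded_\<Omega> by auto
 define RA where "RA A \<longleftrightarrow> (\<forall>u\<in>X. \<forall>h z. 0 < h \<and> 4 * h \<le> h0 \<and> z \<in> Q \<and> bdist \<Omega> (snd z) \<le> 3 * h \<longrightarrow>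
  ?av z h u \<le> A * h * ?av z (10 * h) (\<epsilon> u))" for A
 have "\<exists>A\<ge>0. RA A" unfolding RA_def by (rule strip_average[OF bse c0])
 then obtain A where A': "A \<ge> 0" "RA A" by blast
 have A: "0 \<le> A" "\<And>u h z. u \<in> X ==> 0 < h ==> 4 * h \<le> h0 ==> z \<in> Q ==> bdist \<Omega> (snd z) \<le> 3 * h ==>
  ?av z h u \<le> A * h * ?av z (10 * h) (\<epsilon> u)"
  using A'(1) A'(2)[unfolded RA_def, rule_format] by auto
 \<comment> \<open>\<open>C2\<close> stems from the mollified gradient. In
   \<open>C1 * A * C3\<close> the h from the strip average has cancelled the 1/h from the gradient
   of the cut-off; the two factors \<open>?n\<close> pass from entries to the matrix norm.\<close>
 define B where "B = ?n * (?n * (C2 + C1 * A * C3))"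
 have B0: "0 \<le> B" using C1(1) C2(1) C3(1) A(1) by (simp add: B_def)
 define RQ where "RQ K \<longleftrightarrow> (\<forall>h>0. \<forall>(g :: real \<times> (real^'n) \<Rightarrow> real^'n) (f :: real \<times> (real^'n) \<Rightarrow> real^'n).
   g \<in> Lp_space Q q \<longrightarrow> f \<in> borel_measurable (lebesgue_on Q) \<longrightarrow>
   (AE x in lebesgue_on Q. norm (f x) \<le> C1 * (?av x (1 * h) g / h ^ ?N)) \<longrightarrow> Lp_norm Q q f \<le> K * Lp_norm Q q g)" for K
 have "\<exists>K\<ge>1. RQ K" unfolding RQ_def by (rule q.average_bounded) (use C1(1) in auto)
 then obtain Kq where Kq': "Kq \<ge> 1" "RQ Kq" by blast
 note Kq = Kq'(1)
 define RP where "RP K \<longleftrightarrow> (\<forall>h>0. \<forall>(g :: real \<times> (real^'n) \<Rightarrow> real^'n^'n) (f :: real \<times> (real^'n) \<Rightarrow> real^'n^'n).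
   g \<in> Lp_space Q p \<longrightarrow> f \<in> borel_measurable (lebesgue_on Q) \<longrightarrow>
   (AE x in lebesgue_on Q. norm (f x) \<le> B * (?av x (10 * h) g / h ^ ?N)) \<longrightarrow> Lp_norm Q p f \<le> K * Lp_norm Q p g)" for K
 have "\<exists>K\<ge>1. RP K" unfolding RP_def by (rule p.average_bounded) (use B0 in auto)
 then obtain Kp where Kp': "Kp \<ge> 1" "RP Kp" by blast
 note Kp = Kp'(1)
 have "N (R_star T \<Omega> h v) \<le> (Kq + Kp) * N v" if v: "v \<in> X" and h: "0 < h" "h < h0 / 4" for v h
 proof -
  note int = X_integrable(1,2)[OF v]
  let ?W = "smoothed h v"
  have avn: "0 \<le> ?av z r g" for z r and g :: "real \<times> (real^'n) \<Rightarrow> 'c::euclidean_space"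
   by (intro Bochner_Integration.integral_nonneg) auto
  note S = st.smooth_eps_space[OF smooth_smoothed[OF h(1) int(1)], of "R_star T \<Omega> h v", OF _ bounded_Q]
  have RW: "R_star T \<Omega> h v z = ?W z" if "z \<in> Q" for z using that by (simp add: R_star_eq zero_ext_def)
  have \<eta>: "\<bar>cutoff \<Omega> h x\<bar> \<le> 1" for x
   using cutoff_nonneg[OF open_\<Omega> bounded_\<Omega> h(1), of x] cutoff_le_1[OF open_\<Omega> bounded_\<Omega> h(1), of x] by simp
  have "Lp_norm Q q ?W \<le> Kq * Lp_norm Q q v"
  proof (rule Kq'(2)[unfolded RQ_def, rule_format, OF h(1)])
   show "v \<in> Lp_space Q q" by (rule X_D(1)[OF v])
   show "?W \<in> borel_measurable (lebesgue_on Q)" by (rule q.Lp_space_measurable[OF S(5)[OF RW]])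
   show "AE z in lebesgue_on Q. norm (?W z) \<le> C1 * (?av z (1 * h) v / h ^ ?N)"
   proof (rule AE_I2)
   fix z
   have "norm (?W z) \<le> 1 * norm (convolution (mollifier h) (zero_ext Q v) z)"
    unfolding smoothed_def norm_scaleR by (intro mult_right_mono \<eta>) auto
   also have "\<dots> \<le> C1 * (?av z (1 * h) v / h ^ ?N)" using C1(2)[OF h(1) int(1), of z] by simp
   finally show "norm (?W z) \<le> C1 * (?av z (1 * h) v / h ^ ?N)" .
   qed
  qed
  moreover have "Lp_norm Q p (classical_sym_grad st_dir ?W) \<le> Kp * Lp_norm Q p (\<epsilon> v)"
  proof (rule Kp'(2)[unfolded RP_def, rule_format, OF h(1)])
   show "\<epsilon> v \<in> Lp_space Q p" by (rule X_D(2)[OF v])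
   show "classical_sym_grad st_dir ?W \<in> borel_measurable (lebesgue_on Q)" by (rule p.Lp_space_measurable[OF S(4)[OF RW]])
   show "AE z in lebesgue_on Q. norm (classical_sym_grad st_dir ?W z) \<le> B * (?av z (10 * h) (\<epsilon> v) / h ^ ?N)"
   proof (rule AE_I2)
   fix z assume "z \<in> space (lebesgue_on Q)"
   then have z: "z \<in> Q" by simp
   let ?a = "?av z (10 * h) (\<epsilon> v)"
   let ?w = "convolution (mollifier h) (zero_ext Q v) z"
   have entry: "\<bar>classical_sym_grad st_dir ?W z $ i $ j\<bar> \<le> (C2 + C1 * A * C3) * (?a / h ^ ?N)" for i j
   proof -
    have iij: "integrable (lebesgue_on Q) (%z. \<epsilon> v z $ i $ j)"
     using integrable_bounded_linear[OF bounded_linear_vec_nth integrable_bounded_linear[OF bounded_linear_vec_nth int(2)]] .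
    have "\<bar>cutoff \<Omega> h (snd z) * convolution (mollifier h) (zero_ext Q (%z. \<epsilon> v z $ i $ j)) z\<bar>
      \<le> 1 * (C2 * (?av z (1 * h) (%z. \<epsilon> v z $ i $ j) / h ^ ?N))"
     unfolding abs_mult using C2(2)[OF h(1) iij, of z] by (intro mult_mono \<eta>) auto
    also have "?av z (1 * h) (%z. \<epsilon> v z $ i $ j) \<le> ?a"
    proof (rule integral_mono_AE')
     show "integrable (lebesgue_on Q) (%y. indicator (ball z (10 * h)) y * norm (\<epsilon> v y))"
      by (intro integrable_indicator_mult integrable_norm int) auto
     have "norm (M $ i $ j) \<le> norm M" for M :: "real^'n^'n"
      using order_trans[OF Finite_Cartesian_Product.norm_nth_le[of "M $ i" j] Finite_Cartesian_Product.norm_nth_le[of M i]] .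
     moreover have "ball z h \<subseteq> ball z (10 * h)" using h(1) by auto
     ultimately have "indicator (ball z (1 * h)) y * norm (\<epsilon> v y $ i $ j) \<le> indicator (ball z (10 * h)) y * norm (\<epsilon> v y)" for y
      by (auto simp: indicator_def)
     then show "AE y in lebesgue_on Q. indicator (ball z (1 * h)) y * norm (\<epsilon> v y $ i $ j) \<le> indicator (ball z (10 * h)) y * norm (\<epsilon> v y)"
      by simp
    qed auto
    finally have t1: "\<bar>cutoff \<Omega> h (snd z) * convolution (mollifier h) (zero_ext Q (%z. \<epsilon> v z $ i $ j)) z\<bar> \<le> C2 * (?a / h ^ ?N)"
     using C2(1) h(1) by (simp add: divide_right_mono mult_left_mono)
    have t2: "\<bar>?w $ k * dird (axis l 1) (cutoff \<Omega> h) (snd z)\<bar> \<le> C1 * A * C3 * (?a / h ^ ?N)" for k l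
    proof (cases "dird (axis l 1) (cutoff \<Omega> h) (snd z) = 0")
     case True
     then show ?thesis using C1(1) A(1) C3(1) avn[of z "10 * h" "\<epsilon> v"] h(1) by simp
    next
     case False
     have b: "bdist \<Omega> (snd z) \<le> 3 * h" by (rule dird_cutoff_nonzeroD(3)[OF open_\<Omega> bounded_\<Omega> h(1) False])
     have "\<bar>?w $ k\<bar> \<le> norm ?w" by (rule component_le_norm_cart)
     also have "\<dots> \<le> C1 * (?av z h v / h ^ ?N)" using C1(2)[OF h(1) int(1), of z] by simp
     also have "\<dots> \<le> C1 * (A * h * ?a / h ^ ?N)"
      using A(2)[OF v h(1) _ z b] h C1(1) by (intro mult_left_mono divide_right_mono) auto
     finally have w: "\<bar>?w $ k\<bar> \<le> C1 * (A * h * ?a / h ^ ?N)" .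
     have "\<bar>dird (axis l 1) (cutoff \<Omega> h) (snd z)\<bar> \<le> C3 / h * norm (axis l 1 :: real^'n)" by (rule C3(2)[OF h(1)])
     then have "\<bar>dird (axis l 1) (cutoff \<Omega> h) (snd z)\<bar> \<le> C3 / h" by simp
     then have "\<bar>?w $ k\<bar> * \<bar>dird (axis l 1) (cutoff \<Omega> h) (snd z)\<bar> \<le> C1 * (A * h * ?a / h ^ ?N) * (C3 / h)"
      using w C1(1) A(1) avn[of z "10 * h" "\<epsilon> v"] h(1) by (intro mult_mono) auto
     also have "\<dots> = C1 * A * C3 * (?a / h ^ ?N)" using h(1) by (simp add: field_simps)
     finally show ?thesis by (simp add: abs_mult)
    qed
    have eqn: "classical_sym_grad st_dir ?W z $ i $ j = cutoff \<Omega> h (snd z) * convolution (mollifier h) (zero_ext Q (%z. \<epsilon> v z $ i $ j)) z +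
     1/2 * (?w $ i * dird (axis j 1) (cutoff \<Omega> h) (snd z) + ?w $ j * dird (axis i 1) (cutoff \<Omega> h) (snd z))"
     by (simp add: classical_sym_grad_smoothed[OF v h(1)])
    have aux: "\<bar>a + 1/2 * (b + c)\<bar> \<le> M1 + M2" if "\<bar>a\<bar> \<le> M1" "\<bar>b\<bar> \<le> M2" "\<bar>c\<bar> \<le> M2" for a b c M1 M2 :: real
    proof -
     have "a \<le> M1" "- a \<le> M1" "b \<le> M2" "- b \<le> M2" "c \<le> M2" "- c \<le> M2" using that by (auto simp: abs_le_iff)
     then show ?thesis by (intro abs_leI) (simp_all add: field_simps)
    qed
    show ?thesis unfolding eqn distrib_right[of C2] by (rule aux[OF t1 t2 t2])
   qed
   have "norm (classical_sym_grad st_dir ?W z) \<le> ?n * (?n * ((C2 + C1 * A * C3) * (?a / h ^ ?N)))"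
    by (rule st.norm_matrix_le[OF entry])
   then show "norm (classical_sym_grad st_dir ?W z) \<le> B * (?a / h ^ ?N)" by (simp add: B_def mult_ac)
   qed
  qed
  ultimately have "N (R_star T \<Omega> h v) \<le> Kq * Lp_norm Q q v + Kp * Lp_norm Q p (\<epsilon> v)"
   unfolding X_st_norm_def using S(3)[OF RW] by simp
  also have "\<dots> \<le> (Kq + Kp) * Lp_norm Q q v + (Kq + Kp) * Lp_norm Q p (\<epsilon> v)"
   using Kq Kp q.Lp_norm_nonneg[OF X_D(1)[OF v]] p.Lp_norm_nonneg[OF X_D(2)[OF v]]
   by (intro add_mono mult_right_mono) auto
  finally show ?thesis by (simp add: N_eq distrib_left)
 qed
 then show ?thesis using Kq Kp by (intro exI[of _ "Kq + Kp"]) auto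
qed

end

section \<open>The dual space\<close>

lemma smooth_of_components:
 fixes g :: "'a::real_normed_vector \<Rightarrow> 'i::finite \<Rightarrow> real"
 assumes "\<And>i. smooth (%y. g y i)"
 shows "smooth (%y. \<Sum>i\<in>UNIV. g y i *\<^sub>R (axis i 1 :: real^'i))"
 by (intro smooth_sum smooth_scaleR assms smooth_const)

context parabolic
begin

section \<open>The dual norm over the seminormed space of representatives\<close>

abbreviation "DN \<equiv> X_dual_norm T \<Omega> q p"

lemma X_dualD:
 assumes "us \<in> X_dual T \<Omega> q p"
 shows "us \<in> extensional X" "u \<in> X ==> v \<in> X ==> us (%z. u z + v z) = us u + us v"
  "u \<in> X ==> us (%z. a *\<^sub>R u z) = a * us u"
 using assms by (auto simp: X_dual_def dual_space_def)

lemma X_dual_bounded: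
 assumes "us \<in> X_dual T \<Omega> q p"
 obtains C where "0 \<le> C" "\<And>u. u \<in> X ==> \<bar>us u\<bar> \<le> C * N u"
proof -
 have "\<exists>C. \<forall>u\<in>X. \<bar>us u\<bar> \<le> C * N u" using assms by (simp add: X_dual_def dual_space_def)
 then obtain C where C: "\<And>u. u \<in> X ==> \<bar>us u\<bar> \<le> C * N u" by blast
 have "\<bar>us u\<bar> \<le> max C 0 * N u" if "u \<in> X" for u
  using C[OF that] mult_right_mono[of C "max C 0" "N u"] N_nonneg[OF that] by simp
 then show thesis using that[of "max C 0"] by auto
qed

lemma zero_X: "(%z. 0) \<in> X"
 by (rule smooth_in_X[OF smooth_const[of 0], where K="{}"]) auto

lemma N_zero: "N (%z. 0) = 0"
 using N_scaleR[OF zero_X, of 0] by simp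

lemma dual_norm_le:
 assumes "0 \<le> c" "\<And>v. v \<in> X ==> \<bar>L v\<bar> \<le> c * N v"
 shows "DN L \<le> c"
 unfolding X_dual_norm_def dual_norm_def
proof (rule cSup_least)
 show "{\<bar>L u\<bar> |u. u \<in> X \<and> N u \<le> 1} \<noteq> {}" using zero_X N_zero by auto
 fix x assume "x \<in> {\<bar>L u\<bar> |u. u \<in> X \<and> N u \<le> 1}"
 then obtain u where u: "x = \<bar>L u\<bar>" "u \<in> X" "N u \<le> 1" by auto
 have "x \<le> c * N u" using assms(2)[OF u(2)] u(1) by simp
 also have "\<dots> \<le> c * 1" using u(3) assms(1) by (intro mult_left_mono)
 finally show "x \<le> c" by simp
qed

lemma dual_norm_ge:
 assumes C: "\<And>v. v \<in> X ==> \<bar>L v\<bar> \<le> C * N v" and u: "u \<in> X" "N u \<le> 1" and "0 \<le> C"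
 shows "\<bar>L u\<bar> \<le> DN L"
 unfolding X_dual_norm_def dual_norm_def
proof (rule cSup_upper)
 show "bdd_above {\<bar>L u\<bar> |u. u \<in> X \<and> N u \<le> 1}"
 proof (rule bdd_aboveI[of _ C])
  fix x assume "x \<in> {\<bar>L u\<bar> |u. u \<in> X \<and> N u \<le> 1}"
  then obtain w where w: "x = \<bar>L w\<bar>" "w \<in> X" "N w \<le> 1" by auto
  have "x \<le> C * N w" using C[OF w(2)] w(1) by simp
  also have "\<dots> \<le> C * 1" using w(3) assms(4) by (intro mult_left_mono)
  finally show "x \<le> C" by simp
 qed
qed (use u in auto)

lemma dual_norm_nonneg:
 assumes "\<And>v. v \<in> X ==> \<bar>L v\<bar> \<le> C * N v" "0 \<le> C" shows "0 \<le> DN L"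
 using dual_norm_ge[OF assms(1) zero_X _ assms(2)] N_zero by force

text \<open>If the seminorm of v vanishes, normalising is impossible, but boundedness already forces
  the functional to vanish at v.\<close>

lemma dual_le:
 assumes us: "us \<in> X_dual T \<Omega> q p" and v: "v \<in> X"
 shows "\<bar>us v\<bar> \<le> DN us * N v"
proof -
 obtain C where C: "0 \<le> C" "\<And>u. u \<in> X ==> \<bar>us u\<bar> \<le> C * N u" by (rule X_dual_bounded[OF us], rule that)
 show ?thesis
 proof (cases "N v = 0")
  case True
  then show ?thesis using C(2)[OF v] by simp
 next
  case False
  then have n: "0 < N v" using N_nonneg[OF v] by simp
  have "N (%z. inverse (N v) *\<^sub>R v z) \<le> 1" using N_scaleR[OF v, of "inverse (N v)"] n by simp
  from dual_norm_ge[OF C(2) X_scaleR[OF v] this C(1)]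
  have "\<bar>inverse (N v) * us v\<bar> \<le> DN us" by (simp add: X_dualD(3)[OF us v])
  then have "inverse (N v) * \<bar>us v\<bar> \<le> DN us" using n by (simp add: abs_mult)
  then show ?thesis using n by (simp add: field_simps)
 qed
qed

lemma X_dual_norm_nonneg: "us \<in> X_dual T \<Omega> q p ==> 0 \<le> DN us"
 by (erule X_dual_bounded) (rule dual_norm_nonneg)

text \<open>Members of X are total functions; altering values off the cylinder changes them by an
  element of seminorm 0, which functionals do not see.\<close>

lemma dual_cong:
 assumes us: "us \<in> X_dual T \<Omega> q p" and u: "u \<in> X" "u' \<in> X" and eq: "\<And>z. z \<in> Q ==> u z = u' z"
 shows "us u = us u'"
proof -
 obtain C where C: "0 \<le> C" "\<And>u. u \<in> X ==> \<bar>us u\<bar> \<le> C * N u" by (rule X_dual_bounded[OF us], rule that)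
 have "N (%z. u z - u' z) = Lp_norm Q q (%z. 0::real^'n) + Lp_norm Q p (classical_sym_grad st_dir (%z::real \<times> (real^'n). 0::real^'n))"
  unfolding X_st_norm_def by (rule st.smooth_eps_space(3)[OF smooth_const _ bounded_Q]) (simp add: eq)
 also have "classical_sym_grad st_dir (%z::real \<times> (real^'n). 0::real^'n) = (%z. 0)"
  by (auto simp: classical_sym_grad_def vec_eq_iff fun_eq_iff)
 finally have "N (%z. u z - u' z) = 0" by (simp add: q.Lp_norm_zero p.Lp_norm_zero)
 then have "us (%z. u z - u' z) = 0" using C(2)[OF X_diff[OF u]] by simp
 moreover have "us (%z. u z + (- 1) *\<^sub>R u' z) = us u + (- 1) * us u'"
  using X_dualD(2)[OF us u(1) X_scaleR[OF u(2)], of "- 1"] X_dualD(3)[OF us u(2), of "- 1"] by simp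
 ultimately show ?thesis by simp
qed

lemma dual_sum:
 assumes us: "us \<in> X_dual T \<Omega> q p" and u: "\<And>i. i \<in> I ==> u i \<in> X" and "finite I"
 shows "(%z. \<Sum>i\<in>I. u i z) \<in> X \<and> us (%z. \<Sum>i\<in>I. u i z) = (\<Sum>i\<in>I. us (u i))"
 using \<open>finite I\<close> u
proof (induction I rule: finite_induct)
 case empty
 have "us (%z. 0) = 0" using X_dualD(3)[OF us zero_X, of 0] by simp
 then show ?case using zero_X by simp
next
 case (insert i I)
 then show ?case using X_add[of "u i" "%z. \<Sum>i\<in>I. u i z"] X_dualD(2)[OF us, of "u i" "%z. \<Sum>i\<in>I. u i z"] by simp
qed

lemma R_op_dual_norm_le:
 assumes us: "us \<in> X_dual T \<Omega> q p" and h: "0 < h" and c: "0 \<le> c" "\<And>v. v \<in> X ==> N (R_star T \<Omega> h v) \<le> c * N v"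
 shows "DN (R_op T \<Omega> q p h us) \<le> c * DN us"
proof (rule dual_norm_le)
 show "0 \<le> c * DN us" using c(1) X_dual_norm_nonneg[OF us] by simp
 fix v assume v: "v \<in> X"
 have "\<bar>us (R_star T \<Omega> h v)\<bar> \<le> DN us * N (R_star T \<Omega> h v)" by (rule dual_le[OF us R_star_in_X[OF h v]])
 also have "\<dots> \<le> DN us * (c * N v)" by (intro mult_left_mono c(2)[OF v] X_dual_norm_nonneg[OF us])
 finally show "\<bar>R_op T \<Omega> q p h us v\<bar> \<le> c * DN us * N v" using v by (simp add: R_op_def mult_ac)
qed

subsection \<open>Functionals given by bounded densities\<close>

lemma integrable_inner_bounded:
 fixes f g :: "'a \<Rightarrow> 'b::euclidean_space"
 assumes "f \<in> borel_measurable M" "\<And>x. x \<in> space M ==> norm (f x) \<le> B" "integrable M g"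
 shows "integrable M (%x. f x \<bullet> g x)"
proof (rule Bochner_Integration.integrable_bound)
 show "integrable M (%x. B * norm (g x))" using assms(3) by auto
 show "AE x in M. norm (f x \<bullet> g x) \<le> norm (B * norm (g x))"
 proof (rule AE_I2)
  fix x assume x: "x \<in> space M"
  have "\<bar>f x \<bullet> g x\<bar> \<le> norm (f x) * norm (g x)" by (rule Cauchy_Schwarz_ineq2)
  also have "\<dots> \<le> B * norm (g x)" by (intro mult_right_mono assms(2) x) auto
  finally show "norm (f x \<bullet> g x) \<le> norm (B * norm (g x))" by simp
 qed
qed (use assms in auto)

text \<open>Linearity is not immediate, as \<open>\<epsilon>\<close> is a choice among
  representatives and hence linear only almost everywhere. Boundedness uses the embedding into
  L^1.\<close>

lemma J_in_X_dual:
 assumes f: "f \<in> borel_measurable (lebesgue_on Q)" "\<And>z. z \<in> Q ==> norm (f z) \<le> B"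
  and F: "F \<in> borel_measurable (lebesgue_on Q)" "\<And>z. z \<in> Q ==> norm (F z) \<le> B" and B: "0 \<le> B"
 shows "J_eps T \<Omega> q p f F \<in> X_dual T \<Omega> q p"
proof -
 let ?J = "J_eps T \<Omega> q p f F"
 have i1: "integrable (lebesgue_on Q) (%z. f z \<bullet> u z)" and i2: "integrable (lebesgue_on Q) (%z. F z \<bullet> \<epsilon> u z)" if "u \<in> X" for u
  using integrable_inner_bounded[OF f(1) _ X_integrable(1)[OF that], of B] f(2)
   integrable_inner_bounded[OF F(1) _ X_integrable(2)[OF that], of B] F(2) by auto
 have J: "?J u = (LINT z|lebesgue_on Q. f z \<bullet> u z) + (LINT z|lebesgue_on Q. F z \<bullet> \<epsilon> u z)" if "u \<in> X" for u
  using i1[OF that] i2[OF that] that by (simp add: J_eps_def)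
 have mE: "(%z. F z \<bullet> \<epsilon> u z) \<in> borel_measurable (lebesgue_on Q)" if "u \<in> X" for u using i2[OF that] by auto
 have "?J (%z. u z + v z) = ?J u + ?J v" if u: "u \<in> X" and v: "v \<in> X" for u v
 proof -
  have "(LINT z|lebesgue_on Q. F z \<bullet> \<epsilon> (%z. u z + v z) z) = (LINT z|lebesgue_on Q. F z \<bullet> \<epsilon> u z + F z \<bullet> \<epsilon> v z)"
  proof (rule integral_cong_AE)
   show "AE z in lebesgue_on Q. F z \<bullet> \<epsilon> (%z. u z + v z) z = F z \<bullet> \<epsilon> u z + F z \<bullet> \<epsilon> v z"
    using st.eps_space_add(2)[OF X_eps_space[OF u] X_eps_space[OF v]] by eventually_elim (simp add: inner_add_right)
  qed (use mE[OF X_add[OF u v]] mE[OF u] mE[OF v] in auto)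
  then show ?thesis using J[OF u] J[OF v] J[OF X_add[OF u v]] i1[OF u] i1[OF v] i2[OF u] i2[OF v]
   by (simp add: inner_add_right)
 qed
 moreover have "?J (%z. a *\<^sub>R u z) = a * ?J u" if u: "u \<in> X" for a u
 proof -
  have "(LINT z|lebesgue_on Q. F z \<bullet> \<epsilon> (%z. a *\<^sub>R u z) z) = (LINT z|lebesgue_on Q. a * (F z \<bullet> \<epsilon> u z))"
  proof (rule integral_cong_AE)
   show "AE z in lebesgue_on Q. F z \<bullet> \<epsilon> (%z. a *\<^sub>R u z) z = a * (F z \<bullet> \<epsilon> u z)"
    using st.eps_space_scaleR(2)[OF X_eps_space[OF u], of a] by eventually_elim simp
  qed (use mE[OF X_scaleR[OF u, of a]] mE[OF u] in auto)
  then show ?thesis using J[OF u] J[OF X_scaleR[OF u, of a]] by (simp add: distrib_left)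
 qed
 moreover have "\<bar>?J u\<bar> \<le> (2 * (B * (1 + q.vol))) * N u" if u: "u \<in> X" for u
 proof -
  have b: "\<bar>LINT z|lebesgue_on Q. g z \<bullet> w z\<bar> \<le> B * (LINT z|lebesgue_on Q. norm (w z))"
   if "integrable (lebesgue_on Q) (%z. g z \<bullet> w z)" "integrable (lebesgue_on Q) w" "\<And>z. z \<in> Q ==> norm (g z) \<le> B"
   for g w :: "real \<times> (real^'n) \<Rightarrow> 'c::euclidean_space"
  proof -
   have "norm (LINT z|lebesgue_on Q. g z \<bullet> w z) \<le> (LINT z|lebesgue_on Q. B * norm (w z))"
   proof (rule Bochner_Integration.integral_norm_bound_integral[OF that(1)])
    fix z assume "z \<in> space (lebesgue_on Q)"
    then have "norm (g z) * norm (w z) \<le> B * norm (w z)" using that(3) by (intro mult_right_mono) auto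
    then show "norm (g z \<bullet> w z) \<le> B * norm (w z)" using Cauchy_Schwarz_ineq2[of "g z" "w z"] by simp
   qed (use that(2) in auto)
   then show ?thesis by simp
  qed
  have "\<bar>?J u\<bar> \<le> B * (LINT z|lebesgue_on Q. norm (u z)) + B * (LINT z|lebesgue_on Q. norm (\<epsilon> u z))"
   unfolding J[OF u] using b[OF i1[OF u] X_integrable(1)[OF u] f(2)] b[OF i2[OF u] X_integrable(2)[OF u] F(2)] by linarith
  also have "\<dots> \<le> B * ((1 + q.vol) * N u) + B * ((1 + q.vol) * N u)"
   by (intro add_mono mult_left_mono X_integrable(3,4)[OF u] B)
  finally show ?thesis by (simp add: algebra_simps)
 qed
 moreover have "?J \<in> extensional X" by (simp add: J_eps_def)
 ultimately show ?thesis unfolding X_dual_def dual_space_def by blast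
qed

lemma smooth_compact_closed_cylinder:
 fixes f :: "real \<times> (real^'n) \<Rightarrow> 'c::euclidean_space"
 assumes f: "f \<in> smooth_compact ({0..T} \<times> \<Omega>)"
 shows "f \<in> borel_measurable (lebesgue_on Q)" "\<exists>B\<ge>0. \<forall>z. norm (f z) \<le> B"
proof -
 let ?S = "{0..T} \<times> \<Omega>" and ?K = "closure {z. f z \<noteq> 0}"
 have c: "continuous_on ?S f" using f Ck_on.simps(1)[of ?S f] unfolding smooth_compact_def by blast
 have K: "compact ?K" "?K \<subseteq> ?S" using f unfolding smooth_compact_def by auto
 have "continuous_on Q f" by (rule continuous_on_subset[OF c]) (auto simp: cylinder_def)
 then show "f \<in> borel_measurable (lebesgue_on Q)"
  using Q_sets by (rule continuous_imp_measurable_on_sets_lebesgue)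
 have "bounded (f ` ?K)"
  by (intro compact_imp_bounded compact_continuous_image continuous_on_subset[OF c] K)
 then obtain B where B: "\<And>z. z \<in> ?K ==> norm (f z) \<le> B" by (auto simp: bounded_iff)
 have "norm (f z) \<le> max B 0" for z
 proof (cases "f z = 0")
  case False
  then have "z \<in> ?K" by (intro subsetD[OF closure_subset]) simp
  then show ?thesis using B[of z] by simp
 qed simp
 then show "\<exists>B\<ge>0. \<forall>z. norm (f z) \<le> B" by (intro exI[of _ "max B 0"]) auto
qed

lemma C_inf_star_subset_dual: "C_inf_star T \<Omega> q p \<subseteq> X_dual T \<Omega> q p"
proof
 fix L assume "L \<in> C_inf_star T \<Omega> q p"
 then obtain f F where fF: "L = J_eps T \<Omega> q p f F" "f \<in> smooth_compact ({0..T} \<times> \<Omega>)" "F \<in> smooth_compact ({0..T} \<times> \<Omega>)"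
  unfolding C_inf_star_def by blast
 obtain B1 where B1: "0 \<le> B1" "\<forall>z. norm (f z) \<le> B1" using smooth_compact_closed_cylinder(2)[OF fF(2)] by blast
 obtain B2 where B2: "0 \<le> B2" "\<forall>z. norm (F z) \<le> B2" using smooth_compact_closed_cylinder(2)[OF fF(3)] by blast
 show "L \<in> X_dual T \<Omega> q p"
  unfolding fF(1)
 proof (rule J_in_X_dual[OF smooth_compact_closed_cylinder(1)[OF fF(2)] _ smooth_compact_closed_cylinder(1)[OF fF(3)]])
  show "norm (f z) \<le> B1 + B2" "norm (F z) \<le> B1 + B2" for z
   using B1(1) B2(1) B1(2)[rule_format, of z] B2(2)[rule_format, of z] by simp_all
 qed (use B1 B2 in auto)
qed

subsection \<open>The smoothed functionals have smooth densities\<close>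

text \<open>The field eta_h \<psi> e_i. The cut-off supplies the spatial compact support, so every
  smooth scalar \<psi> yields an element of X, and a dual functional induces scalar functionals of
  \<psi>.\<close>

definition bump_field :: "real \<Rightarrow> (real \<times> (real^'n) \<Rightarrow> real) \<Rightarrow> 'n \<Rightarrow> real \<times> (real^'n) \<Rightarrow> real^'n" where
 "bump_field h \<psi> i z = (cutoff \<Omega> h (snd z) * \<psi> z) *\<^sub>R axis i 1"

lemma smooth_bump_field:
 assumes "0 < h" "smooth \<psi>" shows "smooth (bump_field h \<psi> i)"
 unfolding bump_field_def[abs_def] by (intro smooth_scaleR smooth_mult smooth_const smooth_cutoff_snd(1) assms)

lemma bump_field_in_X:
 assumes h: "0 < h" and \<psi>: "smooth \<psi>" shows "bump_field h \<psi> i \<in> X"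
proof (rule smooth_in_X[OF smooth_bump_field[OF h \<psi>] refl])
 show "compact (inner_compact (2 * h))" "inner_compact (2 * h) \<subseteq> \<Omega>" using inner_compact h by auto
 show "bump_field h \<psi> i (t, x) = 0" if "x \<notin> inner_compact (2 * h)" for t x
  using that cutoff_nonzeroD[OF open_\<Omega> bounded_\<Omega> h, of x]
  by (cases "cutoff \<Omega> h x = 0") (auto simp: bump_field_def inner_compact_def)
qed

text \<open>The product rule for eta_h and \<psi>. The constant may depend on h, since smoothness of
  the density is needed for each h separately.\<close>

lemma N_bump_field_le:
 assumes h: "0 < h"
 shows "\<exists>K\<ge>0. \<forall>\<psi> M i. smooth \<psi> \<and> (\<forall>z. \<bar>\<psi> z\<bar> \<le> M) \<and> (\<forall>z v. \<bar>dird v \<psi> z\<bar> \<le> M * norm v) \<longrightarrow> N (bump_field h \<psi> i) \<le> K * M"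
proof -
 obtain C where C: "0 \<le> C" "\<And>x v. \<bar>dird v (cutoff \<Omega> h) x\<bar> \<le> C * norm v"
  using test_fn_dird_bounded[OF test_fn_cutoff[OF open_\<Omega> bounded_\<Omega> h]] by metis
 have \<eta>: "\<bar>cutoff \<Omega> h x\<bar> \<le> 1" for x
  using cutoff_nonneg[OF open_\<Omega> bounded_\<Omega> h, of x] cutoff_le_1[OF open_\<Omega> bounded_\<Omega> h, of x] by simp
 show ?thesis
 proof (intro exI[of _ "(1 + q.vol) * (1 + real CARD('n) * real CARD('n)) * (1 + C)"] conjI allI impI)
  show "0 \<le> (1 + q.vol) * (1 + real CARD('n) * real CARD('n)) * (1 + C)" using C(1) by simp
  fix \<psi> :: "real \<times> (real^'n) \<Rightarrow> real" and M :: real and i :: 'n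
  assume *: "smooth \<psi> \<and> (\<forall>z. \<bar>\<psi> z\<bar> \<le> M) \<and> (\<forall>z v. \<bar>dird v \<psi> z\<bar> \<le> M * norm v)"
  then have \<psi>: "smooth \<psi>" "\<And>z. \<bar>\<psi> z\<bar> \<le> M" "\<And>z v. \<bar>dird v \<psi> z\<bar> \<le> M * norm v" by auto
  have M: "0 \<le> M" using \<psi>(2)[of 0] by simp
  have "N (bump_field h \<psi> i) \<le> (1 + q.vol) * (1 + real CARD('n) * real CARD('n)) * ((1 + C) * M)"
   unfolding X_st_norm_def
  proof (rule st.smooth_eps_norm_le[OF smooth_bump_field[OF h \<psi>(1)] refl bounded_Q])
   show "0 \<le> (1 + C) * M" using C(1) M by simp
   have CM: "0 \<le> C * M" using C(1) M by simp
   fix z assume "z \<in> Q"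
   have "\<bar>cutoff \<Omega> h (snd z)\<bar> * \<bar>\<psi> z\<bar> \<le> 1 * M" by (intro mult_mono \<eta> \<psi>(2)) auto
   then show "norm (bump_field h \<psi> i z) \<le> (1 + C) * M"
    using CM by (simp add: bump_field_def abs_mult algebra_simps)
   fix k j
   let ?g = "%z::real \<times> (real^'n). cutoff \<Omega> h (snd z) *\<^sub>R \<psi> z"
   have sg: "smooth ?g" by (intro smooth_scaleR smooth_cutoff_snd(1) h \<psi>(1))
   have "dird (st_dir j) ?g z = cutoff \<Omega> h (snd z) *\<^sub>R dird (st_dir j) \<psi> z + dird (st_dir j) (%z::real \<times> (real^'n). cutoff \<Omega> h (snd z)) z *\<^sub>R \<psi> z"
    by (rule frechet_derivative_scaleR_smooth[OF smooth_cutoff_snd(1)[OF h] \<psi>(1)])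
   also have "dird (st_dir j) (%z::real \<times> (real^'n). cutoff \<Omega> h (snd z)) z = dird (axis j 1) (cutoff \<Omega> h) (snd z)"
    using smooth_cutoff_snd(2)[OF h, where v="st_dir j" and z=z] by (simp add: st_dir_def)
   finally have "\<bar>dird (st_dir j) ?g z\<bar> \<le> \<bar>cutoff \<Omega> h (snd z)\<bar> * \<bar>dird (st_dir j) \<psi> z\<bar> + \<bar>dird (axis j 1) (cutoff \<Omega> h) (snd z)\<bar> * \<bar>\<psi> z\<bar>"
    by (simp add: abs_mult[symmetric])
   also have "\<dots> \<le> 1 * (M * norm (st_dir j :: real \<times> (real^'n))) + (C * norm (axis j 1 :: real^'n)) * M"
    by (intro add_mono mult_mono \<eta> \<psi> C) (use C(1) M in auto)
   also have "\<dots> = (1 + C) * M" by (simp add: st_dir_def norm_Pair algebra_simps)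
   finally have d: "\<bar>dird (st_dir j) ?g z\<bar> \<le> (1 + C) * M" .
   have "(%z. bump_field h \<psi> i z $ k) = (%z. (axis i 1 $ k :: real) * ?g z)"
    by (auto simp: bump_field_def fun_eq_iff)
   then have "dird (st_dir j) (%z. bump_field h \<psi> i z $ k) z = (axis i 1 $ k) * dird (st_dir j) ?g z"
    using frechet_derivative_bounded_linear_smooth[OF sg bounded_linear_mult_right, where x=z and v="st_dir j"] by simp
   moreover have "\<bar>(axis i 1 $ k) :: real\<bar> \<le> 1" by (simp add: axis_def)
   ultimately show "\<bar>dird (st_dir j) (%z. bump_field h \<psi> i z $ k) z\<bar> \<le> (1 + C) * M"
    using mult_mono[of "\<bar>(axis i 1 $ k) :: real\<bar>" 1 "\<bar>dird (st_dir j) ?g z\<bar>" "(1 + C) * M"] d by (simp add: abs_mult)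
  qed
  then show "N (bump_field h \<psi> i) \<le> (1 + q.vol) * (1 + real CARD('n) * real CARD('n)) * (1 + C) * M" by (simp add: mult_ac)
 qed
qed

lemma bump_field_functional:
 assumes us: "us \<in> X_dual T \<Omega> q p" and h: "0 < h"
 shows "\<exists>C\<ge>0. C1_functional (%\<psi>. us (bump_field h \<psi> i)) C"
proof -
 define RK where "RK K \<longleftrightarrow> (\<forall>\<psi> M i. smooth \<psi> \<and> (\<forall>z. \<bar>\<psi> z\<bar> \<le> M) \<and> (\<forall>z v. \<bar>dird v \<psi> z\<bar> \<le> M * norm v) \<longrightarrow> N (bump_field h \<psi> i) \<le> K * M)" for K
 have "\<exists>K\<ge>0. RK K" unfolding RK_def by (rule N_bump_field_le[OF h])
 then obtain K where K: "0 \<le> K" "RK K" by blast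
 obtain C where C: "0 \<le> C" "\<And>u. u \<in> X ==> \<bar>us u\<bar> \<le> C * N u" by (rule X_dual_bounded[OF us], rule that)
 have "C1_functional (%\<psi>. us (bump_field h \<psi> i)) (C * K)"
 proof
  fix f g :: "real \<times> (real^'n) \<Rightarrow> real"
  assume f: "test_fn f"
  then have sf: "smooth f" by (simp add: test_fn_def)
  show "us (bump_field h (%x. c * f x) i) = c *\<^sub>R us (bump_field h f i)" for c
  proof -
   have "bump_field h (%x. c * f x) i = (%z. c *\<^sub>R bump_field h f i z)" by (auto simp: bump_field_def fun_eq_iff)
   then show ?thesis using X_dualD(3)[OF us bump_field_in_X[OF h sf], of c] by simp
  qed
  show "norm (us (bump_field h f i)) \<le> C * K * M" if "\<And>x. \<bar>f x\<bar> \<le> M" "\<And>x v. \<bar>dird v f x\<bar> \<le> M * norm v" for M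
  proof -
   have "N (bump_field h f i) \<le> K * M"
    by (rule K(2)[unfolded RK_def, rule_format]) (intro conjI allI sf that)
   then have "C * N (bump_field h f i) \<le> C * (K * M)" by (intro mult_left_mono C(1))
   then show ?thesis using C(2)[OF bump_field_in_X[OF h sf], of i] by (simp add: mult.assoc)
  qed
  assume g: "test_fn g"
  then have sg: "smooth g" by (simp add: test_fn_def)
  have "bump_field h (%x. f x + g x) i = (%z. bump_field h f i z + bump_field h g i z)"
   by (auto simp: bump_field_def fun_eq_iff distrib_left scaleR_add_left)
  then show "us (bump_field h (%x. f x + g x) i) = us (bump_field h f i) + us (bump_field h g i)"
   using X_dualD(2)[OF us bump_field_in_X[OF h sf, of i] bump_field_in_X[OF h sg, of i]] by simp
 qed
 then show ?thesis using C(1) K(1) by (intro exI[of _ "C * K"]) auto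
qed

text \<open>At the ends of the time interval one steps inwards, elsewhere the set is open in space;
  derivatives within the closed cylinder are therefore unique.\<close>

lemma fat_closed_cylinder:
 assumes z: "z \<in> {0..T} \<times> \<Omega>" and i: "i \<in> Basis" and e: "0 < e"
 shows "\<exists>d. 0 < \<bar>d\<bar> \<and> \<bar>d\<bar> < e \<and> z + d *\<^sub>R i \<in> {0..T} \<times> \<Omega>"
proof -
 obtain t x where tx: "z = (t, x)" "0 \<le> t" "t \<le> T" "x \<in> \<Omega>" using z by auto
 consider "i = (1, 0)" | b where "i = (0, b)" "b \<in> Basis" using i by (auto simp: Basis_prod_def)
 then show ?thesis
 proof cases
  case 1
  define m where "m = min (e / 2) (T / 2)"
  have m: "0 < m" "m < e" "m \<le> T / 2" using e T_pos by (auto simp: m_def)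
  show ?thesis
  proof (cases "t \<le> T / 2")
   case True
   then show ?thesis using m tx 1 by (intro exI[of _ m]) auto
  next
   case False
   then show ?thesis using m tx 1 by (intro exI[of _ "- m"]) auto
  qed
 next
  case 2
  obtain r where r: "0 < r" "ball x r \<subseteq> \<Omega>" using open_\<Omega> tx(4) openE by blast
  define m where "m = min (e / 2) (r / 2)"
  have m: "0 < m" "m < e" "m < r" using e r by (auto simp: m_def)
  have "x + m *\<^sub>R b \<in> ball x r" using m 2 by (simp add: dist_norm)
  then have "x + m *\<^sub>R b \<in> \<Omega>" using r(2) by blast
  then show ?thesis using m tx 2 by (intro exI[of _ m]) auto
 qed
qed

lemma convolution_component:
 fixes v :: "real \<times> (real^'n) \<Rightarrow> real^'n"
 assumes h: "0 < h" and int: "integrable (lebesgue_on Q) v"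
 shows "convolution (mollifier h) (zero_ext Q v) z $ i = convolution (mollifier h) (zero_ext Q (%z. v z $ i)) z"
proof -
 have "convolution (mollifier h) (zero_ext Q v) z $ i = (LINT y|lebesgue. (mollifier h (z - y) *\<^sub>R zero_ext Q v y) $ i)"
  unfolding convolution_def
  by (rule integral_bounded_linear[symmetric, OF bounded_linear_vec_nth
   integrable_convolution_integrand[OF test_fn_mollifier[OF h] integrable_zero_ext[OF Q_sets int]]])
 also have "\<dots> = convolution (mollifier h) (zero_ext Q (%z. v z $ i)) z"
  unfolding convolution_def by (intro Bochner_Integration.integral_cong) (auto simp: zero_ext_def)
 finally show ?thesis .
qed

text \<open>The density has components f_i(y) = us (eta_h omega_h(. - y) e_i) and the matrix part is
  zero. Smoothness comes from \<open>smooth_translate\<close>, the representation from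
  \<open>C1_functional_convolution\<close> in each component.\<close>

lemma R_op_in_C_inf_star:
 assumes us: "us \<in> X_dual T \<Omega> q p" and h: "0 < h"
 shows "R_op T \<Omega> q p h us \<in> C_inf_star T \<Omega> q p"
proof -
 let ?m = "mollifier h :: real \<times> (real^'n) \<Rightarrow> real"
 have m: "test_fn ?m" by (rule test_fn_mollifier[OF h])
 define \<theta> where "\<theta> y i = us (bump_field h (%z. ?m (z - y)) i)" for y i
 have sm\<theta>: "smooth (%y. \<theta> y i)" for i
  using bump_field_functional[OF us h, of i] C1_functional.smooth_translate[OF _ m] unfolding \<theta>_def by blast
 define f0 where "f0 y = (\<Sum>i\<in>UNIV. \<theta> y i *\<^sub>R (axis i 1 :: real^'n))" for y
 have sf0: "smooth f0" unfolding f0_def[abs_def] by (rule smooth_of_components[OF sm\<theta>])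
 have f0i: "f0 y $ i = \<theta> y i" for y i by (simp add: f0_def axis_def if_distrib cong: if_cong)
 let ?S = "{0..T} \<times> \<Omega>"
 \<comment> \<open>\<open>f0\<close> is smooth everywhere but may persist at times outside [0, T].
   Cutting it off there makes the support compact in the closed cylinder, and \<open>Ck_on\<close>
   within that set still sees \<open>f0\<close>.\<close>
 define f where "f y = (if fst y \<in> {0..T} \<and> snd y \<in> inner_compact h then f0 y else 0)" for y
 \<comment> \<open>The field at z is nonzero only if z is more than 2h from the boundary; a kernel
   of radius h centred within h of the boundary, or outside, cannot reach such points.\<close>
 have zero: "f0 y = 0" if y: "snd y \<notin> inner_compact h" for y
 proof -
  have "bump_field h (%z. ?m (z - y)) i z = 0" for i z
  proof (cases "cutoff \<Omega> h (snd z) = 0")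
   case False
   note nz = cutoff_nonzeroD[OF open_\<Omega> bounded_\<Omega> h False]
   have "h \<le> dist (snd z) (snd y)"
   proof (rule ccontr)
    assume "\<not> h \<le> dist (snd z) (snd y)"
    then have d: "dist (snd z) (snd y) < h" by simp
    then have "snd y \<in> \<Omega>" using bdist_ball[OF nz(1), of "snd y"] nz(2) h by linarith
    moreover have "h \<le> bdist \<Omega> (snd y)" using bdist_diff[of \<Omega> "snd z" "snd y"] nz(2) d by linarith
    ultimately show False using y by (simp add: inner_compact_def)
   qed
   also have "\<dots> \<le> norm (z - y)" using dist_snd_le[of z y] by (simp add: dist_norm)
   finally show ?thesis using mollifier_eq_0[OF h, of "z - y"] by (simp add: bump_field_def)
  qed (simp add: bump_field_def)
  then have "bump_field h (%z. ?m (z - y)) i = (%z. 0)" for i by auto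
  then have "\<theta> y i = 0" for i using X_dualD(3)[OF us zero_X, of 0] by (simp add: \<theta>_def)
  then show ?thesis by (simp add: f0_def)
 qed
 have ff0: "f y = f0 y" if "y \<in> ?S" for y using that zero[of y] by (auto simp: f_def)
 have fsc: "f \<in> smooth_compact ?S"
 proof -
  have "Ck_on k ?S f" for k
   by (rule Ck_on_of_UNIV[of ?S k f0 f, OF fat_closed_cylinder _ ff0]) (use sf0 in \<open>auto simp: smooth_def\<close>)
  moreover have "compact ({0..T} \<times> inner_compact h)" by (intro compact_Times inner_compact(1) h) simp
  moreover have "{y. f y \<noteq> 0} \<subseteq> {0..T} \<times> inner_compact h" by (auto simp: f_def mem_Times_iff split: if_splits)
  ultimately have "closure {y. f y \<noteq> 0} \<subseteq> {0..T} \<times> inner_compact h" "compact (closure {y. f y \<noteq> 0})"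
   using compact_imp_closed closure_minimal compact_imp_bounded bounded_subset compact_closure by metis+
  moreover have "{0..T} \<times> inner_compact h \<subseteq> ?S" using inner_compact(2) by auto
  ultimately show ?thesis using \<open>\<And>k. Ck_on k ?S f\<close> unfolding smooth_compact_def by blast
 qed
 have Fsc: "(%z. 0::real^'n^'n) \<in> smooth_compact ?S"
 proof -
  have "Ck_on k ?S (%z. 0::real^'n^'n)" for k
   by (rule Ck_on_of_UNIV[of ?S k "%z. 0", OF fat_closed_cylinder]) (use smooth_const in \<open>auto simp: smooth_def\<close>)
  then show ?thesis by (simp add: smooth_compact_def)
 qed
 have "R_op T \<Omega> q p h us = J_eps T \<Omega> q p f (%z. 0)"
 proof
  fix v
  show "R_op T \<Omega> q p h us v = J_eps T \<Omega> q p f (%z. 0) v"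
  proof (cases "v \<in> X")
   case True
   note int = X_integrable(1)[OF True]
   let ?g = "%i. zero_ext Q (%z. v z $ i)"
   have ig: "integrable lebesgue (?g i)" for i
    by (rule integrable_zero_ext[OF Q_sets integrable_bounded_linear[OF bounded_linear_vec_nth int]])
   have scv: "smooth (convolution ?m (?g i))" for i by (rule smooth_convolution[OF m ig])
   have bX: "bump_field h (convolution ?m (?g i)) i \<in> X" for i by (rule bump_field_in_X[OF h scv])
   note ci = convolution_component[OF h int]
   have ds: "(%z. \<Sum>i\<in>UNIV. bump_field h (convolution ?m (?g i)) i z) \<in> X \<and>
     us (%z. \<Sum>i\<in>UNIV. bump_field h (convolution ?m (?g i)) i z) = (\<Sum>i\<in>UNIV. us (bump_field h (convolution ?m (?g i)) i))"
    by (rule dual_sum[OF us bX]) simp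
   \<comment> \<open>The splitting into component fields holds on the cylinder only, where
     \<open>R_star\<close> is not cut off; \<open>dual_cong\<close> disregards the rest.\<close>
   have "us (R_star T \<Omega> h v) = us (%z. \<Sum>i\<in>UNIV. bump_field h (convolution ?m (?g i)) i z)"
   proof (rule dual_cong[OF us R_star_in_X[OF h True] conjunct1[OF ds]])
    fix z assume "z \<in> Q"
    then show "R_star T \<Omega> h v z = (\<Sum>i\<in>UNIV. bump_field h (convolution ?m (?g i)) i z)"
     by (simp add: R_star_eq zero_ext_def smoothed_def bump_field_def vec_eq_iff ci axis_def if_distrib cong: if_cong)
   qed
   also have "\<dots> = (\<Sum>i\<in>UNIV. us (bump_field h (convolution ?m (?g i)) i))" by (rule conjunct2[OF ds])
   also have "\<dots> = (\<Sum>i\<in>UNIV. LINT y|lebesgue_on Q. v y $ i * \<theta> y i)"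
   proof (rule sum.cong[OF refl])
    fix i
    obtain C where C: "0 \<le> C" "C1_functional (%\<psi>. us (bump_field h \<psi> i)) C" using bump_field_functional[OF us h] by blast
    have "us (bump_field h (convolution ?m (?g i)) i) = (LINT y|lebesgue. \<theta> y i * ?g i y)"
     unfolding \<theta>_def by (rule C1_functional_convolution[OF C(2,1) m ig bounded_Q]) (simp add: zero_ext_def)
    also have "\<dots> = (LINT y|lebesgue_on Q. v y $ i * \<theta> y i)" by (rule integral_zero_ext_mult[OF Q_sets])
    finally show "us (bump_field h (convolution ?m (?g i)) i) = (LINT y|lebesgue_on Q. v y $ i * \<theta> y i)" .
   qed
   also have "\<dots> = (LINT y|lebesgue_on Q. (\<Sum>i\<in>UNIV. v y $ i * \<theta> y i))"
   proof (rule Bochner_Integration.integral_sum[symmetric])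
    fix i
    obtain B where B: "\<And>y. y \<in> Q ==> norm (\<theta> y i) \<le> B"
     using continuous_bounded_on_bounded[OF smooth_continuous_on[OF sm\<theta>] bounded_Q] by metis
    have "integrable (lebesgue_on Q) (%y. \<theta> y i \<bullet> (v y $ i))"
     by (rule integrable_inner_bounded[OF _ _ integrable_bounded_linear[OF bounded_linear_vec_nth int]])
      (use B smooth_borel[OF sm\<theta>] in \<open>auto intro!: measurable_restrict_space1 borel_measurable_lebesgueI\<close>)
    then show "integrable (lebesgue_on Q) (%y. v y $ i * \<theta> y i)" by (simp add: mult.commute)
   qed
   also have "\<dots> = (LINT y|lebesgue_on Q. f y \<bullet> v y + (0::real^'n^'n) \<bullet> \<epsilon> v y)"
   proof (intro Bochner_Integration.integral_cong refl)
    fix y assume "y \<in> space (lebesgue_on Q)"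
    then have "f y = f0 y" by (intro ff0) (auto simp: cylinder_def)
    then show "(\<Sum>i\<in>UNIV. v y $ i * \<theta> y i) = f y \<bullet> v y + (0::real^'n^'n) \<bullet> \<epsilon> v y"
     by (simp add: inner_vec_def f0i mult.commute)
   qed
   finally show ?thesis using True by (simp add: R_op_def J_eps_def)
  qed (simp add: R_op_def J_eps_def)
 qed
 then show ?thesis using fsc Fsc unfolding C_inf_star_def
  by (intro CollectI exI[of _ f] exI[of _ "%z. 0"]) (simp add: transpose_def vec_eq_iff)
qed

end

section \<open>Density of functionals with continuous densities\<close>

text \<open>The map |x|^(r-2) x, that is, the gradient of |x|^r / r; writing it with
  \<open>sgn\<close> gives the value 0 at the origin.\<close>

definition duality_map :: "real \<Rightarrow> 'b::euclidean_space \<Rightarrow> 'b" where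
 "duality_map r x = norm x powr (r - 1) *\<^sub>R sgn x"

lemma norm_duality_map: "norm (duality_map r x) \<le> norm x powr (r - 1)"
 by (simp add: duality_map_def norm_sgn)

lemma duality_map_scaleR: "0 < c ==> duality_map r (c *\<^sub>R x) = c powr (r - 1) *\<^sub>R duality_map r x"
 by (simp add: duality_map_def powr_mult sgn_scaleR)

lemma young_powr:
 assumes r: "1 < r" and xy: "0 \<le> x" "0 \<le> (y::real)"
 shows "r * (x powr (r - 1) * y) \<le> (r - 1) * x powr r + y powr r"
proof (cases "x = 0 \<or> y = 0")
 case True
 then show ?thesis using r by auto
next
 case False
 then have pos: "0 < x powr r" "0 < y powr r" and xy': "0 < x" "0 < y" using xy by auto
 have "(x powr r) powr ((r - 1) / r) * (y powr r) powr (1 / r) \<le> (r - 1) / r * x powr r + 1 / r * y powr r"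
  by (rule Youngs_inequality_0) (use r pos in \<open>auto simp: field_simps\<close>)
 then have "x powr (r - 1) * y \<le> (r - 1) / r * x powr r + 1 / r * y powr r"
  using r xy' by (simp add: powr_powr)
 then have "r * (x powr (r - 1) * y) \<le> r * ((r - 1) / r * x powr r + 1 / r * y powr r)"
  using r by (intro mult_left_mono) auto
 also have "\<dots> = (r - 1) * x powr r + y powr r" using r by (simp add: field_simps)
 finally show ?thesis .
qed

text \<open>The tangent inequality for the convex function |x|^r, obtained from Cauchy-Schwarz and
  Young.\<close>

lemma duality_map_gradient:
 fixes a x :: "'b::euclidean_space"
 assumes r: "1 < r"
 shows "norm x powr r + r * (duality_map r x \<bullet> (a - x)) \<le> norm a powr r"
proof (cases "x = 0")
 case True
 then show ?thesis using r by (simp add: duality_map_def)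
next
 case False
 then have n: "0 < norm x" by simp
 have "sgn x \<bullet> x = norm x"
  using n by (simp add: sgn_div_norm inner_commute divide_inverse[symmetric] power2_norm_eq_inner[symmetric] power2_eq_square)
 then have xx: "duality_map r x \<bullet> x = norm x powr r"
  using n by (simp add: duality_map_def powr_diff)
 have "duality_map r x \<bullet> a \<le> norm (duality_map r x) * norm a" by (rule norm_cauchy_schwarz)
 also have "\<dots> \<le> norm x powr (r - 1) * norm a" by (intro mult_right_mono norm_duality_map) auto
 finally have "r * (duality_map r x \<bullet> a) \<le> r * (norm x powr (r - 1) * norm a)" using r by simp
 also have "\<dots> \<le> (r - 1) * norm x powr r + norm a powr r" by (rule young_powr[OF r]) auto
 finally show ?thesis using xx by (simp add: inner_diff_right algebra_simps)
qed

text \<open>Joint continuity in exponent and argument. At the origin the direction is discontinuous,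
  but the factor |x|^(r-1) tends to 0 because r > 1.\<close>

lemma continuous_on_duality_map:
 "continuous_on ({1<..} \<times> UNIV) (%(r, x::'b::euclidean_space). duality_map r x)"
 unfolding continuous_on_def
proof (intro ballI, clarify)
 fix r :: real and x :: 'b
 assume r: "1 < r"
 let ?F = "at (r, x) within {1<..} \<times> UNIV"
 have f: "(fst \<longlongrightarrow> r) ?F" and s: "(snd \<longlongrightarrow> x) ?F"
  by (auto intro!: tendsto_eq_intros)
 have n: "((%z. norm (snd z) powr (fst z - 1)) \<longlongrightarrow> norm x powr (r - 1)) ?F"
  by (intro tendsto_powr' tendsto_norm tendsto_diff f s tendsto_const) (use r in auto)
 show "((%(r, x). duality_map r x) \<longlongrightarrow> duality_map r x) ?F"
 proof (cases "x = 0")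
  case False
  then show ?thesis unfolding duality_map_def split_def
   by (intro tendsto_scaleR n[unfolded split_def] tendsto_sgn s)
 next
  case True
  have "((%z. norm (snd z) powr (fst z - 1)) \<longlongrightarrow> 0) ?F" using n True r by simp
  then have "((%(r, x). duality_map r x) \<longlongrightarrow> 0) ?F"
   by (rule Lim_null_comparison[rotated]) (auto intro!: always_eventually norm_duality_map)
  then show ?thesis using True by (simp add: duality_map_def)
 qed
qed

lemma duality_map_uniform:
 assumes m: "1 < m" and e: "0 < e"
 shows "\<exists>s0. 0 < s0 \<and> s0 \<le> 1 \<and> (\<forall>s r (a::'b::euclidean_space) b. 0 < s \<and> s \<le> s0 \<and> m \<le> r \<and> r \<le> P \<and> norm a \<le> 1 \<and> norm b \<le> 1 \<longrightarrow>
  norm (duality_map r (a + s *\<^sub>R b) - duality_map r a) \<le> e)"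
proof -
 \<comment> \<open>Compactness gives uniformity over all exponents at once; radius 2 accommodates a
   + s b for s \<le> 1.\<close>
 let ?K = "{m..P} \<times> cball (0::'b) 2"
 have "uniformly_continuous_on ?K (%(r, x). duality_map r x)"
  by (intro compact_uniformly_continuous continuous_on_subset[OF continuous_on_duality_map] compact_Times)
   (use m in auto)
 then obtain d where d: "0 < d" "\<And>z z'. z \<in> ?K ==> z' \<in> ?K ==> dist z' z < d ==>
   dist (case z' of (r, x) \<Rightarrow> duality_map r x) (case z of (r, x) \<Rightarrow> duality_map r x) < e"
  unfolding uniformly_continuous_on_def using e by meson
 show ?thesis
 proof (intro exI[of _ "min 1 (d / 2)"] conjI allI impI)
  fix s r and a b :: 'b
  assume H: "0 < s \<and> s \<le> min 1 (d / 2) \<and> m \<le> r \<and> r \<le> P \<and> norm a \<le> 1 \<and> norm b \<le> 1"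
  have sb: "norm (s *\<^sub>R b) \<le> s" using H by (simp add: mult_left_le)
  have "norm (a + s *\<^sub>R b) \<le> 2" using norm_triangle_ineq[of a "s *\<^sub>R b"] sb H by linarith
  moreover have "dist (r, a + s *\<^sub>R b) (r, a) = norm (s *\<^sub>R b)" by (simp add: dist_Pair_Pair dist_norm)
  then have "dist (r, a + s *\<^sub>R b) (r, a) < d" using sb H d(1) by linarith
  moreover have "(r, a) \<in> ?K" using H by (simp add: mem_cball_0)
  moreover have "norm (a + s *\<^sub>R b) \<le> 2 ==> (r, a + s *\<^sub>R b) \<in> ?K" using H by (simp only: mem_Times_iff fst_conv snd_conv mem_cball_0) simp
  ultimately have "dist (case (r, a + s *\<^sub>R b) of (r, x) \<Rightarrow> duality_map r x) (case (r, a) of (r, x) \<Rightarrow> duality_map r x) < e"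
   by (intro d(2)) auto
  then show "norm (duality_map r (a + s *\<^sub>R b) - duality_map r a) \<le> e" by (simp add: dist_norm)
 qed (use d in auto)
qed

text \<open>A first-order upper expansion whose step s0 depends on neither a, b nor r. Convexity
  bounds the increment by the gradient at the displaced point, homogeneity reduces to the unit ball,
  and uniform continuity there replaces that gradient by the one at a.\<close>

lemma powr_increment:
 assumes m: "1 < m" and e: "0 < e" and P: "0 < P"
 shows "\<exists>s0. 0 < s0 \<and> s0 \<le> 1 \<and> (\<forall>s r (a::'b::euclidean_space) b. 0 < s \<and> s \<le> s0 \<and> m \<le> r \<and> r \<le> P \<longrightarrow>
  norm (a + s *\<^sub>R b) powr r \<le> norm a powr r + s * (r * (duality_map r a \<bullet> b)) + s * e * (norm a powr r + norm b powr r))"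
proof -
 have eP: "0 < e / P" using e P by simp
 obtain s0 where s0: "0 < s0" "s0 \<le> 1" and S: "\<And>s r (a::'b) b. 0 < s ==> s \<le> s0 ==> m \<le> r ==> r \<le> P ==> norm a \<le> 1 ==> norm b \<le> 1 ==>
  norm (duality_map r (a + s *\<^sub>R b) - duality_map r a) \<le> e / P"
  using duality_map_uniform[OF m eP, of P, where 'b='b] by blast
 show ?thesis
 proof (intro exI[of _ s0] conjI allI impI s0)
  fix s r and a b :: 'b assume "0 < s \<and> s \<le> s0 \<and> m \<le> r \<and> r \<le> P"
  then have H: "0 < s" "s \<le> s0" "m \<le> r" "r \<le> P" by auto
  \<comment> \<open>Dividing by the larger norm puts both vectors into the unit ball; the gradient
    scales by M^(r-1), and the remaining factor M comes from b.\<close>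
  define M where "M = max (norm a) (norm b)"
  show "norm (a + s *\<^sub>R b) powr r \<le> norm a powr r + s * (r * (duality_map r a \<bullet> b)) + s * e * (norm a powr r + norm b powr r)"
  proof (cases "M = 0")
   case True
   then have "norm a = 0 \<and> norm b = 0" unfolding M_def using norm_ge_zero[of a] norm_ge_zero[of b] by linarith
   then show ?thesis by simp
  next
   case False
   then have M: "0 < M" unfolding M_def using norm_ge_zero[of a] by linarith
   define a' where "a' = a /\<^sub>R M"
   define b' where "b' = b /\<^sub>R M"
   have ab: "a = M *\<^sub>R a'" "b = M *\<^sub>R b'" using M by (auto simp: a'_def b'_def)
   have n: "norm a' \<le> 1" "norm b' \<le> 1" using M by (auto simp: a'_def b'_def M_def field_simps)
   let ?x = "a + s *\<^sub>R b"
   have x: "?x = M *\<^sub>R (a' + s *\<^sub>R b')" by (simp add: ab scaleR_add_right mult.commute)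
   \<comment> \<open>The tangent is taken at the displaced point, not at a: this direction of the
     inequality bounds the increment from above.\<close>
   have "norm ?x powr r + r * (duality_map r ?x \<bullet> (a - ?x)) \<le> norm a powr r"
    by (rule duality_map_gradient) (use m H in simp)
   then have 1: "norm ?x powr r \<le> norm a powr r + s * (r * (duality_map r ?x \<bullet> b))"
    by (simp add: algebra_simps)
   have "M powr (r - 1 + 1) = M powr (r - 1) * M powr 1" by (rule powr_add)
   then have pm: "M powr (r - 1) * M = M powr r" using M by simp
   have bM: "norm b \<le> M" by (simp add: M_def)
   have dx: "duality_map r ?x = M powr (r - 1) *\<^sub>R duality_map r (a' + s *\<^sub>R b')"
    by (simp only: x duality_map_scaleR[OF M])
   have da: "duality_map r a = M powr (r - 1) *\<^sub>R duality_map r a'"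
    unfolding ab(1) by (rule duality_map_scaleR[OF M])
   have dd: "duality_map r ?x - duality_map r a = M powr (r - 1) *\<^sub>R (duality_map r (a' + s *\<^sub>R b') - duality_map r a')"
    unfolding dx da by (rule scaleR_diff_right[symmetric])
   have nn: "norm (duality_map r ?x - duality_map r a) * norm b \<le> (M powr (r - 1) * (e / P)) * M"
    unfolding dd norm_scaleR abs_of_nonneg[OF powr_ge_zero] using bM M eP e P by (intro mult_mono S[OF H n]) auto
   have "(duality_map r ?x - duality_map r a) \<bullet> b \<le> norm (duality_map r ?x - duality_map r a) * norm b"
    by (rule norm_cauchy_schwarz)
   also have "norm (duality_map r ?x - duality_map r a) * norm b \<le> (M powr (r - 1) * (e / P)) * M" by (rule nn)
   also have "\<dots> = e / P * (M powr (r - 1) * M)" by (simp only: mult_ac)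
   also have "\<dots> = e / P * M powr r" unfolding pm ..
   also have "\<dots> \<le> e / P * (norm a powr r + norm b powr r)"
    using eP by (intro mult_left_mono) (auto simp: M_def max_def)
   finally have 2: "(duality_map r ?x - duality_map r a) \<bullet> b \<le> e / P * (norm a powr r + norm b powr r)" .
   have "r * ((duality_map r ?x - duality_map r a) \<bullet> b) \<le> r * (e / P * (norm a powr r + norm b powr r))"
    using 2 m H by (intro mult_left_mono) auto
   also have "\<dots> \<le> P * (e / P * (norm a powr r + norm b powr r))"
    using eP H by (intro mult_right_mono mult_nonneg_nonneg) auto
   also have "\<dots> = e * (norm a powr r + norm b powr r)" using P by simp
   finally have "s * (r * ((duality_map r ?x - duality_map r a) \<bullet> b)) \<le> s * (e * (norm a powr r + norm b powr r))"
    using H by (intro mult_left_mono) auto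
   then show ?thesis using 1 by (simp add: inner_diff_left algebra_simps)
  qed
 qed
qed

subsection \<open>The differential of the modular\<close>

context log_hoelder_exponent
begin

definition modular_gradient :: "('a \<Rightarrow> 'b::euclidean_space) \<Rightarrow> 'a \<Rightarrow> 'b" where
 "modular_gradient a x = p x *\<^sub>R duality_map (p x) (a x)"

lemma modular_gradient_measurable:
 assumes a: "a \<in> borel_measurable (lebesgue_on G)"
 shows "modular_gradient a \<in> borel_measurable (lebesgue_on G)"
proof -
 note [measurable] = a p_meas
 show ?thesis unfolding modular_gradient_def[abs_def] duality_map_def sgn_div_norm by measurable
qed

lemma norm_modular_gradient: "x \<in> G ==> norm (modular_gradient a x) \<le> P * norm (a x) powr (p x - 1)"
 unfolding modular_gradient_def using norm_duality_map[of "p x" "a x"] p1[of x] pP[of x]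
 by (simp add: mult_mono)

text \<open>With M the larger of |a| and |b|, the product |a|^(p-1) |b| is at most M^p, hence at
  most |a|^p + |b|^p.\<close>

lemma modular_gradient_inner_integrable:
 fixes a b :: "'a \<Rightarrow> 'b::euclidean_space"
 assumes a: "a \<in> Lp_space G p" and b: "b \<in> Lp_space G p"
 shows "integrable (lebesgue_on G) (%x. modular_gradient a x \<bullet> b x)"
proof (rule Bochner_Integration.integrable_bound)
 show "integrable (lebesgue_on G) (%x. P * (norm (a x) powr p x + norm (b x) powr p x))"
  by (intro integrable_mult_right Bochner_Integration.integrable_add Lp_integrable_powr a b)
 show "(%x. modular_gradient a x \<bullet> b x) \<in> borel_measurable (lebesgue_on G)"
  using modular_gradient_measurable Lp_space_measurable a b by (intro borel_measurable_inner) auto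
 show "AE x in lebesgue_on G. norm (modular_gradient a x \<bullet> b x) \<le> norm (P * (norm (a x) powr p x + norm (b x) powr p x))"
 proof (rule AE_I2)
  fix x assume "x \<in> space (lebesgue_on G)"
  then have x: "x \<in> G" by simp
  define M where "M = max (norm (a x)) (norm (b x))"
  have M: "0 \<le> M" by (simp add: M_def le_max_iff_disj)
  have "\<bar>modular_gradient a x \<bullet> b x\<bar> \<le> norm (modular_gradient a x) * norm (b x)" by (rule Cauchy_Schwarz_ineq2)
  also have "\<dots> \<le> (P * M powr (p x - 1)) * M"
   using p1[OF x] pP[OF x] M by (intro mult_mono order_trans[OF norm_modular_gradient[OF x]] mult_left_mono powr_mono2) (auto simp: M_def)
  also have "\<dots> = P * M powr p x" using M by (cases "M = 0") (auto simp: powr_diff)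
  also have "\<dots> \<le> P * (norm (a x) powr p x + norm (b x) powr p x)"
   using p1[OF x] pP[OF x] by (intro mult_left_mono) (auto simp: M_def max_def)
  finally show "norm (modular_gradient a x \<bullet> b x) \<le> norm (P * (norm (a x) powr p x + norm (b x) powr p x))"
   by simp
 qed
qed

lemma modular_increment:
 assumes m: "1 < m" "\<And>x. x \<in> G ==> m \<le> p x" and e: "0 < e" and P: "0 < P"
 shows "\<exists>s0. 0 < s0 \<and> s0 \<le> 1 \<and> (\<forall>s (a::'a \<Rightarrow> 'b::euclidean_space) b. 0 < s \<and> s \<le> s0 \<and> a \<in> Lp_space G p \<and> b \<in> Lp_space G p \<longrightarrow>
  (LINT x|lebesgue_on G. norm (a x + s *\<^sub>R b x) powr p x) \<le> (LINT x|lebesgue_on G. norm (a x) powr p x) +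
   s * (LINT x|lebesgue_on G. modular_gradient a x \<bullet> b x) +
   s * e * ((LINT x|lebesgue_on G. norm (a x) powr p x) + (LINT x|lebesgue_on G. norm (b x) powr p x)))"
proof -
 obtain s0 where s0: "0 < s0" "s0 \<le> 1" and S: "\<And>s r (a::'b) b. 0 < s ==> s \<le> s0 ==> m \<le> r ==> r \<le> P ==>
  norm (a + s *\<^sub>R b) powr r \<le> norm a powr r + s * (r * (duality_map r a \<bullet> b)) + s * e * (norm a powr r + norm b powr r)"
  using powr_increment[OF m(1) e P, where 'b='b] by blast
 show ?thesis
 proof (intro exI[of _ s0] conjI allI impI s0)
  fix s and a b :: "'a \<Rightarrow> 'b"
  assume "0 < s \<and> s \<le> s0 \<and> a \<in> Lp_space G p \<and> b \<in> Lp_space G p"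
  then have s: "0 < s" "s \<le> s0" and a: "a \<in> Lp_space G p" and b: "b \<in> Lp_space G p" by auto
  have c: "(%x. a x + s *\<^sub>R b x) \<in> Lp_space G p" by (intro Lp_space_add a Lp_space_scaleR b)
  note ia = Lp_integrable_powr(1)[OF a] and ib = Lp_integrable_powr(1)[OF b] and ic = Lp_integrable_powr(1)[OF c]
   and ig = modular_gradient_inner_integrable[OF a b]
  have "(LINT x|lebesgue_on G. norm (a x + s *\<^sub>R b x) powr p x) \<le>
   (LINT x|lebesgue_on G. norm (a x) powr p x + s * (modular_gradient a x \<bullet> b x) + s * e * (norm (a x) powr p x + norm (b x) powr p x))"
  proof (rule integral_mono[OF ic])
   show "integrable (lebesgue_on G) (%x. norm (a x) powr p x + s * (modular_gradient a x \<bullet> b x) + s * e * (norm (a x) powr p x + norm (b x) powr p x))"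
    by (intro integrable_mult_right Bochner_Integration.integrable_add ia ib ig)
   fix x assume "x \<in> space (lebesgue_on G)"
   then show "norm (a x + s *\<^sub>R b x) powr p x \<le> norm (a x) powr p x + s * (modular_gradient a x \<bullet> b x) + s * e * (norm (a x) powr p x + norm (b x) powr p x)"
    using S[OF s m(2) pP, of x "a x" "b x"] by (simp add: modular_gradient_def)
  qed
  also have "\<dots> = (LINT x|lebesgue_on G. norm (a x) powr p x) +
   s * (LINT x|lebesgue_on G. modular_gradient a x \<bullet> b x) +
   s * e * ((LINT x|lebesgue_on G. norm (a x) powr p x) + (LINT x|lebesgue_on G. norm (b x) powr p x))"
   by (simp only: ia ib ig integral_mult_right_zero Bochner_Integration.integral_add Bochner_Integration.integrable_add integrable_mult_right)
  finally show "(LINT x|lebesgue_on G. norm (a x + s *\<^sub>R b x) powr p x) \<le> (LINT x|lebesgue_on G. norm (a x) powr p x) +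
   s * (LINT x|lebesgue_on G. modular_gradient a x \<bullet> b x) +
   s * e * ((LINT x|lebesgue_on G. norm (a x) powr p x) + (LINT x|lebesgue_on G. norm (b x) powr p x))" .
 qed
qed

end

context log_hoelder_exponent
begin

end

text \<open>A Young inequality with an arbitrarily small weight 1/L on b. Either d \<le> b^(r-1) /
  L, or b is at most (L d)^(1/(r-1)); the exponent 1/(m-1) makes the constant uniform for all r
  \<ge> m.\<close>

lemma split_product:
 assumes m: "1 < m" "m \<le> r" and L: "1 \<le> L" and db: "0 \<le> d" "0 \<le> (b::real)"
 shows "d * b \<le> b powr r / L + L powr (1 / (m - 1)) * d powr (r / (r - 1))"
proof (cases "L * d \<le> b powr (r - 1)")
 case True
 then have "d \<le> b powr (r - 1) / L" using L by (simp add: field_simps)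
 then have "d * b \<le> b powr (r - 1) / L * b" using db by (intro mult_right_mono)
 also have "\<dots> = b powr r / L" using db by (cases "b = 0") (auto simp: powr_diff)
 finally show ?thesis by (smt (verit) mult_nonneg_nonneg powr_ge_zero)
next
 case False
 then have d: "0 < d" using db powr_ge_zero[of b "r - 1"] by (cases "d = 0") auto
 have r: "1 < r" using m by simp
 have "b = (b powr (r - 1)) powr (1 / (r - 1))" using db r by (cases "b = 0") (auto simp: powr_powr)
 also have "\<dots> \<le> (L * d) powr (1 / (r - 1))" using False r by (intro powr_mono2) auto
 also have "\<dots> = L powr (1 / (r - 1)) * d powr (1 / (r - 1))" using L d by (simp add: powr_mult)
 also have "\<dots> \<le> L powr (1 / (m - 1)) * d powr (1 / (r - 1))"
  using L m by (intro mult_right_mono powr_mono frac_le) auto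
 finally have "d * b \<le> d * (L powr (1 / (m - 1)) * d powr (1 / (r - 1)))" using db by (intro mult_left_mono)
 also have "\<dots> = L powr (1 / (m - 1)) * d powr (1 + 1 / (r - 1))" using d by (simp add: powr_add)
 also have "1 + 1 / (r - 1) = r / (r - 1)" using r by (simp add: field_simps)
 finally show ?thesis using L by (smt (verit) divide_nonneg_nonneg powr_ge_zero)
qed

text \<open>Ramps in n times the distance to the complement: they vanish where that distance is at
  most 1/n and equal 1 where it is at least 2/n, for n > 0.\<close>

lemma compact_exhaustion_function:
 fixes G :: "'a::euclidean_space set"
 assumes G: "open G" "bounded G"
 obtains \<eta> :: "nat \<Rightarrow> 'a \<Rightarrow> real" where "\<And>n. continuous_on UNIV (\<eta> n)" "\<And>n x. 0 \<le> \<eta> n x \<and> \<eta> n x \<le> 1"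
  "\<And>x. x \<in> G ==> (%n. \<eta> n x) \<longlonglongrightarrow> 1" "\<And>n. \<exists>K. compact K \<and> K \<subseteq> G \<and> (\<forall>x. x \<notin> K \<longrightarrow> \<eta> n x = 0)"
proof
 let ?\<eta> = "%n x. min 1 (max 0 (real n * infdist x (- G) - 1))"
 have ne: "- G \<noteq> {}"
 proof
  assume "- G = {}"
  then have "G = UNIV" by blast
  then show False using G(2) not_bounded_UNIV by blast
 qed
 show "continuous_on UNIV (?\<eta> n)" for n by (intro continuous_intros)
 show "0 \<le> ?\<eta> n x \<and> ?\<eta> n x \<le> 1" for n x by auto
 show "(%n. ?\<eta> n x) \<longlonglongrightarrow> 1" if x: "x \<in> G" for x
 proof -
  have d: "0 < infdist x (- G)" using infdist_pos_not_in_closed[of "- G" x] G(1) ne x by (simp add: closed_def)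
  obtain k where k: "2 / infdist x (- G) < real k" using reals_Archimedean2 by blast
  have "?\<eta> n x = 1" if "k \<le> n" for n
  proof -
   have "2 / infdist x (- G) < real n" using k that by linarith
   then show ?thesis using d by (simp add: field_simps)
  qed
  then have "eventually (%n. ?\<eta> n x = 1) sequentially" by (auto simp: eventually_sequentially)
  then show ?thesis by (rule tendsto_eventually)
 qed
 show "\<exists>K. compact K \<and> K \<subseteq> G \<and> (\<forall>x. x \<notin> K \<longrightarrow> ?\<eta> n x = 0)" for n
 proof (intro exI[of _ "{x. 1 \<le> real n * infdist x (- G)}"] conjI)
  have sub: "{x. 1 \<le> real n * infdist x (- G)} \<subseteq> G"
  proof
   fix x assume "x \<in> {x. 1 \<le> real n * infdist x (- G)}"
   then have "infdist x (- G) \<noteq> 0" by auto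
   moreover have "infdist x (- G) = 0" if "x \<notin> G" using that by simp
   ultimately show "x \<in> G" by blast
  qed
  moreover have "closed {x. 1 \<le> real n * infdist x (- G)}" by (intro closed_Collect_le continuous_intros)
  ultimately show "compact {x. 1 \<le> real n * infdist x (- G)}" using G(2) bounded_subset by (auto simp: compact_eq_bounded_closed)
  show "{x. 1 \<le> real n * infdist x (- G)} \<subseteq> G" by (rule sub)
 qed auto
qed

section \<open>Pairing with densities in the conjugate space and their approximation\<close>

context log_hoelder_exponent
begin

text \<open>Takes the place of Hoelder's inequality: smallness of the conjugate modular of d makes
  the pairing small uniformly on the unit ball.\<close>

lemma pairing_small:
 assumes m: "1 < m" "\<And>x. x \<in> G ==> m \<le> p x" and \<delta>: "0 < \<delta>"
 shows "\<exists>\<eta>>0. \<forall>(d::'a \<Rightarrow> 'b::euclidean_space) (b::'a \<Rightarrow> 'b). d \<in> borel_measurable (lebesgue_on G) \<and>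
  integrable (lebesgue_on G) (%x. norm (d x) powr (p x / (p x - 1))) \<and>
  (LINT x|lebesgue_on G. norm (d x) powr (p x / (p x - 1))) \<le> \<eta> \<and> b \<in> Lp_space G p \<and> Lp_norm G p b \<le> 1 \<longrightarrow>
  integrable (lebesgue_on G) (%x. norm (d x) * norm (b x)) \<and> (LINT x|lebesgue_on G. norm (d x) * norm (b x)) \<le> \<delta>"
proof -
 \<comment> \<open>On the unit ball the modular of b is at most 2^P; this L reduces its share to
   \<delta>/2, and the bound \<delta> / (2 A) on the modular of d takes care of the other
   half.\<close>
 define L where "L = max 1 (2 * 2 powr P / \<delta>)"
 define A where "A = L powr (1 / (m - 1))"
 have L: "1 \<le> L" "2 powr P / L \<le> \<delta> / 2" using \<delta> by (auto simp: L_def field_simps max_def)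
 have A: "0 < A" using L by (simp add: A_def)
 show ?thesis
 proof (intro exI[of _ "\<delta> / (2 * A)"] conjI allI impI; (elim conjE)?)
  show "0 < \<delta> / (2 * A)" using \<delta> A by simp
  fix d b :: "'a \<Rightarrow> 'b"
  assume d: "d \<in> borel_measurable (lebesgue_on G)" "integrable (lebesgue_on G) (%x. norm (d x) powr (p x / (p x - 1)))"
   "(LINT x|lebesgue_on G. norm (d x) powr (p x / (p x - 1))) \<le> \<delta> / (2 * A)" and b: "b \<in> Lp_space G p" "Lp_norm G p b \<le> 1"
  let ?B = "%x. norm (b x) powr p x / L + A * norm (d x) powr (p x / (p x - 1))"
  have i: "integrable (lebesgue_on G) ?B"
   by (intro Bochner_Integration.integrable_add integrable_mult_right integrable_divide_zero Lp_integrable_powr(1)[OF b(1)] d(2))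
  have le: "norm (d x) * norm (b x) \<le> ?B x" if "x \<in> G" for x
   unfolding A_def by (rule split_product[OF m(1) m(2)[OF that] L(1)]) auto
  show int: "integrable (lebesgue_on G) (%x. norm (d x) * norm (b x))"
  proof (rule Bochner_Integration.integrable_bound[OF i])
   show "AE x in lebesgue_on G. norm (norm (d x) * norm (b x)) \<le> norm (?B x)"
   proof (rule AE_I2)
    fix x assume "x \<in> space (lebesgue_on G)"
    then have "norm (d x) * norm (b x) \<le> ?B x" by (intro le) simp
    then show "norm (norm (d x) * norm (b x)) \<le> norm (?B x)" by simp
   qed
  qed (use d(1) Lp_space_measurable[OF b(1)] in auto)
  have "(LINT x|lebesgue_on G. norm (d x) * norm (b x)) \<le> (LINT x|lebesgue_on G. ?B x)"
   by (rule integral_mono[OF int i]) (simp add: le)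
  also have "\<dots> = (LINT x|lebesgue_on G. norm (b x) powr p x) / L + A * (LINT x|lebesgue_on G. norm (d x) powr (p x / (p x - 1)))"
   by (subst Bochner_Integration.integral_add) (auto intro!: integrable_divide_zero Lp_integrable_powr(1)[OF b(1)] d(2))
  also have "\<dots> \<le> 2 powr P / L + A * (\<delta> / (2 * A))"
   using L A d(3) by (intro add_mono divide_right_mono mult_left_mono modular_le_of_norm_le_1[OF b]) auto
  also have "A * (\<delta> / (2 * A)) = \<delta> / 2" using A by simp
  also have "2 powr P / L + \<delta> / 2 \<le> \<delta>" using L(2) by linarith
  finally show "(LINT x|lebesgue_on G. norm (d x) * norm (b x)) \<le> \<delta>" .
 qed
qed

text \<open>The conjugate power undoes the exponent: |a|^(p-1) to the power p/(p-1) is |a|^p, up to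
  a constant from the factor p.\<close>

lemma modular_gradient_conjugate:
 fixes a :: "'a \<Rightarrow> 'b::euclidean_space"
 assumes m: "1 < m" "\<And>x. x \<in> G ==> m \<le> p x" and P: "1 \<le> P" and a: "a \<in> Lp_space G p"
 shows "integrable (lebesgue_on G) (%x. norm (modular_gradient a x) powr (p x / (p x - 1)))"
proof (rule Bochner_Integration.integrable_bound)
 show "integrable (lebesgue_on G) (%x. P powr (m / (m - 1)) * norm (a x) powr p x)"
  by (intro integrable_mult_right Lp_integrable_powr(1) a)
 note [measurable] = modular_gradient_measurable[OF Lp_space_measurable[OF a]] p_meas
 show "(%x. norm (modular_gradient a x) powr (p x / (p x - 1))) \<in> borel_measurable (lebesgue_on G)" by measurable
 show "AE x in lebesgue_on G. norm (norm (modular_gradient a x) powr (p x / (p x - 1))) \<le> norm (P powr (m / (m - 1)) * norm (a x) powr p x)"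
 proof (rule AE_I2)
  fix x assume "x \<in> space (lebesgue_on G)"
  then have x: "x \<in> G" by simp
  have px: "1 < p x" "m \<le> p x" using m(1) m(2)[OF x] by auto
  have "norm (modular_gradient a x) powr (p x / (p x - 1)) \<le> (P * norm (a x) powr (p x - 1)) powr (p x / (p x - 1))"
   using px by (intro powr_mono2 norm_modular_gradient[OF x]) auto
  also have "\<dots> = P powr (p x / (p x - 1)) * norm (a x) powr p x"
   using P px by (simp add: powr_mult powr_powr)
  also have "\<dots> \<le> P powr (m / (m - 1)) * norm (a x) powr p x"
  proof -
   have "p x / (p x - 1) = 1 + 1 / (p x - 1)" "m / (m - 1) = 1 + 1 / (m - 1)" using px m(1) by (simp_all add: field_simps)
   moreover have "1 / (p x - 1) \<le> 1 / (m - 1)" using px m(1) by (intro frac_le) auto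
   ultimately show ?thesis using P by (intro mult_right_mono powr_mono) auto
  qed
  finally show "norm (norm (modular_gradient a x) powr (p x / (p x - 1))) \<le> norm (P powr (m / (m - 1)) * norm (a x) powr p x)"
   by simp
 qed
qed

text \<open>First truncate, then apply Lusin approximation to the bounded truncation, so that dominated convergence applies to both steps.\<close>

lemma continuous_density_approx:
 fixes a :: "'a \<Rightarrow> 'b::euclidean_space"
 assumes G: "open G" "bounded G" and m: "1 < m" "\<And>x. x \<in> G ==> m \<le> p x" and P: "1 \<le> P"
  and a: "a \<in> Lp_space G p" and \<delta>: "0 < \<delta>"
 obtains g :: "'a \<Rightarrow> 'b" and K where "continuous_on UNIV g" "compact K" "K \<subseteq> G" "\<And>x. x \<notin> K ==> g x = 0"
  "\<And>b. b \<in> Lp_space G p ==> Lp_norm G p b \<le> 1 ==> \<bar>LINT x|lebesgue_on G. (modular_gradient a x - g x) \<bullet> b x\<bar> \<le> \<delta>"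
proof -
 let ?p' = "%x. p x / (p x - 1)"
 let ?f = "modular_gradient a"
 \<comment> \<open>Nearest-point projection onto the ball of radius k: continuous, bounded by k, the
   identity on vectors of norm at most k, and it moves a vector by at most its norm.\<close>
 let ?c = "%k::nat. closest_point (cball (0::'b) (real k))"
 interpret finite_measure "lebesgue_on G" by (rule finite_measure_lebesgue_on)
 have d2: "0 < \<delta> / 2" using \<delta> by simp
 obtain \<eta> where \<eta>: "0 < \<eta>" and H: "\<And>(d::'a \<Rightarrow> 'b) (b::'a \<Rightarrow> 'b). d \<in> borel_measurable (lebesgue_on G) ==>
  integrable (lebesgue_on G) (%x. norm (d x) powr ?p' x) ==>
  (LINT x|lebesgue_on G. norm (d x) powr ?p' x) \<le> \<eta> ==> b \<in> Lp_space G p ==> Lp_norm G p b \<le> 1 ==>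
  integrable (lebesgue_on G) (%x. norm (d x) * norm (b x)) \<and> (LINT x|lebesgue_on G. norm (d x) * norm (b x)) \<le> \<delta> / 2"
  using pairing_small[OF m d2, where 'b='b] by blast
 have p': "1 \<le> ?p' x" "?p' x \<le> m / (m - 1)" "1 < p x" if "x \<in> G" for x
 proof -
  have px: "1 < p x" "m \<le> p x" using m(1) m(2)[OF that] by auto
  then have "?p' x = 1 + 1 / (p x - 1)" by (simp add: field_simps)
  moreover have "m / (m - 1) = 1 + 1 / (m - 1)" using m(1) by (simp add: field_simps)
  moreover have "1 / (p x - 1) \<le> 1 / (m - 1)" using px m(1) by (intro frac_le) auto
  ultimately show "1 \<le> ?p' x" "?p' x \<le> m / (m - 1)" "1 < p x" using px by auto
 qed
 note [measurable] = modular_gradient_measurable[OF Lp_space_measurable[OF a]] p_meas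
 have cc: "continuous_on UNIV (?c k)" for k by (rule continuous_on_closest_point) auto
 have cm [measurable]: "?c k \<in> borel_measurable borel" for k by (rule borel_measurable_continuous_onI[OF cc])
 have cn: "norm (?c k y) \<le> real k" for k y
  using closest_point_in_set[of "cball (0::'b) (real k)" y] by auto
 have cd: "norm (y - ?c k y) \<le> norm y" for k y
  using closest_point_le[of "cball (0::'b) (real k)" 0 y] by (simp add: dist_norm)
 have ce: "?c k y = y" if "norm y \<le> real k" for k y by (rule closest_point_self) (use that in auto)
 define f' where "f' k x = ?c k (?f x)" for k x
 have f'm [measurable]: "f' k \<in> borel_measurable (lebesgue_on G)" for k unfolding f'_def[abs_def] by measurable
 have f'i: "integrable (lebesgue_on G) (%x. norm (?f x) powr ?p' x)" by (rule modular_gradient_conjugate[OF m P a])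
 have bound1: "norm (norm (?f x - f' k x) powr ?p' x) \<le> norm (?f x) powr ?p' x" if "x \<in> G" for k x
  using p'[OF that] by (simp add: f'_def) (intro powr_mono2 cd; simp)
 have "(%k. LINT x|lebesgue_on G. norm (?f x - f' k x) powr ?p' x) \<longlonglongrightarrow> (LINT x|lebesgue_on G. 0)"
 proof (rule integral_dominated_convergence[OF _ _ f'i])
  show "AE x in lebesgue_on G. (%k. norm (?f x - f' k x) powr ?p' x) \<longlonglongrightarrow> 0"
  proof (rule AE_I2)
   fix x assume x: "x \<in> space (lebesgue_on G)"
   obtain k0 where "norm (?f x) < real k0" using reals_Archimedean2 by blast
   then have "norm (?f x - f' k x) powr ?p' x = 0" if "k0 \<le> k" for k
    using ce[of "?f x" k] that by (simp add: f'_def)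
   then show "(%k. norm (?f x - f' k x) powr ?p' x) \<longlonglongrightarrow> 0"
    by (intro tendsto_eventually) (auto simp: eventually_sequentially)
  qed
  show "AE x in lebesgue_on G. norm (norm (?f x - f' k x) powr ?p' x) \<le> norm (?f x) powr ?p' x" for k
   by (rule AE_I2) (rule bound1, simp)
 qed measurable
 then have "eventually (%k. (LINT x|lebesgue_on G. norm (?f x - f' k x) powr ?p' x) < \<eta>) sequentially"
  using \<eta> by (intro order_tendstoD(2)) auto
 then obtain k where k: "(LINT x|lebesgue_on G. norm (?f x - f' k x) powr ?p' x) < \<eta>"
  by (auto simp: eventually_sequentially)
 have ki: "integrable (lebesgue_on G) (%x. norm (?f x - f' k x) powr ?p' x)"
  by (rule Bochner_Integration.integrable_bound[OF f'i], measurable) (rule AE_I2, use bound1 in auto)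
 have "(%x. if x \<in> G then ?f x else 0) \<in> borel_measurable lebesgue"
  using modular_gradient_measurable[OF Lp_space_measurable[OF a]] borel_measurable_if[OF G_sets] by blast
 then have "(%x. if x \<in> G then ?f x else 0) measurable_on UNIV" by (rule lebesgue_measurable_imp_measurable_on) simp
 \<comment> \<open>Almost everywhere pointwise approximation by continuous functions of the whole
   space; neither bounds nor supports are controlled yet.\<close>
 then obtain N g0 where N: "negligible N" and g0: "\<And>n. continuous_on UNIV (g0 n)" "\<And>x. x \<notin> N ==> (%n. g0 n x) \<longlonglongrightarrow> (if x \<in> G then ?f x else 0)"
  unfolding measurable_on_def by auto
 obtain \<chi>' :: "nat \<Rightarrow> 'a \<Rightarrow> real" where \<chi>': "\<And>n. continuous_on UNIV (\<chi>' n)" "\<And>n x. 0 \<le> \<chi>' n x \<and> \<chi>' n x \<le> 1"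
  "\<And>x. x \<in> G ==> (%n. \<chi>' n x) \<longlonglongrightarrow> 1" "\<And>n. \<exists>K. compact K \<and> K \<subseteq> G \<and> (\<forall>x. x \<notin> K \<longrightarrow> \<chi>' n x = 0)"
  by (rule compact_exhaustion_function[OF G], rule that)
 \<comment> \<open>Projection to radius k supplies the uniform bound needed for dominated
   convergence, and the exhaustion supplies the compact support; both keep continuity.\<close>
 define g where "g n x = \<chi>' n x *\<^sub>R ?c k (g0 n x)" for n x
 have gc: "continuous_on UNIV (g n)" for n
  unfolding g_def[abs_def] by (intro continuous_on_scaleR \<chi>'(1) continuous_on_compose2[OF cc g0(1)]) auto
 have gm [measurable]: "g n \<in> borel_measurable (lebesgue_on G)" for n
  by (rule measurable_restrict_space1[OF measurable_completion]) (use gc in \<open>auto intro!: borel_measurable_continuous_onI\<close>)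
 have gn: "norm (g n x) \<le> real k" for n x
 proof -
  have "norm (g n x) \<le> 1 * real k" unfolding g_def norm_scaleR using \<chi>'(2)[of n x] by (intro mult_mono cn) auto
  then show ?thesis by simp
 qed
 let ?C = "(2 * real k + 1) powr (m / (m - 1))"
 have bound2: "norm (norm (f' k x - g n x) powr ?p' x) \<le> ?C" if x: "x \<in> G" for n x
 proof -
  have "norm (f' k x - g n x) \<le> 2 * real k + 1"
   using norm_triangle_ineq4[of "f' k x" "g n x"] cn[of k "?f x"] gn[of n x] unfolding f'_def by linarith
  then have "norm (f' k x - g n x) powr ?p' x \<le> (2 * real k + 1) powr ?p' x" using p'[OF x] by (intro powr_mono2) auto
  also have "\<dots> \<le> ?C" using p'[OF x] by (intro powr_mono) auto
  finally show ?thesis by simp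
 qed
 have Cint: "integrable (lebesgue_on G) (%x. ?C)" by simp
 have AEN: "AE x in lebesgue_on G. x \<notin> N"
 proof -
  have "AE x in lebesgue. x \<notin> N" using N by (intro AE_not_in) (simp add: negligible_iff_null_sets)
  then show ?thesis using G_sets by (subst AE_restrict_space_iff) (auto elim!: eventually_mono)
 qed
 have "(%n. LINT x|lebesgue_on G. norm (f' k x - g n x) powr ?p' x) \<longlonglongrightarrow> (LINT x|lebesgue_on G. 0)"
 proof (rule integral_dominated_convergence[OF _ _ Cint])
  show "AE x in lebesgue_on G. (%n. norm (f' k x - g n x) powr ?p' x) \<longlonglongrightarrow> 0"
   using AEN AE_space
  proof eventually_elim
   fix x assume x: "x \<notin> N" "x \<in> space (lebesgue_on G)"
   then have xG: "x \<in> G" by simp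
   have "(%n. ?c k (g0 n x)) \<longlonglongrightarrow> ?c k (?f x)"
    using g0(2)[OF x(1)] xG by (intro continuous_on_tendsto_compose[OF cc]) auto
   then have "(%n. g n x) \<longlonglongrightarrow> 1 *\<^sub>R f' k x" unfolding g_def f'_def by (intro tendsto_scaleR \<chi>'(3)[OF xG])
   then have "(%n. norm (f' k x - g n x)) \<longlonglongrightarrow> norm (f' k x - 1 *\<^sub>R f' k x)" by (intro tendsto_intros)
   then show "(%n. norm (f' k x - g n x) powr ?p' x) \<longlonglongrightarrow> 0"
    using p'(1)[OF xG] by (intro tendsto_zero_powrI[where b="?p' x"]) auto
  qed
  show "AE x in lebesgue_on G. norm (norm (f' k x - g n x) powr ?p' x) \<le> ?C" for n
   by (rule AE_I2) (rule bound2, simp)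
 qed measurable
 then have "eventually (%n. (LINT x|lebesgue_on G. norm (f' k x - g n x) powr ?p' x) < \<eta>) sequentially"
  using \<eta> by (intro order_tendstoD(2)) auto
 then obtain n where n: "(LINT x|lebesgue_on G. norm (f' k x - g n x) powr ?p' x) < \<eta>"
  by (auto simp: eventually_sequentially)
 have ni: "integrable (lebesgue_on G) (%x. norm (f' k x - g n x) powr ?p' x)"
  by (rule Bochner_Integration.integrable_bound[OF Cint], measurable) (rule AE_I2, use bound2 in auto)
 obtain K where K: "compact K" "K \<subseteq> G" "\<And>x. x \<notin> K ==> \<chi>' n x = 0" using \<chi>'(4)[of n] by blast
 show thesis
 proof (rule that[OF gc[of n] K(1,2)])
  show "g n x = 0" if "x \<notin> K" for x using K(3)[OF that] by (simp add: g_def)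
  fix b :: "'a \<Rightarrow> 'b" assume b: "b \<in> Lp_space G p" "Lp_norm G p b \<le> 1"
  note bm [measurable] = Lp_space_measurable[OF b(1)]
  have 1: "integrable (lebesgue_on G) (%x. norm (?f x - f' k x) * norm (b x)) \<and> (LINT x|lebesgue_on G. norm (?f x - f' k x) * norm (b x)) \<le> \<delta> / 2"
   by (rule H[OF _ ki less_imp_le[OF k] b]) measurable
  have 2: "integrable (lebesgue_on G) (%x. norm (f' k x - g n x) * norm (b x)) \<and> (LINT x|lebesgue_on G. norm (f' k x - g n x) * norm (b x)) \<le> \<delta> / 2"
   by (rule H[OF _ ni less_imp_le[OF n] b]) measurable
  let ?h = "%x. norm (?f x - f' k x) * norm (b x) + norm (f' k x - g n x) * norm (b x)"
  have hi: "integrable (lebesgue_on G) ?h" using 1 2 by auto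
  have le: "norm ((?f x - g n x) \<bullet> b x) \<le> ?h x" for x
  proof -
   have "norm ((?f x - g n x) \<bullet> b x) \<le> norm (?f x - g n x) * norm (b x)" by (simp add: Cauchy_Schwarz_ineq2)
   also have "\<dots> \<le> (norm (?f x - f' k x) + norm (f' k x - g n x)) * norm (b x)"
    using norm_triangle_ineq[of "?f x - f' k x" "f' k x - g n x"] by (intro mult_right_mono) auto
   finally show ?thesis by (simp add: distrib_right)
  qed
  have "integrable (lebesgue_on G) (%x. (?f x - g n x) \<bullet> b x)"
  proof (rule Bochner_Integration.integrable_bound[OF hi])
   show "AE x in lebesgue_on G. norm ((?f x - g n x) \<bullet> b x) \<le> norm (?h x)"
    by (rule AE_I2) (rule order_trans[OF le], simp)
  qed measurable
  then have "norm (LINT x|lebesgue_on G. (?f x - g n x) \<bullet> b x) \<le> (LINT x|lebesgue_on G. ?h x)"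
   by (rule Bochner_Integration.integral_norm_bound_integral[OF _ hi le])
  also have "\<dots> = (LINT x|lebesgue_on G. norm (?f x - f' k x) * norm (b x)) + (LINT x|lebesgue_on G. norm (f' k x - g n x) * norm (b x))"
   by (rule Bochner_Integration.integral_add) (use 1 2 in auto)
  also have "\<dots> \<le> \<delta>" using 1 2 by linarith
  finally show "\<bar>LINT x|lebesgue_on G. (?f x - g n x) \<bullet> b x\<bar> \<le> \<delta>" by simp
 qed
qed

end

section \<open>Approximate representation of functionals\<close>

locale parabolic_strict = parabolic \<Omega> T q p P c1
 for \<Omega> :: "(real^'n::finite) set" and T q p P c1 +
 fixes m :: real
 assumes m: "1 < m" and mq: "\<And>z. z \<in> cylinder T \<Omega> ==> m \<le> q z" and mp: "\<And>z. z \<in> cylinder T \<Omega> ==> m \<le> p z"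
  and P1: "1 \<le> P"
begin

definition energy :: "(real \<times> (real^'n) \<Rightarrow> real^'n) \<Rightarrow> real" where
 "energy v = (LINT z|lebesgue_on Q. norm (v z) powr q z) + (LINT z|lebesgue_on Q. norm (\<epsilon> v z) powr p z)"

definition energy_derivative :: "(real \<times> (real^'n) \<Rightarrow> real^'n) \<Rightarrow> (real \<times> (real^'n) \<Rightarrow> real^'n) \<Rightarrow> real" where
 "energy_derivative u v = (LINT z|lebesgue_on Q. q.modular_gradient u z \<bullet> v z) +
  (LINT z|lebesgue_on Q. p.modular_gradient (\<epsilon> u) z \<bullet> \<epsilon> v z)"

lemma energy_nonneg: "0 \<le> energy v"
 unfolding energy_def by (intro add_nonneg_nonneg Bochner_Integration.integral_nonneg) auto

text \<open>The order of quantifiers is the point: one step s serves all u and v, so s can be fixed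
  before a near-minimiser is selected.\<close>

lemma energy_increment:
 assumes e: "0 < e"
 shows "\<exists>s. 0 < s \<and> (\<forall>u\<in>X. \<forall>v\<in>X. energy (%z. u z + s *\<^sub>R v z) \<le> energy u + s * energy_derivative u v + s * e * (energy u + energy v))"
proof -
 have P0: "0 < P" using P1 by simp
 obtain s1 where s1: "0 < s1" "s1 \<le> 1" and S1: "\<And>s (a::real \<times> (real^'n) \<Rightarrow> real^'n) b. 0 < s ==> s \<le> s1 ==> a \<in> Lp_space Q q ==> b \<in> Lp_space Q q ==>
  (LINT x|lebesgue_on Q. norm (a x + s *\<^sub>R b x) powr q x) \<le> (LINT x|lebesgue_on Q. norm (a x) powr q x) +
   s * (LINT x|lebesgue_on Q. q.modular_gradient a x \<bullet> b x) +
   s * e * ((LINT x|lebesgue_on Q. norm (a x) powr q x) + (LINT x|lebesgue_on Q. norm (b x) powr q x))"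
  using q.modular_increment[OF m mq e P0, where 'b="real^'n"] by blast
 obtain s2 where s2: "0 < s2" "s2 \<le> 1" and S2: "\<And>s (a::real \<times> (real^'n) \<Rightarrow> real^'n^'n) b. 0 < s ==> s \<le> s2 ==> a \<in> Lp_space Q p ==> b \<in> Lp_space Q p ==>
  (LINT x|lebesgue_on Q. norm (a x + s *\<^sub>R b x) powr p x) \<le> (LINT x|lebesgue_on Q. norm (a x) powr p x) +
   s * (LINT x|lebesgue_on Q. p.modular_gradient a x \<bullet> b x) +
   s * e * ((LINT x|lebesgue_on Q. norm (a x) powr p x) + (LINT x|lebesgue_on Q. norm (b x) powr p x))"
  using p.modular_increment[OF m mp e P0, where 'b="real^'n^'n"] by blast
 define s where "s = min s1 s2"
 have s: "0 < s" "s \<le> s1" "s \<le> s2" using s1 s2 by (auto simp: s_def)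
 show ?thesis
 proof (intro exI[of _ s] conjI ballI s(1))
  fix u v assume u: "u \<in> X" and v: "v \<in> X"
  have sv: "(%z. s *\<^sub>R v z) \<in> X" by (rule X_scaleR[OF v])
  have w: "(%z. u z + s *\<^sub>R v z) \<in> X" by (rule X_add[OF u sv])
  have ae: "AE z in lebesgue_on Q. norm (\<epsilon> (%z. u z + s *\<^sub>R v z) z) powr p z = norm (\<epsilon> u z + s *\<^sub>R \<epsilon> v z) powr p z"
   using st.eps_space_add(2)[OF X_eps_space[OF u] X_eps_space[OF sv]] st.eps_space_scaleR(2)[OF X_eps_space[OF v], of s]
   by eventually_elim simp
  have "(LINT z|lebesgue_on Q. norm (\<epsilon> (%z. u z + s *\<^sub>R v z) z) powr p z) = (LINT z|lebesgue_on Q. norm (\<epsilon> u z + s *\<^sub>R \<epsilon> v z) powr p z)"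
   by (rule integral_cong_AE[OF _ _ ae])
    (intro p.powr_measurable p.Lp_space_measurable X_D(2) w p.Lp_space_add p.Lp_space_scaleR u v)+
  then show "energy (%z. u z + s *\<^sub>R v z) \<le> energy u + s * energy_derivative u v + s * e * (energy u + energy v)"
   using S1[OF s(1,2) X_D(1)[OF u] X_D(1)[OF v]] S2[OF s(1,3) X_D(2)[OF u] X_D(2)[OF v]]
   unfolding energy_def energy_derivative_def by (simp add: algebra_simps)
 qed
qed

lemma energy_derivative_minus:
 assumes u: "u \<in> X" and v: "v \<in> X" shows "energy_derivative u (%z. (- 1) *\<^sub>R v z) = - energy_derivative u v"
proof -
 have ae: "AE z in lebesgue_on Q. p.modular_gradient (\<epsilon> u) z \<bullet> \<epsilon> (%z. (- 1) *\<^sub>R v z) z = - (p.modular_gradient (\<epsilon> u) z \<bullet> \<epsilon> v z)"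
  using st.eps_space_scaleR(2)[OF X_eps_space[OF v], of "- 1"] by eventually_elim simp
 have "(LINT z|lebesgue_on Q. p.modular_gradient (\<epsilon> u) z \<bullet> \<epsilon> (%z. (- 1) *\<^sub>R v z) z) = (LINT z|lebesgue_on Q. - (p.modular_gradient (\<epsilon> u) z \<bullet> \<epsilon> v z))"
  by (rule integral_cong_AE[OF _ _ ae])
   (intro borel_measurable_inner borel_measurable_uminus p.modular_gradient_measurable p.Lp_space_measurable X_D(2) X_scaleR u v)+
 then show ?thesis unfolding energy_derivative_def by simp
qed

text \<open>A near-minimiser \<open>u\<close> of \<open>energy - us\<close> nearly satisfies the Euler-Lagrange equation, uniformly on the unit ball, because the
 modular is uniformly differentiable on bounded sets. This replaces Hahn-Banach and the duality theory of \<open>L\<^sup>p\<close>.\<close>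

lemma approximate_gradient:
 assumes us: "us \<in> X_dual T \<Omega> q p" and \<delta>: "0 < \<delta>"
 shows "\<exists>u\<in>X. \<forall>v\<in>X. N v \<le> 1 \<longrightarrow> \<bar>us v - energy_derivative u v\<bar> \<le> \<delta>"
proof -
 obtain C where C: "0 \<le> C" "\<And>u. u \<in> X ==> \<bar>us u\<bar> \<le> C * N u" by (rule X_dual_bounded[OF us], rule that)
 \<comment> \<open>Coercivity with constant 2 C absorbs the functional into half of the energy; the
   other half bounds the energy of near-minimisers.\<close>
 have C2: "0 \<le> 2 * C" using C by simp
 obtain K1 where K1: "\<And>f::real \<times> (real^'n) \<Rightarrow> real^'n. f \<in> Lp_space Q q ==> 2 * C * Lp_norm Q q f \<le> (LINT x|lebesgue_on Q. norm (f x) powr q x) + K1"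
  using q.modular_coercive[OF m mq C2, where 'b="real^'n"] by blast
 obtain K2 where K2: "\<And>f::real \<times> (real^'n) \<Rightarrow> real^'n^'n. f \<in> Lp_space Q p ==> 2 * C * Lp_norm Q p f \<le> (LINT x|lebesgue_on Q. norm (f x) powr p x) + K2"
  using p.modular_coercive[OF m mp C2, where 'b="real^'n^'n"] by blast
 define F where "F v = energy v - us v" for v
 have low: "energy v / 2 - (K1 + K2) / 2 \<le> F v" if v: "v \<in> X" for v
 proof -
  have "2 * us v \<le> 2 * C * N v" using C(2)[OF v] by linarith
  also have "\<dots> = 2 * C * Lp_norm Q q v + 2 * C * Lp_norm Q p (\<epsilon> v)" by (simp add: N_eq distrib_left)
  also have "\<dots> \<le> energy v + (K1 + K2)" using K1[OF X_D(1)[OF v]] K2[OF X_D(2)[OF v]] unfolding energy_def by linarith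
  finally show ?thesis unfolding F_def by (simp add: field_simps)
 qed
 define I where "I = Inf (F ` X)"
 have bdd: "bdd_below (F ` X)"
 proof (rule bdd_belowI2[of _ "- (K1 + K2) / 2"])
  show "- (K1 + K2) / 2 \<le> F v" if "v \<in> X" for v using low[OF that] energy_nonneg[of v] by (simp add: field_simps)
 qed
 have I: "I \<le> F v" if "v \<in> X" for v unfolding I_def by (rule cInf_lower) (use that bdd in auto)
 \<comment> \<open>Bounds \<open>energy u + energy v\<close>: the first summand is the energy bound
   for a near-minimiser of tolerance at most 1, by comparison with 0; the second bounds both
   modulars of v on the unit ball.\<close>
 define S where "S = max 0 (2 * (F (%z. 0) + 1 + (K1 + K2) / 2)) + 2 * 2 powr P"
 have S: "0 < S" unfolding S_def by (rule add_nonneg_pos) auto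
 define e where "e = \<delta> / (2 * S)"
 have e: "0 < e" using \<delta> S by (simp add: e_def)
 obtain s where s: "0 < s" and inc: "\<And>u v. u \<in> X ==> v \<in> X ==> energy (%z. u z + s *\<^sub>R v z) \<le> energy u + s * energy_derivative u v + s * e * (energy u + energy v)"
  using energy_increment[OF e] by blast
 \<comment> \<open>The tolerance must be small relative to s, since the resulting inequality is
   divided by s.\<close>
 define \<eta> where "\<eta> = min 1 (s * \<delta> / 2)"
 have \<eta>: "0 < \<eta>" "\<eta> \<le> 1" "\<eta> \<le> s * \<delta> / 2" using s \<delta> by (auto simp: \<eta>_def)
 have "F ` X \<noteq> {}" using zero_X by blast
 then have "\<exists>y\<in>F ` X. y < I + \<eta>" using \<eta>(1) unfolding I_def by (intro cInf_lessD) auto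
 then obtain u where u: "u \<in> X" "F u < I + \<eta>" by auto
 have Eu: "energy u + 2 * 2 powr P \<le> S"
  using low[OF u(1)] u(2) I[OF zero_X] \<eta>(2) unfolding S_def by (simp add: max_def field_simps)
 have key: "us v - energy_derivative u v \<le> \<delta>" if v: "v \<in> X" "N v \<le> 1" for v
 proof -
  have n: "Lp_norm Q q v \<le> 1" "Lp_norm Q p (\<epsilon> v) \<le> 1"
   using v(2) q.Lp_norm_nonneg[of v] p.Lp_norm_nonneg[of "\<epsilon> v"] X_D(1,2)[OF v(1)] unfolding N_eq by auto
  have Ev: "energy v \<le> 2 * 2 powr P"
   using q.modular_le_of_norm_le_1[OF X_D(1)[OF v(1)] n(1)] p.modular_le_of_norm_le_1[OF X_D(2)[OF v(1)] n(2)]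
   unfolding energy_def by simp
  have sv: "(%z. s *\<^sub>R v z) \<in> X" by (rule X_scaleR[OF v(1)])
  have usw: "us (%z. u z + s *\<^sub>R v z) = us u + s * us v"
   using X_dualD(2)[OF us u(1) sv] X_dualD(3)[OF us v(1), of s] by simp
  have "I \<le> F (%z. u z + s *\<^sub>R v z)" by (rule I[OF X_add[OF u(1) sv]])
  then have "F u - \<eta> \<le> energy u + s * energy_derivative u v + s * e * (energy u + energy v) - (us u + s * us v)"
   using inc[OF u(1) v(1)] u(2) usw unfolding F_def by linarith
  then have "s * (us v - energy_derivative u v) \<le> \<eta> + s * e * (energy u + energy v)"
   unfolding F_def by (simp add: algebra_simps)
  also have "\<dots> \<le> s * \<delta> / 2 + s * e * S"
   using Eu Ev s e \<eta>(3) by (intro add_mono mult_left_mono) auto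
  also have "\<dots> = s * \<delta>" using S by (simp add: e_def field_simps)
  finally show ?thesis using s by simp
 qed
 show ?thesis
 proof (intro bexI[OF _ u(1)] ballI impI)
  fix v assume v: "v \<in> X" "N v \<le> 1"
  have "us (%z. (- 1) *\<^sub>R v z) = - us v" using X_dualD(3)[OF us v(1), of "- 1"] by simp
  moreover have "N (%z. (- 1) *\<^sub>R v z) \<le> 1" using N_scaleR[OF v(1), of "- 1"] v(2) by simp
  ultimately have "- us v - - energy_derivative u v \<le> \<delta>"
   using key[OF X_scaleR[OF v(1), of "- 1"]] energy_derivative_minus[OF u(1) v(1)] by simp
  then show "\<bar>us v - energy_derivative u v\<bar> \<le> \<delta>" using key[OF v] by (simp add: abs_le_iff)
 qed
qed

end

text \<open>Compact support is witnessed by some K outside of which g vanishes; such a K serves all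
  components at once.\<close>

definition compactly_in :: "'a::euclidean_space set \<Rightarrow> ('a \<Rightarrow> 'b::euclidean_space) \<Rightarrow> bool" where
 "compactly_in G g \<longleftrightarrow> continuous_on UNIV g \<and> (\<exists>K. compact K \<and> K \<subseteq> G \<and> (\<forall>z. z \<notin> K \<longrightarrow> g z = 0))"

lemma compactly_in_bounded:
 assumes "compactly_in G g" shows "\<exists>B\<ge>0. \<forall>z. norm (g z) \<le> B"
proof -
 obtain K where K: "continuous_on UNIV g" "compact K" "\<And>z. z \<notin> K ==> g z = 0" using assms unfolding compactly_in_def by blast
 obtain B where B: "0 \<le> B" "\<And>z. z \<in> K ==> norm (g z) \<le> B"
  by (rule continuous_bounded_on_bounded[OF K(1) compact_imp_bounded[OF K(2)]], rule that)
 have "norm (g z) \<le> B" for z using B K(3)[of z] by (cases "z \<in> K") auto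
 then show ?thesis using B(1) by blast
qed

lemma continuous_on_UNIV_lebesgue_on:
 fixes g :: "'a::euclidean_space \<Rightarrow> 'b::euclidean_space"
 shows "continuous_on UNIV g ==> g \<in> borel_measurable (lebesgue_on G)"
 by (rule measurable_restrict_space1[OF measurable_completion]) (auto intro!: borel_measurable_continuous_onI)

lemma compactly_in_measurable: "compactly_in G g ==> g \<in> borel_measurable (lebesgue_on S)"
 unfolding compactly_in_def by (blast intro: continuous_on_UNIV_lebesgue_on)

lemma compactly_in_uniform:
 fixes g :: "'a::euclidean_space \<Rightarrow> 'b::euclidean_space"
 assumes g: "compactly_in G g" and e: "0 < e"
 shows "\<exists>d>0. \<forall>y z. dist y z \<le> d \<longrightarrow> norm (g y - g z) \<le> e"
proof -
 obtain K where K: "continuous_on UNIV g" "compact K" "\<And>z. z \<notin> K ==> g z = 0" using g unfolding compactly_in_def by blast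
 obtain r where r: "\<And>z. z \<in> K ==> norm z \<le> r" using compact_imp_bounded[OF K(2)] by (auto simp: bounded_iff)
 have "uniformly_continuous_on (cball 0 (r + 1)) g"
  by (intro compact_uniformly_continuous continuous_on_subset[OF K(1)]) auto
 then obtain d where d: "0 < d" "\<And>y z. y \<in> cball 0 (r + 1) ==> z \<in> cball 0 (r + 1) ==> dist z y < d ==> dist (g z) (g y) < e"
  unfolding uniformly_continuous_on_def using e by meson
 show ?thesis
 \<comment> \<open>Halving d allows the non-strict inequality; the cap 1 keeps both points in the
   ball of radius r + 1 as soon as one of them lies in K.\<close>
 proof (intro exI[of _ "min (d / 2) 1"] conjI allI impI)
  fix y z :: 'a assume yz: "dist y z \<le> min (d / 2) 1"
  show "norm (g y - g z) \<le> e"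
  proof (cases "y \<in> K \<or> z \<in> K")
   case True
   have "norm y \<le> norm z + dist y z" "norm z \<le> norm y + dist y z"
    using norm_triangle_sub[of y z] norm_triangle_sub[of z y] by (auto simp: dist_norm norm_minus_commute)
   then have "norm y \<le> r + 1 \<and> norm z \<le> r + 1" using True r[of y] r[of z] yz by auto
   then have "dist (g y) (g z) < e" using yz d(1) by (intro d(2)) (auto simp: mem_cball_0)
   then show ?thesis by (simp add: dist_norm)
  next
   case False
   then show ?thesis using K(3) e by simp
  qed
 qed (use d in auto)
qed

section \<open>Functionals with continuous densities of compact support in the cylinder\<close>

context parabolic_strict
begin

lemma J_eps_eq:
 assumes g: "compactly_in Q g" and F: "compactly_in Q F" and v: "v \<in> X"
 shows "J_eps T \<Omega> q p g F v = (LINT z|lebesgue_on Q. g z \<bullet> v z) + (LINT z|lebesgue_on Q. F z \<bullet> \<epsilon> v z)"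
  "integrable (lebesgue_on Q) (%z. g z \<bullet> v z)" "integrable (lebesgue_on Q) (%z. F z \<bullet> \<epsilon> v z)"
proof -
 obtain B where B: "\<forall>z. norm (g z) \<le> B" using compactly_in_bounded[OF g] by blast
 obtain B' where B': "\<forall>z. norm (F z) \<le> B'" using compactly_in_bounded[OF F] by blast
 show i: "integrable (lebesgue_on Q) (%z. g z \<bullet> v z)" "integrable (lebesgue_on Q) (%z. F z \<bullet> \<epsilon> v z)"
  using integrable_inner_bounded[OF compactly_in_measurable[OF g] B[rule_format] X_integrable(1)[OF v]]
   integrable_inner_bounded[OF compactly_in_measurable[OF F] B'[rule_format] X_integrable(2)[OF v]] by auto
 show "J_eps T \<Omega> q p g F v = (LINT z|lebesgue_on Q. g z \<bullet> v z) + (LINT z|lebesgue_on Q. F z \<bullet> \<epsilon> v z)"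
  using v i by (simp add: J_eps_def)
qed

lemma J_compactly_in_X_dual:
 assumes g: "compactly_in Q g" and F: "compactly_in Q F"
 shows "J_eps T \<Omega> q p g F \<in> X_dual T \<Omega> q p"
proof -
 obtain B where B: "0 \<le> B" "\<forall>z. norm (g z) \<le> B" using compactly_in_bounded[OF g] by blast
 obtain B' where B': "0 \<le> B'" "\<forall>z. norm (F z) \<le> B'" using compactly_in_bounded[OF F] by blast
 show ?thesis
 proof (rule J_in_X_dual[OF compactly_in_measurable[OF g] _ compactly_in_measurable[OF F], of "B + B'"])
  show "norm (g z) \<le> B + B'" "norm (F z) \<le> B + B'" for z
   using B(1) B'(1) B(2)[rule_format, of z] B'(2)[rule_format, of z] by simp_all
 qed (use B(1) B'(1) in simp)
qed

lemma X_dual_diff: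
 assumes us: "us \<in> X_dual T \<Omega> q p" and w: "w \<in> X_dual T \<Omega> q p"
 shows "restrict (%v. us v - w v) X \<in> X_dual T \<Omega> q p"
proof -
 obtain C where C: "0 \<le> C" "\<And>u. u \<in> X ==> \<bar>us u\<bar> \<le> C * N u" by (rule X_dual_bounded[OF us], rule that)
 obtain C' where C': "0 \<le> C'" "\<And>u. u \<in> X ==> \<bar>w u\<bar> \<le> C' * N u" by (rule X_dual_bounded[OF w], rule that)
 have "\<bar>us u - w u\<bar> \<le> (C + C') * N u" if "u \<in> X" for u
  using C(2)[OF that] C'(2)[OF that] by (simp add: distrib_right)
 then have E: "\<exists>C. \<forall>u\<in>X. \<bar>restrict (%v. us v - w v) X u\<bar> \<le> C * N u" by (intro exI[of _ "C + C'"]) simp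
 show ?thesis
  unfolding X_dual_def dual_space_def mem_Collect_eq
  by (intro conjI ballI allI; (rule E)?)
   (simp_all add: X_add X_scaleR X_dualD(2,3)[OF us] X_dualD(2,3)[OF w] algebra_simps)
qed

lemma dual_norm_restrict: "DN (restrict L X) = DN L"
proof -
 have "{\<bar>restrict L X u\<bar> | u. u \<in> X \<and> N u \<le> 1} = {\<bar>L u\<bar> | u. u \<in> X \<and> N u \<le> 1}" by force
 then show ?thesis by (simp add: X_dual_norm_def dual_norm_def)
qed

lemma dual_norm_le_unit:
 assumes "\<And>v. v \<in> X ==> N v \<le> 1 ==> \<bar>L v\<bar> \<le> c"
 shows "DN L \<le> c"
 unfolding X_dual_norm_def dual_norm_def
 by (rule cSup_least) (use zero_X N_zero assms in auto)

text \<open>Three errors of \<delta>/3: the Euler-Lagrange error of the near-minimiser u, and the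
  approximation of the two modular gradients, at u and at \<open>\<epsilon> u\<close>, by continuous
  densities. The bound on the unit ball extends to X through \<open>dual_le\<close>.\<close>

lemma approximation_continuous_density:
 assumes us: "us \<in> X_dual T \<Omega> q p" and \<delta>: "0 < \<delta>"
 shows "\<exists>g F. compactly_in Q g \<and> compactly_in Q F \<and> (\<forall>v\<in>X. \<bar>us v - J_eps T \<Omega> q p g F v\<bar> \<le> \<delta> * N v)"
proof -
 have d3: "0 < \<delta> / 3" using \<delta> by simp
 obtain u where u: "u \<in> X" "\<And>v. v \<in> X ==> N v \<le> 1 ==> \<bar>us v - energy_derivative u v\<bar> \<le> \<delta> / 3"
  using approximate_gradient[OF us d3] by blast
 obtain g :: "real \<times> (real^'n) \<Rightarrow> real^'n" and K where g: "continuous_on UNIV g" "compact K" "K \<subseteq> Q" "\<And>x. x \<notin> K ==> g x = 0"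
  "\<And>b. b \<in> Lp_space Q q ==> Lp_norm Q q b \<le> 1 ==> \<bar>LINT x|lebesgue_on Q. (q.modular_gradient u x - g x) \<bullet> b x\<bar> \<le> \<delta> / 3"
  by (rule q.continuous_density_approx[OF open_Q bounded_Q m mq P1 X_D(1)[OF u(1)] d3], assumption, rule that)
 obtain F :: "real \<times> (real^'n) \<Rightarrow> real^'n^'n" and K' where F: "continuous_on UNIV F" "compact K'" "K' \<subseteq> Q" "\<And>x. x \<notin> K' ==> F x = 0"
  "\<And>b. b \<in> Lp_space Q p ==> Lp_norm Q p b \<le> 1 ==> \<bar>LINT x|lebesgue_on Q. (p.modular_gradient (\<epsilon> u) x - F x) \<bullet> b x\<bar> \<le> \<delta> / 3"
  by (rule p.continuous_density_approx[OF open_Q bounded_Q m mp P1 X_D(2)[OF u(1)] d3], assumption, rule that)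
 have gF: "compactly_in Q g" "compactly_in Q F" using g F unfolding compactly_in_def by blast+
 let ?J = "J_eps T \<Omega> q p g F"
 have est: "\<bar>us v - ?J v\<bar> \<le> \<delta>" if v: "v \<in> X" "N v \<le> 1" for v
 proof -
  have n: "Lp_norm Q q v \<le> 1" "Lp_norm Q p (\<epsilon> v) \<le> 1"
   using v(2) q.Lp_norm_nonneg[of v] p.Lp_norm_nonneg[of "\<epsilon> v"] X_D(1,2)[OF v(1)] unfolding N_eq by auto
  have "(LINT x|lebesgue_on Q. (q.modular_gradient u x - g x) \<bullet> v x) = (LINT x|lebesgue_on Q. q.modular_gradient u x \<bullet> v x) - (LINT x|lebesgue_on Q. g x \<bullet> v x)"
   unfolding inner_diff_left
   by (rule Bochner_Integration.integral_diff[OF q.modular_gradient_inner_integrable[OF X_D(1)[OF u(1)] X_D(1)[OF v(1)]] J_eps_eq(2)[OF gF v(1)]])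
  moreover have "(LINT x|lebesgue_on Q. (p.modular_gradient (\<epsilon> u) x - F x) \<bullet> \<epsilon> v x) = (LINT x|lebesgue_on Q. p.modular_gradient (\<epsilon> u) x \<bullet> \<epsilon> v x) - (LINT x|lebesgue_on Q. F x \<bullet> \<epsilon> v x)"
   unfolding inner_diff_left
   by (rule Bochner_Integration.integral_diff[OF p.modular_gradient_inner_integrable[OF X_D(2)[OF u(1)] X_D(2)[OF v(1)]] J_eps_eq(3)[OF gF v(1)]])
  ultimately show ?thesis
   using u(2)[OF v] g(5)[OF X_D(1)[OF v(1)] n(1)] F(5)[OF X_D(2)[OF v(1)] n(2)] J_eps_eq(1)[OF gF v(1)]
   unfolding energy_derivative_def by linarith
 qed
 have D: "restrict (%v. us v - ?J v) X \<in> X_dual T \<Omega> q p" by (rule X_dual_diff[OF us J_compactly_in_X_dual[OF gF]])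
 have DN: "DN (restrict (%v. us v - ?J v) X) \<le> \<delta>" by (rule dual_norm_le_unit) (simp add: est)
 have "\<bar>us v - ?J v\<bar> \<le> \<delta> * N v" if v: "v \<in> X" for v
 proof -
  have "\<bar>us v - ?J v\<bar> \<le> DN (restrict (%v. us v - ?J v) X) * N v" using dual_le[OF D v] v by simp
  also have "\<dots> \<le> \<delta> * N v" by (rule mult_right_mono[OF DN N_nonneg[OF v]])
  finally show ?thesis .
 qed
 then show ?thesis using gF by blast
qed

end

section \<open>Convergence of the smoothed functionals\<close>

text \<open>The evenness of the kernel moves mollification from w to g, with
  \<open>C1_functional_convolution\<close> in the role of Fubini. Mollifying g changes it by at most
  e uniformly, so the error involves only the L^1 norm of w and no regularity of w.\<close>

lemma convolution_pairing:
 fixes g w :: "'a::euclidean_space \<Rightarrow> real"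
 assumes g: "compactly_in G g" and w: "integrable lebesgue w" and S: "bounded S" "\<forall>y. y \<notin> S \<longrightarrow> w y = 0"
  and h: "0 < h" and e: "\<forall>y z. dist y z \<le> h \<longrightarrow> norm (g y - g z) \<le> e"
 shows "\<bar>(LINT z|lebesgue. convolution (mollifier h) w z * g z) - (LINT z|lebesgue. w z * g z)\<bar> \<le> e * (LINT z|lebesgue. \<bar>w z\<bar>)"
  "continuous_on UNIV k ==> integrable lebesgue (%z. k z * g z)" "integrable lebesgue (%z. w z * g z)"
proof -
 obtain K where K: "continuous_on UNIV g" "compact K" "\<And>z. z \<notin> K ==> g z = 0" using g unfolding compactly_in_def by blast
 obtain B where B: "0 \<le> B" "\<forall>z. norm (g z) \<le> B" using compactly_in_bounded[OF g] by blast
 have cm: "f \<in> borel_measurable lebesgue" if "continuous_on UNIV f" for f :: "'a \<Rightarrow> real"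
  using that by (intro measurable_completion) (auto intro!: borel_measurable_continuous_onI)
 have ig: "integrable lebesgue (%z. k z * g z)" if k: "continuous_on UNIV k" for k
 proof -
  have "integrable lborel (%z. indicator K z *\<^sub>R (k z * g z))"
   by (intro borel_integrable_compact K(2) continuous_on_mult continuous_on_subset[OF k] continuous_on_subset[OF K(1)]) auto
  moreover have "(%z. indicator K z *\<^sub>R (k z * g z)) = (%z. k z * g z)" using K(3) by (auto simp: indicator_def fun_eq_iff)
  ultimately have "integrable lborel (%z. k z * g z)" by simp
  then show ?thesis by (subst integrable_completion) auto
 qed
 then show "continuous_on UNIV k ==> integrable lebesgue (%z. k z * g z)" .
 have wb: "integrable lebesgue (%z. w z * f z)" if f: "continuous_on UNIV f" "\<And>z. \<bar>f z\<bar> \<le> b" for f :: "'a \<Rightarrow> real" and b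
 proof (rule Bochner_Integration.integrable_bound)
  show "integrable lebesgue (%z. b * \<bar>w z\<bar>)" using w by auto
  show "AE z in lebesgue. norm (w z * f z) \<le> norm (b * \<bar>w z\<bar>)"
  proof (rule AE_I2)
   fix z
   have "norm (w z * f z) = \<bar>f z\<bar> * \<bar>w z\<bar>" by (simp add: abs_mult mult.commute)
   also have "\<dots> \<le> b * \<bar>w z\<bar>" using f(2)[of z] by (intro mult_right_mono) auto
   also have "\<dots> \<le> norm (b * \<bar>w z\<bar>)" unfolding real_norm_def by (rule abs_ge_self)
   finally show "norm (w z * f z) \<le> norm (b * \<bar>w z\<bar>)" .
  qed
 qed (use w cm[OF f(1)] in auto)
 show wg: "integrable lebesgue (%z. w z * g z)" by (rule wb[OF K(1), of B]) (use B(2) in auto)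
 let ?\<Lambda> = "%\<phi>. LINT z|lebesgue. \<phi> z * g z"
 let ?m = "mollifier h :: 'a \<Rightarrow> real"
 have m: "test_fn ?m" by (rule test_fn_mollifier[OF h])
 have tc: "continuous_on UNIV \<phi>" if "test_fn \<phi>" for \<phi> :: "'a \<Rightarrow> real" using that smooth_continuous_on by (auto simp: test_fn_def)
 have gabs: "integrable lebesgue (%z. \<bar>g z\<bar>)" using ig[OF continuous_on_const[of UNIV 1]] by simp
 have L: "C1_functional ?\<Lambda> (LINT z|lebesgue. \<bar>g z\<bar>)"
 proof
  fix f f' :: "'a \<Rightarrow> real" assume f: "test_fn f"
  show "(LINT z|lebesgue. (c * f z) * g z) = c *\<^sub>R (LINT z|lebesgue. f z * g z)" for c by (simp add: mult.assoc)
  show "norm (LINT z|lebesgue. f z * g z) \<le> (LINT z|lebesgue. \<bar>g z\<bar>) * M" if "\<And>x. \<bar>f x\<bar> \<le> M" "\<And>x v. \<bar>dird v f x\<bar> \<le> M * norm v" for M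
  proof -
   have "norm (LINT z|lebesgue. f z * g z) \<le> (LINT z|lebesgue. M * \<bar>g z\<bar>)"
   proof (rule Bochner_Integration.integral_norm_bound_integral[OF ig[OF tc[OF f]]])
    show "integrable lebesgue (%z. M * \<bar>g z\<bar>)" using gabs by simp
    show "norm (f z * g z) \<le> M * \<bar>g z\<bar>" for z using that(1)[of z] by (simp add: abs_mult mult_right_mono)
   qed
   then show ?thesis by (simp add: mult.commute)
  qed
  assume f': "test_fn f'"
  show "(LINT z|lebesgue. (f z + f' z) * g z) = (LINT z|lebesgue. f z * g z) + (LINT z|lebesgue. f' z * g z)"
   unfolding distrib_right by (rule Bochner_Integration.integral_add[OF ig[OF tc[OF f]] ig[OF tc[OF f']]])
 qed
 have C0: "0 \<le> (LINT z|lebesgue. \<bar>g z\<bar>)" by simp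
 \<comment> \<open>The mollification of g, written with the kernel argument reversed to match the
   translates in \<open>C1_functional\<close>.\<close>
 define H where "H y = (LINT z|lebesgue. ?m (z - y) * g z)" for y
 have conv: "(LINT z|lebesgue. convolution ?m w z * g z) = (LINT y|lebesgue. H y * w y)"
  unfolding H_def by (rule C1_functional_convolution[OF L C0 m w S(1) S(2)[rule_format]])
 have "smooth H" unfolding H_def[abs_def] by (rule C1_functional.smooth_translate[OF L m])
 then have Hc: "continuous_on UNIV H" by (rule smooth_continuous_on)
 have Hg: "\<bar>H y - g y\<bar> \<le> e" for y
 proof -
  have one: "(LINT z|lebesgue. ?m (z - y)) = 1"
   using integral_mollifier(1)[OF h, of y] mollifier_uminus[of h "_ - y"] by (simp add: minus_diff_eq)
  then have im: "integrable lebesgue (%z. ?m (z - y))" using not_integrable_integral_eq by fastforce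
  have mc: "continuous_on UNIV (%z. ?m (z - y))" by (rule continuous_on_compose2[OF tc[OF m]]) (auto intro!: continuous_intros)
  have "H y - g y = (LINT z|lebesgue. ?m (z - y) * g z) - (LINT z|lebesgue. ?m (z - y) * g y)"
   using one by (simp add: H_def)
  also have "\<dots> = (LINT z|lebesgue. ?m (z - y) * g z - ?m (z - y) * g y)"
   by (rule Bochner_Integration.integral_diff[symmetric, OF ig[OF mc]]) (use im in auto)
  finally have eq: "H y - g y = (LINT z|lebesgue. ?m (z - y) * g z - ?m (z - y) * g y)" .
  have "norm (LINT z|lebesgue. ?m (z - y) * g z - ?m (z - y) * g y) \<le> (LINT z|lebesgue. ?m (z - y) * e)"
  proof (rule Bochner_Integration.integral_norm_bound_integral)
   show "integrable lebesgue (%z. ?m (z - y) * g z - ?m (z - y) * g y)" using ig[OF mc] im by auto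
   show "integrable lebesgue (%z. ?m (z - y) * e)" using im by auto
   fix z
   show "norm (?m (z - y) * g z - ?m (z - y) * g y) \<le> ?m (z - y) * e"
   proof (cases "dist z y \<le> h")
    case True
    have "norm (?m (z - y) * (g z - g y)) \<le> ?m (z - y) * e"
     unfolding norm_mult using e[rule_format, OF True] mollifier_nonneg[OF h, of "z - y"] by (simp add: mult_left_mono)
    then show ?thesis by (simp add: right_diff_distrib)
   next
    case False
    then show ?thesis using mollifier_eq_0[OF h, of "z - y"] by (simp add: dist_norm)
   qed
  qed
  also have "\<dots> = e" using one by simp
  finally show ?thesis unfolding eq by simp
 qed
 have HB: "\<bar>H y\<bar> \<le> B + e" for y using Hg[of y] B(2)[rule_format, of y] by (simp add: abs_le_iff)
 have iH: "integrable lebesgue (%y. w y * H y)" by (rule wb[OF Hc HB])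
 have "(LINT z|lebesgue. convolution ?m w z * g z) - (LINT z|lebesgue. w z * g z) = (LINT y|lebesgue. w y * H y) - (LINT y|lebesgue. w y * g y)"
  unfolding conv by (simp add: mult.commute)
 also have "\<dots> = (LINT y|lebesgue. w y * H y - w y * g y)" by (rule Bochner_Integration.integral_diff[symmetric, OF iH wg])
 finally have eq: "(LINT z|lebesgue. convolution ?m w z * g z) - (LINT z|lebesgue. w z * g z) = (LINT y|lebesgue. w y * H y - w y * g y)" .
 have "norm (LINT y|lebesgue. w y * H y - w y * g y) \<le> (LINT y|lebesgue. e * \<bar>w y\<bar>)"
 proof (rule Bochner_Integration.integral_norm_bound_integral)
  show "integrable lebesgue (%y. w y * H y - w y * g y)" using iH wg by auto
  show "integrable lebesgue (%y. e * \<bar>w y\<bar>)" using w by auto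
  fix y
  have "norm (w y * (H y - g y)) \<le> e * \<bar>w y\<bar>" using mult_right_mono[OF Hg[of y], of "\<bar>w y\<bar>"] by (simp add: abs_mult mult.commute)
  then show "norm (w y * H y - w y * g y) \<le> e * \<bar>w y\<bar>" by (simp add: right_diff_distrib)
 qed
 then show "\<bar>(LINT z|lebesgue. convolution (mollifier h) w z * g z) - (LINT z|lebesgue. w z * g z)\<bar> \<le> e * (LINT z|lebesgue. \<bar>w z\<bar>)"
  unfolding eq by simp
qed

context parabolic_strict
begin

lemma cylinder_pairing:
 fixes g w :: "real \<times> (real^'n) \<Rightarrow> real"
 assumes g: "compactly_in Q g" and w: "integrable (lebesgue_on Q) w" and h: "0 < h" and e: "\<forall>y z. dist y z \<le> h \<longrightarrow> norm (g y - g z) \<le> e"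
 shows "\<bar>(LINT z|lebesgue_on Q. convolution (mollifier h) (zero_ext Q w) z * g z) - (LINT z|lebesgue_on Q. w z * g z)\<bar> \<le> e * (LINT z|lebesgue_on Q. \<bar>w z\<bar>)"
  "integrable (lebesgue_on Q) (%z. convolution (mollifier h) (zero_ext Q w) z * g z)" "integrable (lebesgue_on Q) (%z. w z * g z)"
proof -
 obtain K where K: "K \<subseteq> Q" "\<And>z. z \<notin> K ==> g z = 0" using g unfolding compactly_in_def by blast
 have g0: "indicator Q z * (f z * g z) = f z * g z" for f z
  using K(1) K(2)[of z] by (cases "z \<in> K") (auto simp: indicator_def)
 note iw = integrable_zero_ext[OF Q_sets w]
 have z0: "\<forall>y. y \<notin> Q \<longrightarrow> zero_ext Q w y = 0" by (simp add: zero_ext_def)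
 note cp = convolution_pairing[OF g iw bounded_Q z0 h e]
 have cc: "continuous_on UNIV (convolution (mollifier h) (zero_ext Q w))"
  by (rule smooth_continuous_on[OF smooth_convolution[OF test_fn_mollifier[OF h] iw]])
 show "integrable (lebesgue_on Q) (%z. convolution (mollifier h) (zero_ext Q w) z * g z)"
  using cp(2)[OF cc] Q_sets by (simp add: integrable_restrict_space g0)
 have zw: "zero_ext Q w z * g z = indicator Q z * (w z * g z)" for z by (simp add: zero_ext_def indicator_def)
 show "integrable (lebesgue_on Q) (%z. w z * g z)"
  using cp(3) Q_sets unfolding zw by (simp add: integrable_restrict_space)
 have 1: "(LINT z|lebesgue_on Q. convolution (mollifier h) (zero_ext Q w) z * g z) = (LINT z|lebesgue. convolution (mollifier h) (zero_ext Q w) z * g z)"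
  using Q_sets by (simp add: integral_restrict_space g0)
 have 2: "(LINT z|lebesgue_on Q. w z * g z) = (LINT z|lebesgue. zero_ext Q w z * g z)"
  unfolding zw using Q_sets by (simp add: integral_restrict_space)
 have 3: "(LINT z|lebesgue_on Q. \<bar>w z\<bar>) = (LINT z|lebesgue. \<bar>zero_ext Q w z\<bar>)"
  using Q_sets by (simp add: integral_restrict_space zero_ext_eq abs_mult)
 show "\<bar>(LINT z|lebesgue_on Q. convolution (mollifier h) (zero_ext Q w) z * g z) - (LINT z|lebesgue_on Q. w z * g z)\<bar> \<le> e * (LINT z|lebesgue_on Q. \<bar>w z\<bar>)"
  unfolding 1 2 3 by (rule cp(1))
qed

text \<open>The distance to the lateral boundary attains a positive minimum over the compact
  support.\<close>

lemma compactly_in_away_from_boundary: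
 assumes "compactly_in Q g"
 shows "\<exists>\<rho>>0. \<forall>z. g z \<noteq> 0 \<longrightarrow> z \<in> Q \<and> \<rho> \<le> bdist \<Omega> (snd z)"
proof -
 obtain K where K: "compact K" "K \<subseteq> Q" "\<And>z. z \<notin> K ==> g z = 0" using assms unfolding compactly_in_def by blast
 show ?thesis
 proof (cases "K = {}")
  case True
  then show ?thesis using K(3) by (intro exI[of _ 1]) auto
 next
  case False
  have "continuous_on K (%z. bdist \<Omega> (snd z))"
   by (rule continuous_on_compose2[OF continuous_on_bdist[of UNIV]]) (auto intro!: continuous_intros)
  then obtain z0 where z0: "z0 \<in> K" "\<And>z. z \<in> K ==> bdist \<Omega> (snd z0) \<le> bdist \<Omega> (snd z)"
   using continuous_attains_inf[OF K(1) False] by blast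
  have x0: "snd z0 \<in> \<Omega>" using z0(1) K(2) by (auto simp: cylinder_def)
  have "\<Omega> \<noteq> UNIV" using bounded_\<Omega> not_bounded_UNIV by auto
  then have "frontier \<Omega> \<noteq> {}" using x0 by (intro frontier_not_empty) auto
  moreover have "snd z0 \<notin> frontier \<Omega>" using x0 open_\<Omega> by (simp add: frontier_def interior_open)
  ultimately have "0 < bdist \<Omega> (snd z0)"
   unfolding bdist_def by (intro infdist_pos_not_in_closed frontier_closed)
  then show ?thesis using z0(2) K(2,3) by (intro exI[of _ "bdist \<Omega> (snd z0)"]) (auto, blast+)
 qed
qed

text \<open>For small h the cut-off is 1 and its gradient 0 on the supports of the densities, so
  smoothing acts there as pure mollification of v and of \<open>\<epsilon> v\<close>. The L^1 norms
  of both are bounded on the unit ball, which gives uniformity in v.\<close>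

lemma R_op_J_tendsto:
 assumes g: "compactly_in Q g" and F: "compactly_in Q F" and e: "0 < e"
 shows "\<exists>h0>0. \<forall>h. 0 < h \<and> h < h0 \<longrightarrow> (\<forall>v\<in>X. N v \<le> 1 \<longrightarrow>
  \<bar>J_eps T \<Omega> q p g F (R_star T \<Omega> h v) - J_eps T \<Omega> q p g F v\<bar> \<le> e)"
proof -
 let ?n = "real CARD('n)"
 \<comment> \<open>There are n components of g and n * n entries of F, each contributing an error of
   at most e' (1 + \<open>q.vol\<close>).\<close>
 define e' where "e' = e / ((?n + ?n * ?n) * (1 + q.vol))"
 have vol: "0 \<le> q.vol" by simp
 have n: "0 < ?n" by simp
 have den: "0 < (?n + ?n * ?n) * (1 + q.vol)" using n vol by (intro mult_pos_pos add_pos_pos add_pos_nonneg) auto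
 have e': "0 < e'" unfolding e'_def using e den by (rule divide_pos_pos)
 obtain r1 where r1: "0 < r1" "\<And>z. g z \<noteq> 0 ==> z \<in> Q \<and> r1 \<le> bdist \<Omega> (snd z)" using compactly_in_away_from_boundary[OF g] by blast
 obtain r2 where r2: "0 < r2" "\<And>z. F z \<noteq> 0 ==> z \<in> Q \<and> r2 \<le> bdist \<Omega> (snd z)" using compactly_in_away_from_boundary[OF F] by blast
 obtain d1 where d1: "0 < d1" "\<And>y z. dist y z \<le> d1 ==> norm (g y - g z) \<le> e'" using compactly_in_uniform[OF g e'] by blast
 obtain d2 where d2: "0 < d2" "\<And>y z. dist y z \<le> d2 ==> norm (F y - F z) \<le> e'" using compactly_in_uniform[OF F e'] by blast
 \<comment> \<open>The quarters give 3h < r1 and 3h < r2, beyond the strip where the cut-off varies;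
   d1 and d2 make the oscillation of the densities small at scale h.\<close>
 define h0 where "h0 = min (min d1 d2) (min (r1 / 4) (r2 / 4))"
 show ?thesis
 proof (intro exI[of _ h0] conjI allI impI ballI)
  show "0 < h0" using r1 r2 d1 d2 by (simp add: h0_def)
  fix h v assume hh: "0 < h \<and> h < h0" and v: "v \<in> X" "N v \<le> 1"
  have h: "0 < h" "h \<le> d1" "h \<le> d2" "3 * h < r1" "3 * h < r2" using hh r1 r2 by (auto simp: h0_def)
  let ?R = "R_star T \<Omega> h v" and ?m = "mollifier h :: real \<times> (real^'n) \<Rightarrow> real"
  have RX: "?R \<in> X" by (rule R_star_in_X[OF h(1) v(1)])
  have gi: "compactly_in Q (%z. g z $ i)" for i
   using g unfolding compactly_in_def by (force intro!: continuous_intros)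
  have Fi: "compactly_in Q (%z. F z $ i $ j)" for i j
   using F unfolding compactly_in_def by (force intro!: continuous_intros)
  have go: "\<forall>y z. dist y z \<le> h \<longrightarrow> norm (g y $ i - g z $ i) \<le> e'" for i
  proof (intro allI impI)
   fix y z :: "real \<times> (real^'n)" assume "dist y z \<le> h"
   then show "norm (g y $ i - g z $ i) \<le> e'"
    using order_trans[OF component_le_norm_cart[of "g y - g z" i] d1(2)[of y z]] h(2) by simp
  qed
  have Fo: "\<forall>y z. dist y z \<le> h \<longrightarrow> norm (F y $ i $ j - F z $ i $ j) \<le> e'" for i j
  proof (intro allI impI)
   fix y z :: "real \<times> (real^'n)" assume yz: "dist y z \<le> h"
   have "norm ((F y - F z) $ i $ j) \<le> norm (F y - F z)"
    using order_trans[OF Finite_Cartesian_Product.norm_nth_le[of "(F y - F z) $ i" j] Finite_Cartesian_Product.norm_nth_le[of "F y - F z" i]] .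
   then show "norm (F y $ i $ j - F z $ i $ j) \<le> e'" using d2(2)[of y z] yz h(3) by simp
  qed
  have vi: "integrable (lebesgue_on Q) (%z. v z $ i)" for i
   by (rule integrable_bounded_linear[OF bounded_linear_vec_nth X_integrable(1)[OF v(1)]])
  have Ei: "integrable (lebesgue_on Q) (%z. \<epsilon> v z $ i $ j)" for i j
   using integrable_bounded_linear[OF bounded_linear_vec_nth integrable_bounded_linear[OF bounded_linear_vec_nth X_integrable(2)[OF v(1)]]] .
  note pg = cylinder_pairing[OF gi vi h(1) go]
  note pF = cylinder_pairing[OF Fi Ei h(1) Fo]
  have gR: "g z \<bullet> ?R z = (\<Sum>i\<in>UNIV. convolution ?m (zero_ext Q (%z. v z $ i)) z * g z $ i)" for z
  proof (cases "g z = 0")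
   case False
   have z: "z \<in> Q" "snd z \<in> \<Omega>" "3 * h \<le> bdist \<Omega> (snd z)" using r1(2)[OF False] h(4) by (auto simp: cylinder_def)
   have "cutoff \<Omega> h (snd z) = 1" by (rule cutoff_eq_1[OF open_\<Omega> bounded_\<Omega> h(1) z(2,3)])
   then have "?R z = convolution ?m (zero_ext Q v) z" using z(1) by (simp add: R_star_eq smoothed_def zero_ext_def)
   then show ?thesis by (simp add: inner_vec_def convolution_component[OF h(1) X_integrable(1)[OF v(1)]] mult.commute)
  qed simp
  have FR: "AE z in lebesgue_on Q. F z \<bullet> \<epsilon> ?R z = (\<Sum>i\<in>UNIV. \<Sum>j\<in>UNIV. convolution ?m (zero_ext Q (%z. \<epsilon> v z $ i $ j)) z * F z $ i $ j)"
  proof -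
   have "AE z in lebesgue_on Q. \<epsilon> ?R z = classical_sym_grad st_dir (smoothed h v) z"
    by (rule st.smooth_eps_space(2)[OF smooth_smoothed[OF h(1) X_integrable(1)[OF v(1)]] _ bounded_Q]) (simp add: R_star_eq zero_ext_def)
   then show ?thesis
   proof eventually_elim
    fix z assume ez: "\<epsilon> ?R z = classical_sym_grad st_dir (smoothed h v) z"
    show "F z \<bullet> \<epsilon> ?R z = (\<Sum>i\<in>UNIV. \<Sum>j\<in>UNIV. convolution ?m (zero_ext Q (%z. \<epsilon> v z $ i $ j)) z * F z $ i $ j)"
    proof (cases "F z = 0")
     case False
     have z: "z \<in> Q" "snd z \<in> \<Omega>" "3 * h < bdist \<Omega> (snd z)" using r2(2)[OF False] h(5) by (auto simp: cylinder_def)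
     have 1: "cutoff \<Omega> h (snd z) = 1" by (rule cutoff_eq_1[OF open_\<Omega> bounded_\<Omega> h(1) z(2)]) (use z(3) in simp)
     have 0: "dird (axis i 1) (cutoff \<Omega> h) (snd z) = 0" for i
     proof (rule ccontr)
      assume nz: "dird (axis i 1) (cutoff \<Omega> h) (snd z) \<noteq> 0"
      show False using dird_cutoff_nonzeroD(3)[OF open_\<Omega> bounded_\<Omega> h(1) nz] z(3) by simp
     qed
     show ?thesis unfolding ez classical_sym_grad_smoothed[OF v(1) h(1)] 0 1 by (simp add: inner_vec_def mult.commute)
    qed simp
   qed
  qed
  have A: "(LINT z|lebesgue_on Q. g z \<bullet> ?R z) - (LINT z|lebesgue_on Q. g z \<bullet> v z) = (\<Sum>i\<in>UNIV.
    (LINT z|lebesgue_on Q. convolution ?m (zero_ext Q (%z. v z $ i)) z * g z $ i) - (LINT z|lebesgue_on Q. v z $ i * g z $ i))"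
  proof -
   have "(LINT z|lebesgue_on Q. g z \<bullet> ?R z) = (\<Sum>i\<in>UNIV. LINT z|lebesgue_on Q. convolution ?m (zero_ext Q (%z. v z $ i)) z * g z $ i)"
    unfolding gR by (rule Bochner_Integration.integral_sum) (rule pg(2))
   moreover have "(LINT z|lebesgue_on Q. g z \<bullet> v z) = (\<Sum>i\<in>UNIV. LINT z|lebesgue_on Q. v z $ i * g z $ i)"
    unfolding inner_vec_def inner_real_def mult.commute[of "g _ $ _"] by (rule Bochner_Integration.integral_sum) (rule pg(3))
   ultimately show ?thesis by (simp add: sum_subtractf)
  qed
  have B: "(LINT z|lebesgue_on Q. F z \<bullet> \<epsilon> ?R z) - (LINT z|lebesgue_on Q. F z \<bullet> \<epsilon> v z) = (\<Sum>i\<in>UNIV. \<Sum>j\<in>UNIV.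
    (LINT z|lebesgue_on Q. convolution ?m (zero_ext Q (%z. \<epsilon> v z $ i $ j)) z * F z $ i $ j) - (LINT z|lebesgue_on Q. \<epsilon> v z $ i $ j * F z $ i $ j))"
  proof -
   have "(LINT z|lebesgue_on Q. F z \<bullet> \<epsilon> ?R z) = (LINT z|lebesgue_on Q. (\<Sum>i\<in>UNIV. \<Sum>j\<in>UNIV. convolution ?m (zero_ext Q (%z. \<epsilon> v z $ i $ j)) z * F z $ i $ j))"
    by (rule integral_cong_AE[OF _ _ FR])
     (use J_eps_eq(3)[OF g F RX] pF(2) in \<open>auto intro!: borel_measurable_sum borel_measurable_integrable\<close>)
   also have "\<dots> = (\<Sum>i\<in>UNIV. \<Sum>j\<in>UNIV. LINT z|lebesgue_on Q. convolution ?m (zero_ext Q (%z. \<epsilon> v z $ i $ j)) z * F z $ i $ j)"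
    using pF(2) by (subst Bochner_Integration.integral_sum; (intro Bochner_Integration.integrable_sum sum.cong refl Bochner_Integration.integral_sum)?) auto
   finally have 1: "(LINT z|lebesgue_on Q. F z \<bullet> \<epsilon> ?R z) = (\<Sum>i\<in>UNIV. \<Sum>j\<in>UNIV. LINT z|lebesgue_on Q. convolution ?m (zero_ext Q (%z. \<epsilon> v z $ i $ j)) z * F z $ i $ j)" .
   have "(LINT z|lebesgue_on Q. F z \<bullet> \<epsilon> v z) = (LINT z|lebesgue_on Q. (\<Sum>i\<in>UNIV. \<Sum>j\<in>UNIV. \<epsilon> v z $ i $ j * F z $ i $ j))"
    by (intro Bochner_Integration.integral_cong refl) (simp add: inner_vec_def mult.commute)
   also have "\<dots> = (\<Sum>i\<in>UNIV. \<Sum>j\<in>UNIV. LINT z|lebesgue_on Q. \<epsilon> v z $ i $ j * F z $ i $ j)"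
    using pF(3) by (subst Bochner_Integration.integral_sum; (intro Bochner_Integration.integrable_sum sum.cong refl Bochner_Integration.integral_sum)?) auto
   finally show ?thesis unfolding 1 by (simp add: sum_subtractf)
  qed
  have vol1: "(LINT z|lebesgue_on Q. norm (v z)) \<le> 1 + q.vol" "(LINT z|lebesgue_on Q. norm (\<epsilon> v z)) \<le> 1 + q.vol"
  proof -
   have mv: "(1 + q.vol) * N v \<le> 1 + q.vol"
    by (rule order_trans[OF mult_left_mono[OF v(2)]]) (simp_all add: vol)
   show "(LINT z|lebesgue_on Q. norm (v z)) \<le> 1 + q.vol" "(LINT z|lebesgue_on Q. norm (\<epsilon> v z)) \<le> 1 + q.vol"
    by (rule order_trans[OF X_integrable(3)[OF v(1)] mv], rule order_trans[OF X_integrable(4)[OF v(1)] mv])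
  qed
  have Ab: "\<bar>(LINT z|lebesgue_on Q. convolution ?m (zero_ext Q (%z. v z $ i)) z * g z $ i) - (LINT z|lebesgue_on Q. v z $ i * g z $ i)\<bar> \<le> e' * (1 + q.vol)" for i
  proof -
   have "(LINT z|lebesgue_on Q. \<bar>v z $ i\<bar>) \<le> (LINT z|lebesgue_on Q. norm (v z))"
    by (rule integral_mono) (use vi X_integrable(1)[OF v(1)] component_le_norm_cart in auto)
   then have "(LINT z|lebesgue_on Q. \<bar>v z $ i\<bar>) \<le> 1 + q.vol" using vol1(1) by linarith
   then show ?thesis using e' by (intro order_trans[OF pg(1)] mult_left_mono) auto
  qed
  have Bb: "\<bar>(LINT z|lebesgue_on Q. convolution ?m (zero_ext Q (%z. \<epsilon> v z $ i $ j)) z * F z $ i $ j) - (LINT z|lebesgue_on Q. \<epsilon> v z $ i $ j * F z $ i $ j)\<bar> \<le> e' * (1 + q.vol)" for i j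
  proof -
   have le: "\<bar>M $ i $ j\<bar> \<le> norm M" for M :: "real^'n^'n"
    using order_trans[OF Finite_Cartesian_Product.norm_nth_le[of "M $ i" j] Finite_Cartesian_Product.norm_nth_le[of M i]] by simp
   have "(LINT z|lebesgue_on Q. \<bar>\<epsilon> v z $ i $ j\<bar>) \<le> (LINT z|lebesgue_on Q. norm (\<epsilon> v z))"
    by (rule integral_mono) (use Ei X_integrable(2)[OF v(1)] le in auto)
   then have "(LINT z|lebesgue_on Q. \<bar>\<epsilon> v z $ i $ j\<bar>) \<le> 1 + q.vol" using vol1(2) by linarith
   then show ?thesis using e' by (intro order_trans[OF pF(1)] mult_left_mono) auto
  qed
  have "\<bar>(LINT z|lebesgue_on Q. g z \<bullet> ?R z) - (LINT z|lebesgue_on Q. g z \<bullet> v z)\<bar> \<le> (\<Sum>i\<in>(UNIV::'n set). e' * (1 + q.vol))"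
   unfolding A by (rule order_trans[OF sum_abs sum_mono]) (rule Ab)
  moreover have "\<bar>(LINT z|lebesgue_on Q. F z \<bullet> \<epsilon> ?R z) - (LINT z|lebesgue_on Q. F z \<bullet> \<epsilon> v z)\<bar> \<le> (\<Sum>i\<in>(UNIV::'n set). \<Sum>j\<in>(UNIV::'n set). e' * (1 + q.vol))"
   unfolding B by (rule order_trans[OF sum_abs sum_mono], rule order_trans[OF sum_abs sum_mono]) (rule Bb)
  moreover have "(\<Sum>i\<in>(UNIV::'n set). e' * (1 + q.vol)) + (\<Sum>i\<in>(UNIV::'n set). \<Sum>j\<in>(UNIV::'n set). e' * (1 + q.vol)) = e"
  proof -
   have dd: "e / D * D = e" if "0 < D" for D using that by simp
   have "e' * ((?n + ?n * ?n) * (1 + q.vol)) = e" unfolding e'_def by (rule dd[OF den])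
   then show ?thesis by (simp add: algebra_simps)
  qed
  ultimately show "\<bar>J_eps T \<Omega> q p g F ?R - J_eps T \<Omega> q p g F v\<bar> \<le> e"
   unfolding J_eps_eq(1)[OF g F RX] J_eps_eq(1)[OF g F v(1)] by linarith
 qed
qed

text \<open>The error is split at a functional J with continuous densities. Its difference to us is
  evaluated at v and at \<open>R_star T \<Omega> h v\<close>, the latter costing the uniform factor
  c; the middle term is \<open>R_op_J_tendsto\<close>.\<close>

lemma R_op_tendsto:
 assumes strip: "boundary_strip_estimate \<Omega> h0 c0" "0 < c0" "0 < h0" and us: "us \<in> X_dual T \<Omega> q p"
 shows "((%h. DN (%v. R_op T \<Omega> q p h us v - us v)) \<longlongrightarrow> 0) (at_right 0)"
proof (rule tendstoI)
 fix e :: real assume e: "0 < e"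
 obtain c where c: "0 < c" "\<And>v h. v \<in> X ==> 0 < h ==> h < h0 / 4 ==> N (R_star T \<Omega> h v) \<le> c * N v"
  using uniform_bound[OF strip(1,2)] by blast
 \<comment> \<open>Makes both \<delta> and \<delta> c at most e/4, so that three terms of size e/4
   stay strictly below e.\<close>
 define \<delta> where "\<delta> = e / (4 * (c + 1))"
 have \<delta>: "0 < \<delta>" using e c(1) by (simp add: \<delta>_def)
 obtain g F where gF: "compactly_in Q g" "compactly_in Q F" and app: "\<And>v. v \<in> X ==> \<bar>us v - J_eps T \<Omega> q p g F v\<bar> \<le> \<delta> * N v"
  using approximation_continuous_density[OF us \<delta>] by blast
 have e4: "0 < e / 4" using e by simp
 obtain h1 where h1: "0 < h1" "\<And>h v. 0 < h ==> h < h1 ==> v \<in> X ==> N v \<le> 1 ==>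
   \<bar>J_eps T \<Omega> q p g F (R_star T \<Omega> h v) - J_eps T \<Omega> q p g F v\<bar> \<le> e / 4"
  using R_op_J_tendsto[OF gF e4] by blast
 show "\<forall>\<^sub>F h in at_right 0. dist (DN (%v. R_op T \<Omega> q p h us v - us v)) 0 < e"
  unfolding eventually_at_right_field
 proof (intro exI[of _ "min h1 (h0 / 4)"] conjI allI impI)
  show "0 < min h1 (h0 / 4)" using h1 strip(3) by simp
  fix h :: real assume "0 < h" "h < min h1 (h0 / 4)"
  then have h: "0 < h" "h < h1" "h < h0 / 4" by auto
  have RD: "R_op T \<Omega> q p h us \<in> X_dual T \<Omega> q p" using R_op_in_C_inf_star[OF us h(1)] C_inf_star_subset_dual by blast
  have "0 \<le> DN (%v. R_op T \<Omega> q p h us v - us v)"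
   using X_dual_norm_nonneg[OF X_dual_diff[OF RD us]] by (simp add: dual_norm_restrict)
  moreover have "DN (%v. R_op T \<Omega> q p h us v - us v) \<le> 3 * e / 4"
  proof (rule dual_norm_le_unit)
   fix v assume v: "v \<in> X" "N v \<le> 1"
   let ?R = "R_star T \<Omega> h v" and ?J = "J_eps T \<Omega> q p g F"
   have "\<bar>us ?R - ?J ?R\<bar> \<le> \<delta> * N ?R" by (rule app[OF R_star_in_X[OF h(1) v(1)]])
   also have "\<dots> \<le> \<delta> * (c * N v)" using \<delta> c(2)[OF v(1) h(1,3)] by (intro mult_left_mono) auto
   also have "\<dots> \<le> \<delta> * (c * 1)" using \<delta> c(1) v(2) by (intro mult_left_mono) auto
   also have "\<dots> \<le> e / 4" using c(1) e by (simp add: \<delta>_def field_simps)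
   finally have 1: "\<bar>us ?R - ?J ?R\<bar> \<le> e / 4" .
   have "\<bar>us v - ?J v\<bar> \<le> \<delta> * N v" by (rule app[OF v(1)])
   also have "\<dots> \<le> \<delta> * 1" using \<delta> v(2) by (intro mult_left_mono) auto
   also have "\<dots> \<le> e / 4" using c(1) e by (simp add: \<delta>_def field_simps)
   finally have 2: "\<bar>us v - ?J v\<bar> \<le> e / 4" .
   have "\<bar>us ?R - us v\<bar> \<le> 3 * e / 4" using 1 2 h1(2)[OF h(1,2) v] by linarith
   then show "\<bar>R_op T \<Omega> q p h us v - us v\<bar> \<le> 3 * e / 4" using v(1) by (simp add: R_op_def)
  qed
  ultimately show "dist (DN (%v. R_op T \<Omega> q p h us v - us v)) 0 < e" using e by (simp add: dist_real_def)
 qed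
qed

end

section \<open>The theorem\<close>

text \<open>Stated for all sufficiently large constants, so that both exponents can share one upper
  bound and one log-Hoelder constant.\<close>

lemma variable_exponent_of_log_exponent:
 fixes r :: "'a::euclidean_space \<Rightarrow> real"
 assumes r: "r \<in> log_exponents G" and G: "open G" "bounded G"
 shows "\<exists>P c. \<forall>P' c'. P \<le> P' \<longrightarrow> c \<le> c' \<longrightarrow> 0 < c' \<longrightarrow> log_hoelder_exponent G r P' c'"
proof -
 obtain M c1 where M: "\<And>x. x \<in> G ==> r x \<le> M" and c1: "\<And>x y. x \<in> G ==> y \<in> G ==> x \<noteq> y ==> \<bar>r x - r y\<bar> \<le> c1 / ln (exp 1 + 1 / norm (x - y))"
  and meas: "r \<in> borel_measurable (lebesgue_on G)" and r1: "\<And>x. x \<in> G ==> 1 \<le> r x"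
  using r unfolding log_exponents_def by blast
 have "log_hoelder_exponent G r P' c'" if P': "M \<le> P'" and c': "c1 \<le> c'" "0 < c'" for P' c'
 proof
  show "G \<in> lmeasurable" using bounded_set_imp_lmeasurable[OF G(2)] G(1) by simp
  show "r x \<le> P'" if "x \<in> G" for x using M[OF that] P' by simp
  fix x y assume xy: "x \<in> G" "y \<in> G" "x \<noteq> y"
  have "1 < exp (1::real) + 1 / norm (x - y)"
 proof -
  have "1 < exp (1::real)" "0 \<le> 1 / norm (x - y)" by simp_all
  then show ?thesis by linarith
 qed
  then have "0 < ln (exp 1 + 1 / norm (x - y))" by (rule ln_gt_zero)
  then have "c1 / ln (exp 1 + 1 / norm (x - y)) \<le> c' / ln (exp 1 + 1 / norm (x - y))" using c' by (intro divide_right_mono) auto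
  then show "\<bar>r x - r y\<bar> \<le> c' / ln (exp 1 + 1 / norm (x - y))" using c1[OF xy] by simp
 qed (use meas r1 c' in auto)
 then show ?thesis by blast
qed

text \<open>By continuity, a violation at one point spreads to a nonempty open set, which has
  positive measure and contradicts the almost everywhere bound.\<close>

lemma (in log_hoelder_exponent) lower_bound_of_ess_inf:
 assumes "open G" and inf: "1 < ess_inf G p"
 shows "\<exists>m>1. \<forall>x\<in>G. m \<le> p x"
proof -
 obtain m :: real where m: "1 < ereal m" "ereal m < ess_inf G p" using ereal_dense2[OF inf] by blast
 let ?E = "esssup (lebesgue_on G) (%x. - ereal (p x))"
 have "ereal m < - ?E" using m(2) unfolding ess_inf_def .
 then have E: "?E < - ereal m" by (rule iffD1[OF ereal_less_uminus_reorder])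
 have "AE x in lebesgue_on G. - ereal (p x) \<le> esssup (lebesgue_on G) (%x. - ereal (p x))" by (rule esssup_AE)
 then have "AE x in lebesgue_on G. m < p x"
 proof eventually_elim
  fix x assume "- ereal (p x) \<le> ?E"
  then have "- ereal (p x) < - ereal m" using E by (rule le_less_trans)
  then show "m < p x" by simp
 qed
 then have ae: "AE x in lebesgue. x \<in> G \<longrightarrow> m < p x" using G_sets by (simp add: AE_restrict_space_iff)
 have "m \<le> p x" if x: "x \<in> G" for x
 proof (rule ccontr)
  assume n: "\<not> m \<le> p x"
  let ?U = "G \<inter> p -` {..<m}"
  have o: "open ?U" by (rule continuous_open_preimage[OF continuous_on_exponent \<open>open G\<close> open_lessThan])
  have "AE y in lebesgue. y \<notin> ?U" using ae by eventually_elim auto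
  then have "?U \<in> null_sets lebesgue" using o by (intro AE_iff_null_sets[THEN iffD2]) auto
  then have "negligible ?U" by (simp add: negligible_iff_null_sets)
  moreover have "x \<in> ?U" using x n by simp
  ultimately show False using open_not_negligible[OF o] by blast
 qed
 then show ?thesis using m(1) by (intro exI[of _ m]) auto
qed

theorem proposition5p19:
  fixes \<Omega> :: "(real^'n::finite) set"
    and T h0 c0 h1 :: real
    and q p :: "real \<times> (real^'n) \<Rightarrow> real"
  assumes "2 \<le> CARD('n)"
    and "bounded_lipschitz_domain \<Omega>"
    and "0 < T"
    and "q \<in> log_exponents (cylinder T \<Omega>)"
    and "p \<in> log_exponents (cylinder T \<Omega>)"
    and "1 < ess_inf (cylinder T \<Omega>) q"
    and "1 < ess_inf (cylinder T \<Omega>) p"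
    and "0 < h0" and "0 < c0"
    and "boundary_strip_estimate \<Omega> h0 c0"
    and "h1 = h0 / 4"
  shows
    "((\<forall>h>0. \<forall>v \<in> X_st T \<Omega> q p. R_star T \<Omega> h v \<in> X_st T \<Omega> q p) \<and>
      (\<forall>h>0. \<forall>us \<in> X_dual T \<Omega> q p. R_op T \<Omega> q p h us \<in> X_dual T \<Omega> q p) \<and>
      C_inf_star T \<Omega> q p \<subseteq> X_dual T \<Omega> q p) \<and>
     (\<exists>c>0. \<forall>v \<in> X_st T \<Omega> q p.
        (SUP h\<in>{0<..<h1}. ereal (X_st_norm T \<Omega> q p (R_star T \<Omega> h v)))
          \<le> ereal (c * X_st_norm T \<Omega> q p v)) \<and>
     (\<forall>us \<in> X_dual T \<Omega> q p.
        (\<forall>c>0. (\<forall>v \<in> X_st T \<Omega> q p.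
             (SUP h\<in>{0<..<h1}. ereal (X_st_norm T \<Omega> q p (R_star T \<Omega> h v)))
               \<le> ereal (c * X_st_norm T \<Omega> q p v)) \<longrightarrow>
           (SUP h\<in>{0<..<h1}. ereal (X_dual_norm T \<Omega> q p (R_op T \<Omega> q p h us)))
             \<le> ereal (c * X_dual_norm T \<Omega> q p us)) \<and>
        (\<forall>h>0. R_op T \<Omega> q p h us \<in> C_inf_star T \<Omega> q p) \<and>
        ((\<lambda>h. X_dual_norm T \<Omega> q p (\<lambda>v. R_op T \<Omega> q p h us v - us v)) \<longlongrightarrow> 0) (at_right 0)) \<and>
     (\<forall>us \<in> X_dual T \<Omega> q p. \<forall>e>0. \<exists>w \<in> C_inf_star T \<Omega> q p.
        X_dual_norm T \<Omega> q p (\<lambda>v. w v - us v) < e)"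
proof -
 have \<Omega>: "open \<Omega>" "bounded \<Omega>" using assms(2) by (simp_all add: bounded_lipschitz_domain_def)
 have Q: "open (cylinder T \<Omega>)" "bounded (cylinder T \<Omega>)"
  using \<Omega> by (simp_all add: cylinder_def open_Times bounded_Times)
 obtain Pq cq where q: "\<And>P' c'. Pq \<le> P' ==> cq \<le> c' ==> 0 < c' ==> log_hoelder_exponent (cylinder T \<Omega>) q P' c'"
  using variable_exponent_of_log_exponent[OF assms(4) Q] by blast
 obtain Pp cp where p: "\<And>P' c'. Pp \<le> P' ==> cp \<le> c' ==> 0 < c' ==> log_hoelder_exponent (cylinder T \<Omega>) p P' c'"
  using variable_exponent_of_log_exponent[OF assms(5) Q] by blast
 \<comment> \<open>The maxima with 1 here and in \<open>c1\<close> provide P \<ge> 1 and a positive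
   log-Hoelder constant.\<close>
 define P where "P = max 1 (max Pq Pp)"
 define c1 where "c1 = max 1 (max cq cp)"
 have qe: "log_hoelder_exponent (cylinder T \<Omega>) q P c1" by (rule q) (auto simp: P_def c1_def)
 have pe: "log_hoelder_exponent (cylinder T \<Omega>) p P c1" by (rule p) (auto simp: P_def c1_def)
 obtain mq where mq: "1 < mq" "\<And>z. z \<in> cylinder T \<Omega> ==> mq \<le> q z"
  using log_hoelder_exponent.lower_bound_of_ess_inf[OF qe Q(1) assms(6)] by blast
 obtain mp where mp: "1 < mp" "\<And>z. z \<in> cylinder T \<Omega> ==> mp \<le> p z"
  using log_hoelder_exponent.lower_bound_of_ess_inf[OF pe Q(1) assms(7)] by blast
 have "parabolic \<Omega> T q p P c1" by (rule parabolic.intro[OF \<Omega> assms(3) qe pe])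
 moreover have "parabolic_strict_axioms \<Omega> T q p P (min mq mp)"
 proof
  show "min mq mp \<le> q z" if "z \<in> cylinder T \<Omega>" for z using mq(2)[OF that] by simp
  show "min mq mp \<le> p z" if "z \<in> cylinder T \<Omega>" for z using mp(2)[OF that] by simp
 qed (use mq(1) mp(1) in \<open>auto simp: P_def\<close>)
 ultimately interpret parabolic_strict \<Omega> T q p P c1 "min mq mp" by (rule parabolic_strict.intro)
 have h1: "0 < h1" using assms(8,11) by simp
 have RX: "R_star T \<Omega> h v \<in> X" if "0 < h" "v \<in> X" for h v by (rule R_star_in_X[OF that])
 have RC: "R_op T \<Omega> q p h us \<in> C_inf_star T \<Omega> q p" if "0 < h" "us \<in> X_dual T \<Omega> q p" for h us
  by (rule R_op_in_C_inf_star[OF that(2,1)])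
 have RD: "R_op T \<Omega> q p h us \<in> X_dual T \<Omega> q p" if "0 < h" "us \<in> X_dual T \<Omega> q p" for h us
  using RC[OF that] C_inf_star_subset_dual by blast
 obtain c where c: "0 < c" "\<And>v h. v \<in> X ==> 0 < h ==> h < h0 / 4 ==> N (R_star T \<Omega> h v) \<le> c * N v"
  using uniform_bound[OF assms(10,9)] by blast
 have lim: "((%h. DN (%v. R_op T \<Omega> q p h us v - us v)) \<longlongrightarrow> 0) (at_right 0)" if "us \<in> X_dual T \<Omega> q p" for us
  by (rule R_op_tendsto[OF assms(10,9,8) that])
 have s1: "(SUP h\<in>{0<..<h1}. ereal (N (R_star T \<Omega> h v))) \<le> ereal (c * N v)" if "v \<in> X" for v
  using c(2)[OF that] assms(11) by (intro SUP_least) auto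
 have s2: "(SUP h\<in>{0<..<h1}. ereal (DN (R_op T \<Omega> q p h us))) \<le> ereal (b * DN us)"
  if us: "us \<in> X_dual T \<Omega> q p" and b: "0 < b" "\<And>v. v \<in> X ==> (SUP h\<in>{0<..<h1}. ereal (N (R_star T \<Omega> h v))) \<le> ereal (b * N v)" for us b
 proof (rule SUP_least)
  fix h assume h: "h \<in> {0<..<h1}"
  have "N (R_star T \<Omega> h v) \<le> b * N v" if "v \<in> X" for v
   using order_trans[OF SUP_upper[OF h] b(2)[OF that]] by simp
  then show "ereal (DN (R_op T \<Omega> q p h us)) \<le> ereal (b * DN us)"
   using R_op_dual_norm_le[OF us, of h b] h b(1) by simp
 qed
 have s3: "\<exists>w\<in>C_inf_star T \<Omega> q p. DN (%v. w v - us v) < e" if us: "us \<in> X_dual T \<Omega> q p" and e: "0 < e" for us e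
 proof -
  have "eventually (%h. DN (%v. R_op T \<Omega> q p h us v - us v) < e) (at_right 0)"
   using lim[OF us] e by (rule order_tendstoD(2))
  then obtain b where b: "0 < b" "\<And>h. 0 < h ==> h < b ==> DN (%v. R_op T \<Omega> q p h us v - us v) < e"
   by (auto simp: eventually_at_right_field)
  then have "DN (%v. R_op T \<Omega> q p (b / 2) us v - us v) < e" by simp
  then show ?thesis using RC[OF _ us, of "b / 2"] b(1) by (intro bexI[of _ "R_op T \<Omega> q p (b / 2) us"]) auto
 qed
 show ?thesis
 proof (intro conjI ballI allI impI exI[of _ c])
  show "R_star T \<Omega> h v \<in> X" if "0 < h" "v \<in> X" for h v by (rule RX[OF that])
  show "R_op T \<Omega> q p h us \<in> X_dual T \<Omega> q p" if "0 < h" "us \<in> X_dual T \<Omega> q p" for h us by (rule RD[OF that])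
  show "C_inf_star T \<Omega> q p \<subseteq> X_dual T \<Omega> q p" by (rule C_inf_star_subset_dual)
  show "0 < c" by (rule c(1))
  show "(SUP h\<in>{0<..<h1}. ereal (N (R_star T \<Omega> h v))) \<le> ereal (c * N v)" if "v \<in> X" for v by (rule s1[OF that])
  show "(SUP h\<in>{0<..<h1}. ereal (DN (R_op T \<Omega> q p h us))) \<le> ereal (b * DN us)"
   if "us \<in> X_dual T \<Omega> q p" "0 < b" "\<forall>v\<in>X. (SUP h\<in>{0<..<h1}. ereal (N (R_star T \<Omega> h v))) \<le> ereal (b * N v)" for us b
   by (rule s2[OF that(1,2)]) (rule bspec[OF that(3)])
  show "R_op T \<Omega> q p h us \<in> C_inf_star T \<Omega> q p" if "us \<in> X_dual T \<Omega> q p" "0 < h" for us h by (rule RC[OF that(2,1)])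
  show "((%h. DN (%v. R_op T \<Omega> q p h us v - us v)) \<longlongrightarrow> 0) (at_right 0)" if "us \<in> X_dual T \<Omega> q p" for us by (rule lim[OF that])
  show "\<exists>w\<in>C_inf_star T \<Omega> q p. DN (%v. w v - us v) < e" if "us \<in> X_dual T \<Omega> q p" "0 < e" for us e by (rule s3[OF that])
 qed
qed

end
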